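(* Let $\Pi=((2),\dots,(2))$ consist of $n$ copies of the partition $(2)$. Then for any trivalent graph $\Gamma$ with $n$ labeled vertices, the contribution $N'(\Pi,\Gamma)$ of the graph $\Gamma$ to the counting of torus covers of profile $\Pi$ is (the $q$-expansion of) a quasimodular form for $\mathrm{SL}(2,\mathbb{Z})$ of mixed weight at most $|\Pi|+\ell(\Pi)=3n$.
   Context: Graphs are finite multigraphs (loops and multiple edges allowed, not necessarily connected) with vertices labeled $1,\dots,n$. Trivalent means every vertex has valency $3$ (a loop counts twice). An orientation $G$ of $\Gamma$ (written $G\in\Gamma$) is a choice of direction for every non-loop edge; loops carry no orientation. For an edge $e$ let $i^-(e)$, $i^+(e)$ be the labels of its initial and terminal vertex (both equal to the base vertex for a loop). Fix $0\le\varepsilon_1<\dots<\varepsilon_n<1$, put $\Delta(e)=\varepsilon_{i^+(e)}-\varepsilon_{i^-(e)}$ if $i^+(e)>i^-(e)$ and $\Delta(e)=1+\varepsilon_{i^+(e)}-\varepsilon_{i^-(e)}$ otherwise, and let the height space be $\widetilde{\mathbb{N}}^{E(G)}=\{(h_e)_{e\in E(G)}\in\mathbb{R}^{E(G)}: h_e-\Delta(e)\in\mathbb{Z}_{\ge0}\text{ for all }e\}$. Contribution of $\Gamma$ (with $\mu_v=(2)$ for all $v$): $$N'(\Pi,\Gamma)=\sum_{G\in\Gamma}\ \sum_{h\in\widetilde{\mathbb{N}}^{E(G)},\ w\in\mathbb{Z}_{\ge1}^{E(G)}}\ \prod_{e\in E(G)}w_e\,q^{h_ew_e}\prod_{v\in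 V(G)}A'(\mathbf w_v^-,\mathbf w_v^+,\mu_v)\,\delta(v),$$ where $\mathbf w_v^-$ (resp. $\mathbf w_v^+$) is the tuple of the $w_e$ over edges $e$ incoming at (resp. outgoing from) $v$, a loop at $v$ contributing to both, and $\delta(v)=1$ if $|\mathbf w_v^-|=|\mathbf w_v^+|$ (sums of entries) and $\delta(v)=0$ otherwise. Here $A'(\mathbf w^-,\mathbf w^+,\mu)$ is the triple Hurwitz number without unramified components: the number, weighted by $1/|\mathrm{Aut}|$, of isomorphism classes of possibly disconnected covers $\pi:S\to\mathbb{P}^1$ of degree $|\mathbf w^-|=|\mathbf w^+|$, unramified outside $0,1,\infty$, with labeled preimages of $0$ (resp. $\infty$) of ramification orders given by $\mathbf w^-$ (resp. $\mathbf w^+$), with ramification over $1$ given by $\mu$ completed by ones, and such that every component of $S$ contains a ramification point over $1$; automorphisms respect the labelings; $A'=0$ if $|\mathbf w^-|\ne|\mathbf w^+|$. Quasimodular forms: the ring of quasimodular forms for $\mathrm{SL}(2,\mathbb{Z})$ is $\mathbb{C}[G_2,G_4,G_6]$, where $G_{2k}=-\frac{B_{2k}}{4k}+\sum_{n\ge1}\sigma_{2k-1}(n)q^n$ has weight $2k$. A quasimodular form of mixed weight $\le K$ is a finite sum of quasimodular forms of weights $\le K$. *)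

theory Defs
  imports
    "HOL-Analysis.Analysis"
    "HOL-Computational_Algebra.Formal_Power_Series"
    "HOL-Library.Multiset"
    "HOL-Library.Uprod"
begin

section \<open>Labelled multigraphs and orientations\<close>

text \<open>The vertices are \<open>1, \<dots>, nverts \<Gamma>\<close>. A loop at \<open>v\<close> is an edge with ends
  \<open>Upair v v\<close>; multiple edges are distinct edges with equal ends.\<close>

record 'e multigraph =
  nverts :: nat
  edges :: "'e set"
  ends :: "'e \<Rightarrow> nat uprod"

definition is_multigraph :: "'e multigraph \<Rightarrow> bool" where
  "is_multigraph \<Gamma> \<longleftrightarrow>
     finite (edges \<Gamma>) \<and> (\<forall>e\<in>edges \<Gamma>. set_uprod (ends \<Gamma> e) \<subseteq> {1..nverts \<Gamma>})"

definition valency :: "'e multigraph \<Rightarrow> nat \<Rightarrow> nat" where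
  "valency \<Gamma> v =
     card {e \<in> edges \<Gamma>. v \<in> set_uprod (ends \<Gamma> e)} + card {e \<in> edges \<Gamma>. ends \<Gamma> e = Upair v v}"

definition trivalent :: "'e multigraph \<Rightarrow> bool" where
  "trivalent \<Gamma> \<longleftrightarrow> (\<forall>v\<in>{1..nverts \<Gamma>}. valency \<Gamma> v = 3)"

text \<open>An orientation maps an edge to its pair (initial vertex, terminal vertex). For a loop
  there is only one such pair, so loops carry no choice.\<close>

definition orientations :: "'e multigraph \<Rightarrow> ('e \<Rightarrow> nat \<times> nat) set" where
  "orientations \<Gamma> = (\<Pi>\<^sub>E e\<in>edges \<Gamma>. {(a, b). Upair a b = ends \<Gamma> e})"

definition incoming :: "'e multigraph \<Rightarrow> ('e \<Rightarrow> nat \<times> nat) \<Rightarrow> nat \<Rightarrow> 'e set" where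
  "incoming \<Gamma> G v = {e \<in> edges \<Gamma>. snd (G e) = v}"

definition outgoing :: "'e multigraph \<Rightarrow> ('e \<Rightarrow> nat \<times> nat) \<Rightarrow> nat \<Rightarrow> 'e set" where
  "outgoing \<Gamma> G v = {e \<in> edges \<Gamma>. fst (G e) = v}"

definition height_shift :: "(nat \<Rightarrow> real) \<Rightarrow> ('e \<Rightarrow> nat \<times> nat) \<Rightarrow> 'e \<Rightarrow> real" where
  "height_shift \<epsilon> G e =
     (if snd (G e) > fst (G e) then \<epsilon> (snd (G e)) - \<epsilon> (fst (G e))
      else 1 + \<epsilon> (snd (G e)) - \<epsilon> (fst (G e)))"

definition height_space ::
  "(nat \<Rightarrow> real) \<Rightarrow> 'e multigraph \<Rightarrow> ('e \<Rightarrow> nat \<times> nat) \<Rightarrow> ('e \<Rightarrow> real) set" where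
  "height_space \<epsilon> \<Gamma> G = (\<Pi>\<^sub>E e\<in>edges \<Gamma>. {x. x - height_shift \<epsilon> G e \<in> \<nat>})"

definition width_space :: "'e multigraph \<Rightarrow> ('e \<Rightarrow> nat) set" where
  "width_space \<Gamma> = (\<Pi>\<^sub>E e\<in>edges \<Gamma>. {1..})"


section \<open>Triple Hurwitz numbers without unramified components\<close>

definition riemann_sphere :: "complex option topology" where
  "riemann_sphere = Alexandroff_compactification euclidean"

text \<open>The inverse of the standard holomorphic coordinate centred at a point of the sphere:
  \<open>z - a\<close> at a finite point \<open>a\<close> and \<open>1 / z\<close> at infinity (\<open>None\<close>).\<close>

fun sphere_param :: "complex option \<Rightarrow> complex \<Rightarrow> complex option" where
  "sphere_param (Some a) t = Some (a + t)"
| "sphere_param None t = (if t = 0 then None else Some (1 / t))"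

text \<open>\<open>p\<close> has ramification order \<open>k\<close> at \<open>x\<close> if it is \<open>z \<mapsto> z ^ k\<close> in a
  coordinate \<open>\<phi>\<close> centred at \<open>x\<close>. Covers are branched covers of surfaces in this sense; the
  surface carries exactly one complex structure that makes \<open>p\<close> holomorphic, and
  homeomorphisms over the sphere are biholomorphic for it.\<close>

definition has_ram_order ::
  "'s topology \<Rightarrow> ('s \<Rightarrow> complex option) \<Rightarrow> 's \<Rightarrow> nat \<Rightarrow> bool" where
  "has_ram_order S p x k \<longleftrightarrow> k \<ge> 1 \<and>
     (\<exists>U r \<phi>. openin S U \<and> x \<in> U \<and> r > 0 \<and>
        homeomorphic_map (subtopology S U) (top_of_set (ball (0::complex) r)) \<phi> \<and> \<phi> x = 0 \<and>
        (\<forall>u\<in>U. p u = sphere_param (p x) (\<phi> u ^ k)))"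

definition ram_order :: "'s topology \<Rightarrow> ('s \<Rightarrow> complex option) \<Rightarrow> 's \<Rightarrow> nat" where
  "ram_order S p x = (THE k. has_ram_order S p x k)"

definition fibre :: "'s topology \<Rightarrow> ('s \<Rightarrow> complex option) \<Rightarrow> complex option \<Rightarrow> 's set" where
  "fibre S p y = {x \<in> topspace S. p x = y}"

definition branched_cover :: "'s topology \<Rightarrow> ('s \<Rightarrow> complex option) \<Rightarrow> bool" where
  "branched_cover S p \<longleftrightarrow>
     compact_space S \<and> Hausdorff_space S \<and> continuous_map S riemann_sphere p \<and>
     (\<forall>x\<in>topspace S. \<exists>k. has_ram_order S p x k)"

text \<open>For a cover unramified outside \<open>0, 1, \<infinity>\<close> the degree is the number of points over any
  other value.\<close>

definition three_point_cover ::
  "'s topology \<Rightarrow> ('s \<Rightarrow> complex option) \<Rightarrow> nat \<Rightarrow> bool" where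
  "three_point_cover S p d \<longleftrightarrow> branched_cover S p \<and>
     (\<forall>y. y \<notin> {Some 0, Some 1, None} \<longrightarrow>
        (\<forall>x\<in>fibre S p y. ram_order S p x = 1) \<and> finite (fibre S p y) \<and> card (fibre S p y) = d)"

text \<open>Surfaces are modelled on subsets of the type \<^typ>\<open>complex option\<close>, with an arbitrary
  topology. Every nonempty compact surface has the cardinality of the continuum, so every
  isomorphism class of covers is represented. Tuples of ramification orders are families
  indexed by finite sets, here \<open>I\<close> over 0 and \<open>J\<close> over infinity, and a labelling is a
  bijection from the index set to the fibre; values outside the index set are irrelevant.\<close>

record ('i, 'j) labelled_cover =
  surface :: "complex option topology"
  proj :: "complex option \<Rightarrow> complex option"
  label_zero :: "'i \<Rightarrow> complex option"
  label_inf :: "'j \<Rightarrow> complex option"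

definition hurwitz_covers ::
  "'i set \<Rightarrow> ('i \<Rightarrow> nat) \<Rightarrow> 'j set \<Rightarrow> ('j \<Rightarrow> nat) \<Rightarrow> nat multiset
     \<Rightarrow> ('i, 'j) labelled_cover set" where
  "hurwitz_covers I wm J wp \<mu> = {c. let S = surface c; p = proj c in
     three_point_cover S p (\<Sum>i\<in>I. wm i) \<and>
     bij_betw (label_zero c) I (fibre S p (Some 0)) \<and>
     (\<forall>i\<in>I. ram_order S p (label_zero c i) = wm i) \<and>
     bij_betw (label_inf c) J (fibre S p None) \<and>
     (\<forall>j\<in>J. ram_order S p (label_inf c j) = wp j) \<and>
     finite (fibre S p (Some 1)) \<and>
     (\<exists>m. image_mset (ram_order S p) (mset_set (fibre S p (Some 1))) = \<mu> + replicate_mset m 1) \<and>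
     (\<forall>C\<in>connected_components_of S. \<exists>x\<in>C. p x = Some 1 \<and> ram_order S p x > 1)}"

definition cover_iso ::
  "'i set \<Rightarrow> 'j set \<Rightarrow> ('i, 'j) labelled_cover \<Rightarrow> ('i, 'j) labelled_cover
     \<Rightarrow> (complex option \<Rightarrow> complex option) \<Rightarrow> bool" where
  "cover_iso I J c c' f \<longleftrightarrow>
     homeomorphic_map (surface c) (surface c') f \<and>
     (\<forall>x\<in>topspace (surface c). proj c' (f x) = proj c x) \<and>
     (\<forall>i\<in>I. f (label_zero c i) = label_zero c' i) \<and>
     (\<forall>j\<in>J. f (label_inf c j) = label_inf c' j)"

definition cover_aut ::
  "'i set \<Rightarrow> 'j set \<Rightarrow> ('i, 'j) labelled_cover \<Rightarrow> (complex option \<Rightarrow> complex option) set" where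
  "cover_aut I J c = {f \<in> extensional (topspace (surface c)). cover_iso I J c c f}"

definition iso_classes ::
  "'i set \<Rightarrow> ('i \<Rightarrow> nat) \<Rightarrow> 'j set \<Rightarrow> ('j \<Rightarrow> nat) \<Rightarrow> nat multiset
     \<Rightarrow> ('i, 'j) labelled_cover set set" where
  "iso_classes I wm J wp \<mu> = hurwitz_covers I wm J wp \<mu> //
     {(c, c'). c \<in> hurwitz_covers I wm J wp \<mu> \<and> c' \<in> hurwitz_covers I wm J wp \<mu> \<and>
        (\<exists>f. cover_iso I J c c' f)}"

definition hurwitz_number ::
  "'i set \<Rightarrow> ('i \<Rightarrow> nat) \<Rightarrow> 'j set \<Rightarrow> ('j \<Rightarrow> nat) \<Rightarrow> nat multiset \<Rightarrow> real" where
  "hurwitz_number I wm J wp \<mu> =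
     (if (\<Sum>i\<in>I. wm i) = (\<Sum>j\<in>J. wp j)
      then \<Sum>K\<in>iso_classes I wm J wp \<mu>. 1 / real (card (cover_aut I J (SOME c. c \<in> K)))
      else 0)"


section \<open>The contribution of a graph\<close>

definition balance :: "'e multigraph \<Rightarrow> ('e \<Rightarrow> nat \<times> nat) \<Rightarrow> ('e \<Rightarrow> nat) \<Rightarrow> nat \<Rightarrow> real" where
  "balance \<Gamma> G w v = (if (\<Sum>e\<in>incoming \<Gamma> G v. w e) = (\<Sum>e\<in>outgoing \<Gamma> G v. w e) then 1 else 0)"

text \<open>The heights are real, so a priori the contribution is a formal series in \<open>q\<close> with real
  exponents. It is given by its coefficient function: \<open>contribution \<epsilon> prof \<Gamma> s\<close> is the
  coefficient of \<open>q\<close> to the power \<open>s\<close>. The partition at vertex \<open>v\<close> is \<open>prof ! (v - 1)\<close>.\<close>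

definition terms_of_exponent ::
  "(nat \<Rightarrow> real) \<Rightarrow> 'e multigraph \<Rightarrow> ('e \<Rightarrow> nat \<times> nat) \<Rightarrow> real
     \<Rightarrow> (('e \<Rightarrow> real) \<times> ('e \<Rightarrow> nat)) set" where
  "terms_of_exponent \<epsilon> \<Gamma> G s =
     {(h, w). h \<in> height_space \<epsilon> \<Gamma> G \<and> w \<in> width_space \<Gamma> \<and> (\<Sum>e\<in>edges \<Gamma>. h e * real (w e)) = s}"

definition contribution ::
  "(nat \<Rightarrow> real) \<Rightarrow> nat multiset list \<Rightarrow> 'e multigraph \<Rightarrow> real \<Rightarrow> complex" where
  "contribution \<epsilon> prof \<Gamma> s =
     (\<Sum>G\<in>orientations \<Gamma>. \<Sum>(h, w)\<in>terms_of_exponent \<epsilon> \<Gamma> G s.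
        of_real ((\<Prod>e\<in>edges \<Gamma>. real (w e)) *
          (\<Prod>v\<in>{1..nverts \<Gamma>}.
             hurwitz_number (incoming \<Gamma> G v) w (outgoing \<Gamma> G v) w (prof ! (v - 1)) *
             balance \<Gamma> G w v)))"

text \<open>The sums in this definition are finite, since all heights are positive.\<close>

lemma finite_orientations:
  assumes "is_multigraph \<Gamma>"
  shows "finite (orientations \<Gamma>)"
  unfolding orientations_def
proof (rule finite_PiE)
  show "finite (edges \<Gamma>)" using assms by (simp add: is_multigraph_def)
next
  fix e assume "e \<in> edges \<Gamma>"
  have "{(a, b). Upair a b = ends \<Gamma> e} \<subseteq> set_uprod (ends \<Gamma> e) \<times> set_uprod (ends \<Gamma> e)"
    by (auto dest!: sym[of _ "ends \<Gamma> e"])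
  then show "finite {(a, b). Upair a b = ends \<Gamma> e}"
    by (rule finite_subset) simp
qed

lemma height_shift_pos:
  assumes \<Gamma>: "is_multigraph \<Gamma>" and G: "G \<in> orientations \<Gamma>" and e: "e \<in> edges \<Gamma>"
    and eps: "\<And>i. i \<in> {1..nverts \<Gamma>} \<Longrightarrow> 0 \<le> \<epsilon> i \<and> \<epsilon> i < 1"
      "strict_mono_on {1..nverts \<Gamma>} \<epsilon>"
  shows "height_shift \<epsilon> G e > 0"
proof -
  obtain a b where ab: "G e = (a, b)" by fastforce
  with G e have "Upair a b = ends \<Gamma> e" by (force simp: orientations_def PiE_iff)
  then have "{a, b} \<subseteq> {1..nverts \<Gamma>}"
    using \<Gamma> e unfolding is_multigraph_def by (metis set_uprod_simps)
  then have "a \<in> {1..nverts \<Gamma>}" "b \<in> {1..nverts \<Gamma>}" by auto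
  then show ?thesis
    using eps(1)[of a] eps(1)[of b] strict_mono_onD[OF eps(2), of a b] ab
    by (auto simp: height_shift_def)
qed

lemma finite_terms_of_exponent:
  assumes \<Gamma>: "is_multigraph \<Gamma>" and G: "G \<in> orientations \<Gamma>"
    and eps: "\<And>i. i \<in> {1..nverts \<Gamma>} \<Longrightarrow> 0 \<le> \<epsilon> i \<and> \<epsilon> i < 1"
      "strict_mono_on {1..nverts \<Gamma>} \<epsilon>"
  shows "finite (terms_of_exponent \<epsilon> \<Gamma> G s)"
proof -
  let ?D = "height_shift \<epsilon> G"
  let ?H = "\<Pi>\<^sub>E e\<in>edges \<Gamma>. (\<lambda>k. ?D e + real k) ` {..nat \<lceil>s\<rceil>}"
  let ?W = "\<Pi>\<^sub>E e\<in>edges \<Gamma>. {..nat \<lceil>s / ?D e\<rceil>}"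
  have fin: "finite (edges \<Gamma>)" using \<Gamma> by (simp add: is_multigraph_def)
  have "terms_of_exponent \<epsilon> \<Gamma> G s \<subseteq> ?H \<times> ?W"
  proof
    fix x assume "x \<in> terms_of_exponent \<epsilon> \<Gamma> G s"
    then obtain h w where x: "x = (h, w)" and h: "h \<in> height_space \<epsilon> \<Gamma> G"
      and w: "w \<in> width_space \<Gamma>" and s: "(\<Sum>e\<in>edges \<Gamma>. h e * real (w e)) = s"
      by (auto simp: terms_of_exponent_def)
    have key: "\<exists>k. h e = ?D e + real k \<and> k \<le> nat \<lceil>s\<rceil> \<and> w e \<le> nat \<lceil>s / ?D e\<rceil>"
      if e: "e \<in> edges \<Gamma>" for e
    proof -
      have ge: "h e' \<ge> ?D e'" "?D e' > 0" "w e' \<ge> 1" if "e' \<in> edges \<Gamma>" for e'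
        using h w that height_shift_pos[OF \<Gamma> G that eps]
        by (auto simp: height_space_def width_space_def PiE_iff elim!: Nats_cases
              dest!: bspec[of _ _ e'])
      obtain k where k: "h e = ?D e + real k"
        using h e by (auto simp: height_space_def PiE_iff elim!: Nats_cases dest!: bspec[of _ _ e]
              simp: algebra_simps)
      have nonneg: "h e' * real (w e') \<ge> 0" if "e' \<in> edges \<Gamma>" for e'
        using ge[OF that] by simp
      have le: "h e * real (w e) \<le> s"
        unfolding s[symmetric] by (rule member_le_sum) (use fin e nonneg in auto)
      have "h e * 1 \<le> h e * real (w e)" using ge[OF e] by (intro mult_left_mono) auto
      then have "real k \<le> s" using le k ge[OF e] by linarith
      then have 1: "k \<le> nat \<lceil>s\<rceil>" by linarith
      have "?D e * real (w e) \<le> h e * real (w e)" using ge[OF e] by (intro mult_right_mono) auto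
      with le have "?D e * real (w e) \<le> s" by linarith
      then have "real (w e) \<le> s / ?D e" using ge(2)[OF e] by (simp add: field_simps)
      then have 2: "w e \<le> nat \<lceil>s / ?D e\<rceil>" by linarith
      show ?thesis using k 1 2 by blast
    qed
    have "h \<in> extensional (edges \<Gamma>)" "w \<in> extensional (edges \<Gamma>)"
      using h w by (auto simp: height_space_def width_space_def PiE_iff)
    moreover have "\<And>e. e \<in> edges \<Gamma> \<Longrightarrow> h e \<in> (\<lambda>k. ?D e + real k) ` {..nat \<lceil>s\<rceil>}"
      using key by fastforce
    moreover have "\<And>e. e \<in> edges \<Gamma> \<Longrightarrow> w e \<in> {..nat \<lceil>s / ?D e\<rceil>}"
      using key by fastforce
    ultimately show "x \<in> ?H \<times> ?W" by (simp add: x PiE_iff)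
  qed
  moreover have "finite (?H \<times> ?W)" using fin by (intro finite_cartesian_product finite_PiE) auto
  ultimately show ?thesis by (rule finite_subset)
qed


section \<open>Quasimodular forms\<close>

text \<open>\<open>B_k / k!\<close> is the coefficient of \<open>X^k\<close> in \<open>X / (exp X - 1)\<close>.\<close>

definition bernoulli_number :: "nat \<Rightarrow> complex" where
  "bernoulli_number k = fact k * fps_nth (fps_X / (fps_exp 1 - 1)) k"

definition divisor_sigma :: "nat \<Rightarrow> nat \<Rightarrow> nat" where
  "divisor_sigma k m = (\<Sum>d | d dvd m. d ^ k)"

text \<open>\<open>eisenstein k\<close> is the q-expansion of the Eisenstein series of weight \<open>2 * k\<close>.\<close>

definition eisenstein :: "nat \<Rightarrow> complex fps" where
  "eisenstein k = Abs_fps (\<lambda>m. if m = 0 then - bernoulli_number (2 * k) / of_nat (4 * k)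
                               else of_nat (divisor_sigma (2 * k - 1) m))"

definition quasimodular_of_weight :: "nat \<Rightarrow> complex fps set" where
  "quasimodular_of_weight k =
     {(\<Sum>(a, b, c)\<in>{(a, b, c). 2 * a + 4 * b + 6 * c = k}.
         fps_const (x a b c) * eisenstein 1 ^ a * eisenstein 2 ^ b * eisenstein 3 ^ c) |
       x :: nat \<Rightarrow> nat \<Rightarrow> nat \<Rightarrow> complex. True}"

definition quasimodular_of_mixed_weight_le :: "nat \<Rightarrow> complex fps set" where
  "quasimodular_of_mixed_weight_le K =
     {(\<Sum>k\<le>K. f k) | f. \<forall>k\<le>K. f k \<in> quasimodular_of_weight k}"

text \<open>A power series in \<open>q\<close> as a series with real exponents.\<close>

definition real_exponent_series :: "complex fps \<Rightarrow> real \<Rightarrow> complex" where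
  "real_exponent_series F s = (if s \<in> \<nat> then fps_nth F (nat \<lfloor>s\<rfloor>) else 0)"

end

theory Submission
  imports Defs "HOL-Complex_Analysis.Complex_Analysis" "HOL-Computational_Algebra.Computational_Algebra"
begin

text \<open>
  The theorem rests on two facts that have nothing to do with each other.

  The first is that all vertex factors are trivial. At a vertex of valency three without loops
  the relevant cover has one point over one of \<open>0, \<infinity>\<close>, two points over the other, and one simple
  branch point over \<open>1\<close>. Up to isomorphism there is exactly one such labelled cover, namely
  \<open>z \<mapsto> c z^a (1 - z)^b\<close> or its reciprocal, and it has no automorphism that respects the labels; hence
  the Hurwitz number of a balanced vertex is \<open>1\<close> (\<open>hurwitz_number_trivalent\<close>). Since covers are given
  here by topological data, the uniqueness needs a proof from scratch. The unique zero has a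
  neighbourhood that covers the plane slit along \<open>[1, \<infinity>)\<close>, and the points over \<open>1\<close> have
  neighbourhoods that cover the plane slit along \<open>(-\<infinity>, 0]\<close>. The way in which these pieces are glued is
  determined by one number \<open>k\<close> between \<open>1\<close> and \<open>d / 2\<close> (\<open>normal_form\<close>), and covers with the same number
  are homeomorphic over the sphere (\<open>NF_homeomorphic\<close>). The models of degree \<open>d\<close> with pole orders \<open>t\<close>
  and \<open>d - t\<close>, for \<open>1 \<le> t \<le> d / 2\<close>, are pairwise inequivalent, so by counting they exhaust all possibilities
  (\<open>two_poles_classification\<close>); in particular the ramification orders over infinity decide the
  isomorphism class. An automorphism of a model is an entire function of linear growth that fixes
  \<open>0\<close> and \<open>1\<close>, hence the identity (\<open>rat_automorphism\<close>).

  A vertex with a loop can never be balanced, so graphs with loops contribute \<open>0\<close>. For the others,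
  fix the direction of every edge from its smaller to its larger end. An orientation together with
  widths is then an integer flow without zeros, the numbers \<open>\<epsilon>\<close> cancel from the exponent because a flow
  has no divergence, and the sum over heights is geometric. So the contribution is
  \<open>\<Sum> \<Prod> n_e / (1 - q^n_e)\<close> over all flows \<open>n\<close>, expanded suitably for negative \<open>n_e\<close>
  (\<open>contribution_flow_sum\<close>).

  The second fact is that such a flow sum is quasimodular (\<open>flow_sum_quasimodular\<close>). With
  \<open>x_n = 1 / (1 - q^n)\<close> for \<open>n \<noteq> 0\<close> and \<open>x_0 = 0\<close>, consider functions \<open>n^r x_n^j\<close> of weight \<open>r + j\<close>, with
  quasimodular coefficients, together with the indicator of \<open>n = 0\<close>. The identity
  \<open>x_m x_n = x_(m + n) (x_m + x_n - 1)\<close> rewrites a product of two edges that leave the same vertex as a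
  sum of products in which one factor depends only on the total flow \<open>m + n\<close>. Combinatorially one of
  the two edges then slides along the other, until the two are parallel and can be replaced by one edge
  that carries their convolution. Each move preserves weights and moves some lower end up or removes
  an edge, so finally no edges are left. What remains are the sums over a single \<open>n\<close>, which are
  divisor sums of odd total exponent; up to constants these are derivatives of Eisenstein series, and the ring of
  quasimodular forms is closed under \<open>q d/dq\<close>. Both properties of Eisenstein series, that all of them are
  polynomials in the first three and that derivatives stay in the ring, come from one elementary
  identity for divisor sums (\<open>dihedral_identity\<close>). Each edge has weight \<open>2\<close>, and a trivalent graph
  with \<open>n\<close> vertices has \<open>3 n / 2\<close> edges, so the weight is at most \<open>3 n\<close>.
\<close>

section \<open>Quasimodular forms and divisor sums\<close>

text \<open>The spanning set is taken over all weights at most \<open>K\<close> at once, in the form of an inductive set, so that closure properties are proved by induction on the number of monomials.\<close>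

definition emono :: "nat \<Rightarrow> nat \<Rightarrow> nat \<Rightarrow> complex fps" where
  "emono a b c = eisenstein 1 ^ a * eisenstein 2 ^ b * eisenstein 3 ^ c"

inductive_set espan :: "nat \<Rightarrow> complex fps set" for K where
  zero: "0 \<in> espan K"
| step: "F \<in> espan K \<Longrightarrow> 2 * a + 4 * b + 6 * c \<le> K \<Longrightarrow> F + fps_const x * emono a b c \<in> espan K"

lemma espan_emono: "2 * a + 4 * b + 6 * c \<le> K \<Longrightarrow> fps_const x * emono a b c \<in> espan K"
  using espan.step[OF espan.zero, of a b c K x] by simp

lemma espan_add:
  assumes "F \<in> espan K" "G \<in> espan K" shows "F + G \<in> espan K"
  using assms(2)
proof (induction G rule: espan.induct)
  case (step G a b c x)
  then show ?case using espan.step[of "F + G" K a b c x] by (simp add: add.assoc)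
qed (use assms in simp)

lemma espan_mono: "F \<in> espan K \<Longrightarrow> K \<le> L \<Longrightarrow> F \<in> espan L"
  by (induction F rule: espan.induct) (auto intro: espan.intros)

lemma emono_mult: "emono a b c * emono a' b' c' = emono (a + a') (b + b') (c + c')"
  by (simp add: emono_def power_add mult_ac)

lemma espan_mult:
  assumes "F \<in> espan K" "G \<in> espan L" shows "F * G \<in> espan (K + L)"
  using assms(1)
proof (induction F rule: espan.induct)
  case (step F a b c x)
  have "fps_const x * emono a b c * G \<in> espan (K + L)" using assms(2)
  proof (induction G rule: espan.induct)
    case (step G a' b' c' x')
    have "fps_const (x * x') * emono (a + a') (b + b') (c + c') \<in> espan (K + L)"
      by (rule espan_emono) (use step \<open>2 * a + 4 * b + 6 * c \<le> K\<close> in simp)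
    moreover have "fps_const (x * x') * emono (a + a') (b + b') (c + c')
        = fps_const x * emono a b c * (fps_const x' * emono a' b' c')"
      by (simp only: emono_mult[symmetric] fps_const_mult[symmetric] mult_ac)
    ultimately show ?case using step espan_add by (simp add: distrib_left)
  qed (simp add: espan.zero)
  with step show ?case by (simp add: distrib_right espan_add)
qed (simp add: espan.zero)

lemma espan_const: "fps_const x \<in> espan K"
  using espan_emono[of 0 0 0 K x] by (simp add: emono_def)

lemma espan_cmult: "F \<in> espan K \<Longrightarrow> fps_const x * F \<in> espan K"
  using espan_mult[OF espan_const[of x 0]] by simp

lemma espan_one: "1 \<in> espan K" using espan_const[of 1 K] by simp

lemma espan_uminus: "F \<in> espan K \<Longrightarrow> - F \<in> espan K"
  using espan_cmult[of F K "-1"] by (simp flip: fps_const_neg)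

lemma espan_diff: "F \<in> espan K \<Longrightarrow> G \<in> espan K \<Longrightarrow> F - G \<in> espan K"
  using espan_add[of F K "- G"] espan_uminus[of G K] by simp

lemma espan_sum: "(\<And>i. i \<in> A \<Longrightarrow> F i \<in> espan K) \<Longrightarrow> sum F A \<in> espan K"
  by (induction A rule: infinite_finite_induct) (auto intro: espan.zero espan_add)

lemma eisenstein_in_espan: "eisenstein 1 \<in> espan 2" "eisenstein 2 \<in> espan 4" "eisenstein 3 \<in> espan 6"
  using espan_emono[of 1 0 0 2 1] espan_emono[of 0 1 0 4 1] espan_emono[of 0 0 1 6 1]
  by (simp_all add: emono_def)

lemma weight_zero: "0 \<in> quasimodular_of_weight k"
  unfolding quasimodular_of_weight_def
  by (auto intro!: exI[of _ "\<lambda>_ _ _. 0"] simp: case_prod_unfold)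

lemma weight_add:
  assumes "F \<in> quasimodular_of_weight k" "G \<in> quasimodular_of_weight k"
  shows "F + G \<in> quasimodular_of_weight k"
proof -
  obtain x y where "F = (\<Sum>(a, b, c)\<in>{(a, b, c). 2 * a + 4 * b + 6 * c = k}.
            fps_const (x a b c) * eisenstein 1 ^ a * eisenstein 2 ^ b * eisenstein 3 ^ c)"
     "G = (\<Sum>(a, b, c)\<in>{(a, b, c). 2 * a + 4 * b + 6 * c = k}.
            fps_const (y a b c) * eisenstein 1 ^ a * eisenstein 2 ^ b * eisenstein 3 ^ c)"
    using assms unfolding quasimodular_of_weight_def by blast
  then have "F + G = (\<Sum>(a, b, c)\<in>{(a, b, c). 2 * a + 4 * b + 6 * c = k}.
            fps_const (x a b c + y a b c) * eisenstein 1 ^ a * eisenstein 2 ^ b * eisenstein 3 ^ c)"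
    by (simp add: sum.distrib[symmetric] case_prod_unfold algebra_simps flip: fps_const_add)
  then show ?thesis unfolding quasimodular_of_weight_def
    by (auto intro!: exI[of _ "\<lambda>a b c. x a b c + y a b c"])
qed

lemma weight_emono: "fps_const x * emono a b c \<in> quasimodular_of_weight (2 * a + 4 * b + 6 * c)"
proof -
  let ?k = "2 * a + 4 * b + 6 * c"
  let ?A = "{(a', b', c'). 2 * a' + 4 * b' + 6 * c' = ?k}"
  have fin: "finite ?A"
    by (rule finite_subset[of _ "{..?k} \<times> {..?k} \<times> {..?k}"]) auto
  have "(\<Sum>p\<in>?A. fps_const (if p = (a, b, c) then x else 0) *
      eisenstein 1 ^ fst p * eisenstein 2 ^ fst (snd p) * eisenstein 3 ^ snd (snd p))
    = (\<Sum>p\<in>?A. if p = (a, b, c) then fps_const x * emono a b c else 0)"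
    by (rule sum.cong) (auto simp: emono_def mult_ac)
  also have "\<dots> = fps_const x * emono a b c" using fin by simp
  finally show ?thesis unfolding quasimodular_of_weight_def
    by (auto intro!: exI[of _ "\<lambda>a' b' c'. if (a', b', c') = (a, b, c) then x else 0"]
          simp: case_prod_unfold)
qed

lemma espan_subset: "espan K \<subseteq> quasimodular_of_mixed_weight_le K"
proof
  fix F assume "F \<in> espan K"
  then show "F \<in> quasimodular_of_mixed_weight_le K"
  proof (induction F rule: espan.induct)
    case zero
    then show ?case unfolding quasimodular_of_mixed_weight_le_def
      by (auto intro!: exI[of _ "\<lambda>_. 0"] weight_zero)
  next
    case (step F a b c x)
    then obtain f where f: "F = (\<Sum>k\<le>K. f k)" "\<forall>k\<le>K. f k \<in> quasimodular_of_weight k"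
      unfolding quasimodular_of_mixed_weight_le_def by blast
    let ?g = "\<lambda>k. if k = 2 * a + 4 * b + 6 * c then fps_const x * emono a b c else 0"
    have "F + fps_const x * emono a b c = (\<Sum>k\<le>K. f k + ?g k)"
      using step by (simp add: f sum.distrib)
    moreover have "\<forall>k\<le>K. f k + ?g k \<in> quasimodular_of_weight k"
      using f(2) weight_add weight_emono weight_zero by auto
    ultimately show ?case unfolding quasimodular_of_mixed_weight_le_def by blast
  qed
qed

text \<open>The non-constant part of an Eisenstein series, in every index. Odd indices give quasimodular forms.\<close>

definition Sg :: "nat \<Rightarrow> complex fps" where
  "Sg i = Abs_fps (\<lambda>k. of_nat (divisor_sigma i k))"

definition qderiv :: "complex fps \<Rightarrow> complex fps" where
  "qderiv F = fps_X * fps_deriv F"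

lemma qderiv_nth [simp]: "fps_nth (qderiv F) k = of_nat k * fps_nth F k"
  by (cases k) (simp_all add: qderiv_def)

lemma divisor_sigma_0 [simp]: "divisor_sigma i 0 = 0"
  by (simp add: divisor_sigma_def infinite_UNIV_nat)

lemma eisenstein_Sg: "k \<ge> 1 \<Longrightarrow> eisenstein k = fps_const (- bernoulli_number (2 * k) / of_nat (4 * k)) + Sg (2 * k - 1)"
  by (rule fps_ext) (simp add: eisenstein_def Sg_def)

lemma Sg_low: "Sg 1 \<in> espan 2" "Sg 3 \<in> espan 4" "Sg 5 \<in> espan 6"
proof -
  have "Sg (2 * k - 1) \<in> espan K" if "k \<ge> 1" "eisenstein k \<in> espan K" for k K
  proof -
    have "Sg (2 * k - 1) = eisenstein k - fps_const (- bernoulli_number (2 * k) / of_nat (4 * k))"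
      using that(1) by (simp only: eisenstein_Sg) simp
    with that show ?thesis by (metis espan_const espan_diff)
  qed
  from this[of 1 2] this[of 2 4] this[of 3 6] eisenstein_in_espan
  show "Sg 1 \<in> espan 2" "Sg 3 \<in> espan 4" "Sg 5 \<in> espan 6" by simp_all
qed

text \<open>Triangularity: the difference of \<open>x^(i + 1)\<close> is \<open>(i + 1) x^i\<close> plus lower powers, which are differences by induction.\<close>

lemma faulhaber:
  "\<exists>P :: real poly. degree P \<le> i + 1 \<and> coeff P (i + 1) = 1 / of_nat (i + 1) \<and> poly P 0 = 0 \<and>
     (\<forall>x. poly P (x + 1) - poly P x = x ^ i)"
proof (induction i rule: less_induct)
  case (less i)
  then obtain P :: "nat \<Rightarrow> real poly" where P: "\<And>l. l < i \<Longrightarrow> degree (P l) \<le> l + 1"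
    "\<And>l. l < i \<Longrightarrow> poly (P l) 0 = 0"
    "\<And>l x. l < i \<Longrightarrow> poly (P l) (x + 1) - poly (P l) x = x ^ l" by metis
  define R where "R = (\<Sum>l<i. smult (of_nat ((i + 1) choose l)) (P l))"
  define Q where "Q = smult (1 / of_nat (i + 1)) (monom 1 (i + 1) - R)"
  have dR: "degree R \<le> i" unfolding R_def
    by (rule degree_sum_le) (auto intro!: order_trans[OF degree_smult_le] order_trans[OF P(1)])
  have "degree Q \<le> i + 1" unfolding Q_def
    by (intro order_trans[OF degree_smult_le] degree_diff_le degree_monom_le) (use dR in auto)
  moreover have "coeff Q (i + 1) = 1 / of_nat (i + 1)"
    using dR by (simp add: Q_def coeff_eq_0)
  moreover have "poly Q 0 = 0" by (simp add: Q_def R_def poly_monom poly_sum P)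
  moreover have "poly Q (x + 1) - poly Q x = x ^ i" for x
  proof -
    have "poly R (x + 1) - poly R x = (\<Sum>l<i. of_nat ((i + 1) choose l) * x ^ l)"
      by (simp add: R_def poly_sum sum_subtractf[symmetric] right_diff_distrib[symmetric] P)
    moreover have "(x + 1) ^ (i + 1) = (\<Sum>l<i. of_nat ((i + 1) choose l) * x ^ l) + of_nat (i + 1) * x ^ i + x ^ (i + 1)"
      unfolding binomial_ring by (simp flip: lessThan_Suc_atMost)
    ultimately show ?thesis
      by (simp add: Q_def poly_monom right_diff_distrib[symmetric] divide_simps del: power_Suc)
  qed
  ultimately show ?case by blast
qed

definition faul :: "nat \<Rightarrow> real poly" where
  "faul i = (SOME P. degree P \<le> i + 1 \<and> coeff P (i + 1) = 1 / of_nat (i + 1) \<and> poly P 0 = 0 \<and>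
     (\<forall>x. poly P (x + 1) - poly P x = x ^ i))"

lemma faul: "degree (faul i) \<le> i + 1" "coeff (faul i) (i + 1) = 1 / of_nat (i + 1)" "poly (faul i) 0 = 0"
     "poly (faul i) (x + 1) - poly (faul i) x = x ^ i"
  using someI_ex[OF faulhaber[of i]] unfolding faul_def[symmetric] by blast+

lemma faul_nat: "poly (faul i) (real d) = (\<Sum>a<d. real a ^ i)"
proof (induction d)
  case (Suc d)
  then show ?case using faul(4)[of i "real d"] by (simp add: add.commute)
qed (simp add: faul)

text \<open>The difference equation determines the values at negative integers as well; the regularised sums below need both signs.\<close>

lemma faul_neg: "poly (faul i) (- real d) = - (\<Sum>a=1..d. (- real a) ^ i)"
proof (induction d)
  case (Suc d)
  then show ?case using faul(4)[of i "- real (Suc d)"] by (simp add: add.commute)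
qed (simp add: faul)

lemma dvd_div_gt0: "0 < k \<Longrightarrow> d dvd k \<Longrightarrow> 0 < k div (d :: nat)"
  by (auto elim!: dvdE)

text \<open>Pairs of factorisations whose products add up to \<open>k\<close>: the index set of the coefficient of \<open>q^k\<close> in a product of two divisor sums.\<close>

definition Tset :: "nat \<Rightarrow> (nat \<times> nat \<times> nat \<times> nat) set" where
  "Tset k = {(a, x, b, y). 0 < a \<and> 0 < x \<and> 0 < b \<and> 0 < y \<and> a * x + b * y = k}"

lemma finite_Tset [simp]: "finite (Tset k)"
proof -
  have "Tset k \<subseteq> {..k} \<times> {..k} \<times> {..k} \<times> {..k}"
  proof (clarsimp simp: Tset_def)
    fix a x b y :: nat assume *: "0 < a" "0 < x" "0 < b" "0 < y"
    have "a \<le> a * x" "x \<le> a * x" "b \<le> b * y" "y \<le> b * y" using * by auto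
    then show "a \<le> a * x + b * y \<and> x \<le> a * x + b * y \<and> b \<le> a * x + b * y \<and> y \<le> a * x + b * y"
      by linarith
  qed
  then show ?thesis by (rule finite_subset) auto
qed

text \<open>By the second symmetry \<open>H a (- b) = H a (a + b)\<close>. The substitution \<open>(a, x, b, y) \<mapsto> (a, x - y, a + b, y)\<close> preserves \<open>a x + b y\<close> and carries the part \<open>x > y\<close> of the sum of \<open>H a (a + b)\<close> to the part \<open>a < b\<close> of the sum of \<open>H a b\<close>; a mirror image does this for \<open>x < y\<close> and \<open>a > b\<close>. Only the diagonals remain.\<close>

lemma dihedral_sum:
  fixes H :: "real \<Rightarrow> real \<Rightarrow> real"
  assumes sym: "\<And>a b. H a b = H b a" and rot: "\<And>a b. H a b = H a (a - b)"
  shows "(\<Sum>(a, x, b, y)\<in>Tset k. H (real a) (- real b) - H (real a) (real b)) =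
     (\<Sum>(a, x, b, y)\<in>{(a, x, b, y)\<in>Tset k. x = y}. H (real a) (real a + real b)) -
     (\<Sum>(a, x, b, y)\<in>{(a, x, b, y)\<in>Tset k. a = b}. H (real a) (real a))"
proof -
  let ?f = "\<lambda>(a, x, b, y). H (real (a::nat)) (real a + real (b::nat))"
  let ?g = "\<lambda>(a, x, b, y). H (real (a::nat)) (real (b::nat))"
  let ?A = "{(a, x, b, y)\<in>Tset k. x > y}" and ?B = "{(a, x, b, y)\<in>Tset k. x < y}"
    and ?C = "{(a, x, b, y)\<in>Tset k. x = y}"
  let ?A' = "{(a, x, b, y)\<in>Tset k. a < b}" and ?B' = "{(a, x, b, y)\<in>Tset k. a > b}"
    and ?C' = "{(a, x, b, y)\<in>Tset k. a = b}"
  have fin: "finite ?A" "finite ?B" "finite ?C" "finite ?A'" "finite ?B'" "finite ?C'"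
    by (rule finite_subset[OF _ finite_Tset[of k]]; auto)+
  have split1: "sum F (Tset k) = sum F ?A + sum F ?B + sum F ?C" for F :: "_ \<Rightarrow> real"
  proof -
    have "Tset k = (?A \<union> ?B) \<union> ?C" by auto
    then have "sum F (Tset k) = sum F ((?A \<union> ?B) \<union> ?C)" by simp
    also have "\<dots> = sum F (?A \<union> ?B) + sum F ?C"
      by (rule sum.union_disjoint) (use fin in auto)
    also have "sum F (?A \<union> ?B) = sum F ?A + sum F ?B"
      by (rule sum.union_disjoint) (use fin in auto)
    finally show ?thesis .
  qed
  have split2: "sum F (Tset k) = sum F ?A' + sum F ?B' + sum F ?C'" for F :: "_ \<Rightarrow> real"
  proof -
    have "Tset k = (?A' \<union> ?B') \<union> ?C'" by auto
    then have "sum F (Tset k) = sum F ((?A' \<union> ?B') \<union> ?C')" by simp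
    also have "\<dots> = sum F (?A' \<union> ?B') + sum F ?C'"
      by (rule sum.union_disjoint) (use fin in auto)
    also have "sum F (?A' \<union> ?B') = sum F ?A' + sum F ?B'"
      by (rule sum.union_disjoint) (use fin in auto)
    finally show ?thesis .
  qed
  have 1: "sum ?f ?A = sum ?g ?A'"
  proof (rule sum.reindex_bij_witness[where j = "\<lambda>(a, x, b, y). (a, x - y, a + b, y)"
          and i = "\<lambda>(a, x, b, y). (a, x + y, b - a, y)"]; clarsimp)
    fix a x b y assume *: "(a, x, b, y) \<in> Tset k"
    { assume "y < x"
      then obtain e where "0 < e" "y + e = x" using less_imp_add_positive by blast
      then show "(a, x - y, a + b, y) \<in> Tset k \<and> 0 < b"
        using * by (auto simp: Tset_def algebra_simps) }
    { assume "a < b"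
      then obtain e where "0 < e" "a + e = b" using less_imp_add_positive by blast
      then show "(a, x + y, b - a, y) \<in> Tset k \<and> 0 < x"
        using * by (auto simp: Tset_def algebra_simps) }
  qed
  have 2: "sum ?f ?B = sum ?g ?B'"
  proof (rule sum.reindex_bij_witness[where j = "\<lambda>(a, x, b, y). (a + b, x, b, y - x)"
          and i = "\<lambda>(a, x, b, y). (a - b, x, b, y + x)"]; clarsimp)
    fix a x b y assume *: "(a, x, b, y) \<in> Tset k"
    { assume "x < y"
      then obtain e where "0 < e" "x + e = y" using less_imp_add_positive by blast
      then show "(a + b, x, b, y - x) \<in> Tset k \<and> 0 < a"
        using * by (auto simp: Tset_def algebra_simps) }
    { assume "b < a"
      then obtain e where "0 < e" "b + e = a" using less_imp_add_positive by blast
      then show "(a - b, x, b, y + x) \<in> Tset k \<and> 0 < y"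
        using * by (auto simp: Tset_def algebra_simps) }
    show "H (real a + real b) (real b) = H (real a) (real a + real b)"
      using sym[of "real a" "real a + real b"] rot[of "real a + real b" "real a"] by simp
  qed
  have flip: "H a (- b) = H a (a + b)" for a b using rot[of a "- b"] by simp
  have "(\<Sum>(a, x, b, y)\<in>Tset k. H (real a) (- real b) - H (real a) (real b)) = sum ?f (Tset k) - sum ?g (Tset k)"
    by (simp add: sum_subtractf case_prod_unfold flip)
  also have "\<dots> = sum ?f ?C - sum ?g ?C'"
    using split1[of ?f] split2[of ?g] 1 2 by simp
  also have "sum ?g ?C' = (\<Sum>(a, x, b, y)\<in>?C'. H (real a) (real a))" by (rule sum.cong) auto
  finally show ?thesis by simp
qed

lemma sum_Tset_eq_x:
  fixes F :: "nat \<Rightarrow> nat \<Rightarrow> real"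
  assumes "k > 0"
  shows "(\<Sum>(a, x, b, y)\<in>{(a, x, b, y)\<in>Tset k. x = y}. F a (a + b)) = (\<Sum>d | d dvd k. \<Sum>a\<in>{1..<d}. F a d)"
proof -
  have fin: "finite {d. d dvd k}" using assms by simp
  have "(\<Sum>d | d dvd k. \<Sum>a\<in>{1..<d}. F a d) = (\<Sum>(d, a)\<in>(SIGMA d:{d. d dvd k}. {1..<d}). F a d)"
    using fin by (subst sum.Sigma) auto
  also have "\<dots> = (\<Sum>(a, x, b, y)\<in>{(a, x, b, y)\<in>Tset k. x = y}. F a (a + b))"
  proof (rule sum.reindex_bij_witness[where i = "\<lambda>(a, x, b, y). (a + b, a)"
          and j = "\<lambda>(d, a). (a, k div d, d - a, k div d)"]; clarsimp)
    fix d a assume "d dvd k" "Suc 0 \<le> a" "a < d"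
    then show "(a, k div d, d - a, k div d) \<in> Tset k"
      using assms by (auto simp: Tset_def dvd_div_gt0 distrib_right[symmetric])
  next
    fix a x b assume "(a, x, b, x) \<in> Tset k"
    then have *: "0 < a" "0 < x" "0 < b" "k = (a + b) * x" by (auto simp: Tset_def algebra_simps)
    then show "k div (a + b) = x" by simp
    show "a + b dvd k \<and> Suc 0 \<le> a \<and> 0 < b" using * by auto
  qed
  finally show ?thesis by simp
qed

lemma sum_Tset_eq_a:
  fixes F :: "nat \<Rightarrow> real"
  assumes "k > 0"
  shows "(\<Sum>(a, x, b, y)\<in>{(a, x, b, y)\<in>Tset k. a = b}. F a) = (\<Sum>d | d dvd k. (real (k div d) - 1) * F d)"
proof -
  have fin: "finite {d. d dvd k}" using assms by simp
  have "(\<Sum>d | d dvd k. (real (k div d) - 1) * F d) = (\<Sum>d | d dvd k. \<Sum>x\<in>{1..<k div d}. F d)"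
  proof (rule sum.cong)
    fix d assume "d \<in> {d. d dvd k}"
    then have "k div d \<ge> 1" using assms dvd_div_gt0[of k d] by (simp add: Suc_le_eq)
    then show "(real (k div d) - 1) * F d = (\<Sum>x\<in>{1..<k div d}. F d)" by (simp add: of_nat_diff)
  qed simp
  also have "\<dots> = (\<Sum>(d, x)\<in>(SIGMA d:{d. d dvd k}. {1..<k div d}). F d)"
    using fin by (subst sum.Sigma) auto
  also have "\<dots> = (\<Sum>(a, x, b, y)\<in>{(a, x, b, y)\<in>Tset k. a = b}. F a)"
  proof (rule sum.reindex_bij_witness[where i = "\<lambda>(a, x, b, y). (a, x)"
          and j = "\<lambda>(d, x). (d, x, d, k div d - x)"]; clarsimp)
    fix d x assume "d dvd k" "Suc 0 \<le> x" "x < k div d"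
    then show "(d, x, d, k div d - x) \<in> Tset k"
      using assms by (auto simp: Tset_def distrib_left[symmetric] intro!: Nat.gr0I)
  next
    fix b x y assume "(b, x, b, y) \<in> Tset k"
    then have *: "0 < b" "0 < x" "0 < y" "k = b * (x + y)" by (auto simp: Tset_def algebra_simps)
    then show "k div b - x = y" by simp
    show "b dvd k \<and> Suc 0 \<le> x \<and> x < k div b" using * by auto
  qed
  finally show ?thesis by simp
qed

lemma sum_Tset_power:
  "(\<Sum>(a, x, b, y)\<in>Tset k. real a ^ i * real b ^ j) = (\<Sum>u=0..k. real (divisor_sigma i u) * real (divisor_sigma j (k - u)))"
proof -
  have "(\<Sum>u=0..k. real (divisor_sigma i u) * real (divisor_sigma j (k - u)))
     = (\<Sum>u\<in>{1..<k}. real (divisor_sigma i u) * real (divisor_sigma j (k - u)))"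
    by (rule sum.mono_neutral_right) (auto simp: Suc_le_eq intro!: Nat.gr0I)
  also have "\<dots> = (\<Sum>u\<in>{1..<k}. \<Sum>(a, b)\<in>{a. a dvd u} \<times> {b. b dvd k - u}. real a ^ i * real b ^ j)"
    by (rule sum.cong) (simp_all add: divisor_sigma_def sum_product sum.cartesian_product)
  also have "\<dots> = (\<Sum>(u, a, b)\<in>(SIGMA u:{1..<k}. {a. a dvd u} \<times> {b. b dvd k - u}). real a ^ i * real b ^ j)"
    by (subst sum.Sigma) (auto intro!: finite_cartesian_product simp: finite_divisors_nat)
  also have "\<dots> = (\<Sum>(a, x, b, y)\<in>Tset k. real a ^ i * real b ^ j)"
    by (rule sum.reindex_bij_witness[where i = "\<lambda>(a, x, b, y). (a * x, a, b)"
          and j = "\<lambda>(u, a, b). (a, u div a, b, (k - u) div b)"])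
       (auto simp: Tset_def dvd_div_gt0 intro: dvd_pos_nat[of "k - x" for x])
  finally show ?thesis by simp
qed

lemma coeff_reflect: "coeff (pcompose G [:0, -1:]) l = (-1) ^ l * coeff (G :: real poly) l"
proof (induction G arbitrary: l)
  case (pCons a G)
  then show ?case by (cases l) (simp_all add: pcompose_pCons)
qed simp

lemma poly_altdef_le: "degree (p :: 'a :: comm_ring_1 poly) \<le> n \<Longrightarrow> poly p x = (\<Sum>l\<le>n. coeff p l * x ^ l)"
  unfolding poly_altdef by (rule sum.mono_neutral_left) (auto simp: coeff_eq_0)

text \<open>For homogeneous \<open>H\<close> of even degree the left side of the previous identity keeps the odd powers of \<open>b\<close> and becomes a combination of products of two divisor sums. The diagonals are power sums, that is a derivative and, by Faulhaber's formula, single divisor sums; symmetry of \<open>H\<close> leaves only those of odd index. The coefficient of the top index is the integral of \<open>H(t, 1)\<close> over the unit interval.\<close>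

lemma dihedral_identity:
  fixes H :: "real \<Rightarrow> real \<Rightarrow> real" and c :: "nat \<Rightarrow> real"
  assumes m: "m \<ge> 1" and sym: "\<And>a b. H a b = H b a" and rot: "\<And>a b. H a b = H a (a - b)"
    and hom: "\<And>a b. H a b = (\<Sum>i\<le>2*m. c i * (a ^ i * b ^ (2*m-i)))"
  obtains g :: "nat \<Rightarrow> real" where "\<And>l. even l \<Longrightarrow> g l = 0" "g (2*m+1) = (\<Sum>i\<le>2*m. c i / (real i + 1))"
    "(\<Sum>i\<in>{i. i \<le> 2*m \<and> odd i}. fps_const (of_real (-2 * c i)) * (Sg i * Sg (2*m-i))) =
      fps_const (of_real (- c (2*m))) * qderiv (Sg (2*m-1)) + (\<Sum>l\<le>2*m+1. fps_const (of_real (g l)) * Sg l)"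
proof -
  define G where "G = (\<Sum>i\<le>2*m. smult (c i) (monom 1 (2*m-i) * faul i))"
  have dG: "degree G \<le> 2*m+1" unfolding G_def
  proof (rule degree_sum_le)
    fix i assume "i \<in> {..2*m}"
    then have "degree (monom 1 (2*m-i) * faul i) \<le> (2*m - i) + (i + 1)"
      by (intro order_trans[OF degree_mult_le] add_mono degree_monom_le faul(1))
    also have "\<dots> = 2 * m + 1" using \<open>i \<in> {..2*m}\<close> by simp
    finally show "degree (smult (c i) (monom 1 (2*m-i) * faul i)) \<le> 2*m+1"
      by (rule order_trans[OF degree_smult_le])
  qed simp
  have lead: "coeff G (2*m+1) = (\<Sum>i\<le>2*m. c i / (real i + 1))"
    unfolding G_def coeff_sum
  proof (rule sum.cong)
    fix i assume "i \<in> {..2*m}"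
    then have "2 * m + 1 - (2 * m - i) = i + 1" by simp
    then show "coeff (smult (c i) (monom 1 (2*m-i) * faul i)) (2*m+1) = c i / (real i + 1)"
      using faul(2)[of i] by (simp add: coeff_monom_mult)
  qed simp
  have diag: "H d d = H 0 d" "H d d = c (2*m) * d ^ (2*m)" for d
  proof -
    have "H d 0 = (\<Sum>i\<le>2*m. if i = 2 * m then c (2*m) * d ^ (2*m) else 0)"
      unfolding hom by (rule sum.cong) auto
    also have "\<dots> = c (2*m) * d ^ (2*m)" by simp
    finally show "H d d = c (2*m) * d ^ (2*m)" "H d d = H 0 d" using rot[of d d] sym[of d 0] by simp_all
  qed
  have polyG: "poly G (real d) = (\<Sum>a<d. H (real a) (real d))" for d
    unfolding G_def hom poly_sum
    by (subst sum.swap, rule sum.cong) (simp_all add: poly_monom faul_nat sum_distrib_left sum_distrib_right mult_ac)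
  have refl: "H (- a) (- b) = H a b" for a b
    unfolding hom
  proof (rule sum.cong)
    fix i assume "i \<in> {..2*m}"
    then have "(- a) ^ i * (- b) ^ (2*m-i) = (-1) ^ (i + (2*m - i)) * (a ^ i * b ^ (2*m-i))"
      by (simp only: power_add power_minus[of a] power_minus[of b] mult_ac)
    also have "i + (2*m - i) = 2 * m" using \<open>i \<in> {..2*m}\<close> by simp
    finally show "c i * ((- a) ^ i * (- b) ^ (2*m-i)) = c i * (a ^ i * b ^ (2*m-i))" by simp
  qed simp
  have "poly G (- real d) = - poly G (real d)" for d
  proof -
    have "poly G (- real d) = - (\<Sum>a=1..d. H (- real a) (- real d))"
      unfolding G_def hom poly_sum sum_negf[symmetric]
      by (subst sum.swap, rule sum.cong)
         (simp_all add: poly_monom faul_neg sum_distrib_left sum_distrib_right mult_ac sum_negf)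
    also have "(\<Sum>a=1..d. H (- real a) (- real d)) = (\<Sum>a=1..d. H (real a) (real d))" by (simp only: refl)
    also have "\<dots> = (\<Sum>a<d. H (real a) (real d))"
    proof (cases d)
      case (Suc e)
      have "(\<Sum>a=1..d. H (real a) (real d)) + H 0 (real d) = (\<Sum>a\<le>d. H (real a) (real d))"
        by (simp add: atMost_atLeast0 sum.atLeast_Suc_atMost)
      also have "\<dots> = (\<Sum>a<d. H (real a) (real d)) + H (real d) (real d)"
        by (simp flip: lessThan_Suc_atMost)
      finally show ?thesis using diag(1)[of "real d"] by simp
    qed simp
    finally show ?thesis by (simp add: polyG)
  qed
  then have "poly (G + pcompose G [:0, -1:]) (real d) = 0" for d by (simp add: poly_pcompose)
  then have "range real \<subseteq> {x. poly (G + pcompose G [:0, -1:]) x = 0}" by auto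
  moreover have "infinite (range real)" by (simp add: range_inj_infinite inj_on_def)
  ultimately have "G + pcompose G [:0, -1:] = 0"
    using poly_roots_finite finite_subset by blast
  then have refl0: "coeff (G + pcompose G [:0, -1:]) l = 0" for l by (metis coeff_0)
  have even: "coeff G l = 0" if "even l" for l
    using that refl0[of l] by (simp add: coeff_reflect)
  have main: "(\<Sum>i\<in>{i. i \<le> 2*m \<and> odd i}. -2 * c i * (\<Sum>u=0..k. real (divisor_sigma i u) * real (divisor_sigma (2*m-i) (k - u))))
      = - c (2*m) * (real k * real (divisor_sigma (2*m-1) k)) + (\<Sum>l\<le>2*m+1. coeff G l * real (divisor_sigma l k))" (is "?L = ?R")
    if k: "k > 0" for k
  proof -
    have odd_part: "H a (- b) - H a b = (\<Sum>i\<in>{i. i \<le> 2*m \<and> odd i}. -2 * c i * (a ^ i * b ^ (2*m-i)))" for a b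
    proof -
      have "H a (- b) - H a b = (\<Sum>i\<le>2*m. c i * (a ^ i * (- b) ^ (2*m-i)) - c i * (a ^ i * b ^ (2*m-i)))"
        by (simp add: hom sum_subtractf)
      also have "\<dots> = (\<Sum>i\<le>2*m. if odd i then -2 * c i * (a ^ i * b ^ (2*m-i)) else 0)"
        by (rule sum.cong) (auto simp: power_minus_odd)
      also have "\<dots> = (\<Sum>i\<in>{i. i \<le> 2*m \<and> odd i}. -2 * c i * (a ^ i * b ^ (2*m-i)))"
        by (subst sum.inter_filter[symmetric]) auto
      finally show ?thesis .
    qed
    have "?L = (\<Sum>i\<in>{i. i \<le> 2*m \<and> odd i}. \<Sum>(a, x, b, y)\<in>Tset k. -2 * c i * (real a ^ i * real b ^ (2*m-i)))"
      by (simp only: sum_Tset_power[symmetric] sum_distrib_left case_prod_unfold)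
    also have "\<dots> = (\<Sum>(a, x, b, y)\<in>Tset k. H (real a) (- real b) - H (real a) (real b))"
      by (subst sum.swap) (simp only: case_prod_unfold odd_part)
    also have "\<dots> = (\<Sum>d | d dvd k. \<Sum>a\<in>{1..<d}. H (real a) (real d)) - (\<Sum>d | d dvd k. (real (k div d) - 1) * H (real d) (real d))"
      using dihedral_sum[of H k, OF sym rot] sum_Tset_eq_x[OF k, of "\<lambda>a d. H (real a) (real d)"]
        sum_Tset_eq_a[OF k, of "\<lambda>d. H (real d) (real d)"] by simp
    also have "\<dots> = (\<Sum>d | d dvd k. poly G (real d) - c (2*m) * (real k * real d ^ (2*m-1)))"
      unfolding sum_subtractf[symmetric]
    proof (rule sum.cong)
      fix d assume "d \<in> {d. d dvd k}"
      then obtain e where e: "k = d * e" by auto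
      with k have d: "d > 0" "e > 0" by auto
      have "(\<Sum>a<d. H (real a) (real d)) = H 0 (real d) + (\<Sum>a\<in>{1..<d}. H (real a) (real d))"
        using d by (simp add: lessThan_atLeast0 sum.atLeast_Suc_lessThan)
      moreover have "real d ^ (2*m) = real d * real d ^ (2*m-1)" using m by (simp flip: power_Suc)
      ultimately show "(\<Sum>a\<in>{1..<d}. H (real a) (real d)) - (real (k div d) - 1) * H (real d) (real d)
         = poly G (real d) - c (2*m) * (real k * real d ^ (2*m-1))"
        using d diag[of "real d"] by (simp add: polyG e algebra_simps)
    qed simp
    also have "\<dots> = (\<Sum>d | d dvd k. \<Sum>l\<le>2*m+1. coeff G l * real d ^ l) - c (2*m) * (real k * real (divisor_sigma (2*m-1) k))"
      by (simp only: sum_subtractf sum_distrib_left[symmetric] divisor_sigma_def of_nat_sum of_nat_power poly_altdef_le[OF dG])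
    also have "(\<Sum>d | d dvd k. \<Sum>l\<le>2*m+1. coeff G l * real d ^ l) = (\<Sum>l\<le>2*m+1. coeff G l * real (divisor_sigma l k))"
      by (subst sum.swap) (simp only: sum_distrib_left[symmetric] divisor_sigma_def of_nat_sum of_nat_power)
    finally show ?thesis by simp
  qed
  show ?thesis
  proof (rule that[of "coeff G", OF even lead])
    show "(\<Sum>i\<in>{i. i \<le> 2*m \<and> odd i}. fps_const (of_real (-2 * c i)) * (Sg i * Sg (2*m-i))) =
      fps_const (of_real (- c (2*m))) * qderiv (Sg (2*m-1)) + (\<Sum>l\<le>2*m+1. fps_const (of_real (coeff G l)) * Sg l)" (is "?A = ?B")
    proof (rule fps_ext)
      fix k
      show "fps_nth ?A k = fps_nth ?B k"
      proof (cases "k = 0")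
        case True
        then show ?thesis by (simp add: fps_sum_nth Sg_def)
      next
        case False
        then have "k > 0" by simp
        have "fps_nth ?A k = of_real (\<Sum>i\<in>{i. i \<le> 2*m \<and> odd i}. -2 * c i * (\<Sum>u=0..k. real (divisor_sigma i u) * real (divisor_sigma (2*m-i) (k - u))))"
          by (simp only: fps_sum_nth fps_mult_left_const_nth)
             (simp only: fps_mult_nth Sg_def fps_nth_Abs_fps of_real_sum of_real_mult of_real_of_nat_eq)
        also have "\<dots> = fps_nth ?B k"
          unfolding main[OF \<open>k > 0\<close>]
          by (simp only: fps_add_nth fps_sum_nth fps_mult_left_const_nth qderiv_nth Sg_def fps_nth_Abs_fps of_real_sum of_real_add of_real_mult of_real_of_nat_eq)
        finally show ?thesis .
      qed
    qed
  qed
qed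

definition homog :: "nat \<Rightarrow> (real \<Rightarrow> real \<Rightarrow> real) \<Rightarrow> bool" where
  "homog d H \<longleftrightarrow> (\<exists>c. \<forall>a b. H a b = (\<Sum>i\<le>d. c i * (a ^ i * b ^ (d - i))))"

lemma homog_const: "homog 0 (\<lambda>a b. x)"
  unfolding homog_def by (rule exI[of _ "\<lambda>_. x"]) simp

lemma homog_diff: "homog d H \<Longrightarrow> homog d K \<Longrightarrow> homog d (\<lambda>a b. H a b - K a b)"
proof -
  assume "homog d H" "homog d K"
  then obtain c c' where "\<forall>a b. H a b = (\<Sum>i\<le>d. c i * (a ^ i * b ^ (d - i)))"
    "\<forall>a b. K a b = (\<Sum>i\<le>d. c' i * (a ^ i * b ^ (d - i)))" unfolding homog_def by blast
  then have "\<forall>a b. H a b - K a b = (\<Sum>i\<le>d. (c i - c' i) * (a ^ i * b ^ (d - i)))"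
    by (simp add: sum_subtractf[symmetric] left_diff_distrib)
  then show ?thesis unfolding homog_def by (rule exI[of _ "\<lambda>i. c i - c' i"])
qed

lemma homog_a: "homog d H \<Longrightarrow> homog (Suc d) (\<lambda>a b. a * H a b)"
proof -
  assume "homog d H"
  then obtain c where c: "\<And>a b. H a b = (\<Sum>i\<le>d. c i * (a ^ i * b ^ (d - i)))" unfolding homog_def by blast
  have "\<forall>a b. a * H a b = (\<Sum>i\<le>Suc d. (case i of 0 \<Rightarrow> 0 | Suc i \<Rightarrow> c i) * (a ^ i * b ^ (Suc d - i)))"
    by (subst sum.atMost_Suc_shift) (simp add: c sum_distrib_left mult_ac)
  then show ?thesis unfolding homog_def by (intro exI[of _ "\<lambda>i. case i of 0 \<Rightarrow> 0 | Suc i \<Rightarrow> c i"])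
qed

lemma homog_b: "homog d H \<Longrightarrow> homog (Suc d) (\<lambda>a b. b * H a b)"
proof -
  assume "homog d H"
  then obtain c where c: "\<And>a b. H a b = (\<Sum>i\<le>d. c i * (a ^ i * b ^ (d - i)))" unfolding homog_def by blast
  have "b * H a b = (\<Sum>i\<le>Suc d. (if i \<le> d then c i else 0) * (a ^ i * b ^ (Suc d - i)))" for a b
  proof -
    have "b * H a b = (\<Sum>i\<le>d. (if i \<le> d then c i else 0) * (a ^ i * b ^ (Suc d - i)))"
      unfolding c sum_distrib_left by (rule sum.cong) (simp_all add: Suc_diff_le)
    then show ?thesis by simp
  qed
  then show ?thesis unfolding homog_def by (intro exI[of _ "\<lambda>i. if i \<le> d then c i else 0"]) blast
qed

text \<open>The form is invariant under the dihedral group generated by the two symmetries, and so are its powers.\<close>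

abbreviation qform :: "real \<Rightarrow> real \<Rightarrow> real" where "qform a b \<equiv> a\<^sup>2 - a * b + b\<^sup>2"

lemma homog_qform_mult:
  assumes "homog d H" shows "homog (Suc (Suc d)) (\<lambda>a b. qform a b * H a b)"
proof -
  have "homog (Suc (Suc d)) (\<lambda>a b. a * (a * H a b) - (a * (b * H a b) - b * (b * H a b)))"
    by (intro homog_diff homog_a homog_b assms)
  then show ?thesis by (simp add: algebra_simps power2_eq_square)
qed

lemma homog_qform: "homog (2 * n) (\<lambda>a b. qform a b ^ n)"
proof (induction n)
  case (Suc n)
  then show ?case using homog_qform_mult[OF Suc] by simp
qed (simp add: homog_const)

lemma homog_qform': "homog (2 * n + 2) (\<lambda>a b. (a - b)\<^sup>2 * qform a b ^ n)"
proof -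
  have "homog (Suc (Suc (2 * n))) (\<lambda>a b. a * (a * qform a b ^ n - b * qform a b ^ n) - b * (a * qform a b ^ n - b * qform a b ^ n))"
    by (intro homog_diff homog_a homog_b homog_qform)
  moreover have "a * (a * z - b * z) - b * (a * z - b * z) = (a - b)\<^sup>2 * z" for a b z :: real
    by (simp add: algebra_simps power2_eq_square)
  ultimately show ?thesis by simp
qed

text \<open>Apply the dihedral identity to \<open>a^2 b^2 (a - b)^2\<close> times a power of the invariant form. Because \<open>H\<close> has no term in \<open>a^0\<close> or \<open>b^0\<close> and none in \<open>a b^(2 m - 1)\<close>, no derivative and only products of lower divisor sums occur, and the top coefficient is an integral of a positive function, hence not zero.\<close>

lemma Sg_odd: "Sg (2 * m + 1) \<in> espan (2 * m + 2)"
proof (induction m rule: less_induct)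
  case (less m)
  consider "m = 0" | "m = 1" | "m = 2" | n where "m = n + 3"
  proof -
    have "m = 0 \<or> m = 1 \<or> m = 2 \<or> m = (m - 3) + 3" by arith
    then show ?thesis using that by blast
  qed
  then show ?case
  proof cases
    case 4
    obtain c' where c': "\<And>a b. (a - b)\<^sup>2 * qform a b ^ n = (\<Sum>i\<le>2 * n + 2. c' i * (a ^ i * b ^ (2 * n + 2 - i)))"
      using homog_qform'[of n] unfolding homog_def by blast
    define c where "c i = (if 2 \<le> i \<and> i \<le> 2 * n + 4 then c' (i - 2) else 0)" for i
    define H where "H a b = a\<^sup>2 * b\<^sup>2 * ((a - b)\<^sup>2 * qform a b ^ n)" for a b :: real
    have hom: "H a b = (\<Sum>i\<le>2*m. c i * (a ^ i * b ^ (2*m-i)))" for a b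
    proof -
      have "(\<Sum>i\<le>2*m. c i * (a ^ i * b ^ (2*m-i))) = (\<Sum>i\<in>{2..2*n+4}. c i * (a ^ i * b ^ (2*m-i)))"
        by (rule sum.mono_neutral_right) (auto simp: c_def 4)
      also have "\<dots> = (\<Sum>j\<le>2*n+2. a\<^sup>2 * b\<^sup>2 * (c' j * (a ^ j * b ^ (2 * n + 2 - j))))"
      proof (rule sum.reindex_bij_witness[where i = "\<lambda>j. j + 2" and j = "\<lambda>i. i - 2"])
        fix i assume i: "i \<in> {2..2*n+4}"
        then obtain j where j: "i = j + 2" by (metis atLeastAtMost_iff le_add_diff_inverse2)
        have "2 * m - i = (2 * n + 2 - j) + 2" using i j 4 by simp
        then show "a\<^sup>2 * b\<^sup>2 * (c' (i - 2) * (a ^ (i - 2) * b ^ (2 * n + 2 - (i - 2)))) = c i * (a ^ i * b ^ (2*m-i))"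
          using i j by (simp only: c_def power_add) simp
      qed auto
      finally show ?thesis by (simp only: H_def c' sum_distrib_left)
    qed
    have sym: "H a b = H b a" for a b by (simp add: H_def power2_commute algebra_simps)
    have rot: "H a b = H a (a - b)" for a b
    proof -
      have *: "qform a (a - b) = qform a b" by (simp add: algebra_simps power2_eq_square)
      have "a - (a - b) = b" by simp
      then show ?thesis by (simp only: H_def * mult_ac)
    qed
    obtain g where g: "\<And>l. even l \<Longrightarrow> g l = 0" "g (2*m+1) = (\<Sum>i\<le>2*m. c i / (real i + 1))"
      "(\<Sum>i\<in>{i. i \<le> 2*m \<and> odd i}. fps_const (of_real (-2 * c i)) * (Sg i * Sg (2*m-i))) =
       fps_const (of_real (- c (2*m))) * qderiv (Sg (2*m-1)) + (\<Sum>l\<le>2*m+1. fps_const (of_real (g l)) * Sg l)"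
      by (rule dihedral_identity[of m H c, OF _ sym rot hom]) (use 4 in auto)
    \<comment> \<open>The top coefficient is \<open>W 1 - W 0\<close> for a primitive \<open>W\<close> of \<open>H t 1\<close>, which is positive inside the interval.\<close>
    have lead: "g (2*m+1) \<noteq> 0"
    proof -
      define W where "W t = (\<Sum>i\<le>2*m. c i * t ^ (i + 1) / (real i + 1))" for t :: real
      have W': "(W has_real_derivative H t 1) (at t)" for t
      proof -
        have "((\<lambda>t. c i * t ^ (i + 1) / (real i + 1)) has_real_derivative c i * (t ^ i * 1 ^ (2 * m - i))) (at t)" for i
        proof -
          have "((\<lambda>t. c i / (real i + 1) * t ^ (i + 1)) has_real_derivative c i / (real i + 1) * (real (i + 1) * t ^ (i + 1 - Suc 0))) (at t)"
            by (intro DERIV_cmult DERIV_pow)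
          moreover have "c i / (real i + 1) * (real (i + 1) * t ^ (i + 1 - Suc 0)) = c i * (t ^ i * 1 ^ (2 * m - i))"
            by (simp add: divide_simps)
          moreover have "(\<lambda>t. c i / (real i + 1) * t ^ (i + 1)) = (\<lambda>t. c i * t ^ (i + 1) / (real i + 1))"
            by auto
          ultimately show ?thesis by (simp only:)
        qed
        then show ?thesis unfolding W_def hom by (intro DERIV_sum)
      qed
      have "W 0 < W 1"
      proof -
        have "\<exists>y. (W has_real_derivative y) (at t) \<and> 0 < y" if t: "0 < t" "t < 1" for t :: real
        proof -
          have "qform t 1 = (t - 1)\<^sup>2 + t" by (simp add: power2_eq_square algebra_simps)
          then have "0 < qform t 1" using t zero_le_power2[of "t - 1"] by linarith
          then have "0 < H t 1" unfolding H_def using t by (intro mult_pos_pos) (auto simp: zero_less_power)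
          then show ?thesis using W' by blast
        qed
        moreover have "continuous_on {0..1} W"
          by (rule continuous_at_imp_continuous_on) (use W' DERIV_isCont in blast)
        ultimately show ?thesis using DERIV_pos_imp_increasing_open[of 0 1 W] by simp
      qed
      then show ?thesis unfolding g(2) by (simp add: W_def)
    qed
    have c0: "c (2*m) = 0" by (simp add: c_def 4)
    have IH: "Sg i \<in> espan (i + 1)" if "odd i" "i < 2 * m + 1" for i
      using less[of "i div 2"] that by (auto elim!: oddE)
    have "fps_const (of_real (g (2*m+1))) * Sg (2*m+1) =
       (\<Sum>i\<in>{i. i \<le> 2*m \<and> odd i}. fps_const (of_real (-2 * c i)) * (Sg i * Sg (2*m-i)))
       - (\<Sum>l\<le>2*m. fps_const (of_real (g l)) * Sg l)"
      unfolding g(3) c0 by simp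
    also have "\<dots> \<in> espan (2*m+2)"
    proof (intro espan_diff espan_sum)
      fix i assume i: "i \<in> {i. i \<le> 2 * m \<and> odd i}"
      then have "odd (2 * m - i)" "2 * m - i < 2 * m + 1" "i < 2 * m + 1" "i + 1 + (2 * m - i + 1) = 2 * m + 2" by auto
      then show "fps_const (of_real (-2 * c i)) * (Sg i * Sg (2*m-i)) \<in> espan (2*m+2)"
        using espan_mult[OF IH IH, of i "2*m-i"] i by (intro espan_cmult) auto
    next
      fix l assume l: "l \<in> {..2*m}"
      show "fps_const (of_real (g l)) * Sg l \<in> espan (2*m+2)"
      proof (cases "odd l")
        case True
        with l have "Sg l \<in> espan (2*m+2)" by (intro espan_mono[OF IH]) auto
        then show ?thesis by (rule espan_cmult)
      qed (simp add: g(1) espan.zero)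
    qed
    finally have "fps_const (of_real (inverse (g (2*m+1)))) * (fps_const (of_real (g (2*m+1))) * Sg (2*m+1)) \<in> espan (2*m+2)"
      by (rule espan_cmult)
    then show ?thesis using lead by (simp add: mult.assoc[symmetric])
  qed (use Sg_low in \<open>simp_all add: eval_nat_numeral\<close>)
qed

text \<open>The same identity for a power of the invariant form itself: now the coefficient of \<open>a^(2 m)\<close> is not zero and the identity can be solved for the derivative.\<close>

lemma qderiv_Sg:
  assumes m: "m \<ge> 1" shows "qderiv (Sg (2 * m - 1)) \<in> espan (2 * m + 2)"
proof -
  obtain c where hom: "\<And>a b. qform a b ^ m = (\<Sum>i\<le>2*m. c i * (a ^ i * b ^ (2*m-i)))"
    using homog_qform[of m] unfolding homog_def by blast
  obtain g where g: "\<And>l. even l \<Longrightarrow> g l = 0"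
      "(\<Sum>i\<in>{i. i \<le> 2*m \<and> odd i}. fps_const (of_real (-2 * c i)) * (Sg i * Sg (2*m-i))) =
       fps_const (of_real (- c (2*m))) * qderiv (Sg (2*m-1)) + (\<Sum>l\<le>2*m+1. fps_const (of_real (g l)) * Sg l)"
  proof -
    have "qform a b ^ m = qform b a ^ m" "qform a b ^ m = qform a (a - b) ^ m" for a b
      by (simp_all add: algebra_simps power2_eq_square)
    from dihedral_identity[of m "\<lambda>a b. qform a b ^ m" c, OF m this hom] that show thesis by blast
  qed
  have "(\<Sum>i\<le>2*m. c i * (1 ^ i * 0 ^ (2*m-i))) = (\<Sum>i\<le>2*m. if i = 2 * m then c (2*m) else 0)"
    by (rule sum.cong) auto
  then have c1: "c (2*m) = 1" using hom[of 1 0] by simp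
  have S: "Sg i \<in> espan (i + 1)" if "odd i" for i
    using Sg_odd[of "i div 2"] that by (auto elim!: oddE)
  have "qderiv (Sg (2*m-1)) = (\<Sum>l\<le>2*m+1. fps_const (of_real (g l)) * Sg l)
      - (\<Sum>i\<in>{i. i \<le> 2*m \<and> odd i}. fps_const (of_real (-2 * c i)) * (Sg i * Sg (2*m-i)))"
    unfolding g(2) c1 by (simp flip: fps_const_neg)
  also have "\<dots> \<in> espan (2*m+2)"
  proof (intro espan_diff espan_sum)
    fix i assume i: "i \<in> {i. i \<le> 2 * m \<and> odd i}"
    then have "odd (2 * m - i)" "i + 1 + (2 * m - i + 1) = 2 * m + 2" by auto
    then show "fps_const (of_real (-2 * c i)) * (Sg i * Sg (2*m-i)) \<in> espan (2*m+2)"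
      using espan_mult[OF S S, of i "2*m-i"] i by (intro espan_cmult) auto
  next
    fix l assume l: "l \<in> {..2*m+1}"
    show "fps_const (of_real (g l)) * Sg l \<in> espan (2*m+2)"
    proof (cases "odd l")
      case True
      with l have "Sg l \<in> espan (2*m+2)" by (intro espan_mono[OF S]) auto
      then show ?thesis by (rule espan_cmult)
    qed (simp add: g(1) espan.zero)
  qed
  finally show ?thesis .
qed

lemma qderiv_add: "qderiv (F + G) = qderiv F + qderiv G"
  and qderiv_const: "qderiv (fps_const c) = 0"
  and qderiv_mult: "qderiv (F * G) = qderiv F * G + F * qderiv G"
  by (simp_all add: qderiv_def algebra_simps)

lemma qderiv_eisenstein: "k \<ge> 1 \<Longrightarrow> qderiv (eisenstein k) \<in> espan (2 * k + 2)"
  using qderiv_Sg[of k] by (simp add: eisenstein_Sg qderiv_add qderiv_const)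

lemma espan_power: "F \<in> espan w \<Longrightarrow> F ^ a \<in> espan (w * a)"
  by (induction a) (auto intro: espan_one espan_mult)

lemma qderiv_power: "F \<in> espan w \<Longrightarrow> qderiv F \<in> espan (w + 2) \<Longrightarrow> qderiv (F ^ a) \<in> espan (w * a + 2)"
proof (induction a)
  case 0
  then show ?case using qderiv_const[of 1] by (simp add: espan.zero)
next
  case (Suc a)
  have "qderiv F * F ^ a \<in> espan (w + 2 + w * a)" by (intro espan_mult espan_power Suc)
  moreover have "F * qderiv (F ^ a) \<in> espan (w + (w * a + 2))" by (intro espan_mult Suc)
  ultimately show ?case by (simp add: qderiv_mult espan_add algebra_simps)
qed

lemma qderiv_espan: "F \<in> espan K \<Longrightarrow> qderiv F \<in> espan (K + 2)"
proof (induction F rule: espan.induct)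
  case zero
  then show ?case using qderiv_const[of 0] by (simp add: espan.zero)
next
  case (step F a b c x)
  let ?A = "eisenstein 1 ^ a" and ?B = "eisenstein 2 ^ b" and ?C = "eisenstein 3 ^ c"
  have A: "?A \<in> espan (2 * a)" "qderiv ?A \<in> espan (2 * a + 2)"
    using espan_power[OF eisenstein_in_espan(1)] qderiv_power[OF eisenstein_in_espan(1)] qderiv_eisenstein[of 1] by auto
  have B: "?B \<in> espan (4 * b)" "qderiv ?B \<in> espan (4 * b + 2)"
    using espan_power[OF eisenstein_in_espan(2)] qderiv_power[OF eisenstein_in_espan(2)] qderiv_eisenstein[of 2] by auto
  have C: "?C \<in> espan (6 * c)" "qderiv ?C \<in> espan (6 * c + 2)"
    using espan_power[OF eisenstein_in_espan(3)] qderiv_power[OF eisenstein_in_espan(3)] qderiv_eisenstein[of 3] by auto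
  have "qderiv ?A * ?B * ?C \<in> espan (2 * a + 2 + 4 * b + 6 * c)" by (intro espan_mult A B C)
  moreover have "?A * qderiv ?B * ?C \<in> espan (2 * a + (4 * b + 2) + 6 * c)" by (intro espan_mult A B C)
  moreover have "?A * ?B * qderiv ?C \<in> espan (2 * a + 4 * b + (6 * c + 2))" by (intro espan_mult A B C)
  ultimately have "qderiv (emono a b c) \<in> espan (2 * a + 4 * b + 6 * c + 2)"
    by (simp add: emono_def qderiv_mult distrib_right espan_add algebra_simps)
  then have "qderiv (emono a b c) \<in> espan (K + 2)" by (rule espan_mono) (use step in simp)
  then show ?case using step by (simp add: qderiv_add qderiv_mult qderiv_const espan_add espan_cmult)
qed

text \<open>The weights \<open>r\<close> and \<open>s\<close> of a divisor and its codivisor can be lowered simultaneously by taking out a factor \<open>k\<close>, that is by differentiation.\<close>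

definition Phi :: "nat \<Rightarrow> nat \<Rightarrow> complex fps" where
  "Phi r s = Abs_fps (\<lambda>k. \<Sum>d | d dvd k. of_nat d ^ r * of_nat (k div d) ^ s)"

lemma Phi_Suc: "Phi (Suc r) (Suc s) = qderiv (Phi r s)"
proof (rule fps_ext)
  fix k show "fps_nth (Phi (Suc r) (Suc s)) k = fps_nth (qderiv (Phi r s)) k"
  proof (cases "k = 0")
    case False
    have "(\<Sum>d | d dvd k. of_nat d ^ Suc r * of_nat (k div d) ^ Suc s)
      = (\<Sum>d | d dvd k. of_nat k * (of_nat d ^ r * of_nat (k div d) ^ s) :: complex)"
    proof (rule sum.cong)
      fix d assume "d \<in> {d. d dvd k}"
      then have "(of_nat d * of_nat (k div d) :: complex) = of_nat k" by (metis dvd_mult_div_cancel mem_Collect_eq of_nat_mult)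
      then show "of_nat d ^ Suc r * of_nat (k div d) ^ Suc s = (of_nat k * (of_nat d ^ r * of_nat (k div d) ^ s) :: complex)"
        by (simp add: algebra_simps)
    qed simp
    then show ?thesis by (simp add: Phi_def sum_distrib_left)
  qed (simp add: Phi_def infinite_UNIV_nat)
qed

lemma Phi_0_right: "Phi r 0 = Sg r"
  by (rule fps_ext) (simp add: Phi_def Sg_def divisor_sigma_def)

lemma Phi_0_left: "Phi 0 s = Sg s"
proof (rule fps_ext)
  fix k show "fps_nth (Phi 0 s) k = fps_nth (Sg s) k"
  proof (cases "k = 0")
    case False
    have "(\<Sum>d | d dvd k. of_nat (k div d) ^ s) = (\<Sum>d | d dvd k. of_nat d ^ s :: complex)"
      by (rule sum.reindex_bij_witness[where i = "\<lambda>d. k div d" and j = "\<lambda>d. k div d"])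
         (use False in \<open>auto simp: div_div_eq_right elim!: dvdE\<close>)
    then show ?thesis by (simp add: Phi_def Sg_def divisor_sigma_def)
  qed (simp add: Phi_def Sg_def infinite_UNIV_nat)
qed

lemma Phi_espan: "odd (r + s) \<Longrightarrow> Phi r s \<in> espan (r + s + 1)"
proof (induction r arbitrary: s)
  case 0
  then show ?case using Sg_odd[of "s div 2"] by (auto simp: Phi_0_left elim!: oddE)
next
  case (Suc r)
  show ?case
  proof (cases s)
    case 0
    then show ?thesis using Sg_odd[of "Suc r div 2"] Suc.prems by (auto simp: Phi_0_right elim!: oddE)
  next
    case (Suc s')
    then show ?thesis using qderiv_espan[OF Suc.IH[of s']] Suc.prems by (simp add: Phi_Suc)
  qed
qed

text \<open>Adding the reflected term cancels the divisor sums of even total exponent, which are not quasimodular.\<close>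

lemma poly_divisor_sum_espan:
  assumes "degree P < j"
  shows "Abs_fps (\<lambda>k. \<Sum>d | d dvd k. of_nat d ^ r * poly P (of_nat (k div d)) - (- of_nat d) ^ r * poly P (- of_nat (k div d)))
     \<in> espan (r + j)" (is "?F \<in> _")
proof -
  have "?F = (\<Sum>s<j. fps_const (coeff P s * (1 - (-1) ^ (r + s))) * Phi r s)"
  proof (rule fps_ext)
    fix k
    have P: "poly P x = (\<Sum>s<j. coeff P s * x ^ s)" for x
      using assms poly_altdef_le[of P "j - 1" x] by (cases j) (auto simp: lessThan_Suc_atMost)
    have neg: "(- x) ^ r * (- y) ^ s = (-1) ^ (r + s) * (x ^ r * y ^ s)" for x y :: complex and s
      by (simp only: power_minus[of x] power_minus[of y] power_add mult_ac)
    have "of_nat d ^ r * poly P (of_nat e) - (- of_nat d) ^ r * poly P (- of_nat e)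
       = (\<Sum>s<j. coeff P s * (1 - (-1) ^ (r + s)) * (of_nat d ^ r * of_nat e ^ s))" for d e :: nat
      unfolding P sum_distrib_left sum_subtractf[symmetric]
    proof (rule sum.cong)
      fix s
      show "of_nat d ^ r * (coeff P s * of_nat e ^ s) - (- of_nat d) ^ r * (coeff P s * (- of_nat e) ^ s) =
         coeff P s * (1 - (-1) ^ (r + s)) * (of_nat d ^ r * of_nat e ^ s)"
        using neg[of "of_nat d" "of_nat e" s] by (simp add: algebra_simps)
    qed simp
    then show "fps_nth ?F k = fps_nth (\<Sum>s<j. fps_const (coeff P s * (1 - (-1) ^ (r + s))) * Phi r s) k"
      by (simp add: fps_sum_nth Phi_def sum_distrib_left) (rule sum.swap)
  qed
  also have "\<dots> \<in> espan (r + j)"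
  proof (rule espan_sum)
    fix s assume s: "s \<in> {..<j}"
    show "fps_const (coeff P s * (1 - (-1) ^ (r + s))) * Phi r s \<in> espan (r + j)"
    proof (cases "odd (r + s)")
      case True
      then show ?thesis by (intro espan_cmult espan_mono[OF Phi_espan[OF True]]) (use s in auto)
    next
      case False
      then have "(-1 :: complex) ^ (r + s) = 1" by simp
      then show ?thesis by (simp add: espan.zero)
    qed
  qed
  finally show ?thesis .
qed

section \<open>Locally finite sums and geometric series\<close>

text \<open>Sums of power series over infinite sets are taken coefficient by coefficient; they make sense if every coefficient receives finitely many contributions.\<close>

definition lfin :: "('a \<Rightarrow> complex fps) \<Rightarrow> 'a set \<Rightarrow> bool" where
  "lfin g A \<longleftrightarrow> (\<forall>k. finite {x\<in>A. fps_nth (g x) k \<noteq> 0})"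

definition fsum :: "('a \<Rightarrow> complex fps) \<Rightarrow> 'a set \<Rightarrow> complex fps" where
  "fsum g A = Abs_fps (\<lambda>k. infsum (\<lambda>x. fps_nth (g x) k) A)"

lemma fsum_nth:
  assumes "finite F" "F \<subseteq> A" "\<And>x. x \<in> A - F \<Longrightarrow> fps_nth (g x) k = 0"
  shows "fps_nth (fsum g A) k = (\<Sum>x\<in>F. fps_nth (g x) k)"
proof -
  have "infsum (\<lambda>x. fps_nth (g x) k) A = infsum (\<lambda>x. fps_nth (g x) k) F"
    by (rule infsum_cong_neutral) (use assms in auto)
  then show ?thesis using assms by (simp add: fsum_def)
qed

lemma fsum_cong: "(\<And>x. x \<in> A \<Longrightarrow> g x = h x) \<Longrightarrow> fsum g A = fsum h A"
  unfolding fsum_def by (simp cong: infsum_cong)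

lemma lfinD: "lfin g A \<Longrightarrow> finite {x\<in>A. fps_nth (g x) k \<noteq> 0}"
  by (simp add: lfin_def)

lemma lfin_upto: "lfin g A \<Longrightarrow> finite {x\<in>A. \<exists>i\<le>k. fps_nth (g x) i \<noteq> 0}"
proof -
  assume "lfin g A"
  then have "finite (\<Union>i\<le>k. {x\<in>A. fps_nth (g x) i \<noteq> 0})" by (auto simp: lfin_def)
  then show ?thesis by (rule rev_finite_subset) auto
qed

lemma lfin_add: "lfin g A \<Longrightarrow> lfin h A \<Longrightarrow> lfin (\<lambda>x. g x + h x) A"
  unfolding lfin_def
proof
  fix k assume "\<forall>k. finite {x\<in>A. fps_nth (g x) k \<noteq> 0}" "\<forall>k. finite {x\<in>A. fps_nth (h x) k \<noteq> 0}"
  then have "finite ({x\<in>A. fps_nth (g x) k \<noteq> 0} \<union> {x\<in>A. fps_nth (h x) k \<noteq> 0})" by auto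
  then show "finite {x\<in>A. fps_nth (g x + h x) k \<noteq> 0}" by (rule rev_finite_subset) auto
qed

lemma lfin_mult: "lfin g A \<Longrightarrow> lfin (\<lambda>x. c x * g x) A"
  unfolding lfin_def[of "\<lambda>x. c x * g x"]
proof
  fix k assume "lfin g A"
  then have "finite {x\<in>A. \<exists>i\<le>k. fps_nth (g x) i \<noteq> 0}" by (rule lfin_upto)
  moreover have "fps_nth (c x * g x) k = 0" if "\<forall>i\<le>k. fps_nth (g x) i = 0" for x
    using that by (simp add: fps_mult_nth)
  ultimately show "finite {x\<in>A. fps_nth (c x * g x) k \<noteq> 0}"
    by (elim rev_finite_subset) auto
qed

lemma lfin_uminus: "lfin g A \<Longrightarrow> lfin (\<lambda>x. - g x) A"
  by (simp add: lfin_def)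

lemma lfin_diff: "lfin g A \<Longrightarrow> lfin h A \<Longrightarrow> lfin (\<lambda>x. g x - h x) A"
  using lfin_add[of g A "\<lambda>x. - h x"] lfin_uminus[of h A] by simp

lemma lfin_finite: "finite {x\<in>A. g x \<noteq> 0} \<Longrightarrow> lfin g A"
  unfolding lfin_def by (auto elim!: rev_finite_subset)

lemma fsum_add: "lfin g A \<Longrightarrow> lfin h A \<Longrightarrow> fsum (\<lambda>x. g x + h x) A = fsum g A + fsum h A"
  unfolding fsum_def lfin_def
  by (rule fps_ext) (simp add: infsum_add finite_nonzero_values_imp_summable_on)

lemma fsum_mult: "lfin g A \<Longrightarrow> fsum (\<lambda>x. c * g x) A = c * fsum g A"
proof (rule fps_ext)
  fix k assume g: "lfin g A"
  let ?F = "{x\<in>A. \<exists>i\<le>k. fps_nth (g x) i \<noteq> 0}"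
  have fin: "finite ?F" using g by (rule lfin_upto)
  have "fps_nth (fsum (\<lambda>x. c * g x) A) k = (\<Sum>x\<in>?F. fps_nth (c * g x) k)"
    by (rule fsum_nth[OF fin]) (auto simp: fps_mult_nth)
  also have "\<dots> = (\<Sum>i=0..k. fps_nth c i * (\<Sum>x\<in>?F. fps_nth (g x) (k - i)))"
    by (simp only: fps_mult_nth sum_distrib_left) (rule sum.swap)
  also have "\<dots> = (\<Sum>i=0..k. fps_nth c i * fps_nth (fsum g A) (k - i))"
    by (intro sum.cong arg_cong2[where f = "(*)"] fsum_nth[OF fin, symmetric] refl) auto
  finally show "fps_nth (fsum (\<lambda>x. c * g x) A) k = fps_nth (c * fsum g A) k" by (simp add: fps_mult_nth)
qed

lemma fsum_reindex:
  assumes "\<And>a. a \<in> S \<Longrightarrow> i (j a) = a" "\<And>a. a \<in> S \<Longrightarrow> j a \<in> T"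
    "\<And>b. b \<in> T \<Longrightarrow> j (i b) = b" "\<And>b. b \<in> T \<Longrightarrow> i b \<in> S" "\<And>a. a \<in> S \<Longrightarrow> h (j a) = g a"
  shows "fsum g S = fsum h T"
  unfolding fsum_def
  by (rule arg_cong[where f = Abs_fps], rule ext, rule infsum_reindex_bij_witness[of _ i j])
     (use assms in auto)

lemma lfin_reindex:
  assumes "\<And>a. a \<in> S \<Longrightarrow> i (j a) = a" "\<And>a. a \<in> S \<Longrightarrow> j a \<in> T"
    "\<And>a. a \<in> S \<Longrightarrow> h (j a) = g a" "lfin h T"
  shows "lfin g S"
  unfolding lfin_def
proof
  fix k
  have "{x\<in>S. fps_nth (g x) k \<noteq> 0} \<subseteq> i ` {x\<in>T. fps_nth (h x) k \<noteq> 0}"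
  proof
    fix x assume x: "x \<in> {x\<in>S. fps_nth (g x) k \<noteq> 0}"
    then have "x = i (j x)" "j x \<in> {x\<in>T. fps_nth (h x) k \<noteq> 0}" using assms by auto
    then show "x \<in> i ` {x\<in>T. fps_nth (h x) k \<noteq> 0}" by blast
  qed
  then show "finite {x\<in>S. fps_nth (g x) k \<noteq> 0}" using lfinD[OF assms(4)] finite_subset by blast
qed

lemma fsum_Sigma:
  assumes "lfin (\<lambda>(x, y). g x y) (Sigma A B)"
  shows "fsum (\<lambda>(x, y). g x y) (Sigma A B) = fsum (\<lambda>x. fsum (g x) (B x)) A"
proof (rule fps_ext)
  fix k
  have "(\<lambda>(x, y). fps_nth (g x y) k) summable_on Sigma A B"
    by (rule finite_nonzero_values_imp_summable_on, rule rev_finite_subset[OF lfinD[OF assms, of k]]) auto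
  from infsum_Sigma'_banach[OF this]
  show "fps_nth (fsum (\<lambda>(x, y). g x y) (Sigma A B)) k = fps_nth (fsum (\<lambda>x. fsum (g x) (B x)) A) k"
    by (simp add: fsum_def case_prod_unfold)
qed

lemma fsum_finite: "finite A \<Longrightarrow> fsum g A = sum g A"
  by (rule fps_ext) (simp add: fsum_def fps_sum_nth)

lemma fsum_neutral:
  assumes "B \<subseteq> A" "\<And>x. x \<in> A - B \<Longrightarrow> g x = 0" shows "fsum g A = fsum g B"
  unfolding fsum_def
  by (rule arg_cong[where f = Abs_fps], rule ext, rule infsum_cong_neutral) (use assms in auto)

text \<open>The series \<open>1 / (1 - q^n)\<close>. For negative \<open>n\<close> it is expanded in positive powers of \<open>q\<close>, which gives \<open>- \<Sum> q^(k |n|)\<close> over \<open>k \<ge> 1\<close>; the value at \<open>n = 0\<close> is set to \<open>0\<close>, and the missing values are supplied later by multiples of the indicator of \<open>0\<close>.\<close>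

definition gf :: "int \<Rightarrow> complex fps" where
 "gf n = (if n > 0 then Abs_fps (\<lambda>k. if nat n dvd k then 1 else 0)
          else if n < 0 then - Abs_fps (\<lambda>k. if k > 0 \<and> nat (- n) dvd k then 1 else 0) else 0)"

lemma gf_0 [simp]: "gf 0 = 0" by (simp add: gf_def)

lemma gf_uminus: "n \<noteq> 0 \<Longrightarrow> gf (- n) = 1 - gf n"
  by (rule fps_ext) (auto simp: gf_def)

lemma gf_geometric: "n > 0 \<Longrightarrow> (1 - fps_X ^ nat n) * gf n = 1"
proof (rule fps_ext)
  fix k assume n: "n > 0"
  have "nat n dvd k \<longleftrightarrow> nat n dvd k - nat n" if "nat n \<le> k" using that by (simp add: dvd_minus_self)
  moreover have "nat n dvd k \<longleftrightarrow> k = 0" if "k < nat n" using that n by (auto dest: dvd_imp_le)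
  ultimately show "fps_nth ((1 - fps_X ^ nat n) * gf n) k = fps_nth 1 k"
    using n by (auto simp: left_diff_distrib fps_X_power_mult_nth gf_def)
qed

lemma qderiv_diff: "qderiv (F - G) = qderiv F - qderiv G"
  by (simp add: qderiv_def algebra_simps)

lemma qderiv_1: "qderiv 1 = 0" using qderiv_const[of 1] by simp

text \<open>Clear denominators: \<open>q d/dq\<close> acts on \<open>q^n\<close> as multiplication by \<open>n\<close>.\<close>

lemma gf_deriv: "qderiv (gf n) = of_int n * (gf n ^ 2 - gf n)"
proof -
  have pos: "qderiv (gf n) = of_int n * (gf n ^ 2 - gf n)" if n: "n > 0" for n
  proof -
    let ?x = "fps_X ^ nat n :: complex fps"
    have qx: "qderiv ?x = of_int n * ?x"
      using n by (auto intro!: fps_ext simp: fps_X_power_nth fps_of_int[symmetric] simp flip: fps_of_int)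
    have "qderiv ((1 - ?x) * gf n) = 0"
      unfolding gf_geometric[OF n] by (rule qderiv_1)
    then have "(1 - ?x) * qderiv (gf n) = of_int n * ?x * gf n"
      by (simp add: qderiv_mult qderiv_diff qderiv_1 qx algebra_simps)
    then have "gf n * ((1 - ?x) * qderiv (gf n)) = gf n * (of_int n * ?x * gf n)" by simp
    moreover have "gf n * ((1 - ?x) * qderiv (gf n)) = ((1 - ?x) * gf n) * qderiv (gf n)" by (simp only: mult_ac)
    moreover have "gf n * (of_int n * ?x * gf n) = of_int n * (gf n ^ 2 - ((1 - ?x) * gf n) * gf n)"
      by (simp add: algebra_simps power2_eq_square)
    ultimately show ?thesis by (simp add: gf_geometric[OF n])
  qed
  consider "n > 0" | "n = 0" | "- n > 0" by linarith
  then show ?thesis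
  proof cases
    case 3
    have "qderiv (gf n) = qderiv (1 - gf (- n))" using 3 gf_uminus[of "- n"] by simp
    also have "\<dots> = - qderiv (gf (- n))"
      by (simp add: qderiv_diff qderiv_1)
    finally have *: "qderiv (gf n) = of_int n * (gf (- n) ^ 2 - gf (- n))" using pos[OF 3] by simp
    have neg: "gf (- n) = 1 - gf n" by (rule gf_uminus) (use 3 in simp)
    show ?thesis unfolding * neg by (simp add: power2_eq_square algebra_simps)
  qed (use pos qderiv_const[of 0] in auto)
qed

text \<open>The addition rule that drives everything: multiply by the three denominators. By the reflection \<open>gf (- n) = 1 - gf n\<close> it is symmetric in three numbers with sum \<open>0\<close>, so two positive arguments suffice.\<close>

lemma gf_fay:
  assumes "m \<noteq> 0" "n \<noteq> 0" "m + n \<noteq> 0"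
  shows "gf m * gf n = gf (m + n) * (gf m + gf n - 1)"
proof -
  define S where "S a b c \<longleftrightarrow> gf a * gf b + gf a * gf c + gf b * gf c = gf a + gf b + gf c - 1" for a b c
  have pp: "S a b (- (a + b))" if ab: "a > 0" "b > 0" for a b
  proof -
    let ?x = "fps_X ^ nat a :: complex fps" and ?y = "fps_X ^ nat b :: complex fps"
    let ?A = "gf a" and ?B = "gf b" and ?G = "gf (a + b)"
    have 1: "(1 - ?x) * ?A = 1" "(1 - ?y) * ?B = 1" "(1 - ?x * ?y) * ?G = 1"
      using gf_geometric[of a] gf_geometric[of b] gf_geometric[of "a + b"] ab
      by (simp_all add: nat_add_distrib power_add)
    have "?A * ?B * (1 - ?x * ?y) = ((1 - ?x) * ?A) * ?B + ((1 - ?y) * ?B) * ?A - ((1 - ?x) * ?A) * ((1 - ?y) * ?B)"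
      by (simp add: algebra_simps)
    then have "?A * ?B * (1 - ?x * ?y) = ?A + ?B - 1" unfolding 1 by simp
    then have "?A * ?B * ((1 - ?x * ?y) * ?G) = (?A + ?B - 1) * ?G" by (simp only: mult.assoc[symmetric])
    then have "?A * ?B = (?A + ?B - 1) * ?G" unfolding 1 by simp
    moreover have neg: "gf (- (a + b)) = 1 - ?G" by (rule gf_uminus) (use ab in simp)
    ultimately show ?thesis unfolding S_def neg by (simp add: algebra_simps)
  qed
  have neg: "S a b c" if "S (- a) (- b) (- c)" "a \<noteq> 0" "b \<noteq> 0" "c \<noteq> 0" for a b c
    using that unfolding S_def by (simp add: gf_uminus algebra_simps)
  have perm: "S a b c \<Longrightarrow> S a c b" "S a b c \<Longrightarrow> S b a c" "S a b c \<Longrightarrow> S c b a" for a b c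
    unfolding S_def by (simp_all add: algebra_simps)
  define l where "l = - (m + n)"
  have l: "l \<noteq> 0" "m + n + l = 0" using assms by (auto simp: l_def)
  have pos2: "S a b c" if "a > 0" "b > 0" "a + b + c = 0" for a b c
    using pp[OF that(1,2)] that(3) by (metis add_eq_0_iff)
  have neg2: "S a b c" if "a < 0" "b < 0" "a + b + c = 0" for a b c
    by (rule neg) (use that in \<open>auto intro!: pos2\<close>)
  have "S m n l"
  proof -
    consider "m > 0 \<and> n > 0" | "m < 0 \<and> n < 0" | "m > 0 \<and> l > 0" | "m < 0 \<and> l < 0" | "n > 0 \<and> l > 0" | "n < 0 \<and> l < 0"
      using assms l by linarith
    then show ?thesis
    proof cases
      case 1 then show ?thesis using l by (intro pos2) auto
    next
      case 2 then show ?thesis using l by (intro neg2) auto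
    next
      case 3 then show ?thesis using l by (intro perm(1)[OF pos2]) auto
    next
      case 4 then show ?thesis using l by (intro perm(1)[OF neg2]) auto
    next
      case 5 then show ?thesis using l by (intro perm(3)[OF perm(2)[OF pos2]]) auto
    next
      case 6 then show ?thesis using l by (intro perm(3)[OF perm(2)[OF neg2]]) auto
    qed
  qed
  moreover have "gf l = 1 - gf (m + n)" using assms gf_uminus[of "m + n"] by (simp add: l_def)
  ultimately show ?thesis unfolding S_def by (simp add: algebra_simps)
qed

text \<open>The coefficients of \<open>1 / (1 - t)^j\<close> are polynomial in the exponent, and the expansion at infinity has the negatives of the values of the same polynomial at negative integers.\<close>

lemma gf_power_coeff:
  assumes "j \<ge> 1"
  shows "\<exists>P :: complex poly. degree P < j \<and> poly P 0 = 1 \<and>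
     (\<forall>n k. n > 0 \<longrightarrow> fps_nth (gf (int n) ^ j) k = (if n dvd k then poly P (of_nat (k div n)) else 0)) \<and>
     (\<forall>n k. n > 0 \<longrightarrow> fps_nth (gf (- int n) ^ j) k = (if 0 < k \<and> n dvd k then - poly P (- of_nat (k div n)) else 0))"
  using assms
proof (induction j rule: dec_induct)
  case base
  show ?case by (rule exI[of _ 1]) (auto simp: gf_def)
next
  case (step j)
  then obtain P where P: "degree P < j" "poly P 0 = 1"
     "\<And>n k. n > 0 \<Longrightarrow> fps_nth (gf (int n) ^ j) k = (if n dvd k then poly P (of_nat (k div n)) else 0)"
     "\<And>n k. n > 0 \<Longrightarrow> fps_nth (gf (- int n) ^ j) k = (if 0 < k \<and> n dvd k then - poly P (- of_nat (k div n)) else 0)"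
    by blast
  have j: "j > 0" using step by simp
  have D: "qderiv (F ^ j) = of_nat j * F ^ (j - 1) * qderiv F" for F
    using j by (simp add: qderiv_def fps_deriv_power' mult_ac)
  have rec: "fps_nth (gf n ^ Suc j) k = (1 + of_nat k / (of_nat j * of_int n)) * fps_nth (gf n ^ j) k" if "n \<noteq> 0" for n k
  proof -
    have "qderiv (gf n ^ j) = of_nat j * of_int n * (gf n ^ Suc j - gf n ^ j)"
      unfolding D gf_deriv using j by (cases j) (simp_all add: algebra_simps power2_eq_square)
    then have "of_nat k * fps_nth (gf n ^ j) k = fps_nth (of_nat j * of_int n * (gf n ^ Suc j - gf n ^ j)) k"
      by (metis qderiv_nth)
    also have "of_nat j * of_int n = fps_const (of_nat j * of_int n :: complex)"
      by (simp flip: fps_of_nat fps_of_int)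
    finally have "of_nat k * fps_nth (gf n ^ j) k = of_nat j * of_int n * (fps_nth (gf n ^ Suc j) k - fps_nth (gf n ^ j) k)"
      by simp
    then show ?thesis using j that by (simp add: field_simps)
  qed
  define Q where "Q = [:1, 1 / of_nat j:] * P"
  have "degree Q < Suc j" unfolding Q_def
    using degree_mult_le[of "[:1, 1 / of_nat j:]" P] P(1) j by simp
  moreover have "poly Q 0 = 1" by (simp add: Q_def P)
  moreover have "fps_nth (gf (int n) ^ Suc j) k = (if n dvd k then poly Q (of_nat (k div n)) else 0)" if "n > 0" for n k
    using that rec[of "int n" k] j by (auto simp: P(3) Q_def algebra_simps elim!: dvdE)
  moreover have "fps_nth (gf (- int n) ^ Suc j) k = (if 0 < k \<and> n dvd k then - poly Q (- of_nat (k div n)) else 0)" if "n > 0" for n k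
    using that rec[of "- int n" k] j by (auto simp: P(4) Q_def algebra_simps elim!: dvdE)
  ultimately show ?case by blast
qed

section \<open>Edge functions and their products\<close>

text \<open>An edge function \<open>n^r / (1 - q^n)^j\<close>, of weight \<open>r + j\<close>, and the indicator of \<open>0\<close>.\<close>

definition EE :: "nat \<Rightarrow> nat \<Rightarrow> int \<Rightarrow> complex fps" where
  "EE r j n = of_int n ^ r * gf n ^ j"

definition dl :: "int \<Rightarrow> complex fps" where "dl n = (if n = 0 then 1 else 0)"

lemma EE_0 [simp]: "j \<ge> 1 \<Longrightarrow> EE r j 0 = 0" by (simp add: EE_def)

lemma dl_0 [simp]: "dl 0 = 1" and dl_nz [simp]: "n \<noteq> 0 \<Longrightarrow> dl n = 0" by (simp_all add: dl_def)

text \<open>Combinations of edge functions with quasimodular coefficients, of total weight at most \<open>K\<close>. The indicator of \<open>0\<close> has weight \<open>0\<close>; it absorbs the correction terms that arise where a denominator would vanish.\<close>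

inductive_set RR :: "nat \<Rightarrow> (int \<Rightarrow> complex fps) set" for K where
  zero: "(\<lambda>n. 0) \<in> RR K"
| EE: "\<phi> \<in> RR K \<Longrightarrow> c \<in> espan a \<Longrightarrow> j \<ge> 1 \<Longrightarrow> a + r + j \<le> K \<Longrightarrow> (\<lambda>n. \<phi> n + c * EE r j n) \<in> RR K"
| dl: "\<phi> \<in> RR K \<Longrightarrow> c \<in> espan K \<Longrightarrow> (\<lambda>n. \<phi> n + c * dl n) \<in> RR K"

lemma RR_EE: "c \<in> espan a \<Longrightarrow> j \<ge> 1 \<Longrightarrow> a + r + j \<le> K \<Longrightarrow> (\<lambda>n. c * EE r j n) \<in> RR K"
  using RR.EE[OF RR.zero] by simp

lemma RR_dl: "c \<in> espan K \<Longrightarrow> (\<lambda>n. c * dl n) \<in> RR K"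
  using RR.dl[OF RR.zero] by simp

lemma RR_EE1: "j \<ge> 1 \<Longrightarrow> r + j \<le> K \<Longrightarrow> EE r j \<in> RR K"
  using RR_EE[OF espan_one[of 0]] by simp

lemma RR_dl1: "dl \<in> RR K"
  using RR_dl[OF espan_one] by simp

lemma RR_add:
  assumes "\<phi> \<in> RR K" "\<psi> \<in> RR K" shows "(\<lambda>n. \<phi> n + \<psi> n) \<in> RR K"
  using assms(2)
proof (induction \<psi> rule: RR.induct)
  case zero
  then show ?case using assms(1) by simp
next
  case (EE \<psi> c a j r)
  show ?case using RR.EE[OF EE.IH EE.hyps(2-4)] by (simp add: add.assoc)
next
  case (dl \<psi> c)
  show ?case using RR.dl[OF dl.IH dl.hyps(2)] by (simp add: add.assoc)
qed

lemma RR_mono: "\<phi> \<in> RR K \<Longrightarrow> K \<le> L \<Longrightarrow> \<phi> \<in> RR L"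
proof (induction \<phi> rule: RR.induct)
  case (EE \<phi> c a j r)
  then show ?case by (intro RR.EE[where a = a]) auto
next
  case (dl \<phi> c)
  then show ?case by (intro RR.dl) (auto intro: espan_mono)
qed (rule RR.zero)

lemma RR_cmult:
  assumes d: "d \<in> espan a" and "\<phi> \<in> RR K" shows "(\<lambda>n. d * \<phi> n) \<in> RR (a + K)"
  using assms(2)
proof (induction \<phi> rule: RR.induct)
  case (EE \<phi> c b j r)
  have "(\<lambda>n. d * \<phi> n + (d * c) * EE r j n) \<in> RR (a + K)"
    by (rule RR.EE[OF EE.IH espan_mult[OF d EE.hyps(2)]]) (use EE in auto)
  then show ?case by (simp add: distrib_left mult.assoc)
next
  case (dl \<phi> c)
  have "(\<lambda>n. d * \<phi> n + (d * c) * dl n) \<in> RR (a + K)"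
    by (rule RR.dl[OF dl.IH espan_mult[OF d dl.hyps(2)]])
  then show ?case by (simp add: distrib_left mult.assoc)
qed (simp add: RR.zero)

lemma RR_const: "\<phi> \<in> RR K \<Longrightarrow> (\<lambda>n. fps_const x * \<phi> n) \<in> RR K"
  using RR_cmult[OF espan_const[of x 0]] by simp

lemma RR_uminus: "\<phi> \<in> RR K \<Longrightarrow> (\<lambda>n. - \<phi> n) \<in> RR K"
  using RR_const[of \<phi> K "-1"] by (simp flip: fps_const_neg)

lemma RR_sum: "(\<And>i. i \<in> A \<Longrightarrow> \<phi> i \<in> RR K) \<Longrightarrow> (\<lambda>n. \<Sum>i\<in>A. \<phi> i n) \<in> RR K"
  by (induction A rule: infinite_finite_induct) (auto intro: RR.zero RR_add)

lemma RR_at_0: "\<phi> \<in> RR K \<Longrightarrow> \<phi> 0 \<in> espan K"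
  by (induction \<phi> rule: RR.induct) (auto intro: espan.zero espan_add)

lemma RR_npower: "\<phi> \<in> RR K \<Longrightarrow> (\<lambda>n. of_int n ^ i * \<phi> n) \<in> RR (K + i)"
proof (induction \<phi> rule: RR.induct)
  case (EE \<phi> c a j r)
  have "(\<lambda>n. of_int n ^ i * \<phi> n + c * EE (r + i) j n) \<in> RR (K + i)"
    by (rule RR.EE[OF EE.IH EE.hyps(2)]) (use EE in auto)
  then show ?case by (simp add: EE_def distrib_left power_add mult_ac)
next
  case (dl \<phi> c)
  have "(\<lambda>n. of_int n ^ i * \<phi> n + (of_int 0 ^ i * c) * dl n) \<in> RR (K + i)"
    by (rule RR.dl[OF dl.IH]) (use dl in \<open>auto simp: power_0_left intro: espan.zero espan_mono\<close>)
  also have "(\<lambda>n. of_int n ^ i * \<phi> n + (of_int 0 ^ i * c) * dl n) = (\<lambda>n. of_int n ^ i * (\<phi> n + c * dl n))"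
    by (auto simp: dl_def distrib_left)
  finally show ?case .
qed (simp add: RR.zero)

lemma fps_const_sum': "fps_const (sum f A) = (\<Sum>i\<in>A. fps_const (f i :: complex))"
  by (induction A rule: infinite_finite_induct) (simp_all flip: fps_const_add)

lemma RR_poly: "\<phi> \<in> RR K \<Longrightarrow> degree p \<le> d \<Longrightarrow> (\<lambda>n. fps_const (of_real (poly p (real_of_int n))) * \<phi> n) \<in> RR (K + d)"
proof -
  assume \<phi>: "\<phi> \<in> RR K" and d: "degree p \<le> d"
  have "(\<lambda>n. \<Sum>i\<le>d. fps_const (of_real (coeff p i)) * (of_int n ^ i * \<phi> n)) \<in> RR (K + d)"
    by (intro RR_sum RR_const RR_mono[OF RR_npower[OF \<phi>]]) auto
  also have "(\<lambda>n. \<Sum>i\<le>d. fps_const (of_real (coeff p i)) * (of_int n ^ i * \<phi> n)) =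
     (\<lambda>n. fps_const (of_real (poly p (real_of_int n))) * \<phi> n)"
  proof
    fix n
    have "fps_const (of_real (poly p (real_of_int n))) = (\<Sum>i\<le>d. fps_const (complex_of_real (coeff p i)) * of_int n ^ i)"
      unfolding poly_altdef_le[OF d]
      by (simp add: fps_const_sum' fps_of_int[symmetric] flip: fps_const_mult fps_const_power)
    then show "(\<Sum>i\<le>d. fps_const (of_real (coeff p i)) * (of_int n ^ i * \<phi> n)) = fps_const (of_real (poly p (real_of_int n))) * \<phi> n"
      by (simp add: sum_distrib_right mult.assoc)
  qed
  finally show ?thesis .
qed

lemma EE_mult: "EE r j n * EE s k n = EE (r + s) (j + k) n"
  by (simp add: EE_def power_add mult_ac)

text \<open>Reversing an edge expands by the binomial theorem, as \<open>gf (- n) = 1 - gf n\<close>.\<close>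

lemma EE_refl: "j \<ge> 1 \<Longrightarrow> (\<lambda>n. EE r j n * EE s k (- n)) \<in> RR (r + s + j + k)"
proof -
  assume j: "j \<ge> 1"
  have "(\<lambda>n. \<Sum>i\<le>k. fps_const ((-1) ^ s * of_nat (k choose i) * (-1) ^ i) * EE (r + s) (j + i) n) \<in> RR (r + s + j + k)"
    by (intro RR_sum RR_const RR_EE1) (use j in auto)
  also have "(\<lambda>n. \<Sum>i\<le>k. fps_const ((-1) ^ s * of_nat (k choose i) * (-1) ^ i) * EE (r + s) (j + i) n) = (\<lambda>n. EE r j n * EE s k (- n))"
  proof
    fix n
    show "(\<Sum>i\<le>k. fps_const ((-1) ^ s * of_nat (k choose i) * (-1) ^ i) * EE (r + s) (j + i) n) = EE r j n * EE s k (- n)"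
    proof (cases "n = 0")
      case False
      have "gf (- n) ^ k = (- gf n + 1) ^ k" using gf_uminus[OF False] by simp
      also have "\<dots> = (\<Sum>i\<le>k. of_nat (k choose i) * ((-1) ^ i * gf n ^ i))"
        unfolding binomial_ring by (simp add: power_minus[of "gf n"] mult_ac)
      finally have "EE r j n * EE s k (- n) = (\<Sum>i\<le>k. (of_int n ^ r * gf n ^ j) * ((-1) ^ s * of_int n ^ s) * (of_nat (k choose i) * ((-1) ^ i * gf n ^ i)))"
        by (simp add: EE_def sum_distrib_left power_minus[of "of_int n"] mult_ac)
      also have "\<dots> = (\<Sum>i\<le>k. fps_const ((-1) ^ s * of_nat (k choose i) * (-1) ^ i) * EE (r + s) (j + i) n)"
        by (rule sum.cong)
           (simp_all add: EE_def power_add mult_ac fps_of_nat[symmetric] flip: fps_const_mult fps_const_power fps_const_neg)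
      finally show ?thesis by simp
    qed (use j in simp)
  qed
  finally show ?thesis .
qed

text \<open>A flow with large negative value on an edge contributes only to high powers of \<open>q\<close>. This makes flow sums converge.\<close>

lemma RR_order: "\<phi> \<in> RR K \<Longrightarrow> int k < - n \<Longrightarrow> fps_nth (\<phi> n) k = 0"
proof (induction \<phi> rule: RR.induct)
  case (EE \<phi> c a j r)
  obtain i where i: "j = Suc i" using EE by (cases j) auto
  have low: "fps_nth (gf n) l = 0" if "l \<le> k" for l
    using that EE.prems by (auto simp: gf_def dest!: dvd_imp_le)
  have "c * EE r j n = (c * of_int n ^ r * gf n ^ i) * gf n" by (simp add: EE_def i mult_ac)
  also have "fps_nth \<dots> k = 0" unfolding fps_mult_nth[of _ "gf n"] by (simp add: low)
  finally show ?case using EE by simp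
qed (auto simp: dl_def)

text \<open>Functions of the flows \<open>m, n\<close> on two edges with a common start in which one factor sees only \<open>m + n\<close>: products of pure edge functions, with constant coefficients.\<close>

inductive_set FF0 :: "nat \<Rightarrow> (int \<Rightarrow> int \<Rightarrow> complex fps) set" for K where
  zero: "(\<lambda>m n. 0) \<in> FF0 K"
| left: "\<Phi> \<in> FF0 K \<Longrightarrow> p \<ge> 1 \<Longrightarrow> q \<ge> 1 \<Longrightarrow> r + s + p + q \<le> K \<Longrightarrow>
    (\<lambda>m n. \<Phi> m n + fps_const c * (EE r p (m + n) * EE s q n)) \<in> FF0 K"
| right: "\<Phi> \<in> FF0 K \<Longrightarrow> p \<ge> 1 \<Longrightarrow> q \<ge> 1 \<Longrightarrow> r + s + p + q \<le> K \<Longrightarrow>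
    (\<lambda>m n. \<Phi> m n + fps_const c * (EE r p (m + n) * EE s q (- m))) \<in> FF0 K"

lemma FF0_add:
  assumes "\<Phi> \<in> FF0 K" "\<Psi> \<in> FF0 K" shows "(\<lambda>m n. \<Phi> m n + \<Psi> m n) \<in> FF0 K"
  using assms(2)
proof (induction \<Psi> rule: FF0.induct)
  case zero
  then show ?case using assms(1) by simp
next
  case (left \<Psi> p q r s c)
  show ?case using FF0.left[OF left.IH left.hyps(2-4)] by (simp add: add.assoc)
next
  case (right \<Psi> p q r s c)
  show ?case using FF0.right[OF right.IH right.hyps(2-4)] by (simp add: add.assoc)
qed

lemma FF0_cmult: "\<Phi> \<in> FF0 K \<Longrightarrow> (\<lambda>m n. fps_const d * \<Phi> m n) \<in> FF0 K"
proof (induction \<Phi> rule: FF0.induct)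
  case (left \<Psi> p q r s c)
  show ?case using FF0.left[OF left.IH left.hyps(2-4), of "d * c"] by (simp add: distrib_left mult.assoc flip: fps_const_mult)
next
  case (right \<Psi> p q r s c)
  show ?case using FF0.right[OF right.IH right.hyps(2-4), of "d * c"] by (simp add: distrib_left mult.assoc flip: fps_const_mult)
qed (simp add: FF0.zero)

lemma FF0_mono: "\<Phi> \<in> FF0 K \<Longrightarrow> K \<le> L \<Longrightarrow> \<Phi> \<in> FF0 L"
  by (induction \<Phi> rule: FF0.induct) (auto intro: FF0.intros)

lemma FF0_left: "p \<ge> 1 \<Longrightarrow> q \<ge> 1 \<Longrightarrow> r + s + p + q \<le> K \<Longrightarrow> (\<lambda>m n. EE r p (m + n) * EE s q n) \<in> FF0 K"
  using FF0.left[OF FF0.zero, of p q r s K 1] by simp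

lemma FF0_right: "p \<ge> 1 \<Longrightarrow> q \<ge> 1 \<Longrightarrow> r + s + p + q \<le> K \<Longrightarrow> (\<lambda>m n. EE r p (m + n) * EE s q (- m)) \<in> FF0 K"
  using FF0.right[OF FF0.zero, of p q r s K 1] by simp

lemma FF0_mult_m: "\<Phi> \<in> FF0 K \<Longrightarrow> (\<lambda>m n. of_int m * \<Phi> m n) \<in> FF0 (Suc K)"
proof (induction \<Phi> rule: FF0.induct)
  case (left \<Psi> p q r s c)
  have "(\<lambda>m n. of_int m * \<Psi> m n + (fps_const c * (EE (Suc r) p (m + n) * EE s q n) +
       fps_const (- c) * (EE r p (m + n) * EE (Suc s) q n))) \<in> FF0 (Suc K)"
    by (intro FF0_add[OF left.IH] FF0_add FF0_cmult FF0_left) (use left in auto)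
  also have "(\<lambda>m n. of_int m * \<Psi> m n + (fps_const c * (EE (Suc r) p (m + n) * EE s q n) +
       fps_const (- c) * (EE r p (m + n) * EE (Suc s) q n))) = (\<lambda>m n. of_int m * (\<Psi> m n + fps_const c * (EE r p (m + n) * EE s q n)))"
    by (intro ext) (simp add: EE_def algebra_simps flip: fps_const_neg)
  finally show ?case .
next
  case (right \<Psi> p q r s c)
  have "(\<lambda>m n. of_int m * \<Psi> m n + fps_const (- c) * (EE r p (m + n) * EE (Suc s) q (- m))) \<in> FF0 (Suc K)"
    by (intro FF0_add[OF right.IH] FF0_cmult FF0_right) (use right in auto)
  then show ?case by (simp add: EE_def algebra_simps flip: fps_const_neg)
qed (simp add: FF0.zero)

lemma FF0_mult_n: "\<Phi> \<in> FF0 K \<Longrightarrow> (\<lambda>m n. of_int n * \<Phi> m n) \<in> FF0 (Suc K)"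
proof (induction \<Phi> rule: FF0.induct)
  case (right \<Psi> p q r s c)
  have "(\<lambda>m n. of_int n * \<Psi> m n + (fps_const c * (EE (Suc r) p (m + n) * EE s q (- m)) +
       fps_const c * (EE r p (m + n) * EE (Suc s) q (- m)))) \<in> FF0 (Suc K)"
    by (intro FF0_add[OF right.IH] FF0_add FF0_cmult FF0_right) (use right in auto)
  also have "(\<lambda>m n. of_int n * \<Psi> m n + (fps_const c * (EE (Suc r) p (m + n) * EE s q (- m)) +
       fps_const c * (EE r p (m + n) * EE (Suc s) q (- m)))) = (\<lambda>m n. of_int n * (\<Psi> m n + fps_const c * (EE r p (m + n) * EE s q (- m))))"
    by (intro ext) (simp add: EE_def algebra_simps)
  finally show ?case .
next
  case (left \<Psi> p q r s c)
  have "(\<lambda>m n. of_int n * \<Psi> m n + fps_const c * (EE r p (m + n) * EE (Suc s) q n)) \<in> FF0 (Suc K)"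
    by (intro FF0_add[OF left.IH] FF0_cmult FF0_left) (use left in auto)
  then show ?case by (simp add: EE_def algebra_simps)
qed (simp add: FF0.zero)

lemma FF0_mult_power: "\<Phi> \<in> FF0 K \<Longrightarrow> (\<lambda>m n. of_int m ^ r * of_int n ^ s * \<Phi> m n) \<in> FF0 (r + s + K)"
proof (induction r)
  case 0
  then show ?case
  proof (induction s)
    case (Suc s)
    then show ?case using FF0_mult_n[OF Suc.IH] by (simp add: mult.assoc)
  qed simp
next
  case (Suc r)
  then show ?case using FF0_mult_m[OF Suc.IH] by (simp add: mult.assoc)
qed

text \<open>Equality off the three lines on which the addition rule fails.\<close>

definition GEN :: "nat \<Rightarrow> (int \<Rightarrow> int \<Rightarrow> complex fps) \<Rightarrow> bool" where
  "GEN K \<Psi> \<longleftrightarrow> (\<exists>\<Phi>\<in>FF0 K. \<forall>m n. m \<noteq> 0 \<longrightarrow> n \<noteq> 0 \<longrightarrow> m + n \<noteq> 0 \<longrightarrow> \<Psi> m n = \<Phi> m n)"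

lemma GEN_cong: "GEN K \<Psi> \<Longrightarrow> (\<And>m n. m \<noteq> 0 \<Longrightarrow> n \<noteq> 0 \<Longrightarrow> m + n \<noteq> 0 \<Longrightarrow> \<Psi>' m n = \<Psi> m n) \<Longrightarrow> GEN K \<Psi>'"
  unfolding GEN_def by metis

lemma GEN_FF0: "\<Phi> \<in> FF0 K \<Longrightarrow> GEN K \<Phi>" unfolding GEN_def by blast

lemma GEN_mono: "GEN K \<Psi> \<Longrightarrow> K \<le> L \<Longrightarrow> GEN L \<Psi>" unfolding GEN_def using FF0_mono by blast

lemma GEN_diff: "GEN K \<Psi> \<Longrightarrow> GEN K \<Psi>' \<Longrightarrow> GEN K (\<lambda>m n. \<Psi> m n - \<Psi>' m n)"
proof -
  assume "GEN K \<Psi>" "GEN K \<Psi>'"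
  then obtain \<Phi> \<Phi>' where *: "\<Phi> \<in> FF0 K" "\<Phi>' \<in> FF0 K"
    "\<And>m n. m \<noteq> 0 \<Longrightarrow> n \<noteq> 0 \<Longrightarrow> m + n \<noteq> 0 \<Longrightarrow> \<Psi> m n = \<Phi> m n \<and> \<Psi>' m n = \<Phi>' m n"
    unfolding GEN_def by metis
  have "(\<lambda>m n. \<Phi> m n + fps_const (- 1) * \<Phi>' m n) \<in> FF0 K" by (intro FF0_add FF0_cmult *)
  then show ?thesis unfolding GEN_def
    by (rule bexI[rotated]) (simp add: * flip: fps_const_neg)
qed

lemma GEN_add:
  assumes "GEN K \<Psi>" "GEN K \<Psi>'" shows "GEN K (\<lambda>m n. \<Psi> m n + \<Psi>' m n)"
  using GEN_diff[OF assms(1) GEN_diff[OF GEN_FF0[OF FF0.zero] assms(2)]] by simp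

text \<open>Induction on \<open>i + q\<close>: the addition rule and reflection give \<open>gf (- m) * gf n = gf n - gf (m + n) * gf n + gf (m + n) * gf (- m)\<close>, which trades a factor in \<open>m\<close> or \<open>n\<close> for one in \<open>m + n\<close>.\<close>

lemma GEN_T: "p \<ge> 1 \<Longrightarrow> i + q \<ge> 1 \<Longrightarrow> GEN (p + i + q) (\<lambda>m n. gf (m + n) ^ p * gf (- m) ^ i * gf n ^ q)"
proof (induction "i + q" arbitrary: p i q rule: less_induct)
  case less
  consider "i = 0" | "q = 0" | i' q' where "i = Suc i'" "q = Suc q'" by (metis not0_implies_Suc)
  then show ?case
  proof cases
    case 1
    have "(\<lambda>m n. EE 0 p (m + n) * EE 0 q n) \<in> FF0 (p + i + q)" by (rule FF0_left) (use 1 less in auto)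
    then show ?thesis using 1 by (intro GEN_FF0) (simp add: EE_def)
  next
    case 2
    have "(\<lambda>m n. EE 0 p (m + n) * EE 0 i (- m)) \<in> FF0 (p + i + q)" by (rule FF0_right) (use 2 less in auto)
    then show ?thesis using 2 by (intro GEN_FF0) (simp add: EE_def)
  next
    case 3
    have 1: "GEN (p + i + q) (\<lambda>m n. gf (m + n) ^ p * gf (- m) ^ i' * gf n ^ q)"
      by (rule GEN_mono[OF less.hyps]) (use 3 less in auto)
    have 2: "GEN (p + i + q) (\<lambda>m n. gf (m + n) ^ Suc p * gf (- m) ^ i' * gf n ^ q)"
      by (rule GEN_mono[OF less.hyps]) (use 3 less in auto)
    have 3: "GEN (p + i + q) (\<lambda>m n. gf (m + n) ^ Suc p * gf (- m) ^ i * gf n ^ q')"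
      by (rule GEN_mono[OF less.hyps]) (use 3 less in auto)
    show ?thesis
    proof (rule GEN_cong[OF GEN_add[OF GEN_diff[OF 1 2] 3]])
      fix m n :: int assume mn: "m \<noteq> 0" "n \<noteq> 0" "m + n \<noteq> 0"
      have A: "gf m = 1 - gf (- m)" using gf_uminus[of m] mn by simp
      have "gf (- m) * gf n = gf n - gf (m + n) * gf n + gf (m + n) * gf (- m)"
        using gf_fay[OF mn] unfolding A by (simp add: algebra_simps)
      then have "gf (m + n) ^ p * gf (- m) ^ i' * gf n ^ q' * (gf (- m) * gf n) =
         gf (m + n) ^ p * gf (- m) ^ i' * gf n ^ q' * (gf n - gf (m + n) * gf n + gf (m + n) * gf (- m))" by simp
      then show "gf (m + n) ^ p * gf (- m) ^ i * gf n ^ q =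
           gf (m + n) ^ p * gf (- m) ^ i' * gf n ^ q -
           gf (m + n) ^ Suc p * gf (- m) ^ i' * gf n ^ q +
           gf (m + n) ^ Suc p * gf (- m) ^ i * gf n ^ q'"
        unfolding \<open>i = Suc i'\<close> \<open>q = Suc q'\<close> by (simp add: algebra_simps)
    qed
  qed
qed

text \<open>Here the factors \<open>gf m\<close> are turned into \<open>1 - gf (- m)\<close> one at a time.\<close>

lemma GEN_V: "i + q \<ge> 1 \<Longrightarrow> GEN (j + 1 + i + q) (\<lambda>m n. gf m ^ j * (gf (m + n) * gf (- m) ^ i * gf n ^ q))"
proof (induction j arbitrary: i)
  case 0
  then show ?case using GEN_T[of 1 i q] by simp
next
  case (Suc j)
  have 1: "GEN (Suc j + 1 + i + q) (\<lambda>m n. gf m ^ j * (gf (m + n) * gf (- m) ^ i * gf n ^ q))"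
    by (rule GEN_mono[OF Suc.IH]) (use Suc in auto)
  have 2: "GEN (Suc j + 1 + i + q) (\<lambda>m n. gf m ^ j * (gf (m + n) * gf (- m) ^ Suc i * gf n ^ q))"
    by (rule GEN_mono[OF Suc.IH]) (use Suc in auto)
  show ?case
  proof (rule GEN_cong[OF GEN_diff[OF 1 2]])
    fix m n :: int assume mn: "m \<noteq> 0" "n \<noteq> 0" "m + n \<noteq> 0"
    have A: "gf m = 1 - gf (- m)" using gf_uminus[of m] mn by simp
    have "gf m ^ Suc j = gf m ^ j * (1 - gf (- m))" by (simp add: A[symmetric])
    then show "gf m ^ Suc j * (gf (m + n) * gf (- m) ^ i * gf n ^ q) =
           gf m ^ j * (gf (m + n) * gf (- m) ^ i * gf n ^ q) -
           gf m ^ j * (gf (m + n) * gf (- m) ^ Suc i * gf n ^ q)"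
      by (simp only: power_Suc) (simp add: algebra_simps)
  qed
qed

text \<open>One application of the addition rule creates the factor \<open>gf (m + n)\<close>; the previous two lemmas dispose of the rest.\<close>

lemma GEN_product:
  assumes "j \<ge> 1" "k \<ge> 1" shows "GEN (j + k) (\<lambda>m n. gf m ^ j * gf n ^ k)"
proof -
  obtain j' k' where jk: "j = Suc j'" "k = Suc k'" using assms by (metis Suc_le_D One_nat_def)
  have 1: "GEN (j + k) (\<lambda>m n. gf m ^ j' * (gf (m + n) * gf (- m) ^ 0 * gf n ^ k))"
    by (rule GEN_mono[OF GEN_V]) (use jk in auto)
  have 2: "GEN (j + k) (\<lambda>m n. gf m ^ j' * (gf (m + n) * gf (- m) ^ 1 * gf n ^ k'))"
    by (rule GEN_mono[OF GEN_V]) (use jk in auto)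
  show ?thesis
  proof (rule GEN_cong[OF GEN_diff[OF 1 2]])
    fix m n :: int assume mn: "m \<noteq> 0" "n \<noteq> 0" "m + n \<noteq> 0"
    have A: "gf (- m) = 1 - gf m" using gf_uminus[of m] mn by simp
    have "gf m * gf n = gf (m + n) * gf n - gf (m + n) * gf (- m)"
      using gf_fay[OF mn] unfolding A by (simp add: algebra_simps)
    then have "gf m ^ j' * gf n ^ k' * (gf m * gf n) = gf m ^ j' * gf n ^ k' * (gf (m + n) * gf n - gf (m + n) * gf (- m))" by simp
    then show "gf m ^ j * gf n ^ k = gf m ^ j' * (gf (m + n) * gf (- m) ^ 0 * gf n ^ k) - gf m ^ j' * (gf (m + n) * gf (- m) ^ 1 * gf n ^ k')"
      unfolding jk by (simp add: algebra_simps)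
  qed
qed

lemma FF0_EE_product:
  assumes "j \<ge> 1" "k \<ge> 1"
  obtains \<Phi> where "\<Phi> \<in> FF0 (r + s + j + k)"
    "\<And>m n. m \<noteq> 0 \<Longrightarrow> n \<noteq> 0 \<Longrightarrow> m + n \<noteq> 0 \<Longrightarrow> EE r j m * EE s k n = \<Phi> m n"
proof -
  obtain \<Phi> where \<Phi>: "\<Phi> \<in> FF0 (j + k)"
    "\<And>m n. m \<noteq> 0 \<Longrightarrow> n \<noteq> 0 \<Longrightarrow> m + n \<noteq> 0 \<Longrightarrow> gf m ^ j * gf n ^ k = \<Phi> m n"
    using GEN_product[OF assms] unfolding GEN_def by blast
  show thesis
  proof (rule that)
    show "(\<lambda>m n. of_int m ^ r * of_int n ^ s * \<Phi> m n) \<in> FF0 (r + s + j + k)"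
      using FF0_mult_power[OF \<Phi>(1)] by (simp add: add.assoc)
    fix m n :: int assume "m \<noteq> 0" "n \<noteq> 0" "m + n \<noteq> 0"
    from \<Phi>(2)[OF this] show "EE r j m * EE s k n = of_int m ^ r * of_int n ^ s * \<Phi> m n"
      by (simp add: EE_def mult_ac flip: \<Phi>(2))
  qed
qed

text \<open>As above, but with arbitrary edge functions as factors. This class is closed under the corrections on the three exceptional lines.\<close>

inductive_set FF :: "nat \<Rightarrow> (int \<Rightarrow> int \<Rightarrow> complex fps) set" for K where
  zero: "(\<lambda>m n. 0) \<in> FF K"
| left: "\<Phi> \<in> FF K \<Longrightarrow> \<alpha> \<in> RR a \<Longrightarrow> \<beta> \<in> RR b \<Longrightarrow> a + b \<le> K \<Longrightarrow> (\<lambda>m n. \<Phi> m n + \<alpha> (m + n) * \<beta> n) \<in> FF K"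
| right: "\<Phi> \<in> FF K \<Longrightarrow> \<alpha> \<in> RR a \<Longrightarrow> \<beta> \<in> RR b \<Longrightarrow> a + b \<le> K \<Longrightarrow> (\<lambda>m n. \<Phi> m n + \<alpha> (m + n) * \<beta> (- m)) \<in> FF K"

lemma FF_left: "\<alpha> \<in> RR a \<Longrightarrow> \<beta> \<in> RR b \<Longrightarrow> a + b \<le> K \<Longrightarrow> (\<lambda>m n. \<alpha> (m + n) * \<beta> n) \<in> FF K"
  using FF.left[OF FF.zero] by simp

lemma FF_right: "\<alpha> \<in> RR a \<Longrightarrow> \<beta> \<in> RR b \<Longrightarrow> a + b \<le> K \<Longrightarrow> (\<lambda>m n. \<alpha> (m + n) * \<beta> (- m)) \<in> FF K"
  using FF.right[OF FF.zero] by simp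

lemma FF_add:
  assumes "\<Phi> \<in> FF K" "\<Psi> \<in> FF K" shows "(\<lambda>m n. \<Phi> m n + \<Psi> m n) \<in> FF K"
  using assms(2)
proof (induction \<Psi> rule: FF.induct)
  case zero
  then show ?case using assms(1) by simp
next
  case (left \<Psi> \<alpha> a \<beta> b)
  show ?case using FF.left[OF left.IH left.hyps(2-4)] by (simp add: add.assoc)
next
  case (right \<Psi> \<alpha> a \<beta> b)
  show ?case using FF.right[OF right.IH right.hyps(2-4)] by (simp add: add.assoc)
qed

lemma FF_cmult: assumes d: "d \<in> espan a'" shows "\<Phi> \<in> FF K \<Longrightarrow> (\<lambda>m n. d * \<Phi> m n) \<in> FF (a' + K)"
proof (induction \<Phi> rule: FF.induct)
  case (left \<Psi> \<alpha> a \<beta> b)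
  have "(\<lambda>m n. d * \<Psi> m n + (d * \<alpha> (m + n)) * \<beta> n) \<in> FF (a' + K)"
    using FF.left[OF left.IH RR_cmult[OF d left.hyps(2)] left.hyps(3)] left.hyps(4) by simp
  then show ?case by (simp add: distrib_left mult.assoc)
next
  case (right \<Psi> \<alpha> a \<beta> b)
  have "(\<lambda>m n. d * \<Psi> m n + (d * \<alpha> (m + n)) * \<beta> (- m)) \<in> FF (a' + K)"
    using FF.right[OF right.IH RR_cmult[OF d right.hyps(2)] right.hyps(3)] right.hyps(4) by simp
  then show ?case by (simp add: distrib_left mult.assoc)
qed (simp add: FF.zero)

lemma FF_mono: "\<Phi> \<in> FF K \<Longrightarrow> K \<le> L \<Longrightarrow> \<Phi> \<in> FF L"
  by (induction \<Phi> rule: FF.induct) (auto intro: FF.intros)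

lemma FF0_FF: "\<Phi> \<in> FF0 K \<Longrightarrow> \<Phi> \<in> FF K"
proof (induction \<Phi> rule: FF0.induct)
  case (left \<Psi> p q r s c)
  have "(\<lambda>m n. \<Psi> m n + (fps_const c * EE r p (m + n)) * EE s q n) \<in> FF K"
    by (rule FF.left[OF left.IH RR_const[OF RR_EE1] RR_EE1, of p r "r + p" q s "s + q"]) (use left in auto)
  then show ?case by (simp add: mult.assoc)
next
  case (right \<Psi> p q r s c)
  have "(\<lambda>m n. \<Psi> m n + (fps_const c * EE r p (m + n)) * EE s q (- m)) \<in> FF K"
    by (rule FF.right[OF right.IH RR_const[OF RR_EE1] RR_EE1, of p r "r + p" q s "s + q"]) (use right in auto)
  then show ?case by (simp add: mult.assoc)
qed (rule FF.zero)

text \<open>The values on the three exceptional lines are again edge functions of one variable, so the defect of the generic identity there is a product with an indicator.\<close>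

lemma FF0_strata:
  "\<Phi> \<in> FF0 K \<Longrightarrow> (\<lambda>N. \<Phi> 0 N) \<in> RR K \<and> (\<lambda>N. \<Phi> N 0) \<in> RR K \<and> (\<forall>m. \<Phi> m (- m) = 0)"
proof (induction \<Phi> rule: FF0.induct)
  case (left \<Psi> p q r s c)
  have "(\<lambda>N. fps_const c * EE (r + s) (p + q) N) \<in> RR K" by (intro RR_const RR_EE1) (use left in auto)
  then show ?case using left by (auto simp: EE_mult intro: RR_add)
next
  case (right \<Psi> p q r s c)
  have "(\<lambda>N. EE r p N * EE s q (- N)) \<in> RR K" by (rule RR_mono[OF EE_refl]) (use right in auto)
  then have "(\<lambda>N. fps_const c * (EE r p N * EE s q (- N))) \<in> RR K" by (rule RR_const)
  then show ?case using right by (auto intro: RR_add)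
qed (auto intro: RR.zero)

text \<open>Take the generic identity and subtract its values on the lines \<open>m = 0\<close>, \<open>n = 0\<close> and \<open>m + n = 0\<close>, each written with the indicator of \<open>0\<close>; only on the last line does the product itself have a value, and that is given by reflection.\<close>

lemma FF_EE_EE:
  assumes "j \<ge> 1" "k \<ge> 1" shows "(\<lambda>m n. EE r j m * EE s k n) \<in> FF (r + s + j + k)"
proof -
  let ?K = "r + s + j + k"
  obtain \<Phi> where \<Phi>: "\<Phi> \<in> FF0 ?K"
    "\<And>m n. m \<noteq> 0 \<Longrightarrow> n \<noteq> 0 \<Longrightarrow> m + n \<noteq> 0 \<Longrightarrow> EE r j m * EE s k n = \<Phi> m n"
    by (rule FF0_EE_product[OF assms, of r s]) blast
  note st = FF0_strata[OF \<Phi>(1)]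
  have "(\<lambda>m n. \<Phi> m n + (- \<Phi> 0 (m + n) * dl (- m) + (- \<Phi> (m + n) 0 * dl n + dl (m + n) * (EE s k n * EE r j (- n))))) \<in> FF ?K"
    by (intro FF_add FF0_FF \<Phi> FF_right[of "\<lambda>N. - \<Phi> 0 N" ?K dl 0] FF_left[of "\<lambda>N. - \<Phi> N 0" ?K dl 0]
          FF_left[of dl 0 "\<lambda>n. EE s k n * EE r j (- n)" ?K] RR_uminus RR_dl1 RR_mono[OF EE_refl[OF assms(2)]])
       (use st in auto)
  also have "(\<lambda>m n. \<Phi> m n + (- \<Phi> 0 (m + n) * dl (- m) + (- \<Phi> (m + n) 0 * dl n + dl (m + n) * (EE s k n * EE r j (- n))))) =
     (\<lambda>m n. EE r j m * EE s k n)"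
  proof (intro ext)
    fix m n :: int
    have z: "\<Phi> 0 0 = 0" using st by (metis add.inverse_neutral)
    consider "m = 0" | "m \<noteq> 0" "n = 0" | "m \<noteq> 0" "n \<noteq> 0" "m = - n" | "m \<noteq> 0" "n \<noteq> 0" "m + n \<noteq> 0" by linarith
    then show "\<Phi> m n + (- \<Phi> 0 (m + n) * dl (- m) + (- \<Phi> (m + n) 0 * dl n + dl (m + n) * (EE s k n * EE r j (- n)))) = EE r j m * EE s k n"
    proof cases
      case 1
      then show ?thesis using assms z by (cases "n = 0") auto
    next
      case 3
      have "\<Phi> m n = 0" using st 3 by (metis add.inverse_inverse)
      then show ?thesis using 3 by (simp add: mult.commute)
    qed (use assms \<Phi>(2)[of m n] in auto)
  qed
  finally show ?thesis .
qed

lemma FF_EE_RR: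
  assumes "j \<ge> 1" "\<psi> \<in> RR b" shows "(\<lambda>m n. EE r j m * \<psi> n) \<in> FF (r + j + b)"
  using assms(2)
proof (induction \<psi> rule: RR.induct)
  case (EE \<psi> c a k s)
  have "(\<lambda>m n. c * (EE r j m * EE s k n)) \<in> FF (r + j + b)"
    by (rule FF_mono[OF FF_cmult[OF EE.hyps(2) FF_EE_EE]]) (use EE assms in auto)
  with EE.IH have "(\<lambda>m n. EE r j m * \<psi> n + c * (EE r j m * EE s k n)) \<in> FF (r + j + b)" by (rule FF_add)
  then show ?case by (simp add: algebra_simps)
next
  case (dl \<psi> c)
  have "(\<lambda>m n. EE r j (m + n) * (c * dl n)) \<in> FF (r + j + b)"
    by (rule FF_left[OF RR_EE1 RR_dl[OF dl.hyps(2)]]) (use assms in auto)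
  with dl.IH have "(\<lambda>m n. EE r j m * \<psi> n + EE r j (m + n) * (c * dl n)) \<in> FF (r + j + b)" by (rule FF_add)
  also have "(\<lambda>m n. EE r j m * \<psi> n + EE r j (m + n) * (c * dl n)) = (\<lambda>m n. EE r j m * (\<psi> n + c * dl n))"
    by (intro ext) (auto simp: dl_def algebra_simps)
  finally show ?case .
qed (simp add: FF.zero)

lemma FF_product:
  assumes "\<phi> \<in> RR a" "\<psi> \<in> RR b" shows "(\<lambda>m n. \<phi> m * \<psi> n) \<in> FF (a + b)"
  using assms(1)
proof (induction \<phi> rule: RR.induct)
  case (EE \<phi> c a' j r)
  have "(\<lambda>m n. c * (EE r j m * \<psi> n)) \<in> FF (a + b)"
    by (rule FF_mono[OF FF_cmult[OF EE.hyps(2) FF_EE_RR[OF EE.hyps(3) assms(2)]]]) (use EE in auto)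
  with EE.IH have "(\<lambda>m n. \<phi> m * \<psi> n + c * (EE r j m * \<psi> n)) \<in> FF (a + b)" by (rule FF_add)
  then show ?case by (simp add: algebra_simps)
next
  case (dl \<phi> c)
  have "(\<lambda>m n. \<psi> (m + n) * (c * dl (- m))) \<in> FF (a + b)"
    by (rule FF_right[OF assms(2) RR_dl[OF dl.hyps(2)]]) auto
  with dl.IH have "(\<lambda>m n. \<phi> m * \<psi> n + \<psi> (m + n) * (c * dl (- m))) \<in> FF (a + b)" by (rule FF_add)
  also have "(\<lambda>m n. \<phi> m * \<psi> n + \<psi> (m + n) * (c * dl (- m))) = (\<lambda>m n. (\<phi> m + c * dl m) * \<psi> n)"
    by (intro ext) (auto simp: dl_def algebra_simps)
  finally show ?case .
qed (simp add: FF.zero)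

section \<open>Regularised sums and convolution\<close>

lemma of_int_power_nth: "fps_nth ((of_int n :: complex fps) ^ r * F) k = of_int n ^ r * fps_nth F k"
proof -
  have "(of_int n :: complex fps) ^ r = fps_const (of_int n ^ r)" by (simp flip: fps_of_int)
  then show ?thesis by simp
qed

lemma of_int_power_nth1: "fps_nth ((of_int n :: complex fps) ^ r) k = (if k = 0 then of_int n ^ r else 0)"
  using of_int_power_nth[of n r 1 k] by simp

text \<open>The limit of an edge function as \<open>q\<close> tends to \<open>0\<close>: the sum of an edge function over all \<open>n\<close> diverges exactly because of this part.\<close>

definition step :: "nat \<Rightarrow> int \<Rightarrow> complex fps" where
  "step r n = (if n > 0 then of_int n ^ r else 0)"

text \<open>What is left of the terms \<open>n\<close> and \<open>- n\<close> together has divisor sums of odd total exponent as coefficients.\<close>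

lemma EE_reg:
  assumes j: "j \<ge> 1"
  shows "lfin (\<lambda>n. EE r j n - step r n) UNIV" (is ?A)
    and "fsum (\<lambda>n. EE r j n - step r n) UNIV \<in> espan (r + j)" (is ?B)
proof -
  obtain P :: "complex poly" where P: "degree P < j" "poly P 0 = 1"
     "\<And>n k. n > 0 \<Longrightarrow> fps_nth (gf (int n) ^ j) k = (if n dvd k then poly P (of_nat (k div n)) else 0)"
     "\<And>n k. n > 0 \<Longrightarrow> fps_nth (gf (- int n) ^ j) k = (if 0 < k \<and> n dvd k then - poly P (- of_nat (k div n)) else 0)"
    using gf_power_coeff[OF j] by blast
  define T where "T n = EE r j n - step r n" for n
  have T0: "T 0 = 0" using j by (simp add: T_def step_def)
  have Tpos: "fps_nth (T (int d)) k = (if 0 < k \<and> d dvd k then of_nat d ^ r * poly P (of_nat (k div d)) else 0)" if "d > 0" for d k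
    using that P(2) of_int_power_nth[of "int d" r "gf (int d) ^ j" k] of_int_power_nth1[of "int d" r k]
    by (auto simp: T_def EE_def step_def P(3))
  have Tneg: "fps_nth (T (- int d)) k = (if 0 < k \<and> d dvd k then - ((- of_nat d) ^ r * poly P (- of_nat (k div d))) else 0)" if "d > 0" for d k
  proof -
    have "fps_nth (T (- int d)) k = (- of_nat d) ^ r * fps_nth (gf (- int d) ^ j) k"
      using of_int_power_nth[of "- int d" r "gf (- int d) ^ j" k] by (simp add: T_def EE_def step_def)
    then show ?thesis using P(4)[OF that, of k] by simp
  qed
  have nz: "n \<in> int ` {d. d dvd k} \<union> (\<lambda>d. - int d) ` {d. d dvd k} \<and> k > 0" if "fps_nth (T n) k \<noteq> 0" for n k
  proof -
    consider "n = 0" | d where "d > 0" "n = int d" | d where "d > 0" "n = - int d"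
      by (metis gr0I int_cases2 int_eq_iff minus_zero of_nat_0)
    then show ?thesis using that T0 Tpos Tneg by cases (auto split: if_splits)
  qed
  have lf: "lfin T UNIV" unfolding lfin_def
  proof
    fix k
    show "finite {x \<in> UNIV. fps_nth (T x) k \<noteq> 0}"
    proof (cases "k = 0")
      case True
      then have "{x \<in> UNIV. fps_nth (T x) k \<noteq> 0} = {}" using nz[of _ k] by auto
      then show ?thesis by (metis finite.emptyI)
    next
      case False
      have "finite (int ` {d. d dvd k} \<union> (\<lambda>d. - int d) ` {d. d dvd k})" using False by auto
      then show ?thesis by (rule rev_finite_subset) (use nz in blast)
    qed
  qed
  have "fsum T UNIV = Abs_fps (\<lambda>k. \<Sum>d | d dvd k. of_nat d ^ r * poly P (of_nat (k div d)) - (- of_nat d) ^ r * poly P (- of_nat (k div d)))"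
    (is "_ = ?R")
  proof (rule fps_ext)
    fix k show "fps_nth (fsum T UNIV) k = fps_nth ?R k"
    proof (cases "k = 0")
      case True
      have "fps_nth (fsum T UNIV) k = (\<Sum>n\<in>{}. fps_nth (T n) k)"
        by (rule fsum_nth) (use nz[of _ k] True in auto)
      then show ?thesis using True by (simp add: infinite_UNIV_nat)
    next
      case False
      let ?D = "{d. d dvd k}"
      have D: "finite ?D" "\<And>d. d \<in> ?D \<Longrightarrow> d > 0" using False by (auto intro!: Nat.gr0I)
      have "fps_nth (fsum T UNIV) k = (\<Sum>n\<in>int ` ?D \<union> (\<lambda>d. - int d) ` ?D. fps_nth (T n) k)"
        by (rule fsum_nth) (use nz D in blast)+
      also have "\<dots> = (\<Sum>n\<in>int ` ?D. fps_nth (T n) k) + (\<Sum>n\<in>(\<lambda>d. - int d) ` ?D. fps_nth (T n) k)"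
        by (rule sum.union_disjoint) (use D in force)+
      also have "(\<Sum>n\<in>int ` ?D. fps_nth (T n) k) = (\<Sum>d\<in>?D. of_nat d ^ r * poly P (of_nat (k div d)))"
        using False D(2) by (subst sum.reindex) (auto simp: inj_on_def Tpos)
      also have "(\<Sum>n\<in>(\<lambda>d. - int d) ` ?D. fps_nth (T n) k) = (\<Sum>d\<in>?D. - ((- of_nat d) ^ r * poly P (- of_nat (k div d))))"
        using False D(2) by (subst sum.reindex) (auto simp: inj_on_def Tneg)
      finally show ?thesis by (simp add: sum.distrib[symmetric])
    qed
  qed
  moreover have "?R \<in> espan (r + j)" by (rule poly_divisor_sum_espan[OF P(1)])
  ultimately show ?A ?B using lf by (simp_all add: T_def[abs_def])
qed

text \<open>The regularisation is not invariant under translation; the defect is a power sum, that is a polynomial in the shift by Faulhaber's formula.\<close>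

lemma step_shift:
  defines "W \<equiv> \<lambda>r N n. step r (n - N) - (if n > 0 then of_int (n - N) ^ r else 0)"
  shows "lfin (W r N) UNIV" "fsum (W r N) UNIV = fps_const (of_real (poly (smult (- ((-1) ^ r)) (faul r)) (of_int N)))"
proof -
  obtain d where "N = int d \<or> N = - int d" by (metis int_cases2)
  then consider "N = int d" | "N = - int d" by blast
  then have "lfin (W r N) UNIV \<and> fsum (W r N) UNIV = fps_const (of_real (poly (smult (- ((-1) ^ r)) (faul r)) (of_int N)))"
  proof cases
    case 1
    have z: "W r N n = 0" if "n \<notin> {1..N}" for n using that 1 by (auto simp: W_def step_def)
    have "{n. W r N n \<noteq> 0} \<subseteq> {1..N}" using z by blast
    then have lf: "lfin (W r N) UNIV" by (intro lfin_finite) (auto intro: finite_subset)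
    have "fsum (W r N) UNIV = fsum (W r N) {1..N}" by (rule fsum_neutral) (use z in auto)
    also have "\<dots> = (\<Sum>n\<in>{1..N}. W r N n)" by (simp add: fsum_finite)
    also have "\<dots> = (\<Sum>n\<in>{1..N}. - (of_int (n - N) ^ r))"
      by (rule sum.cong) (auto simp: W_def step_def)
    also have "\<dots> = (\<Sum>a<d. - ((- of_nat a) ^ r))"
      by (rule sum.reindex_bij_witness[where i = "\<lambda>a. N - int a" and j = "\<lambda>n. nat (N - n)"]) (use 1 in auto)
    also have "\<dots> = (\<Sum>a<d. fps_const (of_real (- ((-1) ^ r) * real a ^ r)))"
    proof (rule sum.cong)
      fix a
      have "(- (of_nat a :: complex fps)) ^ r = (-1) ^ r * of_nat a ^ r" by (rule power_minus)
      then show "- ((- (of_nat a :: complex fps)) ^ r) = fps_const (of_real (- ((-1) ^ r) * real a ^ r))"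
        by (simp add: fps_of_nat[symmetric] flip: fps_const_mult fps_const_power fps_const_neg)
    qed simp
    also have "\<dots> = fps_const (of_real (poly (smult (- ((-1) ^ r)) (faul r)) (of_int N)))"
      unfolding 1 by (simp add: faul_nat sum_distrib_left fps_const_sum' flip: sum_negf)
    finally show ?thesis using lf by simp
  next
    case 2
    have z: "W r N n = 0" if "n \<notin> {N<..0}" for n using that 2 by (auto simp: W_def step_def)
    have "{n. W r N n \<noteq> 0} \<subseteq> {N<..0}" using z by blast
    then have lf: "lfin (W r N) UNIV" by (intro lfin_finite) (auto intro: finite_subset)
    have "fsum (W r N) UNIV = fsum (W r N) {N<..0}" by (rule fsum_neutral) (use z in auto)
    also have "\<dots> = (\<Sum>n\<in>{N<..0}. W r N n)" by (simp add: fsum_finite)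
    also have "\<dots> = (\<Sum>n\<in>{N<..0}. of_int (n - N) ^ r)"
      by (rule sum.cong) (auto simp: W_def step_def)
    also have "\<dots> = (\<Sum>a\<in>{1..d}. of_nat a ^ r)"
      by (rule sum.reindex_bij_witness[where i = "\<lambda>a. N + int a" and j = "\<lambda>n. nat (n - N)"]) (use 2 in auto)
    also have "\<dots> = (\<Sum>a\<in>{1..d}. fps_const (of_real ((-1) ^ r * (- real a) ^ r)))"
    proof (rule sum.cong)
      fix a
      have "(-1) ^ r * (- real a) ^ r = real a ^ r" by (metis (no_types) minus_minus mult_minus1 power_mult_distrib)
      then show "(of_nat a :: complex fps) ^ r = fps_const (of_real ((-1) ^ r * (- real a) ^ r))"
        by (simp add: fps_of_nat[symmetric] flip: fps_const_power)
    qed simp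
    also have "\<dots> = fps_const (of_real (poly (smult (- ((-1) ^ r)) (faul r)) (of_int N)))"
      unfolding 2 by (simp add: faul_neg sum_distrib_left fps_const_sum')
    finally show ?thesis using lf by simp
  qed
  then show "lfin (W r N) UNIV" "fsum (W r N) UNIV = fps_const (of_real (poly (smult (- ((-1) ^ r)) (faul r)) (of_int N)))" by auto
qed

text \<open>Coefficientwise polynomial functions are the admissible divergent parts. Subtracted on the positive integers only, they are unique: a polynomial that is locally finitely supported there vanishes.\<close>

definition coefpoly :: "(int \<Rightarrow> complex fps) \<Rightarrow> bool" where
  "coefpoly u \<longleftrightarrow> (\<forall>k. \<exists>P. \<forall>n. fps_nth (u n) k = poly P (of_int n))"

lemma coefpoly_add: "coefpoly u \<Longrightarrow> coefpoly v \<Longrightarrow> coefpoly (\<lambda>n. u n + v n)"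
  unfolding coefpoly_def by (metis fps_add_nth poly_add)

lemma coefpoly_cmult: "coefpoly u \<Longrightarrow> coefpoly (\<lambda>n. c * u n)"
proof -
  assume "coefpoly u"
  then obtain P where P: "\<And>k n. fps_nth (u n) k = poly (P k) (of_int n)" unfolding coefpoly_def by metis
  have "fps_nth (c * u n) k = poly (\<Sum>i=0..k. smult (fps_nth c i) (P (k - i))) (of_int n)" for k n
    by (simp add: fps_mult_nth P poly_sum)
  then show ?thesis unfolding coefpoly_def by blast
qed

lemma coefpoly_power: "coefpoly (\<lambda>n. of_int (n - s) ^ r)"
  unfolding coefpoly_def
proof
  fix k
  have "fps_nth ((of_int (n - s) :: complex fps) ^ r) k = poly (if k = 0 then [:- of_int s, 1:] ^ r else 0) (of_int n)" for n
    unfolding of_int_power_nth1 by (simp add: poly_power)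
  then show "\<exists>P. \<forall>n. fps_nth ((of_int (n - s) :: complex fps) ^ r) k = poly P (of_int n)" by blast
qed

lemma coefpoly_eq_0:
  assumes "coefpoly u" "lfin (\<lambda>n. if n > 0 then u n else 0) UNIV" shows "u n = 0"
proof (rule fps_ext)
  fix k
  obtain P where P: "\<And>n. fps_nth (u n) k = poly P (of_int n)" using assms(1) unfolding coefpoly_def by blast
  have "finite {n. fps_nth (if n > 0 then u n else 0) k \<noteq> 0}" using lfinD[OF assms(2), of k] by simp
  then have "infinite ({n. n > 0} - {n::int. fps_nth (if n > 0 then u n else 0) k \<noteq> 0})"
    by (rule Diff_infinite_finite) (metis infinite_Ioi greaterThan_def)
  moreover have "{n. n > 0} - {n::int. fps_nth (if n > 0 then u n else 0) k \<noteq> 0} \<subseteq> {n. poly P (of_int n) = 0}"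
    using P by auto
  ultimately have "infinite {n::int. poly P (of_int n) = 0}" using finite_subset by blast
  then have "infinite ((of_int :: int \<Rightarrow> complex) ` {n::int. poly P (of_int n) = 0})"
    by (simp add: finite_image_iff inj_on_def)
  moreover have "(of_int :: int \<Rightarrow> complex) ` {n::int. poly P (of_int n) = 0} \<subseteq> {x. poly P x = 0}" by auto
  ultimately have "P = 0" using poly_roots_finite finite_subset by blast
  then show "fps_nth (u n) k = fps_nth 0 k" using P by simp
qed

lemma EE_reg_shift:
  assumes j: "j \<ge> 1" and s: "s = (\<lambda>N::int. 0) \<or> s = (\<lambda>N. N)"
  obtains c p where "c \<in> espan (r + j)" "degree p \<le> r + 1"
    "\<And>N. lfin (\<lambda>n. EE r j (n - s N) - (if n > 0 then of_int (n - s N) ^ r else 0)) UNIV"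
    "\<And>N. fsum (\<lambda>n. EE r j (n - s N) - (if n > 0 then of_int (n - s N) ^ r else 0)) UNIV = c + fps_const (of_real (poly p (of_int N)))"
proof -
  let ?c = "fsum (\<lambda>n. EE r j n - step r n) UNIV"
  let ?q = "smult (- ((-1) ^ r)) (faul r)"
  define p where "p = (if s = (\<lambda>N. 0) then 0 else ?q)"
  have dq: "degree ?q \<le> r + 1" by (rule order_trans[OF degree_smult_le faul(1)])
  then have dp: "degree p \<le> r + 1" by (simp add: p_def)
  have p: "poly ?q (of_int (s N)) = poly p (of_int N)" for N
  proof (cases "s = (\<lambda>N. 0)")
    case True
    then show ?thesis by (simp add: p_def faul)
  next
    case False
    then have "s N = N" using s by simp
    then show ?thesis using False by (simp add: p_def)
  qed
  have split: "EE r j (n - t) - (if n > 0 then of_int (n - t) ^ r else 0) =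
      (EE r j (n - t) - step r (n - t)) + (step r (n - t) - (if n > 0 then of_int (n - t) ^ r else 0))" for n t by simp
  have lf: "lfin (\<lambda>n. EE r j (n - t) - step r (n - t)) UNIV" for t
    by (rule lfin_reindex[where i = "\<lambda>n. n + t" and j = "\<lambda>n. n - t", OF _ _ _ EE_reg(1)[OF j, of r]]) auto
  have fs: "fsum (\<lambda>n. EE r j (n - t) - step r (n - t)) UNIV = ?c" for t
    by (rule fsum_reindex[where i = "\<lambda>n. n + t" and j = "\<lambda>n. n - t"]) auto
  show thesis
  proof (rule that[OF EE_reg(2)[OF j] dp])
    fix N
    show "lfin (\<lambda>n. EE r j (n - s N) - (if n > 0 then of_int (n - s N) ^ r else 0)) UNIV"
      unfolding split by (intro lfin_add lf step_shift)
    show "fsum (\<lambda>n. EE r j (n - s N) - (if n > 0 then of_int (n - s N) ^ r else 0)) UNIV = ?c + fps_const (of_real (poly p (of_int N)))"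
      unfolding split by (subst fsum_add[OF lf step_shift(1)]) (simp only: fs step_shift(2) p)
  qed
qed

text \<open>For a product of a function of the total \<open>N\<close> with a function of one edge, the regularised sum is again an edge function of \<open>N\<close>. The shift contributes a polynomial of degree at most \<open>r + 1\<close>, which is within the weight as \<open>j \<ge> 1\<close>.\<close>

lemma RR_reg:
  assumes \<alpha>: "\<alpha> \<in> RR a" and \<beta>: "\<beta> \<in> RR b" and s: "s = (\<lambda>N::int. 0) \<or> s = (\<lambda>N. N)"
  shows "\<exists>\<rho>\<in>RR (a + b). \<exists>u. (\<forall>N. coefpoly (u N)) \<and>
    (\<forall>N. lfin (\<lambda>n. \<alpha> N * \<beta> (n - s N) - (if n > 0 then u N n else 0)) UNIV \<and>
         fsum (\<lambda>n. \<alpha> N * \<beta> (n - s N) - (if n > 0 then u N n else 0)) UNIV = \<rho> N)"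
  using \<beta>
proof (induction \<beta> rule: RR.induct)
  case zero
  have "coefpoly (\<lambda>n. 0)" unfolding coefpoly_def by (auto intro: exI[of _ 0])
  moreover have "lfin (\<lambda>n. 0) UNIV" "fsum (\<lambda>n. 0) (UNIV :: int set) = 0"
    by (auto intro!: lfin_finite fps_ext simp: fsum_def)
  ultimately show ?case by (intro bexI[OF _ RR.zero] exI[of _ "\<lambda>N n. 0"]) auto
next
  case (EE \<beta> c a' j r)
  then obtain \<rho> u where \<rho>: "\<rho> \<in> RR (a + b)" "\<And>N. coefpoly (u N)"
    "\<And>N. lfin (\<lambda>n. \<alpha> N * \<beta> (n - s N) - (if n > 0 then u N n else 0)) UNIV"
    "\<And>N. fsum (\<lambda>n. \<alpha> N * \<beta> (n - s N) - (if n > 0 then u N n else 0)) UNIV = \<rho> N" by blast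
  obtain d p where d: "d \<in> espan (r + j)" "degree p \<le> r + 1"
    "\<And>N. lfin (\<lambda>n. EE r j (n - s N) - (if n > 0 then of_int (n - s N) ^ r else 0)) UNIV"
    "\<And>N. fsum (\<lambda>n. EE r j (n - s N) - (if n > 0 then of_int (n - s N) ^ r else 0)) UNIV = d + fps_const (of_real (poly p (of_int N)))"
    by (rule EE_reg_shift[OF EE.hyps(3) s, of r]) blast
  let ?X = "\<lambda>N n. EE r j (n - s N) - (if n > 0 then of_int (n - s N) ^ r else 0)"
  have split: "\<alpha> N * (\<beta> (n - s N) + c * EE r j (n - s N)) - (if n > 0 then u N n + (\<alpha> N * c) * of_int (n - s N) ^ r else 0)
     = (\<alpha> N * \<beta> (n - s N) - (if n > 0 then u N n else 0)) + (\<alpha> N * c) * ?X N n" for N n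
    by (simp add: algebra_simps)
  have cd: "c * d \<in> espan (a' + (r + j))" by (intro espan_mult EE.hyps d)
  have "(\<lambda>N. \<rho> N + (c * d * \<alpha> N + c * (fps_const (of_real (poly p (real_of_int N))) * \<alpha> N))) \<in> RR (a + b)"
    by (intro RR_add \<rho>(1) RR_mono[OF RR_cmult[OF cd \<alpha>]] RR_mono[OF RR_cmult[OF EE.hyps(2) RR_poly[OF \<alpha> d(2)]]])
       (use EE in auto)
  then show ?case
  proof (intro bexI exI conjI allI)
    fix N
    show "coefpoly (\<lambda>n. u N n + (\<alpha> N * c) * of_int (n - s N) ^ r)"
      by (intro coefpoly_add coefpoly_cmult coefpoly_power \<rho>)
    show "lfin (\<lambda>n. \<alpha> N * (\<beta> (n - s N) + c * EE r j (n - s N)) - (if n > 0 then u N n + (\<alpha> N * c) * of_int (n - s N) ^ r else 0)) UNIV"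
      unfolding split by (intro lfin_add \<rho> lfin_mult d)
    show "fsum (\<lambda>n. \<alpha> N * (\<beta> (n - s N) + c * EE r j (n - s N)) - (if n > 0 then u N n + (\<alpha> N * c) * of_int (n - s N) ^ r else 0)) UNIV
       = \<rho> N + (c * d * \<alpha> N + c * (fps_const (of_real (poly p (real_of_int N))) * \<alpha> N))"
      unfolding split
      by (subst fsum_add[OF \<rho>(3) lfin_mult[OF d(3)]], subst fsum_mult[OF d(3)]) (simp add: \<rho> d algebra_simps)
  qed
next
  case (dl \<beta> c)
  then obtain \<rho> u where \<rho>: "\<rho> \<in> RR (a + b)" "\<And>N. coefpoly (u N)"
    "\<And>N. lfin (\<lambda>n. \<alpha> N * \<beta> (n - s N) - (if n > 0 then u N n else 0)) UNIV"
    "\<And>N. fsum (\<lambda>n. \<alpha> N * \<beta> (n - s N) - (if n > 0 then u N n else 0)) UNIV = \<rho> N" by blast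
  have split: "\<alpha> N * (\<beta> (n - s N) + c * dl (n - s N)) - (if n > 0 then u N n else 0)
     = (\<alpha> N * \<beta> (n - s N) - (if n > 0 then u N n else 0)) + (\<alpha> N * c) * dl (n - s N)" for N n
    by (simp add: algebra_simps)
  have lf: "lfin (\<lambda>n. dl (n - t)) UNIV" for t
    by (rule lfin_finite, rule finite_subset[of _ "{t}"]) (auto simp: dl_def split: if_splits)
  have fs: "fsum (\<lambda>n. dl (n - t)) UNIV = 1" for t
  proof -
    have "fsum (\<lambda>n. dl (n - t)) UNIV = fsum (\<lambda>n. dl (n - t)) {t}" by (rule fsum_neutral) (auto simp: dl_def)
    then show ?thesis by (simp add: fsum_finite)
  qed
  have "(\<lambda>N. \<rho> N + c * \<alpha> N) \<in> RR (a + b)"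
    using RR_cmult[OF dl.hyps(2) \<alpha>] by (intro RR_add \<rho>(1)) (simp add: add.commute)
  then show ?case
  proof (intro bexI exI conjI allI)
    fix N
    show "coefpoly (u N)" by (rule \<rho>)
    show "lfin (\<lambda>n. \<alpha> N * (\<beta> (n - s N) + c * dl (n - s N)) - (if n > 0 then u N n else 0)) UNIV"
      unfolding split by (intro lfin_add \<rho> lfin_mult lf)
    show "fsum (\<lambda>n. \<alpha> N * (\<beta> (n - s N) + c * dl (n - s N)) - (if n > 0 then u N n else 0)) UNIV = \<rho> N + c * \<alpha> N"
      unfolding split
      by (subst fsum_add[OF \<rho>(3) lfin_mult[OF lf]], subst fsum_mult[OF lf]) (simp add: \<rho> fs algebra_simps)
  qed
qed

lemma FF_reg:
  "\<Phi> \<in> FF K \<Longrightarrow> \<exists>\<rho>\<in>RR K. \<exists>u. (\<forall>N. coefpoly (u N)) \<and>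
    (\<forall>N. lfin (\<lambda>n. \<Phi> (N - n) n - (if n > 0 then u N n else 0)) UNIV \<and>
         fsum (\<lambda>n. \<Phi> (N - n) n - (if n > 0 then u N n else 0)) UNIV = \<rho> N)"
proof (induction \<Phi> rule: FF.induct)
  case zero
  have "coefpoly (\<lambda>n. 0)" unfolding coefpoly_def by (auto intro: exI[of _ 0])
  moreover have "lfin (\<lambda>n. 0) UNIV" "fsum (\<lambda>n. 0) (UNIV :: int set) = 0"
    by (auto intro!: lfin_finite fps_ext simp: fsum_def)
  ultimately show ?case by (intro bexI[OF _ RR.zero] exI[of _ "\<lambda>N n. 0"]) auto
next
  case (left \<Phi> \<alpha> a \<beta> b)
  then obtain \<rho> u where \<rho>: "\<rho> \<in> RR K" "\<And>N. coefpoly (u N)"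
    "\<And>N. lfin (\<lambda>n. \<Phi> (N - n) n - (if n > 0 then u N n else 0)) UNIV"
    "\<And>N. fsum (\<lambda>n. \<Phi> (N - n) n - (if n > 0 then u N n else 0)) UNIV = \<rho> N" by blast
  obtain \<sigma> v where \<sigma>: "\<sigma> \<in> RR (a + b)" "\<And>N. coefpoly (v N)"
    "\<And>N. lfin (\<lambda>n. \<alpha> N * \<beta> n - (if n > 0 then v N n else 0)) UNIV"
    "\<And>N. fsum (\<lambda>n. \<alpha> N * \<beta> n - (if n > 0 then v N n else 0)) UNIV = \<sigma> N"
    using RR_reg[OF left.hyps(2,3), of "\<lambda>N. 0"] by auto
  have split: "\<Phi> (N - n) n + \<alpha> (N - n + n) * \<beta> n - (if n > 0 then u N n + v N n else 0)
    = (\<Phi> (N - n) n - (if n > 0 then u N n else 0)) + (\<alpha> N * \<beta> n - (if n > 0 then v N n else 0))" for N n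
    by simp
  have "(\<lambda>N. \<rho> N + \<sigma> N) \<in> RR K" using left \<sigma>(1) by (intro RR_add \<rho>(1)) (auto intro: RR_mono)
  then show ?case
  proof (intro bexI exI conjI allI)
    fix N
    show "coefpoly (\<lambda>n. u N n + v N n)" by (intro coefpoly_add \<rho> \<sigma>)
    show "lfin (\<lambda>n. \<Phi> (N - n) n + \<alpha> (N - n + n) * \<beta> n - (if n > 0 then u N n + v N n else 0)) UNIV"
      unfolding split by (intro lfin_add \<rho> \<sigma>)
    show "fsum (\<lambda>n. \<Phi> (N - n) n + \<alpha> (N - n + n) * \<beta> n - (if n > 0 then u N n + v N n else 0)) UNIV = \<rho> N + \<sigma> N"
      unfolding split by (subst fsum_add[OF \<rho>(3) \<sigma>(3)]) (simp add: \<rho> \<sigma>)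
  qed
next
  case (right \<Phi> \<alpha> a \<beta> b)
  then obtain \<rho> u where \<rho>: "\<rho> \<in> RR K" "\<And>N. coefpoly (u N)"
    "\<And>N. lfin (\<lambda>n. \<Phi> (N - n) n - (if n > 0 then u N n else 0)) UNIV"
    "\<And>N. fsum (\<lambda>n. \<Phi> (N - n) n - (if n > 0 then u N n else 0)) UNIV = \<rho> N" by blast
  obtain \<sigma> v where \<sigma>: "\<sigma> \<in> RR (a + b)" "\<And>N. coefpoly (v N)"
    "\<And>N. lfin (\<lambda>n. \<alpha> N * \<beta> (n - N) - (if n > 0 then v N n else 0)) UNIV"
    "\<And>N. fsum (\<lambda>n. \<alpha> N * \<beta> (n - N) - (if n > 0 then v N n else 0)) UNIV = \<sigma> N"
    using RR_reg[OF right.hyps(2,3), of "\<lambda>N. N"] by auto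
  have split: "\<Phi> (N - n) n + \<alpha> (N - n + n) * \<beta> (- (N - n)) - (if n > 0 then u N n + v N n else 0)
    = (\<Phi> (N - n) n - (if n > 0 then u N n else 0)) + (\<alpha> N * \<beta> (n - N) - (if n > 0 then v N n else 0))" for N n
    by simp
  have "(\<lambda>N. \<rho> N + \<sigma> N) \<in> RR K" using right \<sigma>(1) by (intro RR_add \<rho>(1)) (auto intro: RR_mono)
  then show ?case
  proof (intro bexI exI conjI allI)
    fix N
    show "coefpoly (\<lambda>n. u N n + v N n)" by (intro coefpoly_add \<rho> \<sigma>)
    show "lfin (\<lambda>n. \<Phi> (N - n) n + \<alpha> (N - n + n) * \<beta> (- (N - n)) - (if n > 0 then u N n + v N n else 0)) UNIV"
      unfolding split by (intro lfin_add \<rho> \<sigma>)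
    show "fsum (\<lambda>n. \<Phi> (N - n) n + \<alpha> (N - n + n) * \<beta> (- (N - n)) - (if n > 0 then u N n + v N n else 0)) UNIV = \<rho> N + \<sigma> N"
      unfolding split by (subst fsum_add[OF \<rho>(3) \<sigma>(3)]) (simp add: \<rho> \<sigma>)
  qed
qed

definition conv :: "(int \<Rightarrow> complex fps) \<Rightarrow> (int \<Rightarrow> complex fps) \<Rightarrow> int \<Rightarrow> complex fps" where
  "conv \<phi> \<psi> N = fsum (\<lambda>n. \<phi> (N - n) * \<psi> n) UNIV"

text \<open>One of the two arguments \<open>N - n\<close> and \<open>n\<close> is very negative when \<open>|n|\<close> is large.\<close>

lemma lfin_conv:
  assumes "\<phi> \<in> RR a" "\<psi> \<in> RR b" shows "lfin (\<lambda>n. \<phi> (N - n) * \<psi> n) UNIV"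
  unfolding lfin_def
proof
  fix k
  have "n \<in> {- int k..N + int k}" if nz: "fps_nth (\<phi> (N - n) * \<psi> n) k \<noteq> 0" for n
  proof (rule ccontr)
    assume "n \<notin> {- int k..N + int k}"
    then consider "int k < - n" | "int k < - (N - n)" by (metis atLeastAtMost_iff linorder_not_le minus_le_iff diff_le_eq minus_diff_eq add.commute)
    then have "fps_nth (\<phi> (N - n) * \<psi> n) k = 0"
    proof cases
      case 1
      then have "fps_nth (\<psi> n) i = 0" if "i \<le> k" for i using that by (intro RR_order[OF assms(2)]) auto
      then show ?thesis by (simp add: fps_mult_nth)
    next
      case 2
      then have "fps_nth (\<phi> (N - n)) i = 0" if "i \<le> k" for i using that by (intro RR_order[OF assms(1)]) auto
      then show ?thesis by (simp add: fps_mult_nth)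
    qed
    with nz show False by simp
  qed
  then have "{n \<in> UNIV. fps_nth (\<phi> (N - n) * \<psi> n) k \<noteq> 0} \<subseteq> {- int k..N + int k}" by blast
  then show "finite {n \<in> UNIV. fps_nth (\<phi> (N - n) * \<psi> n) k \<noteq> 0}"
    by (rule finite_subset) simp
qed

text \<open>Split the product by \<open>FF_product\<close> and regularise each term. The convolution itself converges, so the polynomial parts that were subtracted must cancel, by \<open>coefpoly_eq_0\<close>.\<close>

lemma conv_RR:
  assumes "\<phi> \<in> RR a" "\<psi> \<in> RR b" shows "conv \<phi> \<psi> \<in> RR (a + b)"
proof -
  obtain \<rho> u where \<rho>: "\<rho> \<in> RR (a + b)" "\<And>N. coefpoly (u N)"
    "\<And>N. lfin (\<lambda>n. \<phi> (N - n) * \<psi> n - (if n > 0 then u N n else 0)) UNIV"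
    "\<And>N. fsum (\<lambda>n. \<phi> (N - n) * \<psi> n - (if n > 0 then u N n else 0)) UNIV = \<rho> N"
    using FF_reg[OF FF_product[OF assms]] by blast
  have "conv \<phi> \<psi> N = \<rho> N" for N
  proof -
    have "lfin (\<lambda>n. \<phi> (N - n) * \<psi> n - (\<phi> (N - n) * \<psi> n - (if n > 0 then u N n else 0))) UNIV"
      by (rule lfin_diff[OF lfin_conv[OF assms] \<rho>(3)])
    then have "lfin (\<lambda>n. if n > 0 then u N n else 0) UNIV" by simp
    then have "u N n = 0" for n by (rule coefpoly_eq_0[OF \<rho>(2)])
    then have "(\<lambda>n. \<phi> (N - n) * \<psi> n - (if n > 0 then u N n else 0)) = (\<lambda>n. \<phi> (N - n) * \<psi> n)" by auto
    then show ?thesis using \<rho>(4)[of N] unfolding conv_def by (simp only:)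
  qed
  then have "conv \<phi> \<psi> = \<rho>" by blast
  with \<rho> show ?thesis by simp
qed

section \<open>Flow sums on directed graphs\<close>

text \<open>Every edge \<open>e\<close> is directed from \<open>lo e\<close> to \<open>hi e\<close>; negative values mean flow against this direction. The condition is that no vertex has divergence.\<close>

definition flows :: "'e set \<Rightarrow> ('e \<Rightarrow> nat) \<Rightarrow> ('e \<Rightarrow> nat) \<Rightarrow> ('e \<Rightarrow> int) set" where
  "flows E lo hi = {f. (\<forall>e. e \<notin> E \<longrightarrow> f e = 0) \<and>
     (\<forall>v. (\<Sum>e\<in>E. f e * (of_bool (lo e = v) - of_bool (hi e = v))) = 0)}"

text \<open>Summation by parts: the total potential drop is the potential paired with the divergence.\<close>

lemma flows_potential:
  fixes x :: "nat \<Rightarrow> real"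
  assumes "finite E" "f \<in> flows E lo hi"
  shows "(\<Sum>e\<in>E. of_int (f e) * (x (lo e) - x (hi e))) = 0"
proof -
  let ?V = "lo ` E \<union> hi ` E"
  have V: "finite ?V" using assms by simp
  have "(\<Sum>e\<in>E. of_int (f e) * (x (lo e) - x (hi e))) =
     (\<Sum>e\<in>E. \<Sum>v\<in>?V. x v * of_int (f e * (of_bool (lo e = v) - of_bool (hi e = v))))"
  proof (rule sum.cong)
    fix e assume e: "e \<in> E"
    have "(\<Sum>v\<in>?V. x v * of_int (f e * (of_bool (lo e = v) - of_bool (hi e = v))))
       = (\<Sum>v\<in>?V. (if v = lo e then of_int (f e) * x (lo e) else 0) - (if v = hi e then of_int (f e) * x (hi e) else 0))"
      by (rule sum.cong) auto
    also have "\<dots> = of_int (f e) * (x (lo e) - x (hi e))"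
      using V e by (simp add: sum_subtractf right_diff_distrib)
    finally show "of_int (f e) * (x (lo e) - x (hi e)) = (\<Sum>v\<in>?V. x v * of_int (f e * (of_bool (lo e = v) - of_bool (hi e = v))))" by simp
  qed simp
  also have "\<dots> = (\<Sum>v\<in>?V. x v * of_int (\<Sum>e\<in>E. f e * (of_bool (lo e = v) - of_bool (hi e = v))))"
    by (subst sum.swap) (simp add: sum_distrib_left)
  also have "\<dots> = 0" using assms by (simp add: flows_def)
  finally show ?thesis .
qed

definition ordr :: "(int \<Rightarrow> complex fps) \<Rightarrow> bool" where
  "ordr \<phi> \<longleftrightarrow> (\<forall>n k. int k < - n \<longrightarrow> fps_nth (\<phi> n) k = 0)"

lemma RR_ordr: "\<phi> \<in> RR K \<Longrightarrow> ordr \<phi>"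
  unfolding ordr_def using RR_order by blast

text \<open>In a given power of \<open>q\<close> all values of the flow are bounded below. Pairing with the potential \<open>v \<mapsto> v\<close>, which increases along every edge, bounds them above.\<close>

lemma lfin_flows:
  assumes E: "finite E" and acyc: "\<And>e. e \<in> E \<Longrightarrow> lo e < hi e" and ord: "\<And>e. e \<in> E \<Longrightarrow> ordr (\<phi> e)"
  shows "lfin (\<lambda>f. \<Prod>e\<in>E. \<phi> e (f e)) (flows E lo hi)"
  unfolding lfin_def
proof
  fix k
  define M where "M = (\<Sum>e\<in>E. hi e)"
  define B where "B = int (card E * M * k)"
  have bnd: "- int k \<le> f e \<and> f e \<le> B" if f: "f \<in> flows E lo hi" "fps_nth (\<Prod>e\<in>E. \<phi> e (f e)) k \<noteq> 0" and e: "e \<in> E" for f e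
  proof -
    have low: "- int k \<le> f e" if e: "e \<in> E" for e
    proof (rule ccontr)
      assume "\<not> - int k \<le> f e"
      then have "fps_nth (\<phi> e (f e)) i = 0" if "i \<le> k" for i
        using ord[OF e] that unfolding ordr_def by auto
      then have "fps_nth (\<phi> e (f e) * (\<Prod>e\<in>E - {e}. \<phi> e (f e))) k = 0" by (simp add: fps_mult_nth)
      then show False using f(2) prod.remove[OF E e, of "\<lambda>e. \<phi> e (f e)"] by simp
    qed
    have "(\<Sum>e\<in>E. real_of_int (f e) * (real (lo e) - real (hi e))) = 0"
      by (rule flows_potential[OF E f(1)])
    then have "real_of_int (\<Sum>e\<in>E. f e * (int (hi e) - int (lo e))) = 0"
      by (simp add: algebra_simps sum_subtractf)
    then have z: "(\<Sum>e\<in>E. f e * (int (hi e) - int (lo e))) = 0" by linarith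
    have hiM: "int (hi e') \<le> int M" if "e' \<in> E" for e'
      unfolding M_def of_nat_le_iff using member_le_sum[OF that, of hi] E by auto
    have each: "- (int k * int M) \<le> f e' * (int (hi e') - int (lo e'))" if "e' \<in> E" for e'
    proof -
      have "- (int k * int M) \<le> - (int k * (int (hi e') - int (lo e')))"
        using hiM[OF that] by (simp add: mult_left_mono)
      also have "\<dots> \<le> f e' * (int (hi e') - int (lo e'))"
        using mult_right_mono[OF low[OF that], of "int (hi e') - int (lo e')"] acyc[OF that] by simp
      finally show ?thesis .
    qed
    have "f e * 1 \<le> B"
    proof (cases "f e \<ge> 0")
      case True
      have "f e * 1 \<le> f e * (int (hi e) - int (lo e))"
        using True acyc[OF e] by (intro mult_left_mono) auto
      also have "\<dots> = - (\<Sum>e'\<in>E - {e}. f e' * (int (hi e') - int (lo e')))"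
        using z sum.remove[OF E e, of "\<lambda>e. f e * (int (hi e) - int (lo e))"] by simp
      also have "\<dots> \<le> (\<Sum>e'\<in>E - {e}. int k * int M)"
        unfolding sum_negf[symmetric] by (rule sum_mono) (use each in force)
      also have "\<dots> \<le> (\<Sum>e'\<in>E. int k * int M)" by (rule sum_mono2) (use E in auto)
      also have "\<dots> = B" by (simp add: B_def)
      finally show ?thesis .
    next
      case False
      have "0 \<le> B" by (simp add: B_def)
      then show ?thesis using False by linarith
    qed
    then show ?thesis using low[OF e] by simp
  qed
  have "{f \<in> flows E lo hi. fps_nth (\<Prod>e\<in>E. \<phi> e (f e)) k \<noteq> 0} \<subseteq>
     {f. \<forall>e. (e \<in> E \<longrightarrow> f e \<in> {- int k..B}) \<and> (e \<notin> E \<longrightarrow> f e = 0)}"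
    using bnd by (auto simp: flows_def)
  moreover have "finite {f. \<forall>e. (e \<in> E \<longrightarrow> f e \<in> {- int k..B}) \<and> (e \<notin> E \<longrightarrow> f e = 0)}"
    by (rule finite_set_of_finite_funs) (use E in auto)
  ultimately show "finite {f \<in> flows E lo hi. fps_nth (\<Prod>e\<in>E. \<phi> e (f e)) k \<noteq> 0}" by (rule finite_subset)
qed

lemma sum_remove2:
  assumes "finite E" "a \<in> E" "b \<in> E" "a \<noteq> b" shows "sum g E = g a + (g b + sum g (E - {a, b}))"
proof -
  have "E - {a} - {b} = E - {a, b}" by auto
  then show ?thesis using assms sum.remove[of E a g] sum.remove[of "E - {a}" b g] by auto
qed

lemma prod_remove2:
  assumes "finite E" "a \<in> E" "b \<in> E" "a \<noteq> b" shows "prod g E = g a * (g b * prod g (E - {a, b}))"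
proof -
  have "E - {a} - {b} = E - {a, b}" by auto
  then show ?thesis using assms prod.remove[of E a g] prod.remove[of "E - {a}" b g] by auto
qed

definition flow_sum :: "'e set \<Rightarrow> ('e \<Rightarrow> nat) \<Rightarrow> ('e \<Rightarrow> nat) \<Rightarrow> ('e \<Rightarrow> int \<Rightarrow> complex fps) \<Rightarrow> complex fps" where
  "flow_sum E lo hi \<phi> = fsum (\<lambda>f. \<Prod>e\<in>E. \<phi> e (f e)) (flows E lo hi)"

lemma div_cong2:
  fixes f f' :: "'e \<Rightarrow> int"
  assumes E: "finite E" "a \<in> E" "b \<in> E" "a \<noteq> b"
    and rest: "\<And>e. e \<in> E - {a, b} \<Longrightarrow> f' e * (of_bool (lo' e = v) - of_bool (hi' e = v)) = f e * (of_bool (lo e = v) - of_bool (hi e = v))"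
    and two: "f' a * (of_bool (lo' a = v) - of_bool (hi' a = v)) + f' b * (of_bool (lo' b = v) - of_bool (hi' b = v))
       = f a * (of_bool (lo a = v) - of_bool (hi a = v)) + f b * (of_bool (lo b = v) - of_bool (hi b = v))"
  shows "(\<Sum>e\<in>E. f' e * (of_bool (lo' e = v) - of_bool (hi' e = v))) = (\<Sum>e\<in>E. f e * (of_bool (lo e = v) - of_bool (hi e = v)))"
proof -
  have "(\<Sum>e\<in>E - {a, b}. f' e * (of_bool (lo' e = v) - of_bool (hi' e = v))) = (\<Sum>e\<in>E - {a, b}. f e * (of_bool (lo e = v) - of_bool (hi e = v)))"
    by (rule sum.cong) (use rest in auto)
  then show ?thesis using two by (simp add: sum_remove2[OF E])
qed

text \<open>A factor in \<open>f a + f b\<close> and a factor in \<open>f b\<close> describe the graph in which \<open>b\<close> starts at the far end of \<open>a\<close>: there the old total flows through \<open>a\<close>.\<close>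

lemma flow_sum_left:
  fixes E :: "'a set" and lo hi :: "'a \<Rightarrow> nat" and \<phi> :: "'a \<Rightarrow> int \<Rightarrow> complex fps" and \<alpha> \<beta> :: "int \<Rightarrow> complex fps"
  assumes E: "finite E" "a \<in> E" "b \<in> E" "a \<noteq> b" and lo: "lo a = lo b"
  defines "lo' \<equiv> lo(b := hi a)" and "\<phi>' \<equiv> \<phi>(a := \<alpha>, b := \<beta>)"
    and "R \<equiv> \<lambda>f. \<Prod>e\<in>E - {a, b}. \<phi> e (f e)"
  shows "fsum (\<lambda>f. \<alpha> (f a + f b) * \<beta> (f b) * R f) (flows E lo hi) = flow_sum E lo' hi \<phi>'"
    and "lfin (\<lambda>f. \<Prod>e\<in>E. \<phi>' e (f e)) (flows E lo' hi) \<Longrightarrow> lfin (\<lambda>f. \<alpha> (f a + f b) * \<beta> (f b) * R f) (flows E lo hi)"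
proof -
  let ?j = "\<lambda>f. f(a := f a + f b)" and ?i = "\<lambda>f :: 'a \<Rightarrow> int. f(a := f a - f b)"
  have 1: "?i (?j f) = f" "?j (?i f) = f" for f using E by auto
  have 2: "?j f \<in> flows E lo' hi" if "f \<in> flows E lo hi" for f
  proof -
    have "(\<Sum>e\<in>E. (?j f) e * (of_bool (lo' e = v) - of_bool (hi e = v))) = (\<Sum>e\<in>E. f e * (of_bool (lo e = v) - of_bool (hi e = v)))" for v
      by (rule div_cong2[OF E]) (use E lo in \<open>auto simp: lo'_def algebra_simps\<close>)
    then show ?thesis using that E by (auto simp: flows_def)
  qed
  have 3: "?i f \<in> flows E lo hi" if "f \<in> flows E lo' hi" for f
  proof -
    have "(\<Sum>e\<in>E. (?i f) e * (of_bool (lo e = v) - of_bool (hi e = v))) = (\<Sum>e\<in>E. f e * (of_bool (lo' e = v) - of_bool (hi e = v)))" for v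
      by (rule div_cong2[OF E]) (use E lo in \<open>auto simp: lo'_def algebra_simps\<close>)
    then show ?thesis using that E by (auto simp: flows_def)
  qed
  have 4: "(\<Prod>e\<in>E. \<phi>' e (?j f e)) = \<alpha> (f a + f b) * \<beta> (f b) * R f" for f
  proof -
    have "(\<Prod>e\<in>E - {a, b}. \<phi>' e (?j f e)) = R f" unfolding R_def
      by (rule prod.cong) (auto simp: \<phi>'_def)
    then show ?thesis using E by (simp add: prod_remove2[OF E] \<phi>'_def)
  qed
  show "fsum (\<lambda>f. \<alpha> (f a + f b) * \<beta> (f b) * R f) (flows E lo hi) = flow_sum E lo' hi \<phi>'"
    unfolding flow_sum_def by (rule fsum_reindex[of _ ?i ?j]) (use 1 2 3 4 in auto)
  show "lfin (\<lambda>f. \<Prod>e\<in>E. \<phi>' e (f e)) (flows E lo' hi) \<Longrightarrow> lfin (\<lambda>f. \<alpha> (f a + f b) * \<beta> (f b) * R f) (flows E lo hi)"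
    by (erule lfin_reindex[of _ ?i ?j, rotated 3]) (use 1 2 4 in auto)
qed

text \<open>Likewise with the roles exchanged: the total flows through \<open>b\<close>, and \<open>a\<close>, with reversed sign, now joins the two far ends.\<close>

lemma flow_sum_right:
  fixes E :: "'a set" and lo hi :: "'a \<Rightarrow> nat" and \<phi> :: "'a \<Rightarrow> int \<Rightarrow> complex fps" and \<alpha> \<beta> :: "int \<Rightarrow> complex fps"
  assumes E: "finite E" "a \<in> E" "b \<in> E" "a \<noteq> b" and lo: "lo a = lo b"
  defines "lo' \<equiv> lo(a := hi a)" and "hi' \<equiv> hi(a := hi b)" and "\<phi>' \<equiv> \<phi>(b := \<alpha>, a := \<beta>)"
    and "R \<equiv> \<lambda>f. \<Prod>e\<in>E - {a, b}. \<phi> e (f e)"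
  shows "fsum (\<lambda>f. \<alpha> (f a + f b) * \<beta> (- f a) * R f) (flows E lo hi) = flow_sum E lo' hi' \<phi>'"
    and "lfin (\<lambda>f. \<Prod>e\<in>E. \<phi>' e (f e)) (flows E lo' hi') \<Longrightarrow> lfin (\<lambda>f. \<alpha> (f a + f b) * \<beta> (- f a) * R f) (flows E lo hi)"
proof -
  let ?j = "\<lambda>f. f(b := f a + f b, a := - f a)"
  have 1: "?j (?j f) = f" for f :: "'a \<Rightarrow> int" using E by auto
  have 2: "?j f \<in> flows E lo' hi'" if "f \<in> flows E lo hi" for f
  proof -
    have "(\<Sum>e\<in>E. (?j f) e * (of_bool (lo' e = v) - of_bool (hi' e = v))) = (\<Sum>e\<in>E. f e * (of_bool (lo e = v) - of_bool (hi e = v)))" for v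
      by (rule div_cong2[OF E]) (use E lo in \<open>auto simp: lo'_def hi'_def algebra_simps\<close>)
    then show ?thesis using that E by (auto simp: flows_def)
  qed
  have 3: "?j f \<in> flows E lo hi" if "f \<in> flows E lo' hi'" for f
  proof -
    have "(\<Sum>e\<in>E. (?j f) e * (of_bool (lo e = v) - of_bool (hi e = v))) = (\<Sum>e\<in>E. f e * (of_bool (lo' e = v) - of_bool (hi' e = v)))" for v
      by (rule div_cong2[OF E]) (use E lo in \<open>auto simp: lo'_def hi'_def algebra_simps\<close>)
    then show ?thesis using that E by (auto simp: flows_def)
  qed
  have 4: "(\<Prod>e\<in>E. \<phi>' e (?j f e)) = \<alpha> (f a + f b) * \<beta> (- f a) * R f" for f
  proof -
    have "(\<Prod>e\<in>E - {a, b}. \<phi>' e (?j f e)) = R f" unfolding R_def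
      by (rule prod.cong) (auto simp: \<phi>'_def)
    then show ?thesis using E by (simp add: prod_remove2[OF E] \<phi>'_def mult_ac)
  qed
  show "fsum (\<lambda>f. \<alpha> (f a + f b) * \<beta> (- f a) * R f) (flows E lo hi) = flow_sum E lo' hi' \<phi>'"
    unfolding flow_sum_def by (rule fsum_reindex[of _ ?j ?j]) (use 1 2 3 4 in auto)
  show "lfin (\<lambda>f. \<Prod>e\<in>E. \<phi>' e (f e)) (flows E lo' hi') \<Longrightarrow> lfin (\<lambda>f. \<alpha> (f a + f b) * \<beta> (- f a) * R f) (flows E lo hi)"
    by (erule lfin_reindex[of _ ?j ?j, rotated 3]) (use 1 2 4 in auto)
qed

text \<open>Only the sum of the flows on parallel edges is constrained, so summing over its splittings gives a convolution.\<close>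

lemma flow_sum_merge:
  fixes E :: "'a set" and lo hi :: "'a \<Rightarrow> nat" and \<phi> :: "'a \<Rightarrow> int \<Rightarrow> complex fps"
  assumes E: "finite E" "a \<in> E" "b \<in> E" "a \<noteq> b" and lo: "lo a = lo b" and hi: "hi a = hi b"
    and acyc: "\<And>e. e \<in> E \<Longrightarrow> lo e < hi e" and RR: "\<And>e. e \<in> E \<Longrightarrow> \<phi> e \<in> RR (K e)"
  shows "flow_sum E lo hi \<phi> = flow_sum (E - {b}) lo hi (\<phi>(a := conv (\<phi> a) (\<phi> b)))"
proof -
  let ?S = "flows (E - {b}) lo hi \<times> (UNIV :: int set)"
  let ?R = "\<lambda>f. \<Prod>e\<in>E - {a, b}. \<phi> e (f e)"
  let ?h = "\<lambda>f n. (\<phi> a (f a - n) * \<phi> b n) * ?R f"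
  let ?j = "\<lambda>f. (f(a := f a + f b, b := 0), f b)" and ?i = "\<lambda>(f, n). f(a := f a - n, b := n)"
  have b0: "f b = 0" if "f \<in> flows (E - {b}) lo hi" for f using that by (auto simp: flows_def)
  have dv: "(\<Sum>e\<in>E - {b}. (f(a := f a + f b, b := 0)) e * (of_bool (lo e = v) - of_bool (hi e = v)))
     = (\<Sum>e\<in>E. f e * (of_bool (lo e = v) - of_bool (hi e = v)))" for f :: "'a \<Rightarrow> int" and v
  proof -
    let ?f = "f(a := f a + f b, b := 0)"
    have "(\<Sum>e\<in>E. ?f e * (of_bool (lo e = v) - of_bool (hi e = v))) = (\<Sum>e\<in>E. f e * (of_bool (lo e = v) - of_bool (hi e = v)))"
      by (rule div_cong2[OF E]) (use E lo hi in \<open>auto simp: algebra_simps\<close>)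
    moreover have "(\<Sum>e\<in>E. ?f e * (of_bool (lo e = v) - of_bool (hi e = v))) = (\<Sum>e\<in>E - {b}. ?f e * (of_bool (lo e = v) - of_bool (hi e = v)))"
      by (subst sum.remove[OF E(1,3)]) simp
    ultimately show ?thesis by simp
  qed
  have ji: "?j (?i z) = z" if "z \<in> ?S" for z using that E b0 by (auto simp: fun_eq_iff split: prod.splits)
  have ij: "?i (?j f) = f" for f :: "'a \<Rightarrow> int" using E by auto
  have jS: "?j f \<in> ?S" if "f \<in> flows E lo hi" for f
    using that dv[of f] E by (auto simp: flows_def simp del: fun_upd_apply) (auto simp: fun_upd_apply)
  have iS: "?i z \<in> flows E lo hi" if "z \<in> ?S" for z
  proof -
    obtain f n where z: "z = (f, n)" by fastforce
    with that have f: "f \<in> flows (E - {b}) lo hi" by simp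
    let ?g = "f(a := f a - n, b := n)"
    have "?g(a := ?g a + ?g b, b := 0) = f" using E b0[OF f] by auto
    then have "(\<Sum>e\<in>E. ?g e * (of_bool (lo e = v) - of_bool (hi e = v))) = 0" for v
      using dv[of ?g v] f unfolding flows_def by auto
    moreover have "?g e = 0" if "e \<notin> E" for e using that E f by (auto simp: flows_def)
    ultimately show ?thesis by (simp add: z flows_def)
  qed
  have val: "(case ?j f of (f, n) \<Rightarrow> ?h f n) = (\<Prod>e\<in>E. \<phi> e (f e))" for f
  proof -
    have "?R (f(a := f a + f b, b := 0)) = ?R f" by (rule prod.cong) auto
    then show ?thesis using E by (simp add: prod_remove2[OF E] mult_ac)
  qed
  have val': "(\<Prod>e\<in>E. \<phi> e (?i z e)) = (case z of (f, n) \<Rightarrow> ?h f n)" if "z \<in> ?S" for z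
    using val[of "?i z"] unfolding ji[OF that] by simp
  have lf: "lfin (\<lambda>f. \<Prod>e\<in>E. \<phi> e (f e)) (flows E lo hi)"
    by (rule lfin_flows[OF E(1) acyc RR_ordr[OF RR]])
  have lf2: "lfin (\<lambda>(f, n). ?h f n) ?S"
    by (rule lfin_reindex[of _ ?j ?i _ "\<lambda>f. \<Prod>e\<in>E. \<phi> e (f e)", OF ji iS val' lf])
  have "flow_sum E lo hi \<phi> = fsum (\<lambda>(f, n). ?h f n) ?S"
    unfolding flow_sum_def by (rule fsum_reindex[of _ ?i ?j]; (rule ij jS ji iS val; assumption?))
  also have "\<dots> = fsum (\<lambda>f. fsum (?h f) UNIV) (flows (E - {b}) lo hi)"
    by (rule fsum_Sigma[OF lf2])
  also have "\<dots> = flow_sum (E - {b}) lo hi (\<phi>(a := conv (\<phi> a) (\<phi> b)))"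
    unfolding flow_sum_def
  proof (rule fsum_cong)
    fix f
    let ?\<phi> = "\<phi>(a := conv (\<phi> a) (\<phi> b))"
    have "fsum (?h f) UNIV = fsum (\<lambda>n. ?R f * (\<phi> a (f a - n) * \<phi> b n)) UNIV" by (simp add: mult_ac)
    also have "\<dots> = ?R f * conv (\<phi> a) (\<phi> b) (f a)"
      unfolding conv_def by (rule fsum_mult[OF lfin_conv[OF RR RR]]) (use E in auto)
    also have "\<dots> = (\<Prod>e\<in>E - {b}. ?\<phi> e (f e))"
    proof -
      have "(\<Prod>e\<in>E - {b} - {a}. ?\<phi> e (f e)) = ?R f"
        by (rule prod.cong) auto
      then show ?thesis using E by (subst prod.remove[of "E - {b}" a]) (auto simp: mult_ac)
    qed
    finally show "fsum (?h f) UNIV = (\<Prod>e\<in>E - {b}. ?\<phi> e (f e))" .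
  qed
  finally show ?thesis .
qed

text \<open>Induction on the total distance of the lower ends to the top. Consider the lowest vertex. A single edge there carries no flow and can be deleted; two parallel edges merge; otherwise the product of two edges is split and, in each term, one of the edges slides up to the nearer of the two far ends.\<close>

theorem flow_sum_quasimodular:
  assumes "finite E" "\<And>e. e \<in> E \<Longrightarrow> lo e < hi e \<and> hi e \<le> n" "\<And>e. e \<in> E \<Longrightarrow> \<phi> e \<in> RR (K e)"
  shows "flow_sum E lo hi \<phi> \<in> espan (\<Sum>e\<in>E. K e)"
  using assms
proof (induction "\<Sum>e\<in>E. Suc n - lo e" arbitrary: E lo hi \<phi> K rule: less_induct)
  case less
  note fin = less.prems(1) and acyc = less.prems(2) and RR = less.prems(3)
  show ?case
  proof (cases "E = {}")
    case True
    have "flows E lo hi = {\<lambda>_. 0}" using True by (auto simp: flows_def)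
    then show ?thesis using True by (simp add: flow_sum_def fsum_finite espan_one)
  next
    case False
    \<comment> \<open>All edges at the lowest vertex start there.\<close>
    define v where "v = Min (lo ` E)"
    have vmin: "v \<le> lo e" if "e \<in> E" for e using fin that by (simp add: v_def)
    have hi_v: "hi e \<noteq> v" if "e \<in> E" for e using vmin[OF that] acyc[OF that] by linarith
    have "v \<in> lo ` E" using fin False unfolding v_def by (intro Min_in) auto
    then obtain a where a: "a \<in> E" "lo a = v" by blast
    show ?thesis
    proof (cases "\<exists>b\<in>E. b \<noteq> a \<and> lo b = v")
      case no: False
      have fa: "f a = 0" if "f \<in> flows E lo hi" for f
      proof -
        have "0 = (\<Sum>e\<in>E. f e * (of_bool (lo e = v) - of_bool (hi e = v)))" using that by (simp add: flows_def)
        also have "\<dots> = f a * (of_bool (lo a = v) - of_bool (hi a = v)) + (\<Sum>e\<in>E - {a}. f e * (of_bool (lo e = v) - of_bool (hi e = v)))"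
          by (rule sum.remove[OF fin a(1)])
        also have "(\<Sum>e\<in>E - {a}. f e * (of_bool (lo e = v) - of_bool (hi e = v))) = 0"
          by (rule sum.neutral) (use no hi_v in auto)
        finally show ?thesis using a hi_v[OF a(1)] by simp
      qed
      have eq: "flows E lo hi = flows (E - {a}) lo hi"
      proof (intro equalityI subsetI)
        fix f assume f: "f \<in> flows E lo hi"
        then show "f \<in> flows (E - {a}) lo hi" using fa[OF f] fin a(1) by (auto simp: flows_def sum.remove)
      next
        fix f assume f: "f \<in> flows (E - {a}) lo hi"
        then have "f a = 0" by (simp add: flows_def)
        with f show "f \<in> flows E lo hi" using fin a(1) by (auto simp: flows_def sum.remove)
      qed
      have "flow_sum E lo hi \<phi> = fsum (\<lambda>f. \<phi> a 0 * (\<Prod>e\<in>E - {a}. \<phi> e (f e))) (flows (E - {a}) lo hi)"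
        unfolding flow_sum_def eq
      proof (rule fsum_cong)
        fix f assume "f \<in> flows (E - {a}) lo hi"
        then have "f a = 0" using fa eq by simp
        then show "(\<Prod>e\<in>E. \<phi> e (f e)) = \<phi> a 0 * (\<Prod>e\<in>E - {a}. \<phi> e (f e))"
          by (simp add: prod.remove[OF fin a(1)])
      qed
      also have "\<dots> = \<phi> a 0 * flow_sum (E - {a}) lo hi \<phi>"
        unfolding flow_sum_def by (rule fsum_mult[OF lfin_flows]) (use fin acyc RR RR_ordr in auto)
      also have "\<dots> \<in> espan (K a + (\<Sum>e\<in>E - {a}. K e))"
      proof (intro espan_mult RR_at_0[OF RR[OF a(1)]] less.hyps)
        show "(\<Sum>e\<in>E - {a}. Suc n - lo e) < (\<Sum>e\<in>E. Suc n - lo e)"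
          using acyc[OF a(1)] by (simp add: sum.remove[OF fin a(1)]) linarith
      qed (use fin acyc RR in auto)
      also have "K a + (\<Sum>e\<in>E - {a}. K e) = (\<Sum>e\<in>E. K e)" by (rule sum.remove[OF fin a(1), symmetric])
      finally show ?thesis .
    next
      case True
      then obtain a b where ab: "a \<in> E" "b \<in> E" "a \<noteq> b" "lo a = v" "lo b = v" "hi a \<le> hi b"
        using a by (metis nle_le)
      then have lo: "lo a = lo b" by simp
      note Eab = fin ab(1,2,3)
      let ?m = "\<Sum>e\<in>E. Suc n - lo e"
      let ?L = "\<Sum>e\<in>E - {a, b}. K e"
      have KL: "(\<Sum>e\<in>E. K e) = K a + K b + ?L" by (simp add: sum_remove2[OF Eab])
      show ?thesis
      proof (cases "hi a = hi b")
        case True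
        let ?\<phi> = "\<phi>(a := conv (\<phi> a) (\<phi> b))" and ?K = "K(a := K a + K b)"
        have "flow_sum E lo hi \<phi> = flow_sum (E - {b}) lo hi ?\<phi>"
          by (rule flow_sum_merge[OF Eab lo True]) (use acyc RR in auto)
        also have "\<dots> \<in> espan (\<Sum>e\<in>E - {b}. ?K e)"
        proof (rule less.hyps)
          show "(\<Sum>e\<in>E - {b}. Suc n - lo e) < ?m"
            using acyc[OF ab(2)] by (simp add: sum.remove[OF fin ab(2)]) linarith
          show "?\<phi> e \<in> RR (?K e)" if "e \<in> E - {b}" for e
            using that RR ab by (auto intro: conv_RR)
        qed (use fin acyc in auto)
        also have "(\<Sum>e\<in>E - {b}. ?K e) = (\<Sum>e\<in>E. K e)"
        proof -
          have "(\<Sum>e\<in>E - {b} - {a}. ?K e) = ?L" by (rule sum.cong) auto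
          then show ?thesis unfolding KL using fin ab by (subst sum.remove[of "E - {b}" a]) auto
        qed
        finally show ?thesis .
      next
        case hne: False
        let ?R = "\<lambda>f. \<Prod>e\<in>E - {a, b}. \<phi> e (f e)"
        have claim: "lfin (\<lambda>f. \<Phi> (f a) (f b) * ?R f) (flows E lo hi) \<and>
            fsum (\<lambda>f. \<Phi> (f a) (f b) * ?R f) (flows E lo hi) \<in> espan (L + ?L)" if "\<Phi> \<in> FF L" for \<Phi> L
          using that
        proof (induction \<Phi> rule: FF.induct)
          case zero
          have "fsum (\<lambda>f. 0) (flows E lo hi) = 0" by (rule fps_ext) (simp add: fsum_def)
          then show ?case by (auto intro!: lfin_finite simp: espan.zero)
        next
          case (left \<Phi> \<alpha> x \<beta> y)
          let ?lo = "lo(b := hi a)" and ?\<phi> = "\<phi>(a := \<alpha>, b := \<beta>)" and ?K = "K(a := x, b := y)"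
          have ac: "?lo e < hi e \<and> hi e \<le> n" if "e \<in> E" for e using acyc[OF that] hne ab by auto
          have rr: "?\<phi> e \<in> RR (?K e)" if "e \<in> E" for e using RR[OF that] left by auto
          have lf: "lfin (\<lambda>f. \<alpha> (f a + f b) * \<beta> (f b) * ?R f) (flows E lo hi)"
            by (rule flow_sum_left(2)[OF Eab lo], rule lfin_flows[OF fin]) (use ac rr RR_ordr in blast)+
          have "fsum (\<lambda>f. \<alpha> (f a + f b) * \<beta> (f b) * ?R f) (flows E lo hi) = flow_sum E ?lo hi ?\<phi>"
            by (rule flow_sum_left(1)[OF Eab lo])
          also have "\<dots> \<in> espan (\<Sum>e\<in>E. ?K e)"
          proof (rule less.hyps[OF _ fin ac rr])
            have "Suc n - ?lo b < Suc n - lo b" using acyc[OF ab(1)] ab by simp linarith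
            moreover have "(\<Sum>e\<in>E - {b}. Suc n - ?lo e) = (\<Sum>e\<in>E - {b}. Suc n - lo e)" by (rule sum.cong) auto
            ultimately show "(\<Sum>e\<in>E. Suc n - ?lo e) < ?m" by (simp only: sum.remove[OF fin ab(2)])
          qed
          finally have e: "fsum (\<lambda>f. \<alpha> (f a + f b) * \<beta> (f b) * ?R f) (flows E lo hi) \<in> espan (\<Sum>e\<in>E. ?K e)" .
          have "(\<Sum>e\<in>E - {a, b}. ?K e) = ?L" by (rule sum.cong) auto
          then have "(\<Sum>e\<in>E. ?K e) \<le> L + ?L" using left(4) ab by (simp add: sum_remove2[OF Eab])
          with e have e: "fsum (\<lambda>f. \<alpha> (f a + f b) * \<beta> (f b) * ?R f) (flows E lo hi) \<in> espan (L + ?L)" by (rule espan_mono)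
          show ?case unfolding distrib_right
            using left.IH lf e by (auto simp: fsum_add intro!: lfin_add espan_add)
        next
          case (right \<Phi> \<alpha> x \<beta> y)
          let ?lo = "lo(a := hi a)" and ?hi = "hi(a := hi b)" and ?\<phi> = "\<phi>(b := \<alpha>, a := \<beta>)" and ?K = "K(b := x, a := y)"
          have ac: "?lo e < ?hi e \<and> ?hi e \<le> n" if "e \<in> E" for e using acyc[OF that] acyc[OF ab(2)] hne ab by auto
          have rr: "?\<phi> e \<in> RR (?K e)" if "e \<in> E" for e using RR[OF that] right by auto
          have lf: "lfin (\<lambda>f. \<alpha> (f a + f b) * \<beta> (- f a) * ?R f) (flows E lo hi)"
            by (rule flow_sum_right(2)[OF Eab lo], rule lfin_flows[OF fin]) (use ac rr RR_ordr in blast)+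
          have "fsum (\<lambda>f. \<alpha> (f a + f b) * \<beta> (- f a) * ?R f) (flows E lo hi) = flow_sum E ?lo ?hi ?\<phi>"
            by (rule flow_sum_right(1)[OF Eab lo])
          also have "\<dots> \<in> espan (\<Sum>e\<in>E. ?K e)"
          proof (rule less.hyps[OF _ fin ac rr])
            have "Suc n - ?lo a < Suc n - lo a" using acyc[OF ab(1)] ab by simp linarith
            moreover have "(\<Sum>e\<in>E - {a}. Suc n - ?lo e) = (\<Sum>e\<in>E - {a}. Suc n - lo e)" by (rule sum.cong) auto
            ultimately show "(\<Sum>e\<in>E. Suc n - ?lo e) < ?m" by (simp only: sum.remove[OF fin ab(1)])
          qed
          finally have e: "fsum (\<lambda>f. \<alpha> (f a + f b) * \<beta> (- f a) * ?R f) (flows E lo hi) \<in> espan (\<Sum>e\<in>E. ?K e)" .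
          have "(\<Sum>e\<in>E - {a, b}. ?K e) = ?L" by (rule sum.cong) auto
          then have "(\<Sum>e\<in>E. ?K e) \<le> L + ?L" using right(4) ab by (simp add: sum_remove2[OF Eab])
          with e have e: "fsum (\<lambda>f. \<alpha> (f a + f b) * \<beta> (- f a) * ?R f) (flows E lo hi) \<in> espan (L + ?L)" by (rule espan_mono)
          show ?case unfolding distrib_right
            using right.IH lf e by (auto simp: fsum_add intro!: lfin_add espan_add)
        qed
        have "flow_sum E lo hi \<phi> = fsum (\<lambda>f. (\<phi> a (f a) * \<phi> b (f b)) * ?R f) (flows E lo hi)"
          unfolding flow_sum_def by (rule fsum_cong) (simp add: prod_remove2[OF Eab] mult.assoc)
        also have "\<dots> \<in> espan (K a + K b + ?L)"
          using claim[OF FF_product[OF RR[OF ab(1)] RR[OF ab(2)]]] by blast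
        finally show ?thesis unfolding KL .
      qed
    qed
  qed
qed

section \<open>Charts and lifts for three-point covers\<close>

lemma sphere_param_inj: "sphere_param y s = sphere_param y t \<longleftrightarrow> s = t"
  by (cases y) auto

lemma sphere_param_0 [simp]: "sphere_param y 0 = y"
  by (cases y) auto

text \<open>It is more convenient to work with the inverse of a coordinate, that is with a parametrisation by a disc that is injective, continuous and open.\<close>

lemma ram_chart:
  assumes "has_ram_order S p x k"
  obtains r \<psi> where "r > 0" "continuous_map (top_of_set (ball 0 r)) S \<psi>" "\<psi> 0 = x" "inj_on \<psi> (ball 0 r)"
    "\<And>W. open W \<Longrightarrow> W \<subseteq> ball 0 r \<Longrightarrow> openin S (\<psi> ` W)"
    "\<And>v. v \<in> ball 0 r \<Longrightarrow> p (\<psi> v) = sphere_param (p x) (v ^ k)"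
proof -
  obtain U r \<phi> where U: "openin S U" "x \<in> U" "r > 0"
    and h: "homeomorphic_map (subtopology S U) (top_of_set (ball (0::complex) r)) \<phi>" and x: "\<phi> x = 0"
    and p: "\<forall>u\<in>U. p u = sphere_param (p x) (\<phi> u ^ k)"
    using assms unfolding has_ram_order_def by blast
  have tU: "topspace (subtopology S U) = U" using U openin_subset by fastforce
  obtain \<psi> where m: "homeomorphic_maps (subtopology S U) (top_of_set (ball (0::complex) r)) \<phi> \<psi>"
    using h by (auto simp: homeomorphic_map_maps)
  then have \<phi>: "continuous_map (subtopology S U) (top_of_set (ball 0 r)) \<phi>"
    and \<psi>: "continuous_map (top_of_set (ball 0 r)) (subtopology S U) \<psi>"
    and inv: "\<And>u. u \<in> U \<Longrightarrow> \<psi> (\<phi> u) = u" "\<And>v. v \<in> ball 0 r \<Longrightarrow> \<phi> (\<psi> v) = v"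
    using tU by (auto simp: homeomorphic_maps_def)
  have \<psi>U: "\<psi> v \<in> U" if "v \<in> ball 0 r" for v
    using \<psi> that tU by (auto simp: continuous_map_def)
  have \<phi>b: "\<phi> u \<in> ball 0 r" if "u \<in> U" for u
    using \<phi> that tU by (auto simp: continuous_map_def)
  show thesis
  proof (rule that[OF U(3), of \<psi>])
    show "continuous_map (top_of_set (ball 0 r)) S \<psi>" using \<psi> by (simp add: continuous_map_in_subtopology)
    show "\<psi> 0 = x" using inv(1)[OF U(2)] x by simp
    show "inj_on \<psi> (ball 0 r)" using inv(2) by (metis inj_onI)
    show "openin S (\<psi> ` W)" if W: "open W" "W \<subseteq> ball 0 r" for W
    proof -
      have "openin (top_of_set (ball 0 r)) W" using W by (metis open_openin openin_open_eq open_ball inf.absorb_iff2)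
      then have "openin (subtopology S U) {u \<in> U. \<phi> u \<in> W}"
        using \<phi> tU by (metis (no_types, lifting) continuous_map_def Collect_cong)
      moreover have "{u \<in> U. \<phi> u \<in> W} = \<psi> ` W" using W inv \<psi>U by (force simp: image_iff)
      ultimately show ?thesis using U(1) by (simp add: openin_open_subtopology)
    qed
    show "p (\<psi> v) = sphere_param (p x) (v ^ k)" if "v \<in> ball 0 r" for v
      using p \<psi>U[OF that] inv(2)[OF that] by simp
  qed
qed

lemma ram_chart_imp:
  assumes "k \<ge> 1" "r > 0" "continuous_map (top_of_set (ball 0 r)) S \<psi>" "\<psi> 0 = x" "inj_on \<psi> (ball 0 r)"
    and op: "\<And>W. open W \<Longrightarrow> W \<subseteq> ball 0 r \<Longrightarrow> openin S (\<psi> ` W)"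
    and p: "\<And>v. v \<in> ball 0 r \<Longrightarrow> p (\<psi> v) = sphere_param (p x) (v ^ k)"
  shows "has_ram_order S p x k"
proof -
  let ?B = "ball (0::complex) r" and ?U = "\<psi> ` ball 0 r"
  have U: "openin S ?U" by (rule op) auto
  have tU: "topspace (subtopology S ?U) = ?U" using openin_subset[OF U] by auto
  have "continuous_map (top_of_set ?B) (subtopology S ?U) \<psi>"
    using assms(3) by (simp add: continuous_map_in_subtopology)
  moreover have "open_map (top_of_set ?B) (subtopology S ?U) \<psi>"
    unfolding open_map_def
  proof (intro allI impI)
    fix W assume "openin (top_of_set ?B) W"
    then have "open W" "W \<subseteq> ?B" by (auto simp: openin_open_eq)
    then have "openin S (\<psi> ` W)" "\<psi> ` W \<subseteq> ?U" using op by auto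
    then show "openin (subtopology S ?U) (\<psi> ` W)" using U by (simp add: openin_open_subtopology)
  qed
  ultimately have "homeomorphic_map (top_of_set ?B) (subtopology S ?U) \<psi>"
    by (intro bijective_open_imp_homeomorphic_map) (use tU assms(5) in auto)
  then obtain \<phi> where m: "homeomorphic_maps (top_of_set ?B) (subtopology S ?U) \<psi> \<phi>"
    by (auto simp: homeomorphic_map_maps)
  then have h: "homeomorphic_map (subtopology S ?U) (top_of_set ?B) \<phi>"
    using homeomorphic_maps_map by blast
  have inv: "\<phi> (\<psi> v) = v" if "v \<in> ?B" for v using m that by (auto simp: homeomorphic_maps_def)
  show ?thesis unfolding has_ram_order_def
  proof (intro conjI exI)
    show "openin S ?U" by (rule U)
    show "homeomorphic_map (subtopology S ?U) (top_of_set ?B) \<phi>" by (rule h)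
    show "x \<in> ?U" using assms(2,4) by (auto intro!: image_eqI[of _ _ 0])
    show "\<phi> x = 0" using inv[of 0] assms by simp
    show "\<forall>u\<in>?U. p u = sphere_param (p x) (\<phi> u ^ k)" using p inv by auto
  qed (use assms in auto)
qed

text \<open>The \<open>k\<close> solutions of \<open>v^k = t\<close>, for small \<open>t\<close>, are distinct points of the surface in the first parametrisation; in the second one they are among the \<open>k'\<close> solutions of \<open>w^k' = t\<close>.\<close>

lemma has_ram_order_le:
  assumes "has_ram_order S p x k" "has_ram_order S p x k'" shows "k \<le> k'"
proof -
  have k: "k \<ge> 1" "k' \<ge> 1" using assms by (auto simp: has_ram_order_def)
  obtain r \<psi> where r: "r > 0" "continuous_map (top_of_set (ball 0 r)) S \<psi>" "\<psi> 0 = x" "inj_on \<psi> (ball 0 r)"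
    "\<And>v. v \<in> ball 0 r \<Longrightarrow> p (\<psi> v) = sphere_param (p x) (v ^ k)"
    by (rule ram_chart[OF assms(1)]) blast
  obtain r' \<psi>' where r': "r' > 0" "\<psi>' 0 = x"
    "\<And>W. open W \<Longrightarrow> W \<subseteq> ball 0 r' \<Longrightarrow> openin S (\<psi>' ` W)"
    "\<And>v. v \<in> ball 0 r' \<Longrightarrow> p (\<psi>' v) = sphere_param (p x) (v ^ k')"
    by (rule ram_chart[OF assms(2)]) blast
  have "openin (top_of_set (ball 0 r)) {v \<in> ball 0 r. \<psi> v \<in> \<psi>' ` ball 0 r'}"
    using openin_continuous_map_preimage[OF r(2) r'(3)[OF open_ball order_refl]] by simp
  then have "open {v \<in> ball 0 r. \<psi> v \<in> \<psi>' ` ball 0 r'}" using openin_open_eq[OF open_ball] by blast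
  moreover have "0 \<in> {v \<in> ball 0 r. \<psi> v \<in> \<psi>' ` ball 0 r'}" using r(1,3) r'(1,2) by (auto intro!: image_eqI[of _ _ 0])
  ultimately obtain e where e: "e > 0" "ball 0 e \<subseteq> {v \<in> ball 0 r. \<psi> v \<in> \<psi>' ` ball 0 r'}"
    using openE by blast
  define t :: complex where "t = of_real ((e / 2) ^ k)"
  have t: "t \<noteq> 0" using e by (simp add: t_def)
  have root: "v \<in> ball 0 e" if "v ^ k = t" for v
  proof -
    have "norm (v ^ k) = (e / 2) ^ k" unfolding that t_def norm_of_real using e by simp
    then have "norm v ^ k = (e / 2) ^ k" by (simp only: norm_power)
    then have "norm v = e / 2" using e k power_eq_iff_eq_base[of k "norm v" "e / 2"] by simp
    then show ?thesis using e by simp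
  qed
  have "\<exists>w. w ^ k' = t \<and> \<psi>' w = \<psi> v" if "v ^ k = t" for v
  proof -
    have v: "v \<in> ball 0 r" "\<psi> v \<in> \<psi>' ` ball 0 r'" using root[OF that] e(2) by auto
    then obtain w where w: "w \<in> ball 0 r'" "\<psi> v = \<psi>' w" by auto
    then have "sphere_param (p x) (v ^ k) = sphere_param (p x) (w ^ k')" using r(5)[OF v(1)] r'(4)[OF w(1)] by simp
    then have "w ^ k' = t" using that by (simp add: sphere_param_inj)
    then show ?thesis using w(2) by (intro exI[of _ w]) simp
  qed
  note ex = this
  define f where "f v = (SOME w. w ^ k' = t \<and> \<psi>' w = \<psi> v)" for v
  have f: "f v ^ k' = t \<and> \<psi>' (f v) = \<psi> v" if "v ^ k = t" for v
    unfolding f_def by (rule someI_ex[OF ex[OF that]])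
  have "inj_on f {v. v ^ k = t}"
  proof (rule inj_onI)
    fix v w assume *: "v \<in> {v. v ^ k = t}" "w \<in> {v. v ^ k = t}" "f v = f w"
    then have "\<psi> v = \<psi> w" using f[of v] f[of w] by simp
    moreover have "v \<in> ball 0 r" "w \<in> ball 0 r" using root[of v] root[of w] e(2) * by blast+
    ultimately show "v = w" by (rule inj_onD[OF r(4)])
  qed
  moreover have "f ` {v. v ^ k = t} \<subseteq> {v. v ^ k' = t}" using f by blast
  moreover have "finite {v. v ^ k' = t}" using k card_nth_roots[OF t, of k'] by (intro card_ge_0_finite) auto
  ultimately have "card {v. v ^ k = t} \<le> card {v. v ^ k' = t}" by (metis card_inj_on_le)
  then show ?thesis using k card_nth_roots[OF t, of k] card_nth_roots[OF t, of k'] by simp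
qed

lemma ram_order_eq: "has_ram_order S p x k \<Longrightarrow> ram_order S p x = k"
  unfolding ram_order_def by (rule the_equality) (auto intro!: antisym elim: has_ram_order_le)

definition locinj :: "'s topology \<Rightarrow> ('s \<Rightarrow> 'c) \<Rightarrow> 's \<Rightarrow> bool" where
  "locinj S p x \<longleftrightarrow> (\<exists>U. openin S U \<and> x \<in> U \<and> inj_on p U)"

lemma locinj_ram1: "has_ram_order S p x 1 \<Longrightarrow> locinj S p x"
proof -
  assume "has_ram_order S p x 1"
  then obtain r \<psi> where r: "r > 0" "\<psi> 0 = x"
    "\<And>W. open W \<Longrightarrow> W \<subseteq> ball 0 r \<Longrightarrow> openin S (\<psi> ` W)"
    "\<And>v. v \<in> ball 0 r \<Longrightarrow> p (\<psi> v) = sphere_param (p x) (v ^ 1)" by (rule ram_chart) blast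
  have "inj_on p (\<psi> ` ball 0 r)" using r(4) by (auto simp: inj_on_def sphere_param_inj)
  then show ?thesis unfolding locinj_def using r by (intro exI[of _ "\<psi> ` ball 0 r"]) (auto intro!: image_eqI[of _ _ 0])
qed

text \<open>Where the projection is locally injective, two lifts agree on an open set, and on a closed set because the target is Hausdorff.\<close>

lemma unique_lift:
  assumes S: "Hausdorff_space S" and X: "connected_space X"
    and s: "continuous_map X S s" and s': "continuous_map X S s'"
    and eq: "\<And>t. t \<in> topspace X \<Longrightarrow> p (s t) = p (s' t)"
    and inj: "\<And>t. t \<in> topspace X \<Longrightarrow> locinj S p (s t)"
    and t0: "t0 \<in> topspace X" "s t0 = s' t0" and t: "t \<in> topspace X"
  shows "s t = s' t"
proof -
  let ?A = "{t \<in> topspace X. s t = s' t}"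
  have cl: "closedin X ?A" by (rule closedin_continuous_maps_eq[OF S s s'])
  have op: "openin X ?A"
  proof (subst openin_subopen, intro ballI)
    fix t assume t: "t \<in> ?A"
    then obtain U where U: "openin S U" "s t \<in> U" "inj_on p U" using inj unfolding locinj_def by blast
    let ?W = "{t \<in> topspace X. s t \<in> U} \<inter> {t \<in> topspace X. s' t \<in> U}"
    have "openin X ?W" using s s' U(1) by (intro openin_Int openin_continuous_map_preimage)
    moreover have "t \<in> ?W" using t U by auto
    moreover have "?W \<subseteq> ?A" using U(3) eq by (auto dest: inj_onD)
    ultimately show "\<exists>T. openin X T \<and> t \<in> T \<and> T \<subseteq> ?A" by blast
  qed
  have "?A = topspace X" using X cl op t0 unfolding connected_space_clopen_in by blast
  then show ?thesis using t by blast
qed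

lemma connected_space_set: "connected T \<Longrightarrow> connected_space (top_of_set T)"
  by (metis connectedin_iff_connected connectedin_def)

lemma unique_lift_set:
  fixes T :: "'a :: topological_space set"
  assumes "Hausdorff_space S" "connected T"
    "continuous_map (top_of_set T) S s" "continuous_map (top_of_set T) S s'"
    "\<And>t. t \<in> T \<Longrightarrow> p (s t) = p (s' t)" "\<And>t. t \<in> T \<Longrightarrow> locinj S p (s t)"
    "t0 \<in> T" "s t0 = s' t0" "t \<in> T"
  shows "s t = s' t"
  by (rule unique_lift[where p = p, OF assms(1) connected_space_set[OF assms(2)] assms(3,4)]) (use assms in auto)

lemma continuous_map_on_subset:
  "continuous_map (top_of_set T) S s \<Longrightarrow> T' \<subseteq> T \<Longrightarrow> continuous_map (top_of_set T') S s"
  by (metis continuous_map_from_subtopology inf.absorb_iff2 subtopology_subtopology)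

lemma continuous_map_compose_on:
  assumes "continuous_map (top_of_set T) S s" "continuous_on T' f" "f ` T' \<subseteq> T"
  shows "continuous_map (top_of_set T') S (\<lambda>x. s (f x))"
proof -
  have "continuous_map (top_of_set T') (top_of_set T) f" using assms(2,3) by (auto simp: continuous_map_iff_continuous2)
  from continuous_map_compose[OF this assms(1)] show ?thesis by (simp add: o_def)
qed

locale tpc =
  fixes S :: "'s topology" and p :: "'s \<Rightarrow> complex option" and d :: nat
  assumes tpc: "three_point_cover S p d"
begin

lemma bc: "compact_space S" "Hausdorff_space S" "continuous_map S riemann_sphere p"
    "\<And>x. x \<in> topspace S \<Longrightarrow> \<exists>k. has_ram_order S p x k"
  using tpc unfolding three_point_cover_def branched_cover_def by auto

lemma ramified: "x \<in> topspace S \<Longrightarrow> has_ram_order S p x (ram_order S p x)"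
  using bc(4) ram_order_eq by metis

lemma generic:
  assumes "y \<noteq> 0" "y \<noteq> 1"
  shows "finite (fibre S p (Some y))" "card (fibre S p (Some y)) = d"
    "\<And>x. x \<in> fibre S p (Some y) \<Longrightarrow> has_ram_order S p x 1"
proof -
  have "Some y \<notin> {Some 0, Some 1, None}" using assms by auto
  then have *: "\<forall>x\<in>fibre S p (Some y). ram_order S p x = 1" "finite (fibre S p (Some y))" "card (fibre S p (Some y)) = d"
    using tpc unfolding three_point_cover_def by blast+
  then show "finite (fibre S p (Some y))" "card (fibre S p (Some y)) = d" by blast+
  fix x assume x: "x \<in> fibre S p (Some y)"
  then have "has_ram_order S p x (ram_order S p x)" by (intro ramified) (simp add: fibre_def)
  then show "has_ram_order S p x 1" using * x by simp
qed

lemma generic_locinj: "x \<in> topspace S \<Longrightarrow> p x = Some y \<Longrightarrow> y \<noteq> 0 \<Longrightarrow> y \<noteq> 1 \<Longrightarrow> locinj S p x"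
  using generic(3)[of y x] locinj_ram1 by (auto simp: fibre_def)

text \<open>Near a generic value the charts give \<open>d\<close> local sections with disjoint images; as each fibre has exactly \<open>d\<close> points there are no others.\<close>

lemma local_sections:
  assumes y: "y \<noteq> 0" "y \<noteq> 1"
  obtains \<rho> where "\<rho> > 0" "0 \<notin> ball y \<rho>" "1 \<notin> ball y \<rho>"
    "\<And>x z. x \<in> topspace S \<Longrightarrow> p x = Some z \<Longrightarrow> z \<in> ball y \<rho> \<Longrightarrow>
      \<exists>s. continuous_map (top_of_set (ball y \<rho>)) S s \<and> (\<forall>w\<in>ball y \<rho>. p (s w) = Some w) \<and> s z = x"
proof -
  let ?F = "fibre S p (Some y)"
  have "\<exists>r \<psi>. r > 0 \<and> continuous_map (top_of_set (ball 0 r)) S \<psi> \<and> \<psi> 0 = x \<and> (\<forall>v\<in>ball 0 r. p (\<psi> v) = Some (y + v))"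
    if xF: "x \<in> ?F" for x
  proof -
    have px: "p x = Some y" using xF by (simp add: fibre_def)
    obtain r \<psi> where "r > 0" "continuous_map (top_of_set (ball 0 r)) S \<psi>" "\<psi> 0 = x"
      "\<And>v. v \<in> ball 0 r \<Longrightarrow> p (\<psi> v) = sphere_param (p x) (v ^ 1)"
      by (rule ram_chart[OF generic(3)[OF y xF]]) blast
    then show ?thesis using px by (intro exI[of _ r] exI[of _ \<psi>]) simp
  qed
  then obtain r \<psi> where r: "\<And>x. x \<in> ?F \<Longrightarrow> r x > (0::real)"
    "\<And>x. x \<in> ?F \<Longrightarrow> continuous_map (top_of_set (ball 0 (r x))) S (\<psi> x)" "\<And>x. x \<in> ?F \<Longrightarrow> \<psi> x 0 = x"
    "\<And>x v. x \<in> ?F \<Longrightarrow> v \<in> ball 0 (r x) \<Longrightarrow> p (\<psi> x v) = Some (y + v)" by metis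
  define \<rho> where "\<rho> = Min (insert (norm y) (insert (norm (y - 1)) (r ` ?F)))"
  have fin: "finite (insert (norm y) (insert (norm (y - 1)) (r ` ?F)))" using generic(1)[OF y] by simp
  have \<rho>: "\<rho> > 0" "\<rho> \<le> norm y" "\<rho> \<le> norm (y - 1)" "\<And>x. x \<in> ?F \<Longrightarrow> \<rho> \<le> r x"
    unfolding \<rho>_def using fin r(1) y by (subst Min_gr_iff) (auto intro!: Min_le finite_imageI generic(1)[OF y] simp del: Min_insert)
  have nin: "0 \<notin> ball y \<rho>" "1 \<notin> ball y \<rho>" using \<rho> by (auto simp: dist_norm)
  define s where "s x w = \<psi> x (w - y)" for x w
  have s1: "continuous_map (top_of_set (ball y \<rho>)) S (s x)" if "x \<in> ?F" for x
    unfolding s_def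
    by (rule continuous_map_compose_on[OF r(2)[OF that]])
       (use \<rho>(4)[OF that] in \<open>auto intro!: continuous_intros simp: dist_norm norm_minus_commute\<close>)
  have s2: "p (s x w) = Some w" if "x \<in> ?F" "w \<in> ball y \<rho>" for x w
    unfolding s_def using r(4)[OF that(1), of "w - y"] that(2) \<rho>(4)[OF that(1)]
    by (auto simp: dist_norm norm_minus_commute)
  have s3: "s x y = x" if "x \<in> ?F" for x using r(3)[OF that] by (simp add: s_def)
  have sS: "s x w \<in> topspace S" if "x \<in> ?F" "w \<in> ball y \<rho>" for x w
    using s1[OF that(1)] that(2) by (auto simp: continuous_map_def)
  show thesis
  proof (rule that[OF \<rho>(1) nin])
    fix x z assume x: "x \<in> topspace S" "p x = Some z" "z \<in> ball y \<rho>"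
    have z: "z \<noteq> 0" "z \<noteq> 1" using x(3) nin by auto
    have "inj_on (\<lambda>x. s x z) ?F"
    proof (rule inj_onI)
      fix a b assume ab: "a \<in> ?F" "b \<in> ?F" "s a z = s b z"
      have "s a y = s b y"
      proof (rule unique_lift_set[OF bc(2) connected_ball s1[OF ab(1)] s1[OF ab(2)] _ _ x(3) ab(3)])
        fix t assume t: "t \<in> ball y \<rho>"
        show "p (s a t) = p (s b t)" using s2 ab t by simp
        show "locinj S p (s a t)" using t nin by (intro generic_locinj[OF sS[OF ab(1) t] s2[OF ab(1) t]]) auto
      qed (use \<rho> in simp)
      then show "a = b" using s3 ab by simp
    qed
    then have "card ((\<lambda>x. s x z) ` ?F) = d" using generic(2)[OF y] by (simp add: card_image)
    moreover have "(\<lambda>x. s x z) ` ?F \<subseteq> fibre S p (Some z)" using sS s2 x(3) by (auto simp: fibre_def)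
    ultimately have "(\<lambda>x. s x z) ` ?F = fibre S p (Some z)"
      using generic(1,2)[OF z] by (metis card_subset_eq)
    moreover have "x \<in> fibre S p (Some z)" using x by (simp add: fibre_def)
    ultimately have "x \<in> (\<lambda>x. s x z) ` ?F" by simp
    then obtain a where "a \<in> ?F" "s a z = x" by blast
    then show "\<exists>s. continuous_map (top_of_set (ball y \<rho>)) S s \<and> (\<forall>w\<in>ball y \<rho>. p (s w) = Some w) \<and> s z = x"
      using s1 s2 by blast
  qed
qed

lemma Hausdorff_sphere: "Hausdorff_space riemann_sphere"
  unfolding riemann_sphere_def by (simp add: Hausdorff_space_Alexandroff_compactification locally_compact_space_euclidean)

lemma closed_map_p: "closed_map S riemann_sphere p"
  by (rule T1_Spaces.continuous_imp_closed_map[OF bc(3,1) Hausdorff_sphere])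

text \<open>The projection is a closed map, so neighbourhoods of a fibre contain the preimages of neighbourhoods of the value.\<close>

lemma fibre_nbhd:
  assumes "openin S N" "fibre S p y \<subseteq> N"
  obtains W where "openin riemann_sphere W" "y \<in> W" "\<And>x. x \<in> topspace S \<Longrightarrow> p x \<in> W \<Longrightarrow> x \<in> N"
proof -
  have "closedin S (topspace S - N)" using assms(1) by blast
  then have cl: "closedin riemann_sphere (p ` (topspace S - N))" using closed_map_p by (auto simp: closed_map_def)
  show thesis
  proof (rule that)
    show "openin riemann_sphere (topspace riemann_sphere - p ` (topspace S - N))" using cl by blast
    show "y \<in> topspace riemann_sphere - p ` (topspace S - N)"
      using assms(2) by (cases y) (auto simp: riemann_sphere_def fibre_def)
  qed auto
qed

end

section \<open>Radial lifting\<close>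

definition radial :: "complex set \<Rightarrow> bool" where
  "radial V \<longleftrightarrow> (\<forall>v\<in>V. \<forall>t. 0 \<le> t \<longrightarrow> t \<le> 1 \<longrightarrow> of_real t * v \<in> V)"

lemma radialD: "radial V \<Longrightarrow> v \<in> V \<Longrightarrow> 0 \<le> t \<Longrightarrow> t \<le> 1 \<Longrightarrow> of_real t * v \<in> V"
  by (simp add: radial_def)

text \<open>A region star-shaped about \<open>0\<close> on which \<open>y + v^m\<close> avoids the branch values except in the centre.\<close>

definition good_region :: "complex \<Rightarrow> nat \<Rightarrow> complex set \<Rightarrow> bool" where
  "good_region y m \<Omega> \<longleftrightarrow> open \<Omega> \<and> 0 \<in> \<Omega> \<and> radial \<Omega> \<and> (\<forall>v\<in>\<Omega>. v \<noteq> 0 \<longrightarrow> y + v ^ m \<noteq> 0 \<and> y + v ^ m \<noteq> 1)"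

context tpc begin

definition lift_of :: "'s \<Rightarrow> complex \<Rightarrow> nat \<Rightarrow> complex set \<Rightarrow> (complex \<Rightarrow> 's) \<Rightarrow> bool" where
  "lift_of x y m \<Omega> g \<longleftrightarrow> continuous_map (top_of_set \<Omega>) S g \<and> g 0 = x \<and> (\<forall>v\<in>\<Omega>. p (g v) = Some (y + v ^ m)) \<and>
     (\<exists>e>0. ball 0 e \<subseteq> \<Omega> \<and> inj_on g (ball 0 e) \<and> (\<forall>W. open W \<longrightarrow> W \<subseteq> ball 0 e \<longrightarrow> openin S (g ` W)))"

lemma radial_lift_unique:
  assumes V: "radial V" "v \<in> V" "v \<noteq> 0" and V': "radial V'" "v' \<in> V'"
    and g: "continuous_map (top_of_set V) S g" "\<And>v. v \<in> V \<Longrightarrow> p (g v) = Some (y + v ^ m)"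
    and g': "continuous_map (top_of_set V') S g'" "\<And>v. v \<in> V' \<Longrightarrow> p (g' v) = Some (y + v ^ m)"
    and ne: "\<And>v. v \<in> V \<Longrightarrow> v \<noteq> 0 \<Longrightarrow> y + v ^ m \<noteq> 0 \<and> y + v ^ m \<noteq> 1"
    and vm: "v ^ m = v' ^ m"
    and t0: "0 < t0" "t0 \<le> 1" "g (of_real t0 * v) = g' (of_real t0 * v')" and t: "0 < t" "t \<le> 1"
  shows "g (of_real t * v) = g' (of_real t * v')"
proof (rule unique_lift_set[where p = p and T = "{0<..1::real}" and ?t0.0 = t0, OF bc(2)])
  show "connected {0<..1::real}" by (rule convex_connected) simp
  show "continuous_map (top_of_set {0<..1::real}) S (\<lambda>t. g (of_real t * v))"
    by (rule continuous_map_compose_on[OF g(1)]) (use radialD[OF V(1,2)] in \<open>auto intro!: continuous_intros\<close>)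
  show "continuous_map (top_of_set {0<..1::real}) S (\<lambda>t. g' (of_real t * v'))"
    by (rule continuous_map_compose_on[OF g'(1)]) (use radialD[OF V'] in \<open>auto intro!: continuous_intros\<close>)
  fix s :: real assume s: "s \<in> {0<..1}"
  then have sv: "of_real s * v \<in> V" "of_real s * v' \<in> V'" "of_real s * v \<noteq> 0"
    using radialD[OF V(1,2)] radialD[OF V'] V(3) by auto
  show "p (g (of_real s * v)) = p (g' (of_real s * v'))"
    using g(2)[OF sv(1)] g'(2)[OF sv(2)] vm by (simp add: power_mult_distrib)
  have "g (of_real s * v) \<in> topspace S" using g(1) sv(1) by (auto simp: continuous_map_def)
  then show "locinj S p (g (of_real s * v))"
    using generic_locinj[OF _ g(2)[OF sv(1)]] ne[OF sv(1,3)] by blast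
qed (use t0 t in auto)

text \<open>Partial lifts on open radial regions that extend the chart agree on overlaps, so they glue to a largest one. If a point were missing from its domain, a local section near the first missing point on the ray would extend it further.\<close>

lemma radial_lift:
  assumes x: "p x = Some y" "has_ram_order S p x m" and \<Omega>: "good_region y m \<Omega>"
  obtains g where "lift_of x y m \<Omega> g"
proof -
  have \<Omega>': "open \<Omega>" "0 \<in> \<Omega>" "radial \<Omega>" "\<And>v. v \<in> \<Omega> \<Longrightarrow> v \<noteq> 0 \<Longrightarrow> y + v ^ m \<noteq> 0 \<and> y + v ^ m \<noteq> 1"
    using \<Omega> by (auto simp: good_region_def)
  obtain r \<psi> where \<psi>: "r > 0" "continuous_map (top_of_set (ball 0 r)) S \<psi>" "\<psi> 0 = x" "inj_on \<psi> (ball 0 r)"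
    "\<And>W. open W \<Longrightarrow> W \<subseteq> ball 0 r \<Longrightarrow> openin S (\<psi> ` W)"
    "\<And>v. v \<in> ball 0 r \<Longrightarrow> p (\<psi> v) = sphere_param (p x) (v ^ m)"
    by (rule ram_chart[OF x(2)]) blast
  obtain e' where e': "e' > 0" "ball 0 e' \<subseteq> \<Omega>" using \<Omega>'(1,2) openE by blast
  define e where "e = min r e'"
  have e: "e > 0" "ball 0 e \<subseteq> \<Omega>" "ball 0 e \<subseteq> ball 0 r" using e' \<psi>(1) by (auto simp: e_def)
  define adm where "adm V g \<longleftrightarrow> open V \<and> ball 0 e \<subseteq> V \<and> V \<subseteq> \<Omega> \<and> radial V \<and> continuous_map (top_of_set V) S g \<and>
    (\<forall>v\<in>V. p (g v) = Some (y + v ^ m)) \<and> (\<forall>v\<in>ball 0 e. g v = \<psi> v)" for V g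
  have admD: "open V" "ball 0 e \<subseteq> V" "V \<subseteq> \<Omega>" "radial V" "continuous_map (top_of_set V) S g"
    "\<And>v. v \<in> V \<Longrightarrow> p (g v) = Some (y + v ^ m)" "\<And>v. v \<in> ball 0 e \<Longrightarrow> g v = \<psi> v" if "adm V g" for V g
    using that unfolding adm_def by auto
  have agree: "g v = g' v" if a: "adm V g" "adm V' g'" and v: "v \<in> V" "v \<in> V'" for V g V' g' v
  proof (cases "v = 0")
    case True
    then show ?thesis using admD(7)[OF a(1), of 0] admD(7)[OF a(2), of 0] e by simp
  next
    case False
    define t0 where "t0 = min 1 (e / (2 * norm v))"
    have t0: "0 < t0" "t0 \<le> 1" "of_real t0 * v \<in> ball 0 e"
    proof -
      show "0 < t0" "t0 \<le> 1" using e False by (auto simp: t0_def)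
      have "t0 * norm v \<le> e / (2 * norm v) * norm v" unfolding t0_def by (rule mult_right_mono) auto
      also have "\<dots> < e" using e False by simp
      finally show "of_real t0 * v \<in> ball 0 e" using \<open>0 < t0\<close> by (simp add: norm_mult)
    qed
    have "g (of_real 1 * v) = g' (of_real 1 * v)"
      by (rule radial_lift_unique[OF admD(4)[OF a(1)] v(1) False admD(4)[OF a(2)] v(2) admD(5,6)[OF a(1)] admD(5,6)[OF a(2)] _ _ t0(1,2)])
         (use \<Omega>'(4) admD(3)[OF a(1)] admD(7)[OF a(1) t0(3)] admD(7)[OF a(2) t0(3)] in auto)
    then show ?thesis by simp
  qed
  have base: "adm (ball 0 e) \<psi>" unfolding adm_def
  proof (intro conjI ballI)
    show "radial (ball 0 e)" unfolding radial_def
    proof (intro ballI allI impI)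
      fix v :: complex and t :: real assume "v \<in> ball 0 e" "0 \<le> t" "t \<le> 1"
      then have "t * norm v \<le> 1 * norm v" by (intro mult_right_mono) auto
      then show "of_real t * v \<in> ball 0 e" using \<open>v \<in> ball 0 e\<close> \<open>0 \<le> t\<close> by (simp add: norm_mult)
    qed
    show "continuous_map (top_of_set (ball 0 e)) S \<psi>" by (rule continuous_map_on_subset[OF \<psi>(2) e(3)])
    show "p (\<psi> v) = Some (y + v ^ m)" if "v \<in> ball 0 e" for v
      using \<psi>(6)[OF subsetD[OF e(3) that]] x(1) by simp
  qed (use e in auto)
  define VV where "VV = \<Union>{V. \<exists>g. adm V g}"
  define G where "G v = (SOME z. \<exists>V g. adm V g \<and> v \<in> V \<and> z = g v)" for v
  have G: "G v = g v" if "adm V g" "v \<in> V" for V g v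
  proof -
    have "\<exists>z. \<exists>V g. adm V g \<and> v \<in> V \<and> z = g v" using that by blast
    from someI_ex[OF this] obtain V' g' where "adm V' g'" "v \<in> V'" "G v = g' v" unfolding G_def by blast
    then show ?thesis using agree that by metis
  qed
  have VVD: "\<exists>V g. adm V g \<and> v \<in> V" if "v \<in> VV" for v using that by (auto simp: VV_def)
  have contG: "continuous_map (top_of_set VV) S G"
  proof (rule pasting_lemma[where I = "{(V, g). adm V g}" and T = fst and f = snd])
    fix i assume "i \<in> {(V, g). adm V g}"
    then obtain V g where i: "i = (V, g)" "adm V g" by auto
    then have "V \<subseteq> VV" by (auto simp: VV_def)
    then show "openin (top_of_set VV) (fst i)" using admD(1)[OF i(2)] i by (simp add: open_subset)
    have "subtopology (top_of_set VV) V = top_of_set V"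
      using \<open>V \<subseteq> VV\<close> by (simp add: subtopology_subtopology inf.absorb2)
    then show "continuous_map (subtopology (top_of_set VV) (fst i)) S (snd i)" using admD(5)[OF i(2)] i by simp
  next
    fix i j v assume "i \<in> {(V, g). adm V g}" "j \<in> {(V, g). adm V g}" "v \<in> topspace (top_of_set VV) \<inter> fst i \<inter> fst j"
    then show "snd i v = snd j v" using agree[of "fst i" "snd i" "fst j" "snd j" v] by auto
  next
    fix v assume "v \<in> topspace (top_of_set VV)"
    then obtain V g where "adm V g" "v \<in> V" using VVD[of v] by auto
    then show "\<exists>j. j \<in> {(V, g). adm V g} \<and> v \<in> fst j \<and> G v = snd j v" using G by (intro exI[of _ "(V, g)"]) auto
  qed
  have admVV: "adm VV G" unfolding adm_def
  proof (intro conjI ballI)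
    show "open VV" unfolding VV_def using admD(1) by blast
    show "ball 0 e \<subseteq> VV" unfolding VV_def using base by blast
    show "VV \<subseteq> \<Omega>" unfolding VV_def using admD(3) by blast
    show "radial VV" unfolding radial_def
    proof (intro ballI allI impI)
      fix v t assume "v \<in> VV" "0 \<le> (t::real)" "t \<le> 1"
      then obtain V g where "adm V g" "of_real t * v \<in> V" using VVD admD(4) radialD by metis
      then show "of_real t * v \<in> VV" unfolding VV_def by blast
    qed
    show "p (G v) = Some (y + v ^ m)" if "v \<in> VV" for v using VVD[OF that] G admD(6) by metis
    show "G v = \<psi> v" if "v \<in> ball 0 e" for v using G[OF base that] .
  qed (rule contG)
  have "VV = \<Omega>"
  proof (rule ccontr)
    assume "VV \<noteq> \<Omega>"
    then obtain u where u: "u \<in> \<Omega>" "u \<notin> VV" using admD(3)[OF admVV] by blast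
    \<comment> \<open>The parameters at which the ray has left the domain; the infimum gives the first missing point.\<close>
    define A where "A = {t. 0 \<le> t \<and> t \<le> 1 \<and> of_real t * u \<notin> VV}"
    have "closed A"
    proof -
      have "A = {0..1} \<inter> (\<lambda>t. of_real t * u) -` (- VV)" by (auto simp: A_def)
      moreover have "closed ({0..1} \<inter> (\<lambda>t. of_real t * u) -` (- VV))"
        by (rule continuous_closed_preimage) (use admD(1)[OF admVV] in \<open>auto intro!: continuous_intros\<close>)
      ultimately show ?thesis by simp
    qed
    moreover have "1 \<in> A" using u by (simp add: A_def)
    moreover have bdd: "bdd_below A" by (rule bdd_belowI[of _ 0]) (simp add: A_def)
    ultimately have infA: "Inf A \<in> A" using closed_contains_Inf by blast
    define t0 where "t0 = Inf A"
    have t0: "0 \<le> t0" "t0 \<le> 1" "of_real t0 * u \<notin> VV" using infA by (auto simp: A_def t0_def)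
    have below: "of_real t * u \<in> VV" if "0 \<le> t" "t < t0" for t
    proof (rule ccontr)
      assume "of_real t * u \<notin> VV"
      then have "t \<in> A" using that t0 by (auto simp: A_def)
      then have "t0 \<le> t" unfolding t0_def using bdd by (rule cInf_lower)
      then show False using that by simp
    qed
    have "0 \<in> VV" using admD(2)[OF admVV] e(1) by auto
    then have "t0 \<noteq> 0" using t0(3) by auto
    with t0 have t0p: "t0 > 0" by simp
    define u0 where "u0 = of_real t0 * u"
    have u0: "u0 \<in> \<Omega>" "u0 \<noteq> 0" "u0 \<notin> VV"
      using radialD[OF \<Omega>'(3) u(1)] t0 t0p u \<open>0 \<in> VV\<close> by (auto simp: u0_def)
    define q where "q v = y + v ^ m" for v
    have q0: "q u0 \<noteq> 0" "q u0 \<noteq> 1" using \<Omega>'(4)[OF u0(1,2)] by (auto simp: q_def)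
    obtain \<rho> where \<rho>: "\<rho> > 0" "0 \<notin> ball (q u0) \<rho>" "1 \<notin> ball (q u0) \<rho>"
      "\<And>x z. x \<in> topspace S \<Longrightarrow> p x = Some z \<Longrightarrow> z \<in> ball (q u0) \<rho> \<Longrightarrow>
         \<exists>s. continuous_map (top_of_set (ball (q u0) \<rho>)) S s \<and> (\<forall>w\<in>ball (q u0) \<rho>. p (s w) = Some w) \<and> s z = x"
      by (rule local_sections[OF q0]) blast
    have contq: "continuous_on UNIV q" unfolding q_def by (intro continuous_intros)
    then have "open (q -` ball (q u0) \<rho> \<inter> (\<Omega> - {0}))"
      using \<Omega>'(1) by (intro open_Int open_vimage) auto
    moreover have "u0 \<in> q -` ball (q u0) \<rho> \<inter> (\<Omega> - {0})" using u0 \<rho>(1) by simp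
    ultimately obtain \<eta> where \<eta>: "\<eta> > 0" "ball u0 \<eta> \<subseteq> q -` ball (q u0) \<rho> \<inter> (\<Omega> - {0})"
      using openE by blast
    define B where "B = ball u0 \<eta>"
    have B: "open B" "u0 \<in> B" "B \<subseteq> \<Omega>" "0 \<notin> B" "\<And>v. v \<in> B \<Longrightarrow> q v \<in> ball (q u0) \<rho>" "convex B"
    proof -
      have sub: "B \<subseteq> q -` ball (q u0) \<rho> \<inter> (\<Omega> - {0})" using \<eta>(2) by (simp add: B_def)
      then show "B \<subseteq> \<Omega>" "0 \<notin> B" by blast+
      show "q v \<in> ball (q u0) \<rho>" if "v \<in> B" for v using sub that by blast
      show "open B" "u0 \<in> B" "convex B" using \<eta>(1) by (simp_all add: B_def)
    qed
    define t1 where "t1 = max (t0 / 2) (t0 - \<eta> / (2 * (norm u + 1)))"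
    have t1: "0 < t1" "t1 < t0" using t0p \<eta>(1) by (auto simp: t1_def field_simps add_pos_nonneg)
    define b0 where "b0 = of_real t1 * u"
    have b0V: "b0 \<in> VV" unfolding b0_def by (rule below) (use t1 in auto)
    have "b0 \<in> B"
    proof -
      have "norm (u0 - b0) = (t0 - t1) * norm u"
        unfolding u0_def b0_def by (simp only: left_diff_distrib[symmetric] of_real_diff[symmetric] norm_mult norm_of_real) (use t1 in simp)
      also have "\<dots> \<le> (\<eta> / (2 * (norm u + 1))) * norm u"
        by (rule mult_right_mono) (auto simp: t1_def)
      also have "\<dots> < \<eta>" using \<eta>(1) by (simp add: divide_simps add_pos_nonneg) (smt (verit) mult_nonneg_nonneg norm_ge_zero distrib_left)
      finally show ?thesis by (simp add: B_def dist_norm)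
    qed
    have GS: "G b0 \<in> topspace S" using contG b0V by (auto simp: continuous_map_def)
    obtain s where s: "continuous_map (top_of_set (ball (q u0) \<rho>)) S s" "\<And>w. w \<in> ball (q u0) \<rho> \<Longrightarrow> p (s w) = Some w" "s (q b0) = G b0"
      using \<rho>(4)[OF GS, of "q b0"] admD(6)[OF admVV b0V] B(5)[OF \<open>b0 \<in> B\<close>] by (auto simp: q_def)
    have contsq: "continuous_map (top_of_set B) S (\<lambda>v. s (q v))"
      by (rule continuous_map_compose_on[OF s(1)]) (use B(5) contq in \<open>auto intro: continuous_on_subset\<close>)
    obtain \<eta>' where \<eta>': "\<eta>' > 0" "ball b0 \<eta>' \<subseteq> B \<inter> VV"
      using openE[of "B \<inter> VV" b0] B(1) admD(1)[OF admVV] b0V \<open>b0 \<in> B\<close> by blast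
    define B' where "B' = ball b0 \<eta>'"
    have B': "B' \<subseteq> B" "B' \<subseteq> VV" "b0 \<in> B'" "open B'" "connected B'"
      using \<eta>' unfolding B'_def by (blast, blast, simp_all)
    have inj: "locinj S p (G v)" if "v \<in> VV" "v \<noteq> 0" for v
    proof (rule generic_locinj[OF _ admD(6)[OF admVV that(1)]])
      show "G v \<in> topspace S" using contG that by (auto simp: continuous_map_def)
    qed (use \<Omega>'(4)[of v] that admD(3)[OF admVV] in auto)
    have psq: "p (s (q v)) = Some (y + v ^ m)" if "v \<in> B" for v
      using s(2)[OF B(5)[OF that]] by (simp add: q_def)
    have onB': "G v = s (q v)" if "v \<in> B'" for v
    proof (rule unique_lift_set[where p = p and T = B' and ?t0.0 = b0 and s = G and s' = "\<lambda>v. s (q v)" and t = v, OF bc(2)])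
      show "connected B'" by (rule B')
      show "continuous_map (top_of_set B') S G"
        by (rule continuous_map_on_subset[OF contG B'(2)])
      show "continuous_map (top_of_set B') S (\<lambda>v. s (q v))"
        by (rule continuous_map_on_subset[OF contsq B'(1)])
      fix v assume "v \<in> B'"
      then have "v \<in> B" "v \<in> VV" "v \<noteq> 0" using B' B(4) by blast+
      then show "p (G v) = p (s (q v))" "locinj S p (G v)" using admD(6)[OF admVV] psq inj by auto
    qed (use that B' s(3) in auto)
    \<comment> \<open>Only those points of the disc are added whose rays pass through a smaller disc on which both lifts are known to agree; this keeps the domain radial.\<close>
    define K where "K = {k \<in> B. \<exists>\<mu>. 0 < \<mu> \<and> \<mu> \<le> 1 \<and> of_real \<mu> * k \<in> B'}"
    have openK: "open K"
    proof -
      have "K = (\<Union>\<mu>\<in>{0<..1}. B \<inter> (\<lambda>k. of_real \<mu> * k) -` B')" by (auto simp: K_def)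
      moreover have "open (B \<inter> (\<lambda>k. of_real \<mu> * k) -` B')" for \<mu> :: real
        using B(1) B'(4) by (intro open_Int open_vimage) (auto intro!: continuous_intros)
      ultimately show ?thesis by (simp only:) (rule open_UN, blast)
    qed
    have u0K: "u0 \<in> K"
    proof -
      have "of_real (t1 / t0) * u0 = b0" using t0p by (simp add: u0_def b0_def)
      then show ?thesis unfolding K_def using B(2) t1 t0p B'(3) by (auto intro!: exI[of _ "t1 / t0"])
    qed
    have between: "of_real t * k \<in> B" if "k \<in> B" "of_real l * k \<in> B" "l \<le> t" "t \<le> 1" for k l t
    proof (cases "l = 1")
      case False
      define a where "a = (t - l) / (1 - l)"
      have l: "l < 1" using that False by simp
      have "a * (1 - l) = t - l" using l by (simp add: a_def)
      then have "t = (1 - a) * l + a" by (simp add: algebra_simps)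
      then have "of_real t * k = of_real ((1 - a) * l + a) * k" by simp
      also have "\<dots> = (1 - a) *\<^sub>R (of_real l * k) + a *\<^sub>R k"
        by (simp add: scaleR_conv_of_real algebra_simps)
      finally have "of_real t * k = (1 - a) *\<^sub>R (of_real l * k) + a *\<^sub>R k" .
      moreover have "0 \<le> a" "a \<le> 1" using that l by (auto simp: a_def)
      ultimately show ?thesis using convexD_alt[OF B(6) that(2,1)] by simp
    qed (use that in simp)
    have GK: "G v = s (q v)" if v: "v \<in> VV" "v \<in> K" for v
    proof -
      obtain \<mu> where \<mu>: "v \<in> B" "0 < \<mu>" "\<mu> \<le> 1" "of_real \<mu> * v \<in> B'" using v(2) by (auto simp: K_def)
      have vB: "of_real t * v \<in> B" if "\<mu> \<le> t" "t \<le> 1" for t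
        using between[OF \<mu>(1) subsetD[OF B'(1) \<mu>(4)] that] .
      have v0: "v \<noteq> 0" using \<mu>(1) B(4) by auto
      have "G (of_real (1::real) * v) = s (q (of_real (1::real) * v))"
      proof (rule unique_lift_set[where p = p and T = "{\<mu>..1}" and ?t0.0 = \<mu> and t = 1
            and s = "\<lambda>t. G (of_real t * v)" and s' = "\<lambda>t. s (q (of_real t * v))", OF bc(2)])
        show "continuous_map (top_of_set {\<mu>..1}) S (\<lambda>t. G (of_real t * v))"
          by (rule continuous_map_compose_on[OF contG])
             (use radialD[OF admD(4)[OF admVV] v(1)] \<mu> in \<open>auto intro!: continuous_intros\<close>)
        show "continuous_map (top_of_set {\<mu>..1}) S (\<lambda>t. s (q (of_real t * v)))"
          by (rule continuous_map_compose_on[OF contsq]) (use vB in \<open>auto intro!: continuous_intros\<close>)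
        fix t assume t: "t \<in> {\<mu>..1}"
        then have "of_real t * v \<in> VV" "of_real t * v \<in> B" "of_real t * v \<noteq> 0"
          using radialD[OF admD(4)[OF admVV] v(1)] vB \<mu> v0 by auto
        then show "p (G (of_real t * v)) = p (s (q (of_real t * v)))" "locinj S p (G (of_real t * v))"
          using admD(6)[OF admVV] psq inj by auto
      qed (use \<mu> onB' in auto)
      then show ?thesis by simp
    qed
    define G' where "G' v = (if v \<in> VV then G v else s (q v))" for v
    have KB: "K \<subseteq> B" by (auto simp: K_def)
    have "adm (VV \<union> K) G'" unfolding adm_def
    proof (intro conjI ballI)
      show "open (VV \<union> K)" using openK admD(1)[OF admVV] by blast
      show "ball 0 e \<subseteq> VV \<union> K" using admD(2)[OF admVV] by blast
      show "VV \<union> K \<subseteq> \<Omega>" using admD(3)[OF admVV] B(3) KB by blast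
      show "radial (VV \<union> K)" unfolding radial_def
      proof (intro ballI allI impI)
        fix k t assume k: "k \<in> VV \<union> K" and t: "0 \<le> (t::real)" "t \<le> 1"
        show "of_real t * k \<in> VV \<union> K"
        proof (cases "k \<in> VV")
          case True
          then show ?thesis using radialD[OF admD(4)[OF admVV]] t by blast
        next
          case False
          then obtain \<mu> where \<mu>: "k \<in> B" "0 < \<mu>" "\<mu> \<le> 1" "of_real \<mu> * k \<in> B'" using k by (auto simp: K_def)
          then have lV: "of_real \<mu> * k \<in> VV" "of_real \<mu> * k \<in> B" using B' by blast+
          show ?thesis
          proof (cases "t \<ge> \<mu>")
            case True
            then have "of_real t * k \<in> B" using between[OF \<mu>(1) lV(2)] t by blast
            moreover have "of_real (\<mu> / t) * (of_real t * k) \<in> B'" using \<mu> True by simp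
            ultimately show ?thesis unfolding K_def using True \<mu> t by (auto intro!: exI[of _ "\<mu> / t"])
          next
            case False
            have "of_real (t / \<mu>) * (of_real \<mu> * k) \<in> VV"
              by (rule radialD[OF admD(4)[OF admVV] lV(1)]) (use False t \<mu> in auto)
            then show ?thesis using \<mu> by simp
          qed
        qed
      qed
      show "continuous_map (top_of_set (VV \<union> K)) S G'"
      proof (rule pasting_lemma[where I = "{True, False}" and T = "\<lambda>b. if b then VV else K" and f = "\<lambda>b. if b then G else (\<lambda>v. s (q v))"])
        fix i :: bool
        show "openin (top_of_set (VV \<union> K)) (if i then VV else K)"
          using openK admD(1)[OF admVV] by (auto intro!: open_subset)
        have "subtopology (top_of_set (VV \<union> K)) VV = top_of_set VV" "subtopology (top_of_set (VV \<union> K)) K = top_of_set K"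
          by (simp_all add: subtopology_subtopology inf.absorb2)
        then show "continuous_map (subtopology (top_of_set (VV \<union> K)) (if i then VV else K)) S (if i then G else (\<lambda>v. s (q v)))"
          using contG continuous_map_on_subset[OF contsq KB] by auto
      next
        fix i j v assume "v \<in> topspace (top_of_set (VV \<union> K)) \<inter> (if i then VV else K) \<inter> (if j then VV else K)"
        then show "(if i then G else (\<lambda>v. s (q v))) v = (if j then G else (\<lambda>v. s (q v))) v"
          using GK[of v] by (auto split: if_splits)
      next
        fix v assume "v \<in> topspace (top_of_set (VV \<union> K))"
        then show "\<exists>j. j \<in> {True, False} \<and> v \<in> (if j then VV else K) \<and> G' v = (if j then G else (\<lambda>v. s (q v))) v"
          by (intro exI[of _ "v \<in> VV"]) (auto simp: G'_def)
      qed
      show "p (G' v) = Some (y + v ^ m)" if "v \<in> VV \<union> K" for v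
        using that admD(6)[OF admVV] psq KB by (auto simp: G'_def)
      show "G' v = \<psi> v" if "v \<in> ball 0 e" for v
        using admD(2,7)[OF admVV] that by (auto simp: G'_def)
    qed
    then have "VV \<union> K \<subseteq> VV" unfolding VV_def by blast
    then show False using u0K u0(3) by blast
  qed
  have near: "g v = \<psi> v" if "v \<in> ball 0 e" "g = G" for v g using admD(7)[OF admVV] that by simp
  have "lift_of x y m \<Omega> G" unfolding lift_of_def
  proof (intro conjI)
    show "continuous_map (top_of_set \<Omega>) S G" using contG \<open>VV = \<Omega>\<close> by simp
    show "G 0 = x" using near[of 0 G] e \<psi>(3) by simp
    show "\<forall>v\<in>\<Omega>. p (G v) = Some (y + v ^ m)" using admD(6)[OF admVV] \<open>VV = \<Omega>\<close> by simp
    have "inj_on G (ball 0 e)" using inj_on_subset[OF \<psi>(4) e(3)] near[of _ G] by (auto simp: inj_on_def)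
    moreover have "openin S (G ` W)" if "open W" "W \<subseteq> ball 0 e" for W
    proof -
      have "G ` W = \<psi> ` W" by (rule image_cong) (use near that in auto)
      then show ?thesis using \<psi>(5)[of W] that e(3) by auto
    qed
    ultimately show "\<exists>e>0. ball 0 e \<subseteq> \<Omega> \<and> inj_on G (ball 0 e) \<and> (\<forall>W. open W \<longrightarrow> W \<subseteq> ball 0 e \<longrightarrow> openin S (G ` W))"
      using e by blast
  qed
  then show thesis by (rule that)
qed

text \<open>If two points have the same image, their rays have the same lifts by uniqueness, down to the chart, where the lift is injective.\<close>

lemma lift_inj:
  assumes g: "lift_of x y m \<Omega> g" and \<Omega>: "good_region y m \<Omega>" and m: "m \<ge> 1"
  shows "inj_on g \<Omega>"
proof (rule inj_onI)
  fix v v' assume v: "v \<in> \<Omega>" "v' \<in> \<Omega>" "g v = g v'"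
  have \<Omega>': "radial \<Omega>" "\<And>v. v \<in> \<Omega> \<Longrightarrow> v \<noteq> 0 \<Longrightarrow> y + v ^ m \<noteq> 0 \<and> y + v ^ m \<noteq> 1"
    using \<Omega> by (auto simp: good_region_def)
  have g': "continuous_map (top_of_set \<Omega>) S g" "\<And>v. v \<in> \<Omega> \<Longrightarrow> p (g v) = Some (y + v ^ m)"
    using g by (auto simp: lift_of_def)
  obtain e where e: "e > 0" "inj_on g (ball 0 e)" using g by (auto simp: lift_of_def)
  have vm: "v ^ m = v' ^ m" using g'(2)[OF v(1)] g'(2)[OF v(2)] v(3) by simp
  show "v = v'"
  proof (cases "v = 0")
    case True
    then show ?thesis using vm m by (metis power_eq_0_iff zero_power less_le_trans zero_less_one)
  next
    case False
    have nv: "norm v = norm v'" using vm m by (metis norm_power norm_ge_zero power_eq_imp_eq_base less_le_trans zero_less_one)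
    define t where "t = min 1 (e / (2 * norm v))"
    have t: "0 < t" "t \<le> 1" "t * norm v < e"
    proof -
      show "0 < t" "t \<le> 1" using e False by (auto simp: t_def)
      have "t * norm v \<le> e / (2 * norm v) * norm v" unfolding t_def by (rule mult_right_mono) auto
      also have "\<dots> < e" using e False by simp
      finally show "t * norm v < e" .
    qed
    have "g (of_real t * v) = g (of_real t * v')"
      by (rule radial_lift_unique[OF \<Omega>'(1) v(1) False \<Omega>'(1) v(2) g' g' _ vm, of 1 t]) (use \<Omega>'(2) v(3) t in auto)
    moreover have "of_real t * v \<in> ball 0 e" "of_real t * v' \<in> ball 0 e" using t nv by (auto simp: norm_mult)
    ultimately have "of_real t * v = of_real t * v'" using e(2) by (metis inj_onD)
    then show ?thesis using t by simp
  qed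
qed

lemma lift_open:
  assumes g: "lift_of x y m \<Omega> g" and \<Omega>: "good_region y m \<Omega>" and m: "m \<ge> 1" and W: "open W" "W \<subseteq> \<Omega>"
  shows "openin S (g ` W)"
proof -
  have g': "continuous_map (top_of_set \<Omega>) S g" "\<And>v. v \<in> \<Omega> \<Longrightarrow> p (g v) = Some (y + v ^ m)"
    using g by (auto simp: lift_of_def)
  obtain e where e: "e > 0" "\<And>W. open W \<Longrightarrow> W \<subseteq> ball 0 e \<Longrightarrow> openin S (g ` W)" using g by (auto simp: lift_of_def)
  have "\<exists>T. openin S T \<and> g v0 \<in> T \<and> T \<subseteq> g ` W" if v0: "v0 \<in> W" for v0
  proof (cases "v0 = 0")
    case True
    have "openin S (g ` (W \<inter> ball 0 e))" by (rule e(2)) (use W in auto)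
    then show ?thesis using e(1) v0 True by (intro exI[of _ "g ` (W \<inter> ball 0 e)"]) auto
  next
    case False
    have v0\<Omega>: "v0 \<in> \<Omega>" using v0 W by auto
    have ne: "y + v0 ^ m \<noteq> 0" "y + v0 ^ m \<noteq> 1" using \<Omega> v0\<Omega> False by (auto simp: good_region_def)
    have gv: "g v0 \<in> topspace S" using g'(1) v0\<Omega> by (auto simp: continuous_map_def)
    have "g v0 \<in> fibre S p (Some (y + v0 ^ m))" using gv g'(2)[OF v0\<Omega>] by (simp add: fibre_def)
    from generic(3)[OF ne this] have ord: "has_ram_order S p (g v0) 1" .
    obtain r \<psi> where \<psi>: "r > 0" "\<psi> 0 = g v0"
      "\<And>W. open W \<Longrightarrow> W \<subseteq> ball 0 r \<Longrightarrow> openin S (\<psi> ` W)"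
      "\<And>v. v \<in> ball 0 r \<Longrightarrow> p (\<psi> v) = sphere_param (p (g v0)) (v ^ 1)"
      by (rule ram_chart[OF ord]) blast
    have p\<psi>: "p (\<psi> v) = Some (y + v0 ^ m + v)" if "v \<in> ball 0 r" for v
      using \<psi>(4)[OF that] g'(2)[OF v0\<Omega>] by simp
    let ?W1 = "{v \<in> \<Omega>. g v \<in> \<psi> ` ball 0 r} \<inter> W"
    have "openin (top_of_set \<Omega>) {v \<in> \<Omega>. g v \<in> \<psi> ` ball 0 r}"
      using openin_continuous_map_preimage[OF g'(1) \<psi>(3)[OF open_ball order_refl]] by simp
    then have W1: "open ?W1" using \<Omega> W openin_open_eq[of \<Omega>] by (auto simp: good_region_def)
    have v0W1: "v0 \<in> ?W1" using v0 v0\<Omega> \<psi>(1,2) by (auto intro!: image_eqI[of _ _ 0])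
    have "((\<lambda>v. v ^ m) has_field_derivative of_nat m * v0 ^ (m - 1)) (at v0)"
      by (auto intro!: derivative_eq_intros)
    then have "deriv (\<lambda>v. v ^ m) v0 = of_nat m * v0 ^ (m - 1)" by (rule DERIV_imp_deriv)
    then have dnz: "deriv (\<lambda>v. v ^ m) v0 \<noteq> 0" using False m by simp
    obtain r1 where r1: "r1 > 0" "ball v0 r1 \<subseteq> ?W1" "open ((\<lambda>v. v ^ m) ` ball v0 r1)"
      by (rule has_complex_derivative_locally_invertible[OF _ v0W1 W1 dnz]) (auto intro!: holomorphic_intros)
    let ?Z = "(\<lambda>z. z - v0 ^ m) ` ((\<lambda>v. v ^ m) ` ball v0 r1)"
    have key: "v ^ m - v0 ^ m \<in> ball 0 r \<and> g v = \<psi> (v ^ m - v0 ^ m)" if v: "v \<in> ball v0 r1" for v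
    proof -
      obtain t where t: "t \<in> ball 0 r" "g v = \<psi> t" using r1(2) v by auto
      have "v \<in> \<Omega>" using r1(2) v by auto
      then have "y + v ^ m = y + v0 ^ m + t" using g'(2)[of v] p\<psi>[OF t(1)] t(2) by simp
      then have "t = v ^ m - v0 ^ m" by (simp add: algebra_simps)
      then show ?thesis using t by simp
    qed
    have "open ?Z" using open_translation[OF r1(3), of "- (v0 ^ m)"] by (simp add: image_image)
    moreover have "?Z \<subseteq> ball 0 r" using key by auto
    ultimately have "openin S (\<psi> ` ?Z)" by (rule \<psi>(3))
    moreover have "\<psi> ` ?Z = g ` ball v0 r1" using key by (auto simp: image_image intro!: image_cong)
    ultimately have "openin S (g ` ball v0 r1)" by simp
    then show ?thesis using r1 by (intro exI[of _ "g ` ball v0 r1"]) auto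
  qed
  then show ?thesis by (subst openin_subopen) auto
qed

end

section \<open>Slit regions and the pieces of a cover with one zero\<close>

text \<open>The centre piece is a \<open>d\<close>-fold branched cover of the complement of \<open>[1, \<infinity>)\<close>, the piece at a point over \<open>1\<close> an \<open>m\<close>-fold cover of the complement of \<open>(-\<infinity>, 0]\<close>, with \<open>m = 1\<close> or \<open>m = 2\<close>. In the coordinates \<open>u\<close> with value \<open>u^d\<close>, and \<open>v\<close> with value \<open>1 + v^m\<close>, they are the regions below.\<close>

definition slit :: "complex set" where "slit = {z. Im z = 0 \<and> Re z \<ge> 1}"

lemma closed_slit: "closed slit"
proof -
  have *: "slit = {z. Im z = 0} \<inter> {z. 1 \<le> Re z}" by (auto simp: slit_def)
  show ?thesis unfolding * by (intro closed_Int closed_Collect_eq closed_Collect_le continuous_intros)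
qed

definition reg0 :: "nat \<Rightarrow> complex set" where "reg0 d = {u. u ^ d \<notin> slit}"
definition reg1 :: "nat \<Rightarrow> complex set" where "reg1 m = {v. - (v ^ m) \<notin> slit}"

lemma slit_scale: "z \<notin> slit \<Longrightarrow> 0 \<le> t \<Longrightarrow> t \<le> 1 \<Longrightarrow> of_real t * z \<notin> slit"
proof
  assume z: "z \<notin> slit" and t: "0 \<le> t" "t \<le> 1" and in_slit: "of_real t * z \<in> slit"
  then have 1: "t * Im z = 0" "t * Re z \<ge> 1" by (auto simp: slit_def)
  then have "t \<noteq> 0" by auto
  with 1 t have "Im z = 0" by simp
  moreover have "Re z \<ge> 1"
  proof (rule ccontr)
    assume "\<not> Re z \<ge> 1"
    then have "t * Re z < t * 1" using t \<open>t \<noteq> 0\<close> by (intro mult_strict_left_mono) auto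
    then show False using 1 t by simp
  qed
  ultimately show False using z by (simp add: slit_def)
qed

lemma good_reg0: "d \<ge> 1 \<Longrightarrow> good_region 0 d (reg0 d)"
  unfolding good_region_def
proof (intro conjI ballI impI)
  assume d: "d \<ge> 1"
  have "reg0 d = (\<lambda>u. u ^ d) -` (- slit)" by (auto simp: reg0_def)
  then show "open (reg0 d)" using closed_slit by (auto intro!: open_vimage continuous_intros)
  show "0 \<in> reg0 d" using d by (cases d) (auto simp: reg0_def slit_def)
  show "radial (reg0 d)" unfolding radial_def reg0_def
  proof (clarsimp)
    fix v :: complex and t :: real assume v: "v ^ d \<notin> slit" "0 \<le> t" "t \<le> 1" "(of_real t * v) ^ d \<in> slit"
    have "(of_real t * v) ^ d = of_real (t ^ d) * v ^ d" by (simp add: power_mult_distrib)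
    then show False using slit_scale[OF v(1), of "t ^ d"] v by (simp add: power_le_one)
  qed
  fix v assume "v \<in> reg0 d" "v \<noteq> 0"
  then show "0 + v ^ d \<noteq> 0" "0 + v ^ d \<noteq> 1" by (auto simp: reg0_def slit_def)
qed

lemma good_reg1: "m \<ge> 1 \<Longrightarrow> good_region 1 m (reg1 m)"
  unfolding good_region_def
proof (intro conjI ballI impI)
  assume m: "m \<ge> 1"
  have "reg1 m = (\<lambda>u. - (u ^ m)) -` (- slit)" by (auto simp: reg1_def)
  then show "open (reg1 m)" using closed_slit by (auto intro!: open_vimage continuous_intros)
  show "0 \<in> reg1 m" using m by (cases m) (auto simp: reg1_def slit_def)
  show "radial (reg1 m)" unfolding radial_def reg1_def
  proof (clarsimp)
    fix v :: complex and t :: real assume v: "- (v ^ m) \<notin> slit" "0 \<le> t" "t \<le> 1" "- ((of_real t * v) ^ m) \<in> slit"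
    have "- ((of_real t * v) ^ m) = of_real (t ^ m) * (- (v ^ m))" by (simp add: power_mult_distrib)
    then show False using slit_scale[OF v(1), of "t ^ m"] v by (simp add: power_le_one)
  qed
  fix v assume v: "v \<in> reg1 m" "v \<noteq> 0"
  have "1 + v ^ m \<noteq> 0"
  proof
    assume "1 + v ^ m = 0"
    then have "- (v ^ m) = 1" by (metis add.commute add_eq_0_iff)
    then have "- (v ^ m) \<in> slit" by (simp only:) (simp add: slit_def)
    then show False using v by (simp add: reg1_def)
  qed
  then show "1 + v ^ m \<noteq> 0" .
  show "1 + v ^ m \<noteq> 1" using v by simp
qed

definition emb :: "'s topology \<Rightarrow> complex set \<Rightarrow> (complex \<Rightarrow> 's) \<Rightarrow> bool" where
  "emb S \<Omega> g \<longleftrightarrow> open \<Omega> \<and> continuous_map (top_of_set \<Omega>) S g \<and> inj_on g \<Omega> \<and> (\<forall>W. open W \<longrightarrow> W \<subseteq> \<Omega> \<longrightarrow> openin S (g ` W))"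

lemma emb_inv:
  assumes "emb S \<Omega> g"
  shows "continuous_map (subtopology S (g ` \<Omega>)) (top_of_set \<Omega>) (inv_into \<Omega> g)" "openin S (g ` \<Omega>)"
proof -
  have e: "open \<Omega>" "inj_on g \<Omega>" "\<And>W. open W \<Longrightarrow> W \<subseteq> \<Omega> \<Longrightarrow> openin S (g ` W)" using assms by (auto simp: emb_def)
  show o: "openin S (g ` \<Omega>)" using e by auto
  have t: "topspace (subtopology S (g ` \<Omega>)) = g ` \<Omega>" using openin_subset[OF o] by auto
  show "continuous_map (subtopology S (g ` \<Omega>)) (top_of_set \<Omega>) (inv_into \<Omega> g)"
    unfolding continuous_map_def t
  proof (intro conjI allI impI)
    show "inv_into \<Omega> g \<in> g ` \<Omega> \<rightarrow> topspace (top_of_set \<Omega>)" by (auto simp: inv_into_into)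
    fix W assume "openin (top_of_set \<Omega>) W"
    then have W: "open W" "W \<subseteq> \<Omega>" by (simp_all only: openin_open_eq[OF e(1)])
    have "{x \<in> g ` \<Omega>. inv_into \<Omega> g x \<in> W} = g ` W"
    proof (intro equalityI subsetI)
      fix x assume "x \<in> {x \<in> g ` \<Omega>. inv_into \<Omega> g x \<in> W}"
      then obtain v where "v \<in> \<Omega>" "x = g v" "inv_into \<Omega> g (g v) \<in> W" by blast
      then show "x \<in> g ` W" using inv_into_f_f[OF e(2)] by simp
    next
      fix x assume "x \<in> g ` W"
      then obtain v where v: "v \<in> W" "x = g v" by blast
      then have "v \<in> \<Omega>" using W(2) by blast
      then show "x \<in> {x \<in> g ` \<Omega>. inv_into \<Omega> g x \<in> W}" using v inv_into_f_f[OF e(2)] by simp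
    qed
    then show "openin (subtopology S (g ` \<Omega>)) {x \<in> g ` \<Omega>. inv_into \<Omega> g x \<in> W}"
      using e(3)[OF W] o W(2) by (simp add: openin_open_subtopology image_mono)
  qed
qed

context tpc begin

lemma lift_emb:
  assumes "lift_of x y m \<Omega> g" "good_region y m \<Omega>" "m \<ge> 1" shows "emb S \<Omega> g"
  unfolding emb_def
proof (intro conjI allI impI)
  show "open \<Omega>" using assms(2) by (simp add: good_region_def)
  show "continuous_map (top_of_set \<Omega>) S g" using assms(1) by (simp add: lift_of_def)
  show "inj_on g \<Omega>" by (rule lift_inj[OF assms])
  show "openin S (g ` W)" if "open W" "W \<subseteq> \<Omega>" for W by (rule lift_open[OF assms that])
qed

lemma lift_rotate:
  assumes g: "lift_of x y m \<Omega> g" and \<Omega>: "\<And>v. v \<in> \<Omega> \<Longrightarrow> \<eta> * v \<in> \<Omega>" and \<eta>: "\<eta> ^ m = 1" "norm \<eta> = 1"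
  shows "lift_of x y m \<Omega> (\<lambda>v. g (\<eta> * v))"
proof -
  have g': "continuous_map (top_of_set \<Omega>) S g" "g 0 = x" "\<And>v. v \<in> \<Omega> \<Longrightarrow> p (g v) = Some (y + v ^ m)"
    using g by (auto simp: lift_of_def)
  obtain e where e: "e > 0" "ball 0 e \<subseteq> \<Omega>" "inj_on g (ball 0 e)" "\<And>W. open W \<Longrightarrow> W \<subseteq> ball 0 e \<Longrightarrow> openin S (g ` W)"
    using g by (auto simp: lift_of_def)
  have \<eta>0: "\<eta> \<noteq> 0" using \<eta>(2) by auto
  show ?thesis unfolding lift_of_def
  proof (intro conjI ballI exI[of _ e] allI impI)
    show "continuous_map (top_of_set \<Omega>) S (\<lambda>v. g (\<eta> * v))"
      by (rule continuous_map_compose_on[OF g'(1)]) (use \<Omega> in \<open>auto intro!: continuous_intros\<close>)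
    show "p (g (\<eta> * v)) = Some (y + v ^ m)" if "v \<in> \<Omega>" for v
      using g'(3)[OF \<Omega>[OF that]] \<eta>(1) by (simp add: power_mult_distrib)
    show "inj_on (\<lambda>v. g (\<eta> * v)) (ball 0 e)"
    proof (rule inj_onI)
      fix v w assume *: "v \<in> ball 0 e" "w \<in> ball 0 e" "g (\<eta> * v) = g (\<eta> * w)"
      then have "\<eta> * v = \<eta> * w" using e(3) \<eta>(2) by (auto simp: norm_mult dest!: inj_onD)
      then show "v = w" using \<eta>0 by simp
    qed
    fix W assume W: "open W" "W \<subseteq> ball (0::complex) e"
    have "(\<lambda>v. \<eta> * v) ` W = (\<lambda>w. w / \<eta>) -` W" using \<eta>0 by (auto simp: image_iff intro!: bexI[of _ "x / \<eta>" for x])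
    then have "open ((\<lambda>v. \<eta> * v) ` W)" using W(1) \<eta>0 by (auto intro!: open_vimage continuous_intros)
    moreover have "(\<lambda>v. \<eta> * v) ` W \<subseteq> ball 0 e" using W(2) \<eta>(2) by (auto simp: norm_mult)
    ultimately have "openin S (g ` (\<lambda>v. \<eta> * v) ` W)" by (rule e(4))
    then show "openin S ((\<lambda>v. g (\<eta> * v)) ` W)" by (simp add: image_image)
  qed (use g' e in auto)
qed

end

lemma roots_of_half:
  assumes "d \<ge> 1"
  defines "r \<equiv> complex_of_real (root d (1 / 2))"
  shows "r ^ d = 1 / 2" "r \<noteq> 0"
proof -
  have "r ^ d = of_real (root d (1/2) ^ d)" by (simp add: r_def)
  also have "root d (1/2) ^ d = 1 / 2" using assms(1) by (intro real_root_pow_pos2) auto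
  finally show "r ^ d = 1 / 2" by simp
  then show "r \<noteq> 0" using assms(1) by (auto simp: power_0_left)
qed

text \<open>Base points over the value \<open>1/2\<close>, which lies in the centre piece and in all the others: \<open>rt d\<close> and its multiples by roots of unity in the centre, \<open>\<plusminus> vst\<close> in the double piece, and \<open>- 1/2\<close> in a simple piece.\<close>

abbreviation rt :: "nat \<Rightarrow> complex" where "rt d \<equiv> complex_of_real (root d (1 / 2))"
abbreviation om :: "nat \<Rightarrow> nat \<Rightarrow> complex" where "om d k \<equiv> exp (2 * of_real pi * \<i> * of_nat k / of_nat d)"
abbreviation vst :: complex where "vst \<equiv> \<i> * of_real (sqrt (1 / 2))"

lemma vst: "vst ^ 2 = - (1 / 2)" "vst \<noteq> 0"
proof -
  have "vst ^ 2 = - of_real (sqrt (1/2) ^ 2)" by (simp add: power_mult_distrib flip: of_real_power)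
  also have "sqrt (1/2) ^ 2 = (1/2 :: real)" by (rule real_sqrt_pow2) simp
  finally show "vst ^ 2 = - (1 / 2)" by simp
qed simp

lemma om_power: "d \<ge> 1 \<Longrightarrow> om d k ^ d = 1"
proof -
  assume "d \<ge> 1"
  then have "om d k ^ d = exp (2 * of_real pi * \<i> * of_nat k)"
    by (simp flip: exp_of_nat_mult)
  also have "\<dots> = exp (2 * of_real pi * \<i>) ^ k" by (simp add: mult_ac flip: exp_of_nat_mult)
  also have "\<dots> = 1" using exp_two_pi_i by (simp add: mult_ac)
  finally show ?thesis .
qed

text \<open>The pieces over \<open>1\<close> are indexed by the roots \<open>u\<close> of \<open>u^d = 1/2\<close> at which they meet the centre piece. The double piece meets it at two roots, \<open>rt d\<close> and \<open>om d k * rt d\<close>, and carries the first as its index.\<close>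

definition mm :: "nat \<Rightarrow> complex \<Rightarrow> nat" where "mm d u = (if u = rt d then 2 else 1)"
definition vbase :: "nat \<Rightarrow> complex \<Rightarrow> complex" where "vbase d u = (if u = rt d then vst else - (1 / 2))"
definition U1 :: "nat \<Rightarrow> nat \<Rightarrow> complex set" where "U1 d k = {u. u ^ d = 1 / 2} - {om d k * rt d}"

text \<open>A cover is in normal form \<open>k\<close> if its finite part is the union of a centre piece \<open>g\<close> and disjoint pieces \<open>G u\<close> over \<open>1\<close>, glued at the base points as prescribed by \<open>k\<close>.\<close>

definition NF :: "'s topology \<Rightarrow> ('s \<Rightarrow> complex option) \<Rightarrow> nat \<Rightarrow> nat \<Rightarrow> (complex \<Rightarrow> 's) \<Rightarrow> (complex \<Rightarrow> complex \<Rightarrow> 's) \<Rightarrow> bool" where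
  "NF S p d k g G \<longleftrightarrow> emb S (reg0 d) g \<and> (\<forall>u\<in>reg0 d. p (g u) = Some (u ^ d)) \<and>
    (\<forall>u\<in>U1 d k. emb S (reg1 (mm d u)) (G u) \<and> (\<forall>v\<in>reg1 (mm d u). p (G u v) = Some (1 + v ^ mm d u)) \<and> G u (vbase d u) = g u) \<and>
    G (rt d) (- vst) = g (om d k * rt d) \<and> rt d \<in> U1 d k \<and>
    (\<forall>z\<in>topspace S. \<forall>y. p z = Some y \<longrightarrow> y \<notin> slit \<longrightarrow> z \<in> g ` reg0 d) \<and>
    (\<forall>u\<in>U1 d k. \<forall>u'\<in>U1 d k. u \<noteq> u' \<longrightarrow> G u ` reg1 (mm d u) \<inter> G u' ` reg1 (mm d u') = {}) \<and>
    (\<forall>z\<in>topspace S. p z \<noteq> None \<longrightarrow> z \<in> g ` reg0 d \<or> (\<exists>u\<in>U1 d k. z \<in> G u ` reg1 (mm d u)))"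

text \<open>Covers with one zero, of full order, and one simple branch point over \<open>1\<close>.\<close>

locale cov12 = tpc S p d for S :: "'s topology" and p d +
  fixes x0 x1 :: 's
  assumes d2: "d \<ge> 2" and x0: "fibre S p (Some 0) = {x0}" "has_ram_order S p x0 d"
    and x1: "x1 \<in> fibre S p (Some 1)" "has_ram_order S p x1 2"
    and others: "\<And>x. x \<in> fibre S p (Some 1) \<Longrightarrow> x \<noteq> x1 \<Longrightarrow> has_ram_order S p x 1"
    and fin1: "finite (fibre S p (Some 1))"
begin

definition ordx :: "'s \<Rightarrow> nat" where "ordx x = (if x = x1 then 2 else 1)"

lemma ordx: "x \<in> fibre S p (Some 1) \<Longrightarrow> has_ram_order S p x (ordx x)" "ordx x \<ge> 1"
  using x1 others by (auto simp: ordx_def)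

text \<open>The radial lift at the zero already accounts for \<open>d\<close> points in each fibre.\<close>

lemma centre_image:
  assumes g: "lift_of x0 0 d (reg0 d) g" and z: "z \<in> topspace S" "p z = Some y" "y \<notin> slit"
  shows "\<exists>u. u ^ d = y \<and> z = g u"
proof (cases "y = 0")
  case True
  then have "z = x0" using z x0 by (auto simp: fibre_def)
  then show ?thesis using g True d2 by (intro exI[of _ 0]) (auto simp: lift_of_def)
next
  case False
  have y1: "y \<noteq> 1" using z(3) by (auto simp: slit_def)
  have sub: "{u. u ^ d = y} \<subseteq> reg0 d" using z(3) by (auto simp: reg0_def)
  have "inj_on g (reg0 d)" using lift_inj[OF g good_reg0] d2 by simp
  then have "card (g ` {u. u ^ d = y}) = card {u. u ^ d = y}" using sub by (meson card_image inj_on_subset)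
  also have "\<dots> = d" using card_nth_roots[OF False, of d] d2 by simp
  finally have c: "card (g ` {u. u ^ d = y}) = d" .
  have "g u \<in> fibre S p (Some y)" if "u ^ d = y" for u
  proof -
    have "u \<in> reg0 d" using sub that by auto
    then show ?thesis using g that by (auto simp: lift_of_def fibre_def continuous_map_def)
  qed
  then have "g ` {u. u ^ d = y} \<subseteq> fibre S p (Some y)" by auto
  then have "g ` {u. u ^ d = y} = fibre S p (Some y)"
    using c generic(1,2)[OF False y1] by (metis card_subset_eq)
  moreover have "z \<in> fibre S p (Some y)" using z by (simp add: fibre_def)
  ultimately have "z \<in> g ` {u. u ^ d = y}" by simp
  then show ?thesis by blast
qed

text \<open>Follow the common lift of a ray towards the value \<open>1\<close>: it ends in both centres.\<close>

lemma pieces_disjoint: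
  assumes g: "lift_of x 1 m (reg1 m) g" "lift_of x' 1 m' (reg1 m') g'" and m: "m \<ge> 1" "m' \<ge> 1"
    and v: "v \<in> reg1 m" "v' \<in> reg1 m'" "g v = g' v'"
  shows "x = x'"
proof -
  have g1: "continuous_map (top_of_set (reg1 m)) S g" "g 0 = x" "\<And>v. v \<in> reg1 m \<Longrightarrow> p (g v) = Some (1 + v ^ m)"
    using g(1) by (auto simp: lift_of_def)
  have g2: "continuous_map (top_of_set (reg1 m')) S g'" "g' 0 = x'" "\<And>v. v \<in> reg1 m' \<Longrightarrow> p (g' v) = Some (1 + v ^ m')"
    using g(2) by (auto simp: lift_of_def)
  have eq: "v ^ m = v' ^ m'" using g1(3)[OF v(1)] g2(3)[OF v(2)] v(3) by simp
  show ?thesis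
  proof (cases "v = 0")
    case True
    then have "v' = 0" using eq m by (metis power_eq_0_iff zero_power less_le_trans zero_less_one)
    then show ?thesis using True v g1 g2 by simp
  next
    case False
    let ?s = "\<lambda>t. g (of_real (root m t) * v)" and ?s' = "\<lambda>t. g' (of_real (root m' t) * v')"
    have r: "0 \<le> root m t" "root m t \<le> 1" "0 \<le> root m' t" "root m' t \<le> 1" if "0 \<le> t" "t \<le> 1" for t
      using that m by (auto simp: real_root_le_1_iff)
    have rad: "radial (reg1 m)" "radial (reg1 m')" using good_reg1 m by (auto simp: good_region_def)
    have in1: "of_real (root m t) * v \<in> reg1 m" "of_real (root m' t) * v' \<in> reg1 m'" if "0 \<le> t" "t \<le> 1" for t
      using radialD[OF rad(1) v(1) r(1,2)] radialD[OF rad(2) v(2) r(3,4)] that by auto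
    have c1: "continuous_map (top_of_set {0..1}) S ?s"
      by (rule continuous_map_compose_on[OF g1(1)]) (use in1 in \<open>auto intro!: continuous_intros\<close>)
    have c2: "continuous_map (top_of_set {0..1}) S ?s'"
      by (rule continuous_map_compose_on[OF g2(1)]) (use in1 in \<open>auto intro!: continuous_intros\<close>)
    have pw: "(complex_of_real (root m t) * v) ^ m = of_real t * v ^ m" "(complex_of_real (root m' t) * v') ^ m' = of_real t * v' ^ m'"
      if "0 \<le> t" for t
      using that m by (simp_all add: power_mult_distrib flip: of_real_power)
    have agree: "?s t = ?s' t" if "t \<in> {0<..1}" for t
    proof (rule unique_lift_set[where p = p and T = "{0<..1::real}" and ?t0.0 = 1 and t = t and s = ?s and s' = ?s', OF bc(2)])
      show "connected {0<..1::real}" by (rule convex_connected) simp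
      show "continuous_map (top_of_set {0<..1}) S ?s" by (rule continuous_map_on_subset[OF c1]) auto
      show "continuous_map (top_of_set {0<..1}) S ?s'" by (rule continuous_map_on_subset[OF c2]) auto
      fix t :: real assume t: "t \<in> {0<..1}"
      then have i: "of_real (root m t) * v \<in> reg1 m" "of_real (root m' t) * v' \<in> reg1 m'" "of_real (root m t) * v \<noteq> 0"
        using in1 m False by auto
      show "p (?s t) = p (?s' t)" using g1(3)[OF i(1)] g2(3)[OF i(2)] pw[of t] eq t by simp
      have "?s t \<in> topspace S" using g1(1) i(1) by (auto simp: continuous_map_def)
      then show "locinj S p (?s t)"
        using generic_locinj[OF _ g1(3)[OF i(1)]] good_reg1[OF m(1)] i by (auto simp: good_region_def)
    qed (use that v m in auto)
    have "closedin (top_of_set {0..1}) {t \<in> topspace (top_of_set {0..1}). ?s t = ?s' t}"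
      by (rule closedin_continuous_maps_eq[OF bc(2) c1 c2])
    then have "closed {t \<in> topspace (top_of_set {0..1::real}). ?s t = ?s' t}" by (rule closedin_closed_trans) simp
    then have "closed {t \<in> {0..1}. ?s t = ?s' t}" by simp
    moreover have "{0<..1} \<subseteq> {t \<in> {0..1}. ?s t = ?s' t}" using agree by auto
    ultimately have "closure {0<..1::real} \<subseteq> {t \<in> {0..1}. ?s t = ?s' t}" by (rule closure_minimal[rotated])
    moreover have "0 \<in> closure {0<..1::real}" by (simp add: closure_greaterThanAtMost)
    ultimately have "?s 0 = ?s' 0" by blast
    then show ?thesis using g1 g2 by simp
  qed
qed

definition gl :: "'s \<Rightarrow> complex \<Rightarrow> 's" where
  "gl x = (SOME g. lift_of x 1 (ordx x) (reg1 (ordx x)) g)"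

lemma gl: "x \<in> fibre S p (Some 1) \<Longrightarrow> lift_of x 1 (ordx x) (reg1 (ordx x)) (gl x)"
proof -
  assume x: "x \<in> fibre S p (Some 1)"
  have "\<exists>g. lift_of x 1 (ordx x) (reg1 (ordx x)) g"
    using radial_lift[OF _ ordx(1)[OF x] good_reg1[OF ordx(2)]] x by (auto simp: fibre_def)
  then show ?thesis unfolding gl_def by (rule someI_ex)
qed

text \<open>Near the value \<open>1\<close> all points lie in a piece, so the local degrees of the pieces add up to \<open>d\<close>; as the pieces are disjoint they then fill every fibre over their region.\<close>

lemma one_image:
  assumes z: "z \<in> topspace S" "p z = Some y" and y: "- (y - 1) \<notin> slit"
  shows "\<exists>x v. x \<in> fibre S p (Some 1) \<and> v ^ ordx x = y - 1 \<and> z = gl x v"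
proof -
  let ?F = "fibre S p (Some 1)"
  let ?T = "\<lambda>y. SIGMA x:?F. {v. v ^ ordx x = y - (1 :: complex)}"
  let ?f = "\<lambda>(x, v). gl x v"
  have glp: "gl x v \<in> topspace S" "p (gl x v) = Some (1 + v ^ ordx x)" if "x \<in> ?F" "v \<in> reg1 (ordx x)" for x v
    using gl[OF that(1)] that(2) by (auto simp: lift_of_def continuous_map_def)
  have inreg: "v \<in> reg1 (ordx x)" if "(x, v) \<in> ?T y" "- (y - 1) \<notin> slit" for x v y using that by (auto simp: reg1_def)
  have cardT: "card (?T y) = sum ordx ?F" if "y \<noteq> 1" for y
  proof -
    have "card (?T y) = (\<Sum>x\<in>?F. card {v. v ^ ordx x = y - 1})"
      by (rule card_SigmaI) (use fin1 that ordx(2) finite_nth_roots in \<open>auto simp: Suc_le_eq\<close>)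
    also have "\<dots> = sum ordx ?F" by (rule sum.cong) (use that ordx(2) card_nth_roots in \<open>auto simp: Suc_le_eq\<close>)
    finally show ?thesis .
  qed
  have inj: "inj_on ?f (?T y)" if "- (y - 1) \<notin> slit" for y
  proof (rule inj_onI, clarify)
    fix a v a' v' assume *: "a \<in> ?F" "v ^ ordx a = y - 1" "a' \<in> ?F" "v' ^ ordx a' = y - 1" "gl a v = gl a' v'"
    have r: "v \<in> reg1 (ordx a)" "v' \<in> reg1 (ordx a')" using * that by (auto simp: reg1_def)
    have "a = a'" by (rule pieces_disjoint[OF gl[OF *(1)] gl[OF *(3)] ordx(2) ordx(2) r *(5)])
    moreover have "v = v'" using lift_inj[OF gl[OF *(1)] good_reg1 ordx(2)] ordx(2) r *(5) \<open>a = a'\<close> by (auto dest: inj_onD)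
    ultimately show "a = a' \<and> v = v'" by simp
  qed
  have sub: "?f ` ?T y \<subseteq> fibre S p (Some y)" if "- (y - 1) \<notin> slit" for y
    using glp inreg[OF _ that] by (auto simp: fibre_def)
  have tot: "sum ordx ?F = d"
  proof -
    let ?N = "\<Union>x\<in>?F. gl x ` reg1 (ordx x)"
    have "openin S (gl x ` reg1 (ordx x))" if "x \<in> ?F" for x
      using lift_open[OF gl[OF that] good_reg1[OF ordx(2)] ordx(2), of "reg1 (ordx x)"] good_reg1[OF ordx(2), of x]
      by (auto simp: good_region_def)
    then have oN: "openin S ?N" by blast
    have "?F \<subseteq> ?N"
    proof
      fix x assume x: "x \<in> ?F"
      have "gl x 0 = x" "0 \<in> reg1 (ordx x)" using gl[OF x] good_reg1[OF ordx(2), of x] by (auto simp: lift_of_def good_region_def)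
      then show "x \<in> ?N" using x by force
    qed
    then obtain W where W: "openin riemann_sphere W" "Some 1 \<in> W" "\<And>x. x \<in> topspace S \<Longrightarrow> p x \<in> W \<Longrightarrow> x \<in> ?N"
      using fibre_nbhd[OF oN] by blast
    have "continuous_map euclidean riemann_sphere Some" unfolding riemann_sphere_def by (rule continuous_map_Some)
    from openin_continuous_map_preimage[OF this W(1)] have "open {z. Some z \<in> W}" by simp
    moreover have "1 \<in> {z. Some z \<in> W}" using W(2) by simp
    ultimately obtain e where e: "e > 0" "ball 1 e \<subseteq> {z. Some z \<in> W}" using openE by blast
    \<comment> \<open>A real value slightly below \<open>1\<close>: close enough for its fibre to lie in the pieces.\<close>
    define \<mu> where "\<mu> = min (e / 2) (1 / 2)"
    have \<mu>: "0 < \<mu>" "\<mu> < 1" "\<mu> < e" using e(1) by (auto simp: \<mu>_def)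
    define y where "y = 1 - complex_of_real \<mu>"
    have y: "y \<noteq> 1" "y \<noteq> 0" "y \<in> ball 1 e" "- (y - 1) \<notin> slit"
      using \<mu> by (auto simp: y_def slit_def dist_norm)
    have "fibre S p (Some y) \<subseteq> ?f ` ?T y"
    proof
      fix z assume z: "z \<in> fibre S p (Some y)"
      then have "z \<in> ?N" using W(3)[of z] e(2) y(3) by (auto simp: fibre_def)
      then obtain x v where xv: "x \<in> ?F" "v \<in> reg1 (ordx x)" "z = gl x v" by auto
      then have "v ^ ordx x = y - 1" using glp(2)[OF xv(1,2)] z by (auto simp: fibre_def)
      then show "z \<in> ?f ` ?T y" using xv by (intro image_eqI[of _ _ "(x, v)"]) auto
    qed
    then have "?f ` ?T y = fibre S p (Some y)" using sub[OF y(4)] by blast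
    then have "card (?T y) = d" using card_image[OF inj[OF y(4)]] generic(2)[OF y(2,1)] by simp
    then show ?thesis using cardT[OF y(1)] by simp
  qed
  show ?thesis
  proof (cases "y = 1")
    case True
    then have zF: "z \<in> ?F" using z by (simp add: fibre_def)
    have "gl z 0 = z" using gl[OF zF] by (simp add: lift_of_def)
    then show ?thesis using zF True ordx(2)[of z] by (intro exI[of _ z] exI[of _ 0]) (simp add: Suc_le_eq)
  next
    case False
    have y0: "y \<noteq> 0" using y by (auto simp: slit_def)
    have "card (?f ` ?T y) = d" using card_image[OF inj[OF y]] cardT[OF False] tot by simp
    then have "?f ` ?T y = fibre S p (Some y)"
      using sub[OF y] generic(1,2)[OF y0 False] by (metis card_subset_eq)
    moreover have "z \<in> fibre S p (Some y)" using z by (simp add: fibre_def)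
    ultimately have "z \<in> ?f ` ?T y" by simp
    then show ?thesis by auto
  qed
qed

end

section \<open>The normal form of a cover with one zero\<close>

context cov12 begin

lemma vst_reg: "vst \<in> reg1 2" "- vst \<in> reg1 2" "- (1 / 2) \<in> reg1 1"
  using vst by (auto simp: reg1_def slit_def)

lemma vst_neg: "vst \<noteq> - vst"
  by (simp add: complex_eq_iff)

text \<open>Rotating the coordinate of the centre piece moves one of the two meeting points with the double piece to \<open>rt d\<close>. Which one is a choice, made by the sign of the coordinate of the double piece, and this replaces \<open>k\<close> by \<open>d - k\<close>.\<close>

lemma centre_lifts:
  obtains g h k where "1 \<le> k" "k \<le> d div 2" "lift_of x0 0 d (reg0 d) g" "lift_of x1 1 2 (reg1 2) h"
    "h vst = g (rt d)" "h (- vst) = g (om d k * rt d)" "h ` reg1 2 = gl x1 ` reg1 2"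
proof -
  have d1: "d \<ge> 1" using d2 by simp
  obtain g0 where g0: "lift_of x0 0 d (reg0 d) g0"
    using radial_lift[OF _ x0(2) good_reg0[OF d1]] x0(1) by (auto simp: fibre_def)
  have h0: "lift_of x1 1 2 (reg1 2) (gl x1)" using gl[OF x1(1)] by (simp add: ordx_def)
  have h0p: "gl x1 v \<in> topspace S" "p (gl x1 v) = Some (1 + v ^ 2)" if "v \<in> reg1 2" for v
    using h0 that by (auto simp: lift_of_def continuous_map_def)
  have half: "(1 / 2 :: complex) \<notin> slit" by (simp add: slit_def)
  have "p (gl x1 vst) = Some (1 / 2)" "p (gl x1 (- vst)) = Some (1 / 2)"
    using h0p(2)[OF vst_reg(1)] h0p(2)[OF vst_reg(2)] vst(1) by (simp_all add: power2_minus)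
  then obtain up um where u: "up ^ d = 1 / 2" "gl x1 vst = g0 up" "um ^ d = 1 / 2" "gl x1 (- vst) = g0 um"
    using centre_image[OF g0 h0p(1)[OF vst_reg(1)] _ half] centre_image[OF g0 h0p(1)[OF vst_reg(2)] _ half] by metis
  have "inj_on (gl x1) (reg1 2)" using lift_inj[OF h0 good_reg1] by simp
  then have "gl x1 vst \<noteq> gl x1 (- vst)" using inj_on_eq_iff[OF _ vst_reg(1,2)] vst_neg by blast
  then have ne: "up \<noteq> um" using u by auto
  have "0 ^ d \<noteq> (1 / 2 :: complex)" using d1 by (cases d) simp_all
  then have u0: "up \<noteq> 0" "um \<noteq> 0" using u(1,3) by metis+
  have "(um / up) ^ d = 1" unfolding power_divide u(1,3) by simp
  then have "um / up \<in> {exp (2 * of_real pi * \<i> * of_nat j / of_nat d) | j. j < d}"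
    using complex_roots_unity[OF d1] by blast
  then obtain j where j: "j < d" "um / up = om d j" by blast
  \<comment> \<open>The two points over \<open>1/2\<close> on the double piece differ by a root of unity in the centre coordinate.\<close>
  have umj: "um = om d j * up" using j u0 by (simp add: field_simps)
  have j0: "j \<noteq> 0" using umj ne by (auto intro: ccontr)
  have rot: "lift_of x0 0 d (reg0 d) (\<lambda>v. g0 (u / rt d * v))" if "u ^ d = 1 / 2" for u
  proof (rule lift_rotate[OF g0])
    show e: "(u / rt d) ^ d = 1" unfolding power_divide that roots_of_half(1)[OF d1] by simp
    then have "norm ((u / rt d) ^ d) = 1" by (simp only: norm_one)
    then have "norm (u / rt d) ^ d = 1 ^ d" by (simp only: norm_power power_one)
    then show "norm (u / rt d) = 1" by (rule power_eq_imp_eq_base[OF _ norm_ge_zero zero_le_one]) (rule d1[unfolded One_nat_def Suc_le_eq])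
    show "u / rt d * v \<in> reg0 d" if "v \<in> reg0 d" for v
      using that unfolding reg0_def mem_Collect_eq power_mult_distrib[of "u / rt d" v d] e mult_1_left .
  qed
  have r0: "rt d \<noteq> 0" using roots_of_half(2)[OF d1] .
  show thesis
  proof (cases "2 * j \<le> d")
    case True
    show ?thesis
    proof (rule that[OF _ _ rot[OF u(1)] h0])
      show "1 \<le> j" "j \<le> d div 2" using True j0 by auto
      show "gl x1 vst = g0 (up / rt d * rt d)" using r0 u by simp
      show "gl x1 (- vst) = g0 (up / rt d * (om d j * rt d))" using r0 u umj by (simp add: mult_ac)
    qed simp
  next
    case False
    have h': "lift_of x1 1 2 (reg1 2) (\<lambda>v. gl x1 (- 1 * v))"
      by (rule lift_rotate[OF h0]) (auto simp: reg1_def)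
    show ?thesis
    proof (rule that[OF _ _ rot[OF u(3)] h'])
      show "1 \<le> d - j" "d - j \<le> d div 2" using False j by auto
      show "gl x1 (- 1 * vst) = g0 (um / rt d * rt d)" using r0 u by simp
      have "om d (d - j) * om d j = exp (2 * of_real pi * \<i>)"
        using j d1 by (simp add: of_nat_diff field_simps flip: exp_add)
      then have "om d (d - j) * om d j = 1" by simp
      then have "up = um * om d (d - j)" unfolding umj by (simp add: mult_ac)
      then show "gl x1 (- 1 * - vst) = g0 (um / rt d * (om d (d - j) * rt d))" using r0 u by (simp add: mult_ac)
      show "(\<lambda>v. gl x1 (- 1 * v)) ` reg1 2 = gl x1 ` reg1 2"
      proof -
        have "uminus ` reg1 2 = reg1 2"
        proof (intro equalityI subsetI)
          fix v assume "v \<in> reg1 2"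
          then show "v \<in> uminus ` reg1 2" by (intro image_eqI[of _ _ "- v"]) (auto simp: reg1_def)
        qed (auto simp: reg1_def)
        then have "gl x1 ` uminus ` reg1 2 = gl x1 ` reg1 2" by simp
        then show ?thesis by (simp add: image_image)
      qed
    qed
  qed
qed

text \<open>Each root of \<open>1/2\<close> other than the two on the double piece lies on exactly one simple piece, which provides the indexing.\<close>

lemma normal_form: "\<exists>k g G. 1 \<le> k \<and> k \<le> d div 2 \<and> NF S p d k g G"
proof -
  have d1: "d \<ge> 1" using d2 by simp
  obtain g h k where k: "1 \<le> k" "k \<le> d div 2" and g: "lift_of x0 0 d (reg0 d) g" and h: "lift_of x1 1 2 (reg1 2) h"
    and hg: "h vst = g (rt d)" "h (- vst) = g (om d k * rt d)" and himg: "h ` reg1 2 = gl x1 ` reg1 2"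
    by (rule centre_lifts) blast
  let ?F = "fibre S p (Some 1)"
  have gp: "g u \<in> topspace S" "p (g u) = Some (u ^ d)" if "u \<in> reg0 d" for u
    using g that by (auto simp: lift_of_def continuous_map_def)
  have half: "(1 / 2 :: complex) \<notin> slit" by (simp add: slit_def)
  have rootreg: "u \<in> reg0 d" if "u ^ d = 1 / 2" for u unfolding reg0_def mem_Collect_eq that using half .
  have ginj: "inj_on g (reg0 d)" using lift_inj[OF g good_reg0[OF d1] d1] .
  have hinj: "inj_on h (reg1 2)" using lift_inj[OF h good_reg1] by simp
  have rtd: "rt d ^ d = 1 / 2" "(om d k * rt d) ^ d = 1 / 2"
    using roots_of_half[OF d1] om_power[OF d1] by (simp_all add: power_mult_distrib)
  have glp: "gl x v \<in> topspace S" "p (gl x v) = Some (1 + v ^ ordx x)" if "x \<in> ?F" "v \<in> reg1 (ordx x)" for x v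
    using gl[OF that(1)] that(2) by (auto simp: lift_of_def continuous_map_def)
  have vroot: "v = vst \<or> v = - vst" if "v ^ 2 = - (1 / 2)" for v
    by (rule power2_eq_iff[THEN iffD1]) (simp only: that vst(1))
  have exx: "\<exists>x\<in>?F. x \<noteq> x1 \<and> gl x (- (1 / 2)) = g u" if u: "u \<in> U1 d k" "u \<noteq> rt d" for u
  proof -
    have ur: "u ^ d = 1 / 2" "u \<noteq> om d k * rt d" using u by (auto simp: U1_def)
    have "\<exists>x v. x \<in> ?F \<and> v ^ ordx x = 1 / 2 - 1 \<and> g u = gl x v"
      by (rule one_image[OF gp[OF rootreg[OF ur(1)], unfolded ur(1)]]) (simp add: slit_def)
    then obtain x v where xv: "x \<in> ?F" "v ^ ordx x = - (1 / 2)" "g u = gl x v" by auto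
    have "x \<noteq> x1"
    proof
      assume x: "x = x1"
      then have "v = vst \<or> v = - vst" using xv(2) vroot by (simp add: ordx_def)
      then have "v \<in> reg1 2" using vst_reg by auto
      then have "gl x1 v \<in> h ` reg1 2" using himg by auto
      then obtain w where w: "w \<in> reg1 2" "gl x1 v = h w" by auto
      have "p (h w) = Some (1 + w ^ 2)" using h w(1) by (simp add: lift_of_def)
      moreover have "p (gl x1 v) = Some (1 + v ^ 2)" using glp(2)[OF x1(1)] \<open>v \<in> reg1 2\<close> by (simp add: ordx_def)
      ultimately have "w ^ 2 = - (1 / 2)" using w(2) xv(2) x by (simp add: ordx_def)
      then have "w = vst \<or> w = - vst" by (rule vroot)
      then have "h w = g (rt d) \<or> h w = g (om d k * rt d)" using hg by blast
      then have "g u = g (rt d) \<or> g u = g (om d k * rt d)" using xv(3) w(2) x by simp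
      then show False using inj_on_eq_iff[OF ginj rootreg[OF ur(1)] rootreg[OF rtd(1)]]
          inj_on_eq_iff[OF ginj rootreg[OF ur(1)] rootreg[OF rtd(2)]] u(2) ur(2) by blast
    qed
    then show ?thesis using xv by (intro bexI[of _ x]) (auto simp: ordx_def)
  qed
  define X where "X u = (if u = rt d then x1 else SOME x. x \<in> ?F \<and> x \<noteq> x1 \<and> gl x (- (1 / 2)) = g u)" for u
  have X: "X u \<in> ?F" "X u \<noteq> x1" "gl (X u) (- (1 / 2)) = g u" if u: "u \<in> U1 d k" "u \<noteq> rt d" for u
  proof -
    have "\<exists>x. x \<in> ?F \<and> x \<noteq> x1 \<and> gl x (- (1 / 2)) = g u" using exx[OF u] by blast
    from someI_ex[OF this] show "X u \<in> ?F" "X u \<noteq> x1" "gl (X u) (- (1 / 2)) = g u" using u(2) by (simp_all add: X_def)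
  qed
  have Xrt: "X (rt d) = x1" by (simp add: X_def)
  define G where "G u = (if u = rt d then h else gl (X u))" for u
  have GL: "lift_of (X u) 1 (mm d u) (reg1 (mm d u)) (G u)" if u: "u \<in> U1 d k" for u
  proof (cases "u = rt d")
    case False
    then show ?thesis using gl[OF X(1)[OF u False]] X(2)[OF u False] by (simp add: G_def mm_def ordx_def)
  qed (use h Xrt in \<open>simp add: G_def mm_def\<close>)
  have mm1: "mm d u \<ge> 1" for u by (simp add: mm_def)
  have rtU: "rt d \<in> U1 d k"
  proof -
    have "h vst \<noteq> h (- vst)" using inj_on_eq_iff[OF hinj vst_reg(1,2)] vst_neg by blast
    then have "rt d \<noteq> om d k * rt d" using hg by auto
    then show ?thesis using rtd by (simp add: U1_def)
  qed
  have Xinj: "u = u'" if u: "u \<in> U1 d k" "u' \<in> U1 d k" and eq: "X u = X u'" for u u'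
  proof (cases "u = rt d \<or> u' = rt d")
    case True
    then show ?thesis using X(2)[OF u(1)] X(2)[OF u(2)] eq Xrt by (cases "u = rt d"; cases "u' = rt d") simp_all
  next
    case False
    then have "g u = g u'" using X(3)[OF u(1)] X(3)[OF u(2)] eq by simp
    then show ?thesis using ginj rootreg u by (auto simp: U1_def dest!: inj_onD)
  qed
  have "NF S p d k g G" unfolding NF_def
  proof (intro conjI ballI impI allI)
    show "emb S (reg0 d) g" by (rule lift_emb[OF g good_reg0[OF d1] d1])
    show "p (g u) = Some (u ^ d)" if "u \<in> reg0 d" for u using gp that by blast
    show "emb S (reg1 (mm d u)) (G u)" if "u \<in> U1 d k" for u by (rule lift_emb[OF GL[OF that] good_reg1[OF mm1] mm1])
    show "p (G u v) = Some (1 + v ^ mm d u)" if "u \<in> U1 d k" "v \<in> reg1 (mm d u)" for u v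
      using GL[OF that(1)] that(2) by (simp add: lift_of_def)
    show "G u (vbase d u) = g u" if "u \<in> U1 d k" for u
      using X(3)[OF that] hg by (auto simp: G_def vbase_def)
    show "G (rt d) (- vst) = g (om d k * rt d)" using hg by (simp add: G_def)
    show "rt d \<in> U1 d k" by (rule rtU)
    show "z \<in> g ` reg0 d" if "z \<in> topspace S" "p z = Some y" "y \<notin> slit" for z y
      using centre_image[OF g that] that(3) by (auto simp: reg0_def)
    show "G u ` reg1 (mm d u) \<inter> G u' ` reg1 (mm d u') = {}" if u: "u \<in> U1 d k" "u' \<in> U1 d k" "u \<noteq> u'" for u u'
      using pieces_disjoint[OF GL[OF u(1)] GL[OF u(2)] mm1 mm1] Xinj[OF u(1,2)] u(3) by fastforce
    fix z assume z: "z \<in> topspace S" "p z \<noteq> None"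
    then obtain y where y: "p z = Some y" by auto
    show "z \<in> g ` reg0 d \<or> (\<exists>u\<in>U1 d k. z \<in> G u ` reg1 (mm d u))"
    proof (cases "y \<in> slit")
      case False
      then show ?thesis using centre_image[OF g z(1) y] by (auto simp: reg0_def)
    next
      case True
      then have ns: "- (y - 1) \<notin> slit" by (auto simp: slit_def)
      obtain x v where xv: "x \<in> ?F" "v ^ ordx x = y - 1" "z = gl x v" using one_image[OF z(1) y ns] by blast
      have vr: "v \<in> reg1 (ordx x)" using xv(2) ns by (simp add: reg1_def)
      show ?thesis
      proof (cases "x = x1")
        case True
        then have "z \<in> h ` reg1 2" using himg xv(3) vr by (auto simp: ordx_def)
        then show ?thesis using rtU by (intro disjI2 bexI[of _ "rt d"]) (simp_all add: G_def mm_def)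
      next
        case False
        then have o1: "ordx x = 1" by (simp add: ordx_def)
        have b: "- (1 / 2) \<in> reg1 (ordx x)" using vst_reg o1 by simp
        have "p (gl x (- (1 / 2))) = Some (1 / 2)" using glp(2)[OF xv(1) b] o1 by simp
        then obtain u where u: "u ^ d = 1 / 2" "gl x (- (1 / 2)) = g u"
          using centre_image[OF g glp(1)[OF xv(1) b] _ half] by blast
        have notx1: "g u \<noteq> h w" if "w \<in> reg1 2" for w
        proof
          assume "g u = h w"
          then have "x = x1" using pieces_disjoint[OF gl[OF xv(1)] h ordx(2) _ b that] u(2) by simp
          then show False using False by simp
        qed
        have ne: "u \<noteq> om d k * rt d" "u \<noteq> rt d"
          using notx1[OF vst_reg(2)] notx1[OF vst_reg(1)] hg by auto
        then have uU: "u \<in> U1 d k" using u by (simp add: U1_def)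
        have b': "- (1 / 2) \<in> reg1 (ordx (X u))" using X(2)[OF uU ne(2)] vst_reg by (simp add: ordx_def)
        have "X u = x"
          by (rule pieces_disjoint[OF gl[OF X(1)[OF uU ne(2)]] gl[OF xv(1)] ordx(2) ordx(2) b' b])
             (use X(3)[OF uU ne(2)] u(2) in simp)
        then have "z \<in> G u ` reg1 (mm d u)" using xv(3) vr o1 ne by (simp add: G_def mm_def)
        then show ?thesis using uU by blast
      qed
    qed
  qed
  then show ?thesis using k by blast
qed

end

text \<open>The overlap of the double piece with the centre piece has two components, the upper region below and its negative, with base points \<open>\<plusminus> vst\<close>; the overlap of a simple piece is connected with base point \<open>- 1/2\<close>. Both are star-shaped.\<close>

definition Qa :: "complex set" where "Qa = {v. 0 < Im v \<and> (Re v = 0 \<longrightarrow> Im v < 1)}"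
definition Qb :: "complex set" where "Qb = {v. Im v \<noteq> 0 \<or> (- 1 < Re v \<and> Re v < 0)}"

lemma connected_Qa: "connected Qa"
proof (rule starlike_imp_connected)
  show "starlike Qa" unfolding starlike_def
  proof (intro bexI[of _ "\<i> / 2"] ballI)
    show "\<i> / 2 \<in> Qa" by (simp add: Qa_def)
    fix v assume v: "v \<in> Qa"
    show "closed_segment (\<i> / 2) v \<subseteq> Qa"
    proof
      fix w assume "w \<in> closed_segment (\<i> / 2) v"
      then obtain t where t: "0 \<le> t" "t \<le> 1" "w = (1 - t) *\<^sub>R (\<i> / 2) + t *\<^sub>R v" by (auto simp: closed_segment_def)
      have w: "Re w = t * Re v" "Im w = (1 - t) / 2 + t * Im v" by (simp_all add: t(3))
      have v': "0 < Im v" "Re v = 0 \<Longrightarrow> Im v < 1" using v by (auto simp: Qa_def)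
      show "w \<in> Qa"
      proof (cases "t = 0")
        case False
        then have tp: "0 < t" using t by simp
        have "0 < t * Im v" using tp v' by simp
        then have "0 < Im w" unfolding w(2) diff_divide_distrib using t(2) by linarith
        moreover have "Im w < 1" if "Re w = 0"
        proof -
          have "Im v < 1" using that tp v' unfolding w(1) by simp
          then have "t * Im v < t" using tp by simp
          then show ?thesis unfolding w(2) diff_divide_distrib using t(1,2) by linarith
        qed
        ultimately show ?thesis by (simp add: Qa_def)
      qed (use w(2) in \<open>simp add: Qa_def\<close>)
    qed
  qed
qed

lemma connected_Qb: "connected Qb"
proof (rule starlike_imp_connected)
  show "starlike Qb" unfolding starlike_def
  proof (intro bexI[of _ "- (1 / 2)"] ballI)
    show "- (1 / 2) \<in> Qb" by (simp add: Qb_def)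
    fix v assume v: "v \<in> Qb"
    show "closed_segment (- (1 / 2)) v \<subseteq> Qb"
    proof
      fix w assume "w \<in> closed_segment (- (1 / 2)) v"
      then obtain t where t: "0 \<le> t" "t \<le> 1" "w = (1 - t) *\<^sub>R (- (1 / 2)) + t *\<^sub>R v" by (auto simp: closed_segment_def)
      have w: "Re w = - ((1 - t) / 2) + t * Re v" "Im w = t * Im v" by (simp_all add: t(3))
      show "w \<in> Qb"
      proof (cases "Im w = 0 \<and> t \<noteq> 0")
        case True
        then have "Im v = 0" "0 < t" using w(2) t(1) by auto
        then have v': "- 1 < Re v" "Re v < 0" using v by (auto simp: Qb_def)
        have "t * (- 1) < t * Re v" "t * Re v < t * 0" using v' \<open>0 < t\<close> by (simp_all only: mult_less_cancel_left_pos)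
        then have "- 1 < Re w" "Re w < 0" unfolding w(1) diff_divide_distrib using t(1,2) by linarith+
        then show ?thesis by (simp add: Qb_def)
      qed (use w(1,2) in \<open>auto simp: Qb_def\<close>)
    qed
  qed
qed

lemma Qa_facts: "v \<in> Qa \<Longrightarrow> v \<in> reg1 2 \<and> 1 + v ^ 2 \<notin> slit" "v \<in> reg1 2 \<Longrightarrow> 0 < Im v \<Longrightarrow> v \<in> Qa"
proof -
  have sq: "Re (v ^ 2) = (Re v)\<^sup>2 - (Im v)\<^sup>2" "Im (v ^ 2) = 2 * (Re v * Im v)"
    by (simp_all add: power2_eq_square)
  {
    assume "v \<in> Qa"
    then have v: "0 < Im v" "Re v = 0 \<Longrightarrow> Im v < 1" by (auto simp: Qa_def)
    have 1: "- (v ^ 2) \<notin> slit"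
    proof
      assume "- (v ^ 2) \<in> slit"
      then have "Re v = 0" "1 \<le> (Im v)\<^sup>2" using v sq by (auto simp: slit_def)
      then show False using v power_strict_mono[of "Im v" 1 2] by simp
    qed
    have 2: "1 + v ^ 2 \<notin> slit"
    proof
      assume "1 + v ^ 2 \<in> slit"
      then have "Re v = 0" "0 \<le> (Re v)\<^sup>2 - (Im v)\<^sup>2" using v sq by (auto simp: slit_def)
      then show False using v by simp
    qed
    show "v \<in> reg1 2 \<and> 1 + v ^ 2 \<notin> slit" using 1 2 by (simp add: reg1_def)
  }
  {
    assume v: "v \<in> reg1 2" "0 < Im v"
    have "Im v < 1" if "Re v = 0"
    proof (rule ccontr)
      assume "\<not> Im v < 1"
      then have "1 \<le> (Im v)\<^sup>2" by (simp add: one_le_power)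
      then have "- (v ^ 2) \<in> slit" using that sq by (simp add: slit_def)
      then show False using v by (simp add: reg1_def)
    qed
    then show "v \<in> Qa" using v by (simp add: Qa_def)
  }
qed

lemma Qb_facts: "v \<in> Qb \<longleftrightarrow> v \<in> reg1 1 \<and> 1 + v \<notin> slit"
proof -
  have a: "v \<in> reg1 1 \<longleftrightarrow> \<not> (Im v = 0 \<and> 1 \<le> - Re v)"
    by (simp only: reg1_def slit_def mem_Collect_eq power_one_right uminus_complex.sel neg_equal_0_iff_equal)
  have b: "1 + v \<in> slit \<longleftrightarrow> Im v = 0 \<and> 1 \<le> 1 + Re v"
    by (simp only: slit_def mem_Collect_eq plus_complex.sel one_complex.sel add_0_left)
  have "(1 \<le> - Re v) = (\<not> - 1 < Re v)" "(1 \<le> 1 + Re v) = (\<not> Re v < 0)" by linarith+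
  then show ?thesis unfolding a b Qb_def mem_Collect_eq by blast
qed

lemma NFD:
  assumes "NF S p d k g G"
  shows "emb S (reg0 d) g" "\<And>u. u \<in> reg0 d \<Longrightarrow> p (g u) = Some (u ^ d)"
    "\<And>u. u \<in> U1 d k \<Longrightarrow> emb S (reg1 (mm d u)) (G u)"
    "\<And>u v. u \<in> U1 d k \<Longrightarrow> v \<in> reg1 (mm d u) \<Longrightarrow> p (G u v) = Some (1 + v ^ mm d u)"
    "\<And>u. u \<in> U1 d k \<Longrightarrow> G u (vbase d u) = g u"
    "G (rt d) (- vst) = g (om d k * rt d)" "rt d \<in> U1 d k"
    "\<And>z y. z \<in> topspace S \<Longrightarrow> p z = Some y \<Longrightarrow> y \<notin> slit \<Longrightarrow> z \<in> g ` reg0 d"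
    "\<And>u u'. u \<in> U1 d k \<Longrightarrow> u' \<in> U1 d k \<Longrightarrow> u \<noteq> u' \<Longrightarrow> G u ` reg1 (mm d u) \<inter> G u' ` reg1 (mm d u') = {}"
    "\<And>z. z \<in> topspace S \<Longrightarrow> p z \<noteq> None \<Longrightarrow> z \<in> g ` reg0 d \<or> (\<exists>u\<in>U1 d k. z \<in> G u ` reg1 (mm d u))"
proof -
  note a1 = assms[unfolded NF_def]
  note a2 = a1[THEN conjunct2] note a3 = a2[THEN conjunct2] note a4 = a3[THEN conjunct2] note a5 = a4[THEN conjunct2]
  note a6 = a5[THEN conjunct2] note a7 = a6[THEN conjunct2] note a8 = a7[THEN conjunct2]
  show "emb S (reg0 d) g" by (rule a1[THEN conjunct1])
  show "p (g u) = Some (u ^ d)" if "u \<in> reg0 d" for u by (rule a2[THEN conjunct1, THEN bspec, OF that])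
  note b = a3[THEN conjunct1, THEN bspec]
  show "emb S (reg1 (mm d u)) (G u)" if "u \<in> U1 d k" for u by (rule b[OF that, THEN conjunct1])
  show "p (G u v) = Some (1 + v ^ mm d u)" if "u \<in> U1 d k" "v \<in> reg1 (mm d u)" for u v
    by (rule b[OF that(1), THEN conjunct2, THEN conjunct1, THEN bspec, OF that(2)])
  show "G u (vbase d u) = g u" if "u \<in> U1 d k" for u by (rule b[OF that, THEN conjunct2, THEN conjunct2])
  show "G (rt d) (- vst) = g (om d k * rt d)" by (rule a4[THEN conjunct1])
  show "rt d \<in> U1 d k" by (rule a5[THEN conjunct1])
  show "z \<in> g ` reg0 d" if "z \<in> topspace S" "p z = Some y" "y \<notin> slit" for z y
    by (rule a6[THEN conjunct1, THEN bspec, OF that(1), THEN spec, THEN mp, OF that(2), THEN mp, OF that(3)])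
  show "G u ` reg1 (mm d u) \<inter> G u' ` reg1 (mm d u') = {}" if "u \<in> U1 d k" "u' \<in> U1 d k" "u \<noteq> u'" for u u'
    by (rule a7[THEN conjunct1, THEN bspec, OF that(1), THEN bspec, OF that(2), THEN mp, OF that(3)])
  show "z \<in> g ` reg0 d \<or> (\<exists>u\<in>U1 d k. z \<in> G u ` reg1 (mm d u))" if "z \<in> topspace S" "p z \<noteq> None" for z
    by (rule a8[THEN bspec, OF that(1), THEN mp, OF that(2)])
qed

text \<open>On a connected part of the overlap the coordinate change is the same in both covers: apply it to the second cover, and use that the result and the second piece are lifts of the same map which agree at the base point.\<close>

lemma NF_overlap:
  assumes S: "tpc S p d" "tpc S' p' d" and N: "NF S p d k g G" "NF S' p' d k g' G'" and u: "u \<in> U1 d k"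
    and Q: "connected Q" "\<And>v. v \<in> Q \<Longrightarrow> v \<in> reg1 (mm d u) \<and> 1 + v ^ mm d u \<notin> slit"
    and w: "w \<in> Q" "b \<in> reg0 d" "G u w = g b" "G' u w = g' b"
    and v: "v \<in> Q" "a \<in> reg0 d" "G u v = g a"
  shows "G' u v = g' a"
proof -
  interpret S: tpc S p d by (rule S)
  interpret S': tpc S' p' d by (rule S)
  let ?m = "mm d u"
  note e = NFD(1)[OF N(1)] NFD(3)[OF N(1) u] NFD(1)[OF N(2)] NFD(3)[OF N(2) u]
  note pg = NFD(2)[OF N(1)] NFD(2)[OF N(2)] and pG = NFD(4)[OF N(1) u] NFD(4)[OF N(2) u] and cov = NFD(8)[OF N(1)]
  have ginj: "inj_on g (reg0 d)" using e(1) by (simp add: emb_def)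
  let ?i = "inv_into (reg0 d) g"
  have cG: "continuous_map (top_of_set Q) S (G u)" "continuous_map (top_of_set Q) S' (G' u)"
    using e(2,4) Q(2) by (auto simp: emb_def intro: continuous_map_on_subset)
  have Gim: "G u v \<in> g ` reg0 d" if "v \<in> Q" for v
  proof (rule cov)
    show "G u v \<in> topspace S" using cG(1) that by (auto simp: continuous_map_def)
    show "p (G u v) = Some (1 + v ^ ?m)" "1 + v ^ ?m \<notin> slit" using pG(1) Q(2)[OF that] by auto
  qed
  have iv: "?i (G u v) \<in> reg0 d" "g (?i (G u v)) = G u v" if "v \<in> Q" for v
    using Gim[OF that] by (auto simp: inv_into_into f_inv_into_f)
  have iu: "?i (g a) = a" if "a \<in> reg0 d" for a by (rule inv_into_f_f[OF ginj that])
  have "continuous_map (top_of_set Q) (subtopology S (g ` reg0 d)) (G u)"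
    using cG(1) Gim by (auto simp: continuous_map_in_subtopology)
  from continuous_map_compose[OF this emb_inv(1)[OF e(1)]]
  have "continuous_map (top_of_set Q) (top_of_set (reg0 d)) (\<lambda>v. ?i (G u v))" by (simp add: o_def)
  moreover have "continuous_map (top_of_set (reg0 d)) S' g'" using e(3) by (simp add: emb_def)
  ultimately have "continuous_map (top_of_set Q) S' (g' \<circ> (\<lambda>v. ?i (G u v)))" by (rule continuous_map_compose)
  then have c: "continuous_map (top_of_set Q) S' (\<lambda>v. g' (?i (G u v)))" by (simp add: o_def)
  have pow: "?i (G u v) ^ d = 1 + v ^ ?m" if "v \<in> Q" for v
    using pg(1)[OF iv(1)[OF that]] iv(2)[OF that] pG(1)[of v] Q(2)[OF that] by simp
  have "G' u v = g' (?i (G u v))"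
  proof (rule unique_lift_set[where p = p' and T = Q and ?t0.0 = w and t = v and s = "G' u" and s' = "\<lambda>v. g' (?i (G u v))",
        OF S'.bc(2) Q(1) cG(2) c])
    fix t assume t: "t \<in> Q"
    have 1: "p' (G' u t) = Some (1 + t ^ ?m)" using pG(2) Q(2)[OF t] by blast
    then show "p' (G' u t) = p' (g' (?i (G u t)))" using pg(2)[OF iv(1)[OF t]] pow[OF t] by simp
    have nz: "1 + t ^ ?m \<noteq> 0"
    proof
      assume "1 + t ^ ?m = 0"
      then have "- (t ^ ?m) = 1" by (simp add: add_eq_0_iff)
      then have "- (t ^ ?m) \<in> slit" by (simp only:) (simp add: slit_def)
      then show False using Q(2)[OF t] by (simp add: reg1_def)
    qed
    have "1 + t ^ ?m \<noteq> 1" using Q(2)[OF t] by (auto simp: slit_def)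
    moreover have "G' u t \<in> topspace S'" using cG(2) t by (auto simp: continuous_map_def)
    ultimately show "locinj S' p' (G' u t)" using S'.generic_locinj[OF _ 1 nz] by blast
  qed (use w v iu in auto)
  then show ?thesis using v(3) iu[OF v(2)] by simp
qed

lemma NF_agree:
  assumes S: "tpc S p d" "tpc S' p' d" and N: "NF S p d k g G" "NF S' p' d k g' G'" and u: "u \<in> U1 d k" and d: "d \<ge> 1"
    and v: "v \<in> reg1 (mm d u)" "a \<in> reg0 d" "G u v = g a"
  shows "G' u v = g' a"
proof -
  have rtd: "rt d ^ d = 1 / 2" "(om d k * rt d) ^ d = 1 / 2"
    using roots_of_half[OF d] om_power[OF d] by (simp_all add: power_mult_distrib)
  have root: "b \<in> reg0 d" if "b ^ d = 1 / 2" for b unfolding reg0_def mem_Collect_eq that by (simp add: slit_def)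
  have ub: "u \<in> reg0 d" using u by (intro root) (simp add: U1_def)
  have base: "G u (vbase d u) = g u" "G' u (vbase d u) = g' u" using NFD(5)[OF N(1) u] NFD(5)[OF N(2) u] by blast+
  have base2: "G (rt d) (- vst) = g (om d k * rt d)" "G' (rt d) (- vst) = g' (om d k * rt d)" using NFD(6)[OF N(1)] NFD(6)[OF N(2)] by blast+
  have "p (G u v) = Some (1 + v ^ mm d u)" "p (g a) = Some (a ^ d)" using NFD(4)[OF N(1) u v(1)] NFD(2)[OF N(1) v(2)] by blast+
  then have ns: "1 + v ^ mm d u \<notin> slit" using v by (simp add: reg0_def)
  show ?thesis
  proof (cases "u = rt d")
    case False
    then have m: "mm d u = 1" "vbase d u = - (1 / 2)" by (simp_all add: mm_def vbase_def)
    show ?thesis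
    proof (rule NF_overlap[OF S N u connected_Qb _ _ ub _ _ _ v(2,3)])
      show "v \<in> reg1 (mm d u) \<and> 1 + v ^ mm d u \<notin> slit" if "v \<in> Qb" for v using that by (simp add: m Qb_facts)
      show "- (1 / 2) \<in> Qb" by (simp add: Qb_def)
      show "G u (- (1 / 2)) = g u" "G' u (- (1 / 2)) = g' u" using base m by simp_all
      show "v \<in> Qb" using v(1) ns by (simp add: m Qb_facts)
    qed
  next
    case True
    then have m: "mm d u = 2" "vbase d u = vst" by (simp_all add: mm_def vbase_def)
    have "Im v \<noteq> 0"
    proof
      assume "Im v = 0"
      then have "1 + v ^ 2 \<in> slit" by (simp add: slit_def power2_eq_square)
      then show False using ns m by simp
    qed
    then consider "0 < Im v" | "0 < Im (- v)" by fastforce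
    then show ?thesis
    proof cases
      case 1
      show ?thesis
      proof (rule NF_overlap[OF S N u connected_Qa _ _ ub _ _ _ v(2,3)])
        show "v \<in> reg1 (mm d u) \<and> 1 + v ^ mm d u \<notin> slit" if "v \<in> Qa" for v using Qa_facts(1)[OF that] by (simp add: m)
        show "vst \<in> Qa" by (simp add: Qa_def)
        show "G u vst = g u" "G' u vst = g' u" using base m by simp_all
        show "v \<in> Qa" using Qa_facts(2) v(1) 1 by (simp add: m)
      qed
    next
      case 2
      have con: "connected (uminus ` Qa)" by (intro connected_continuous_image connected_Qa continuous_intros)
      show ?thesis
      proof (rule NF_overlap[OF S N u con _ _ root[OF rtd(2)] _ _ _ v(2,3)])
        show "v \<in> reg1 (mm d u) \<and> 1 + v ^ mm d u \<notin> slit" if "v \<in> uminus ` Qa" for v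
          using that Qa_facts(1) by (auto simp: m reg1_def)
        show "- vst \<in> uminus ` Qa" by (auto simp: Qa_def)
        show "G u (- vst) = g (om d k * rt d)" "G' u (- vst) = g' (om d k * rt d)" using base2 True by simp_all
        have "- v \<in> Qa" using Qa_facts(2)[of "- v"] v(1) 2 by (simp add: m reg1_def)
        then show "v \<in> uminus ` Qa" by force
      qed
    qed
  qed
qed

section \<open>Isomorphism of covers with equal normal form\<close>

definition finpart :: "'s topology \<Rightarrow> ('s \<Rightarrow> complex option) \<Rightarrow> 's set" where
  "finpart S p = {z \<in> topspace S. p z \<noteq> None}"

text \<open>The identity in the coordinates of the pieces is well defined, because the coordinate changes agree.\<close>

lemma NF_map:
  assumes S: "tpc S p d" "tpc S' p' d" and N: "NF S p d k g G" "NF S' p' d k g' G'" and d: "d \<ge> 1"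
  obtains h where "continuous_map (subtopology S (finpart S p)) S' h"
    "\<And>a. a \<in> reg0 d \<Longrightarrow> h (g a) = g' a" "\<And>u v. u \<in> U1 d k \<Longrightarrow> v \<in> reg1 (mm d u) \<Longrightarrow> h (G u v) = G' u v"
proof -
  let ?X = "subtopology S (finpart S p)" and ?I = "insert None (Some ` U1 d k)"
  define T where "T = case_option (g ` reg0 d) (\<lambda>u. G u ` reg1 (mm d u))"
  define f where "f = case_option (\<lambda>z. g' (inv_into (reg0 d) g z)) (\<lambda>u z. G' u (inv_into (reg1 (mm d u)) (G u) z))"
  have inj: "inj_on g (reg0 d)" "\<And>u. u \<in> U1 d k \<Longrightarrow> inj_on (G u) (reg1 (mm d u))"
    using NFD(1,3)[OF N(1)] by (auto simp: emb_def)
  have f0: "f None (g a) = g' a" if "a \<in> reg0 d" for a using inv_into_f_f[OF inj(1) that] by (simp add: f_def)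
  have f1: "f (Some u) (G u v) = G' u v" if "u \<in> U1 d k" "v \<in> reg1 (mm d u)" for u v
    using inv_into_f_f[OF inj(2)[OF that(1)] that(2)] by (simp add: f_def)
  have oT: "openin S (T i)" if "i \<in> ?I" for i
    using that emb_inv(2)[OF NFD(1)[OF N(1)]] emb_inv(2)[OF NFD(3)[OF N(1)]] by (auto simp: T_def)
  have TS: "T i \<subseteq> finpart S p" if "i \<in> ?I" for i
  proof
    fix z assume z: "z \<in> T i"
    have "z \<in> topspace S" using openin_subset[OF oT[OF that]] z by blast
    moreover have "p z \<noteq> None" using that z NFD(2,4)[OF N(1)] by (auto simp: T_def)
    ultimately show "z \<in> finpart S p" by (simp add: finpart_def)
  qed
  have cov: "\<exists>i\<in>?I. z \<in> T i" if "z \<in> finpart S p" for z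
    using NFD(10)[OF N(1), of z] that by (auto simp: finpart_def T_def)
  obtain h where h: "continuous_map ?X S' h" "\<And>x i. i \<in> ?I \<Longrightarrow> x \<in> topspace ?X \<inter> T i \<Longrightarrow> h x = f i x"
  proof (rule pasting_lemma_exists[where X = ?X and Y = S' and I = ?I and T = T and f = f])
    show "topspace ?X \<subseteq> \<Union> (T ` ?I)" using cov by auto
    show "openin ?X (T i)" if "i \<in> ?I" for i
      using oT[OF that] TS[OF that] by (metis openin_subtopology inf.absorb1)
    show "continuous_map (subtopology ?X (T i)) S' (f i)" if i: "i \<in> ?I" for i
    proof -
      have e: "subtopology ?X (T i) = subtopology S (T i)" using TS[OF i] by (simp add: subtopology_subtopology inf.absorb2)
      show ?thesis unfolding e
      proof (cases i)
        case None
        have "continuous_map (top_of_set (reg0 d)) S' g'" using NFD(1)[OF N(2)] by (simp add: emb_def)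
        from continuous_map_compose[OF emb_inv(1)[OF NFD(1)[OF N(1)]] this]
        show "continuous_map (subtopology S (T i)) S' (f i)" by (simp add: None T_def f_def o_def)
      next
        case (Some u)
        then have u: "u \<in> U1 d k" using i by auto
        have "continuous_map (top_of_set (reg1 (mm d u))) S' (G' u)" using NFD(3)[OF N(2) u] by (simp add: emb_def)
        from continuous_map_compose[OF emb_inv(1)[OF NFD(3)[OF N(1) u]] this]
        show "continuous_map (subtopology S (T i)) S' (f i)" by (simp add: Some T_def f_def o_def)
      qed
    qed
    have mix: "f None x = f (Some u) x" if u: "u \<in> U1 d k" and x: "x \<in> T None" "x \<in> T (Some u)" for x u
    proof -
      obtain a v where a: "a \<in> reg0 d" "x = g a" and v: "v \<in> reg1 (mm d u)" "x = G u v" using x by (auto simp: T_def)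
      show ?thesis using NF_agree[OF S N u d v(1) a(1)] f0[OF a(1)] f1[OF u v(1)] a v by simp
    qed
    show "f i x = f j x" if ij: "i \<in> ?I" "j \<in> ?I" and x: "x \<in> topspace ?X \<inter> T i \<inter> T j" for i j x
    proof (cases i)
      case None
      then show ?thesis using mix ij x by (cases j) auto
    next
      case (Some u)
      then have u: "u \<in> U1 d k" using ij by auto
      show ?thesis
      proof (cases j)
        case None
        then show ?thesis using mix[OF u, of x] Some x by simp
      next
        case (Some u')
        then have u': "u' \<in> U1 d k" using ij by auto
        have "u = u'"
        proof (rule ccontr)
          assume "u \<noteq> u'"
          then show False using NFD(9)[OF N(1) u u'] x \<open>i = Some u\<close> Some by (auto simp: T_def)
        qed
        then show ?thesis using \<open>i = Some u\<close> Some by simp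
      qed
    qed
  qed blast
  have tX: "topspace ?X = finpart S p" by (auto simp: finpart_def)
  show thesis
  proof (rule that[OF h(1)])
    fix a assume a: "a \<in> reg0 d"
    then have "g a \<in> T None" by (simp add: T_def)
    then show "h (g a) = g' a" using h(2)[of None "g a"] TS[of None] f0[OF a] unfolding tX by auto
  next
    fix u v assume u: "u \<in> U1 d k" and v: "v \<in> reg1 (mm d u)"
    then have "G u v \<in> T (Some u)" by (simp add: T_def)
    then show "h (G u v) = G' u v" using h(2)[of "Some u" "G u v"] TS[of "Some u"] u f1[OF u v] unfolding tX by auto
  qed
qed

context tpc begin

lemma small_ball:
  assumes "continuous_map (top_of_set (ball (0::complex) r)) S \<psi>" "r > 0" "openin S T" "\<psi> 0 \<in> T"
  obtains e where "e > 0" "e \<le> r" "\<psi> ` ball (0::complex) e \<subseteq> T"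
proof -
  have "openin (top_of_set (ball 0 r)) {v \<in> topspace (top_of_set (ball 0 r)). \<psi> v \<in> T}"
    by (rule openin_continuous_map_preimage[OF assms(1,3)])
  then have "openin (top_of_set (ball 0 r)) {v \<in> ball 0 r. \<psi> v \<in> T}" by simp
  then have "open {v \<in> ball 0 r. \<psi> v \<in> T}" by (rule openin_open_trans[OF _ open_ball])
  moreover have "0 \<in> {v \<in> ball 0 r. \<psi> v \<in> T}" using assms(2,4) by simp
  ultimately obtain e where "e > 0" "ball 0 e \<subseteq> {v \<in> ball 0 r. \<psi> v \<in> T}" using openE by blast
  then show thesis by (intro that[of "min e r"]) (use assms(2) in auto)
qed

lemma none_chart:
  assumes "x \<in> topspace S" "p x = None"
  obtains r \<psi> where "r > 0" "continuous_map (top_of_set (ball (0::complex) r)) S \<psi>" "\<psi> 0 = x"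
    "\<And>W. open W \<Longrightarrow> W \<subseteq> ball (0::complex) r \<Longrightarrow> openin S (\<psi> ` W)" "\<And>v. v \<in> ball (0::complex) r \<Longrightarrow> v \<noteq> 0 \<Longrightarrow> \<psi> v \<in> finpart S p"
proof -
  obtain r \<psi> where \<psi>: "r > 0" "continuous_map (top_of_set (ball (0::complex) r)) S \<psi>" "\<psi> 0 = x"
    "\<And>W. open W \<Longrightarrow> W \<subseteq> ball (0::complex) r \<Longrightarrow> openin S (\<psi> ` W)"
    "\<And>v. v \<in> ball 0 r \<Longrightarrow> p (\<psi> v) = sphere_param (p x) (v ^ ram_order S p x)"
    by (rule ram_chart[OF ramified[OF assms(1)]]) blast
  show thesis
  proof (rule that[OF \<psi>(1-4)])
    fix v assume v: "v \<in> ball (0::complex) r" "v \<noteq> 0"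
    have "\<psi> v \<in> topspace S" using \<psi>(2) v(1) by (auto simp: continuous_map_def)
    then show "\<psi> v \<in> finpart S p" using \<psi>(5)[OF v(1)] v(2) assms(2) by (simp add: finpart_def)
  qed
qed

lemma finpart_dense: "topspace S \<subseteq> S closure_of finpart S p"
proof
  fix x assume x: "x \<in> topspace S"
  show "x \<in> S closure_of finpart S p"
  proof (cases "p x = None")
    case False
    then have "x \<in> finpart S p" using x by (simp add: finpart_def)
    then show ?thesis using closure_of_subset[of "finpart S p" S] by (auto simp: finpart_def)
  next
    case True
    obtain r \<psi> where \<psi>: "r > 0" "continuous_map (top_of_set (ball (0::complex) r)) S \<psi>" "\<psi> 0 = x"
      "\<And>v. v \<in> ball (0::complex) r \<Longrightarrow> v \<noteq> 0 \<Longrightarrow> \<psi> v \<in> finpart S p" by (rule none_chart[OF x True]) blast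
    show ?thesis unfolding in_closure_of
    proof (intro conjI allI impI x)
      fix T assume T: "x \<in> T \<and> openin S T"
      obtain e where e: "e > 0" "e \<le> r" "\<psi> ` ball (0::complex) e \<subseteq> T"
        by (rule small_ball[OF \<psi>(2,1), of T]) (use T \<psi>(3) in auto)
      let ?v = "complex_of_real (e / 2)"
      have "?v \<in> ball 0 e" "?v \<noteq> 0" using e(1) by auto
      then show "\<exists>y. y \<in> finpart S p \<and> y \<in> T" using \<psi>(4)[of ?v] e(2,3) by (intro exI[of _ "\<psi> ?v"]) auto
    qed
  qed
qed

end

lemma disjoint_neighbourhoods:
  assumes S: "Hausdorff_space S" and F: "finite F" "F \<subseteq> topspace S"
  obtains N where "\<And>y. y \<in> F \<Longrightarrow> openin S (N y)" "\<And>y. y \<in> F \<Longrightarrow> y \<in> N y"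
    "\<And>y y'. y \<in> F \<Longrightarrow> y' \<in> F \<Longrightarrow> y \<noteq> y' \<Longrightarrow> N y \<inter> N y' = {}"
proof -
  have ex: "\<exists>W. openin S (fst W) \<and> openin S (snd W) \<and> y \<in> fst W \<and> y' \<in> snd W \<and> fst W \<inter> snd W = {}"
    if y: "y \<in> F" "y' \<in> F" "y \<noteq> y'" for y y'
  proof -
    obtain U V where "openin S U" "openin S V" "y \<in> U" "y' \<in> V" "disjnt U V"
      using S[unfolded Hausdorff_space_def, rule_format, of y y'] subsetD[OF F(2) y(1)] subsetD[OF F(2) y(2)] y(3) by metis
    then show ?thesis by (intro exI[of _ "(U, V)"]) (simp add: disjnt_def)
  qed
  define W where "W y y' = (SOME W. openin S (fst W) \<and> openin S (snd W) \<and> y \<in> fst W \<and> y' \<in> snd W \<and> fst W \<inter> snd W = {})" for y y'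
  have W: "openin S (fst (W y y')) \<and> openin S (snd (W y y')) \<and>
      y \<in> fst (W y y') \<and> y' \<in> snd (W y y') \<and> fst (W y y') \<inter> snd (W y y') = {}"
    if y: "y \<in> F" "y' \<in> F" "y \<noteq> y'" for y y'
    unfolding W_def by (rule someI_ex) (rule ex[OF y])
  define N where "N y = (\<Inter>y'\<in>F - {y}. fst (W y y') \<inter> snd (W y' y)) \<inter> topspace S" for y
  show thesis
  proof (rule that[of N])
    show "openin S (N y)" if "y \<in> F" for y
      unfolding N_def by (rule openin_INT) (use F(1) W that in auto)
    show "y \<in> N y" if "y \<in> F" for y using W that F(2) by (auto simp: N_def)
    show "N y \<inter> N y' = {}" if y: "y \<in> F" "y' \<in> F" "y \<noteq> y'" for y y'
    proof -
      have "N y \<subseteq> fst (W y y')" "N y' \<subseteq> snd (W y y')" using y by (auto simp: N_def)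
      then show ?thesis using W[OF y] by blast
    qed
  qed
qed

text \<open>Let \<open>x\<close> lie over infinity. The image of a small punctured disc about \<open>x\<close> is connected and close to the fibre over infinity of the target, which is finite; so it stays near a single point, and this point is the limit. Limits at all missing points suffice as the target is regular.\<close>

lemma extend_over_infinity:
  assumes S: "tpc S p d" "tpc S' p' d" and fin: "finite (fibre S' p' None)"
    and h: "continuous_map (subtopology S (finpart S p)) S' h" "\<And>z. z \<in> finpart S p \<Longrightarrow> p' (h z) = p z"
  obtains H where "continuous_map S S' H" "\<And>z. z \<in> finpart S p \<Longrightarrow> H z = h z" "\<And>z. z \<in> topspace S \<Longrightarrow> p' (H z) = p z"
proof -
  interpret A: tpc S p d by (rule S)
  interpret B: tpc S' p' d by (rule S)
  let ?C = "finpart S p" and ?F = "fibre S' p' None"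
  have tC: "topspace (subtopology S ?C) = ?C" by (auto simp: finpart_def)
  have hS: "h z \<in> topspace S'" if "z \<in> ?C" for z using h(1) that unfolding continuous_map_def tC by auto
  have Ft: "?F \<subseteq> topspace S'" by (auto simp: fibre_def)
  obtain N where N: "\<And>y. y \<in> ?F \<Longrightarrow> openin S' (N y)" "\<And>y. y \<in> ?F \<Longrightarrow> y \<in> N y"
    "\<And>y y'. y \<in> ?F \<Longrightarrow> y' \<in> ?F \<Longrightarrow> y \<noteq> y' \<Longrightarrow> N y \<inter> N y' = {}"
    by (rule disjoint_neighbourhoods[OF B.bc(2) fin Ft]) blast
  have lim: "\<exists>l. limitin S' h l (atin_within S x ?C)" if xT: "x \<in> topspace S - ?C" for x
  proof -
    have x: "x \<in> topspace S" "p x = None" using xT by (auto simp: finpart_def)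
    obtain r \<psi> where \<psi>: "r > 0" "continuous_map (top_of_set (ball (0::complex) r)) S \<psi>" "\<psi> 0 = x"
      "\<And>W. open W \<Longrightarrow> W \<subseteq> ball (0::complex) r \<Longrightarrow> openin S (\<psi> ` W)" "\<And>v. v \<in> ball (0::complex) r \<Longrightarrow> v \<noteq> 0 \<Longrightarrow> \<psi> v \<in> ?C"
      by (rule A.none_chart[OF x]) blast
    have key: "\<exists>e>0. e \<le> r \<and> (\<forall>v\<in>ball 0 e. v \<noteq> 0 \<longrightarrow> h (\<psi> v) \<in> M)" if M: "openin S' M" "?F \<subseteq> M" for M
    proof -
      obtain W where W: "openin riemann_sphere W" "None \<in> W" "\<And>z. z \<in> topspace S' \<Longrightarrow> p' z \<in> W \<Longrightarrow> z \<in> M"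
        by (rule B.fibre_nbhd[OF M]) blast
      have "openin S {z \<in> topspace S. p z \<in> W}" by (rule openin_continuous_map_preimage[OF A.bc(3) W(1)])
      then obtain e where e: "e > 0" "e \<le> r" "\<psi> ` ball (0::complex) e \<subseteq> {z \<in> topspace S. p z \<in> W}"
        by (rule A.small_ball[OF \<psi>(2,1)]) (use x W(2) \<psi>(3) in auto)
      have "h (\<psi> v) \<in> M" if v: "v \<in> ball 0 e" "v \<noteq> 0" for v
      proof (rule W(3))
        have c: "\<psi> v \<in> ?C" using \<psi>(5) v e(2) by auto
        show "h (\<psi> v) \<in> topspace S'" by (rule hS[OF c])
        show "p' (h (\<psi> v)) \<in> W" using h(2)[OF c] subsetD[OF e(3) imageI[OF v(1)]] by simp
      qed
      then show ?thesis using e by blast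
    qed
    let ?N = "\<Union>y\<in>?F. N y"
    obtain e0 where e0: "e0 > 0" "e0 \<le> r" "\<And>v. v \<in> ball 0 e0 \<Longrightarrow> v \<noteq> 0 \<Longrightarrow> h (\<psi> v) \<in> ?N"
    proof -
      have "openin S' ?N" using N(1) by blast
      moreover have "?F \<subseteq> ?N" using N(2) by blast
      ultimately show thesis using key[of ?N] that by blast
    qed
    let ?D = "ball (0::complex) e0 - {0}"
    have "continuous_map (top_of_set ?D) (subtopology S ?C) \<psi>"
      unfolding continuous_map_in_subtopology
    proof
      show "continuous_map (top_of_set ?D) S \<psi>" by (rule continuous_map_on_subset[OF \<psi>(2)]) (use e0(2) in auto)
      show "\<psi> \<in> topspace (top_of_set ?D) \<rightarrow> ?C" using \<psi>(5) e0(2) by auto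
    qed
    from continuous_map_compose[OF this h(1)] have c: "continuous_map (top_of_set ?D) S' (\<lambda>v. h (\<psi> v))" by (simp add: o_def)
    have "connected ?D" by (rule connected_open_delete) auto
    then have con: "connectedin S' ((\<lambda>v. h (\<psi> v)) ` ?D)"
      using connectedin_continuous_map_image[OF c, of ?D] by (simp add: connectedin_subtopology)
    let ?v = "complex_of_real (e0 / 2)"
    have v1: "?v \<in> ?D" using e0(1) by auto
    then have "h (\<psi> ?v) \<in> ?N" using e0(3)[of ?v] by blast
    then obtain y where y: "y \<in> ?F" "h (\<psi> ?v) \<in> N y" by blast
    let ?R = "\<Union>y'\<in>?F - {y}. N y'"
    have oR: "openin S' ?R" using N(1) by blast
    have dis: "N y \<inter> ?R = {}" using N(3)[OF y(1)] by blast
    have inN: "h (\<psi> v) \<in> N y" if v: "v \<in> ?D" for v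
    proof (rule ccontr)
      assume "h (\<psi> v) \<notin> N y"
      moreover have "h (\<psi> v) \<in> ?N" using e0(3)[of v] v by blast
      ultimately have "h (\<psi> v) \<in> ?R" by blast
      then have "?R \<inter> (\<lambda>v. h (\<psi> v)) ` ?D \<noteq> {}" using v by blast
      moreover have "N y \<inter> (\<lambda>v. h (\<psi> v)) ` ?D \<noteq> {}" using y(2) v1 by blast
      moreover have "(\<lambda>v. h (\<psi> v)) ` ?D \<subseteq> N y \<union> ?R" using e0(3) by blast
      ultimately show False using connectedinD[OF con N(1)[OF y(1)] oR] dis by blast
    qed
    have "limitin S' h y (atin_within S x ?C)"
      unfolding limitin_def
    proof (intro conjI allI impI)
      show "y \<in> topspace S'" using Ft y(1) by blast
      fix U assume U: "openin S' U \<and> y \<in> U"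
      have "openin S' ((N y \<inter> U) \<union> ?R)" using U N(1)[OF y(1)] oR by blast
      moreover have "?F \<subseteq> (N y \<inter> U) \<union> ?R" using U N(2) by blast
      ultimately obtain e1 where e1: "e1 > 0" "e1 \<le> r" "\<And>v. v \<in> ball 0 e1 \<Longrightarrow> v \<noteq> 0 \<Longrightarrow> h (\<psi> v) \<in> (N y \<inter> U) \<union> ?R"
        using key[of "(N y \<inter> U) \<union> ?R"] by blast
      let ?T = "\<psi> ` ball 0 (min e0 e1)"
      have "openin S ?T" by (rule \<psi>(4)) (use e0(2) in auto)
      moreover have "x \<in> ?T" using \<psi>(3) e0(1) e1(1) by (intro image_eqI[of _ _ 0]) auto
      moreover have "h z \<in> U" if z: "z \<in> ?T" "z \<noteq> x" for z
      proof -
        obtain v where v: "v \<in> ball 0 (min e0 e1)" "z = \<psi> v" using z(1) by blast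
        then have "v \<noteq> 0" using z(2) \<psi>(3) by auto
        then have "h (\<psi> v) \<in> N y" "h (\<psi> v) \<in> (N y \<inter> U) \<union> ?R" using inN[of v] e1(3)[of v] v(1) by auto
        then show ?thesis using dis v(2) by blast
      qed
      ultimately show "\<forall>\<^sub>F z in atin_within S x ?C. h z \<in> U" unfolding eventually_atin_within by blast
    qed
    then show ?thesis by blast
  qed
  obtain H where H: "continuous_map (subtopology S (topspace S)) S' H" "\<And>z. z \<in> ?C \<Longrightarrow> H z = h z"
    by (rule continuous_map_extension_pointwise_alt[OF compact_Hausdorff_imp_regular_space[OF B.bc(1,2)] _ A.finpart_dense h(1) lim])
       (auto simp: finpart_def)
  have H': "continuous_map S S' H" using H(1) by simp
  show thesis
  proof (rule that[OF H' H(2)])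
    fix z assume z: "z \<in> topspace S"
    have "continuous_map S riemann_sphere (p' \<circ> H)" by (rule continuous_map_compose[OF H' B.bc(3)])
    then have c: "continuous_map S riemann_sphere (\<lambda>z. p' (H z))" by (simp add: o_def)
    show "p' (H z) = p z"
      by (rule forall_in_closure_of_eq[OF _ A.Hausdorff_sphere c A.bc(3)]) (use A.finpart_dense z H(2) h(2) in auto)
  qed
qed

text \<open>Isomorphisms of covers without labels.\<close>

definition over :: "'s topology \<Rightarrow> ('s \<Rightarrow> complex option) \<Rightarrow> 't topology \<Rightarrow> ('t \<Rightarrow> complex option) \<Rightarrow> ('s \<Rightarrow> 't) \<Rightarrow> bool" where
  "over S p S' p' h \<longleftrightarrow> homeomorphic_map S S' h \<and> (\<forall>x\<in>topspace S. p' (h x) = p x)"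

text \<open>Extend the maps in both directions; they are inverse to each other on a dense set.\<close>

lemma NF_homeomorphic:
  assumes S: "tpc S p d" "tpc S' p' d" and N: "NF S p d k g G" "NF S' p' d k g' G'" and d: "d \<ge> 1"
    and fin: "finite (fibre S p None)" "finite (fibre S' p' None)"
  shows "\<exists>h. over S p S' p' h"
proof -
  have proj_eq: "p' (h z) = p z" if N: "NF S p d k g G" "NF S' p' d k g' G'" and z: "z \<in> finpart S p"
      and h: "\<And>a. a \<in> reg0 d \<Longrightarrow> h (g a) = g' a" "\<And>u v. u \<in> U1 d k \<Longrightarrow> v \<in> reg1 (mm d u) \<Longrightarrow> h (G u v) = G' u v"
    for S :: "'x topology" and p S' p' g g' h z and G :: "complex \<Rightarrow> complex \<Rightarrow> 'x" and G' :: "complex \<Rightarrow> complex \<Rightarrow> 'y"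
  proof -
    consider a where "a \<in> reg0 d" "z = g a" | u v where "u \<in> U1 d k" "v \<in> reg1 (mm d u)" "z = G u v"
      using NFD(10)[OF N(1), of z] z by (auto simp: finpart_def)
    then show ?thesis
    proof cases
      case 1
      then show ?thesis using h(1) NFD(2)[OF N(1)] NFD(2)[OF N(2)] by simp
    next
      case 2
      then show ?thesis using h(2) NFD(4)[OF N(1)] NFD(4)[OF N(2)] by simp
    qed
  qed
  obtain h where h: "continuous_map (subtopology S (finpart S p)) S' h"
    "\<And>a. a \<in> reg0 d \<Longrightarrow> h (g a) = g' a" "\<And>u v. u \<in> U1 d k \<Longrightarrow> v \<in> reg1 (mm d u) \<Longrightarrow> h (G u v) = G' u v"
    by (rule NF_map[OF S N d]) blast
  obtain h' where h': "continuous_map (subtopology S' (finpart S' p')) S h'"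
    "\<And>a. a \<in> reg0 d \<Longrightarrow> h' (g' a) = g a" "\<And>u v. u \<in> U1 d k \<Longrightarrow> v \<in> reg1 (mm d u) \<Longrightarrow> h' (G' u v) = G u v"
    by (rule NF_map[OF S(2,1) N(2,1) d]) blast
  obtain H where H: "continuous_map S S' H" "\<And>z. z \<in> finpart S p \<Longrightarrow> H z = h z" "\<And>z. z \<in> topspace S \<Longrightarrow> p' (H z) = p z"
    by (rule extend_over_infinity[OF S fin(2) h(1) proj_eq[OF N _ h(2,3)]]) blast+
  obtain H' where H': "continuous_map S' S H'" "\<And>z. z \<in> finpart S' p' \<Longrightarrow> H' z = h' z" "\<And>z. z \<in> topspace S' \<Longrightarrow> p (H' z) = p' z"
    by (rule extend_over_infinity[OF S(2,1) fin(1) h'(1) proj_eq[OF N(2,1) _ h'(2,3)]]) blast+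
  have inv: "H' (H z) = z" if S: "tpc S p d" "tpc S' p' d" and N: "NF S p d k g G" "NF S' p' d k g' G'" and z: "z \<in> topspace S"
      and H: "continuous_map S S' H" "\<And>z. z \<in> finpart S p \<Longrightarrow> H z = h z" "\<And>z. z \<in> topspace S \<Longrightarrow> p' (H z) = p z"
      and H': "continuous_map S' S H'" "\<And>z. z \<in> finpart S' p' \<Longrightarrow> H' z = h' z"
      and h: "\<And>a. a \<in> reg0 d \<Longrightarrow> h (g a) = g' a" "\<And>u v. u \<in> U1 d k \<Longrightarrow> v \<in> reg1 (mm d u) \<Longrightarrow> h (G u v) = G' u v"
      and h': "\<And>a. a \<in> reg0 d \<Longrightarrow> h' (g' a) = g a" "\<And>u v. u \<in> U1 d k \<Longrightarrow> v \<in> reg1 (mm d u) \<Longrightarrow> h' (G' u v) = G u v"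
    for S :: "'x topology" and p and S' :: "'y topology" and p' g g' G G' H H' h h' z
  proof -
    have c: "continuous_map S S (\<lambda>z. H' (H z))" using continuous_map_compose[OF H(1) H'(1)] by (simp add: o_def)
    show ?thesis
    proof (rule forall_in_closure_of_eq[OF _ tpc.bc(2)[OF S(1)] c, of z "finpart S p" "\<lambda>z. z"])
      show "z \<in> S closure_of finpart S p" using tpc.finpart_dense[OF S(1)] z by blast
      fix z assume z: "z \<in> finpart S p"
      then have zt: "z \<in> topspace S" "p z \<noteq> None" by (auto simp: finpart_def)
      have "H z \<in> topspace S'" using H(1) zt(1) by (auto simp: continuous_map_def)
      then have "H z \<in> finpart S' p'" using H(3)[OF zt(1)] zt(2) by (simp add: finpart_def)
      then have e: "H' (H z) = h' (h z)" using H'(2) H(2)[OF z] by simp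
      consider a where "a \<in> reg0 d" "z = g a" | u v where "u \<in> U1 d k" "v \<in> reg1 (mm d u)" "z = G u v"
        using NFD(10)[OF N(1) zt] by auto
      then show "H' (H z) = z" by cases (use e h h' in auto)
    qed simp
  qed
  have "homeomorphic_maps S S' H H'"
    unfolding homeomorphic_maps_def
    using H(1) H'(1) inv[OF S N _ H H'(1,2) h(2,3) h'(2,3)] inv[OF S(2,1) N(2,1) _ H' H(1,2) h'(2,3) h(2,3)] by blast
  then show ?thesis unfolding over_def homeomorphic_map_maps using H(3) by blast
qed

section \<open>Holomorphic charts and polynomial covers of the sphere\<close>

text \<open>A nonvanishing factor \<open>e\<close> can be absorbed into the coordinate: \<open>v\<close> times a \<open>k\<close>-th root of \<open>e v\<close> is invertible near \<open>0\<close>.\<close>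

lemma has_ram_order_holomorphic:
  assumes k: "k \<ge> 1" and \<psi>: "r > 0" "continuous_map (top_of_set (ball (0::complex) r)) S \<psi>" "\<psi> 0 = x" "inj_on \<psi> (ball (0::complex) r)"
      "\<And>W. open W \<Longrightarrow> W \<subseteq> ball (0::complex) r \<Longrightarrow> openin S (\<psi> ` W)"
    and p: "\<And>v. v \<in> ball (0::complex) r \<Longrightarrow> p (\<psi> v) = sphere_param (p x) (v ^ k * e v)"
    and e: "e holomorphic_on ball (0::complex) r" "e 0 \<noteq> 0"
  shows "has_ram_order S p x k"
proof -
  have "continuous_on (ball (0::complex) r) e" using e(1) by (rule holomorphic_on_imp_continuous_on)
  then have "open (ball (0::complex) r \<inter> e -` ball (e 0) (norm (e 0)))" by (rule continuous_open_preimage) auto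
  moreover have "0 \<in> ball (0::complex) r \<inter> e -` ball (e 0) (norm (e 0))" using \<psi>(1) e(2) by simp
  ultimately obtain s where s: "s > 0" "ball (0::complex) s \<subseteq> ball (0::complex) r \<inter> e -` ball (e 0) (norm (e 0))" using openE by blast
  have s1: "ball (0::complex) s \<subseteq> ball (0::complex) r" using s(2) by blast
  have re: "e v / e 0 \<notin> \<real>\<^sub>\<le>\<^sub>0" if v: "v \<in> ball (0::complex) s" for v
  proof -
    have "dist (e 0) (e v) < norm (e 0)" using s(2) v by auto
    moreover have "(1 - e v / e 0) * e 0 = e 0 - e v" using e(2) by (simp add: field_simps)
    ultimately have "norm ((1 - e v / e 0) * e 0) < norm (e 0)" by (simp add: dist_norm)
    then have "norm (1 - e v / e 0) * norm (e 0) < 1 * norm (e 0)" by (simp only: norm_mult mult_1_left)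
    then have "norm (1 - e v / e 0) < 1" using e(2) by (simp only: mult_less_cancel_right_pos zero_less_norm_iff not_False_eq_True)
    then have "Re (1 - e v / e 0) < 1" using complex_Re_le_cmod[of "1 - e v / e 0"] by linarith
    then have "Re (e v / e 0) > 0" by (simp only: minus_complex.sel one_complex.sel)
    then show ?thesis by (auto simp: complex_nonpos_Reals_iff)
  qed
  define l where "l v = exp (Ln (e 0) / of_nat k) * exp (Ln (e v / e 0) / of_nat k)" for v
  have k0: "of_nat k \<noteq> (0::complex)" "k \<noteq> 0" using k by auto
  have e0: "e v \<noteq> 0" if "v \<in> ball (0::complex) s" for v using re[OF that] by auto
  have lk: "l v ^ k = e v" if v: "v \<in> ball (0::complex) s" for v
  proof -
    have "l v ^ k = exp (Ln (e 0)) * exp (Ln (e v / e 0))"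
      unfolding l_def power_mult_distrib exp_of_nat_mult[symmetric] using k0 by simp
    also have "\<dots> = e v" using e(2) e0[OF v] by simp
    finally show ?thesis .
  qed
  have lh: "l holomorphic_on ball (0::complex) s"
    unfolding l_def by (intro holomorphic_intros holomorphic_on_subset[OF e(1) s1]) (use re e(2) k0 in auto)
  define u where "u v = v * l v" for v
  have uh: "u holomorphic_on ball (0::complex) s" unfolding u_def by (intro holomorphic_intros lh)
  have "(l has_field_derivative deriv l 0) (at 0)" using lh s(1) by (intro holomorphic_derivI[of _ "ball (0::complex) s"]) auto
  from DERIV_mult[OF DERIV_ident this] have "(u has_field_derivative l 0) (at 0)" by (simp add: u_def[abs_def])
  then have "deriv u 0 = l 0" by (rule DERIV_imp_deriv)
  moreover have "l 0 \<noteq> 0" by (simp add: l_def)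
  ultimately have du: "deriv u 0 \<noteq> 0" by simp
  obtain r2 where r2: "r2 > 0" "ball (0::complex) r2 \<subseteq> ball (0::complex) s" "open (u ` ball (0::complex) r2)" "inj_on u (ball (0::complex) r2)"
    by (rule has_complex_derivative_locally_invertible[OF uh centre_in_ball[THEN iffD2, OF s(1)] open_ball du]) blast
  have uh2: "u holomorphic_on ball (0::complex) r2" using uh r2(2) by (rule holomorphic_on_subset)
  obtain \<rho> where \<rho>: "\<rho> holomorphic_on u ` ball (0::complex) r2" "\<And>z. z \<in> ball (0::complex) r2 \<Longrightarrow> \<rho> (u z) = z"
    by (rule holomorphic_has_inverse[OF uh2 open_ball r2(4)]) blast
  have u0: "u 0 = 0" by (simp add: u_def)
  have "0 \<in> u ` ball (0::complex) r2" using r2(1) u0 by (metis centre_in_ball imageI)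
  then obtain \<delta> where \<delta>: "\<delta> > 0" "ball (0::complex) \<delta> \<subseteq> u ` ball (0::complex) r2" using r2(3) openE by blast
  have \<rho>2: "\<rho> w \<in> ball (0::complex) r2" "u (\<rho> w) = w" if "w \<in> ball (0::complex) \<delta>" for w
  proof -
    obtain z where "z \<in> ball (0::complex) r2" "w = u z" using \<delta>(2) \<open>w \<in> ball (0::complex) \<delta>\<close> by blast
    then show "\<rho> w \<in> ball (0::complex) r2" "u (\<rho> w) = w" using \<rho>(2) by auto
  qed
  have br: "ball (0::complex) r2 \<subseteq> ball (0::complex) r" using r2(2) s1 by blast
  show ?thesis
  proof (rule ram_chart_imp[OF k \<delta>(1), where \<psi> = "\<lambda>w. \<psi> (\<rho> w)"])
    have "continuous_on (ball (0::complex) \<delta>) \<rho>" using holomorphic_on_imp_continuous_on[OF \<rho>(1)] \<delta>(2) by (rule continuous_on_subset)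
    then show "continuous_map (top_of_set (ball (0::complex) \<delta>)) S (\<lambda>w. \<psi> (\<rho> w))"
      by (rule continuous_map_compose_on[OF \<psi>(2)]) (use \<rho>2(1) br in blast)
    have "\<rho> 0 = 0" using \<rho>(2)[of 0] r2(1) u0 by simp
    then show "\<psi> (\<rho> 0) = x" using \<psi>(3) by simp
    show "inj_on (\<lambda>w. \<psi> (\<rho> w)) (ball (0::complex) \<delta>)"
    proof (rule inj_onI)
      fix w w' assume w: "w \<in> ball (0::complex) \<delta>" "w' \<in> ball (0::complex) \<delta>" "\<psi> (\<rho> w) = \<psi> (\<rho> w')"
      have "\<rho> w = \<rho> w'" by (rule inj_onD[OF \<psi>(4) w(3) subsetD[OF br \<rho>2(1)[OF w(1)]] subsetD[OF br \<rho>2(1)[OF w(2)]]])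
      then have "u (\<rho> w) = u (\<rho> w')" by (rule arg_cong)
      then show "w = w'" unfolding \<rho>2(2)[OF w(1)] \<rho>2(2)[OF w(2)] .
    qed
    show "openin S ((\<lambda>w. \<psi> (\<rho> w)) ` W)" if W: "open W" "W \<subseteq> ball (0::complex) \<delta>" for W
    proof -
      have "\<rho> ` W = ball (0::complex) r2 \<inter> u -` W"
      proof (intro equalityI subsetI)
        fix z assume "z \<in> \<rho> ` W"
        then obtain w where "w \<in> W" "z = \<rho> w" by blast
        then show "z \<in> ball (0::complex) r2 \<inter> u -` W" using \<rho>2 W(2) by auto
      next
        fix z assume z: "z \<in> ball (0::complex) r2 \<inter> u -` W"
        then show "z \<in> \<rho> ` W" using \<rho>(2)[of z] by (intro image_eqI[of _ _ "u z"]) auto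
      qed
      also have "open \<dots>" by (rule continuous_open_preimage[OF holomorphic_on_imp_continuous_on[OF uh2] open_ball W(1)])
      finally have "open (\<rho> ` W)" .
      moreover have "\<rho> ` W \<subseteq> ball (0::complex) r" using W(2) \<rho>2(1) br by blast
      ultimately have "openin S (\<psi> ` \<rho> ` W)" by (rule \<psi>(5))
      then show ?thesis by (simp add: image_image)
    qed
    show "p (\<psi> (\<rho> w)) = sphere_param (p x) (w ^ k)" if w: "w \<in> ball (0::complex) \<delta>" for w
    proof -
      have z: "\<rho> w \<in> ball (0::complex) r" "\<rho> w \<in> ball (0::complex) s" using \<rho>2(1)[OF w] br r2(2) by auto
      have "(\<rho> w * l (\<rho> w)) ^ k = \<rho> w ^ k * l (\<rho> w) ^ k" by (rule power_mult_distrib)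
      then have "\<rho> w ^ k * e (\<rho> w) = w ^ k" using lk[OF z(2)] \<rho>2(2)[OF w] by (simp add: u_def)
      then show ?thesis using p[OF z(1)] by simp
    qed
  qed
qed

lemma openin_sphere:
  "openin riemann_sphere V \<longleftrightarrow> (\<exists>U. open U \<and> V = Some ` U) \<or> (\<exists>C. compact C \<and> V = insert None (Some ` (- C)))"
  unfolding riemann_sphere_def openin_Alexandroff_compactification
  by (auto simp: compactin_euclidean_iff compact_imp_closed Compl_eq_Diff_UNIV)

lemma topspace_sphere [simp]: "topspace riemann_sphere = UNIV"
  by (auto simp: riemann_sphere_def) (metis not_Some_eq rangeI)

lemma openin_sphere_Some: "open U \<Longrightarrow> openin riemann_sphere (Some ` U)"
  by (auto simp: openin_sphere)

lemma open_sphere_Some: "openin riemann_sphere V \<Longrightarrow> open {z. Some z \<in> V}"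
  unfolding openin_sphere
proof (elim disjE exE conjE)
  fix C assume "compact C" "V = insert None (Some ` (- C))"
  then show "open {z. Some z \<in> V}" using compact_imp_closed[of C] by (auto simp: open_Compl image_iff Collect_neg_eq)
qed (auto simp: image_iff)

lemma open_inverse: "open W \<Longrightarrow> open {z::complex. z \<noteq> 0 \<and> 1 / z \<in> W}"
proof -
  assume "open W"
  have "continuous_on (- {0}) (\<lambda>z::complex. 1 / z)" by (intro continuous_intros) auto
  then have "open (- {0} \<inter> (\<lambda>z. 1 / z) -` W)" using \<open>open W\<close> by (intro continuous_open_preimage) auto
  also have "- {0} \<inter> (\<lambda>z. 1 / z) -` W = {z. z \<noteq> 0 \<and> 1 / z \<in> W}" by auto
  finally show ?thesis .
qed

lemma open_sphere_param_vimage: "openin riemann_sphere V \<Longrightarrow> open {t. sphere_param y t \<in> V}"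
proof (cases y)
  case (Some a)
  assume "openin riemann_sphere V"
  from open_sphere_Some[OF this] have "open ((\<lambda>t. a + t) -` {z. Some z \<in> V})"
    by (intro open_vimage continuous_intros)
  then show ?thesis by (simp add: Some vimage_def)
next
  case None
  assume V: "openin riemann_sphere V"
  have o: "open {t. t \<noteq> 0 \<and> 1 / t \<in> {z. Some z \<in> V}}" by (rule open_inverse[OF open_sphere_Some[OF V]])
  show ?thesis
  proof (cases "None \<in> V")
    case False
    then have "{t. sphere_param y t \<in> V} = {t. t \<noteq> 0 \<and> 1 / t \<in> {z. Some z \<in> V}}" by (auto simp: None)
    then show ?thesis using o by simp
  next
    case True
    then obtain C where C: "compact C" "V = insert None (Some ` (- C))" using V unfolding openin_sphere by blast
    obtain B where B: "B > 0" "\<And>z. z \<in> C \<Longrightarrow> norm z \<le> B" using compact_imp_bounded[OF C(1), unfolded bounded_pos] by blast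
    have "{t. sphere_param y t \<in> V} = {t. t \<noteq> 0 \<and> 1 / t \<in> {z. Some z \<in> V}} \<union> ball (0::complex) (1 / B)"
    proof -
      have big: "Some (1 / t) \<in> V" if "norm t < 1 / B" "t \<noteq> 0" for t
      proof -
        have "norm (1 / t) > B" using that B(1) by (simp add: norm_divide field_simps)
        then have "1 / t \<notin> C" using B(2)[of "1 / t"] by linarith
        then show ?thesis unfolding C(2) by blast
      qed
      show ?thesis
      proof (intro set_eqI)
        fix t :: complex
        show "t \<in> {t. sphere_param y t \<in> V} \<longleftrightarrow> t \<in> {t. t \<noteq> 0 \<and> 1 / t \<in> {z. Some z \<in> V}} \<union> ball 0 (1 / B)"
        proof (cases "t = 0")
          case True
          then show ?thesis using \<open>None \<in> V\<close> B(1) by (simp add: None)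
        next
          case False
          then show ?thesis using big[of t] by (simp only: None sphere_param.simps if_False Un_iff mem_Collect_eq mem_ball_0) blast
        qed
      qed
    qed
    then show ?thesis using open_Un[OF o open_ball] by (simp only:)
  qed
qed

lemma open_sphere_param_image: "open W \<Longrightarrow> openin riemann_sphere (sphere_param y ` W)"
proof (cases y)
  case (Some a)
  assume "open W"
  then have "open ((+) a ` W)" by (rule open_translation)
  from openin_sphere_Some[OF this] show ?thesis by (simp add: Some image_image)
next
  case None
  assume W: "open W"
  have o: "open {z. z \<noteq> 0 \<and> 1 / z \<in> W}" (is "open ?D") by (rule open_inverse[OF W])
  have D: "Some ` ?D = sphere_param y ` (W - {0})"
  proof (intro equalityI subsetI)
    fix q assume "q \<in> Some ` ?D"
    then obtain z where "z \<noteq> 0" "1 / z \<in> W" "q = Some z" by auto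
    then show "q \<in> sphere_param y ` (W - {0})" by (intro image_eqI[of _ _ "1 / z"]) (auto simp: None)
  qed (auto simp: None)
  show ?thesis
  proof (cases "0 \<in> W")
    case False
    then show ?thesis using D openin_sphere_Some[OF o] by simp
  next
    case True
    then obtain \<epsilon> where \<epsilon>: "\<epsilon> > 0" "ball (0::complex) \<epsilon> \<subseteq> W" using W openE by blast
    have "bounded (- ?D)"
    proof (rule boundedI[of _ "1 / \<epsilon>"])
      fix z assume z: "z \<in> - ?D"
      show "norm z \<le> 1 / \<epsilon>"
      proof (cases "z = 0")
        case False
        then have "1 / z \<notin> ball (0::complex) \<epsilon>" using z \<epsilon>(2) by auto
        then show ?thesis using \<epsilon>(1) False by (simp add: norm_divide field_simps)
      qed (use \<epsilon> in simp)
    qed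
    moreover have "closed (- ?D)" using o by (simp add: closed_Compl)
    ultimately have "compact (- ?D)" by (simp add: compact_eq_bounded_closed)
    then have "openin riemann_sphere (insert None (Some ` (- (- ?D))))" unfolding openin_sphere by blast
    moreover have "sphere_param y ` W = insert None (Some ` ?D)" unfolding D using True by (auto simp: None)
    ultimately show ?thesis by simp
  qed
qed

lemma continuous_sphere_param: "continuous_map euclidean riemann_sphere (sphere_param y)"
  unfolding continuous_map_def using open_sphere_param_vimage by auto

lemma continuous_sphere_param_on: "continuous_map (top_of_set T) riemann_sphere (sphere_param y)"
  by (rule continuous_map_from_subtopology[OF continuous_sphere_param])

lemma connected_sphere: "connected_components_of riemann_sphere = {UNIV}"
proof -
  have c: "connectedin riemann_sphere (range (sphere_param y))" for y
    using connectedin_continuous_map_image[OF continuous_sphere_param, of UNIV y] connected_UNIV by simp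
  have "None \<in> range (sphere_param None)" "Some 1 \<in> range (sphere_param None)" "Some 1 \<in> range (sphere_param (Some 0))"
    by (auto intro: image_eqI[of _ _ "0::complex"] image_eqI[of _ _ "1::complex"])
  moreover have "Some z \<in> range (sphere_param (Some 0))" for z by (auto intro: image_eqI[of _ _ z])
  ultimately have u: "range (sphere_param None) \<union> range (sphere_param (Some 0)) = UNIV"
    "range (sphere_param None) \<inter> range (sphere_param (Some 0)) \<noteq> {}"
    by (auto simp: set_eq_iff)
  then have "connectedin riemann_sphere UNIV" using connectedin_Un[OF c c] by metis
  then have "connected_space riemann_sphere" by (simp flip: connectedin_topspace)
  then show ?thesis unfolding connected_components_of_eq_singleton by (metis UNIV_not_empty null_topspace_iff_trivial topspace_sphere)
qed

lemma sphere_has_ram_order: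
  assumes "k \<ge> 1" "r > 0" "e holomorphic_on ball (0::complex) r" "e 0 \<noteq> 0"
    "\<And>v. v \<in> ball (0::complex) r \<Longrightarrow> p (sphere_param x v) = sphere_param (p x) (v ^ k * e v)"
  shows "has_ram_order riemann_sphere p x k"
  by (rule has_ram_order_holomorphic[OF assms(1,2), where \<psi> = "sphere_param x" and e = e])
     (use assms continuous_sphere_param_on open_sphere_param_image in \<open>auto simp: inj_on_def sphere_param_inj\<close>)

definition polymap :: "complex poly \<Rightarrow> complex option \<Rightarrow> complex option" where "polymap P = map_option (poly P)"

lemma polymap_simps [simp]: "polymap P None = None" "polymap P (Some z) = Some (poly P z)"
  by (simp_all add: polymap_def)

text \<open>At infinity, \<open>1 / P (1 / v)\<close> is \<open>v^d\<close> divided by the reflected polynomial.\<close>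

lemma polymap_ram:
  assumes "degree P \<ge> 1"
  shows "has_ram_order riemann_sphere (polymap P) (Some a) (order a (P - [:poly P a:]))"
    "has_ram_order riemann_sphere (polymap P) None (degree P)"
proof -
  let ?Q = "P - [:poly P a:]"
  have Q0: "?Q \<noteq> 0" using assms by (metis degree_pCons_0 not_one_le_zero right_minus_eq)
  obtain R where R: "?Q = [:- a, 1:] ^ order a ?Q * R" "\<not> [:- a, 1:] dvd R" using order_decomp[OF Q0] by blast
  show "has_ram_order riemann_sphere (polymap P) (Some a) (order a ?Q)"
  proof (rule sphere_has_ram_order[where r = 1 and e = "\<lambda>v. poly R (a + v)"])
    have "poly ?Q a = 0" by simp
    then have "order a ?Q \<noteq> 0" using Q0 order_root by blast
    then show "1 \<le> order a ?Q" by linarith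
    show "(\<lambda>v. poly R (a + v)) holomorphic_on ball (0::complex) 1" by (intro holomorphic_intros)
    show "poly R (a + 0) \<noteq> 0" using R(2) by (simp add: poly_eq_0_iff_dvd)
    fix v :: complex
    have "poly ?Q (a + v) = poly ([:- a, 1:] ^ order a ?Q * R) (a + v)" by (rule arg_cong[OF R(1)])
    then have "poly P (a + v) = poly P a + v ^ order a ?Q * poly R (a + v)" by (simp add: algebra_simps poly_power)
    then show "polymap P (sphere_param (Some a) v) = sphere_param (polymap P (Some a)) (v ^ order a ?Q * poly R (a + v))" by simp
  qed simp
  let ?q = "reflect_poly P"
  have q0: "poly ?q 0 \<noteq> 0" using assms by auto
  have "open (poly ?q -` (- {0}))" by (intro open_vimage continuous_intros)
  moreover have "0 \<in> poly ?q -` (- {0})" using q0 by simp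
  ultimately obtain r where r: "r > 0" "ball (0::complex) r \<subseteq> poly ?q -` (- {0})" using openE by blast
  show "has_ram_order riemann_sphere (polymap P) None (degree P)"
  proof (rule sphere_has_ram_order[where r = r and e = "\<lambda>v. 1 / poly ?q v"])
    show "(\<lambda>v. 1 / poly ?q v) holomorphic_on ball (0::complex) r" using r(2) by (intro holomorphic_intros) auto
    show "1 / poly ?q 0 \<noteq> 0" using q0 by simp
    show "polymap P (sphere_param None v) = sphere_param (polymap P None) (v ^ degree P * (1 / poly ?q v))" if v: "v \<in> ball (0::complex) r" for v
    proof (cases "v = 0")
      case True
      then show ?thesis using assms by (simp add: power_0_left)
    next
      case False
      have "poly ?q v = v ^ degree P * poly P (inverse v)" by (rule poly_reflect_poly_nz[OF False])
      moreover have "poly ?q v \<noteq> 0" using r(2) v by auto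
      ultimately show ?thesis using False by (simp add: field_simps inverse_eq_divide)
    qed
  qed (use assms r in auto)
qed

lemma polymap_continuous:
  assumes "degree P \<ge> 1" shows "continuous_map riemann_sphere riemann_sphere (polymap P)"
  unfolding continuous_map_def
proof (intro conjI allI impI)
  fix V assume V: "openin riemann_sphere V"
  have o: "open {z. poly P z \<in> U}" if "open U" for U
    using open_vimage[OF that, of "poly P"] by (simp add: vimage_def continuous_intros)
  show "openin riemann_sphere {x \<in> topspace riemann_sphere. polymap P x \<in> V}"
  proof (cases "None \<in> V")
    case False
    then have "{x \<in> topspace riemann_sphere. polymap P x \<in> V} = Some ` {z. poly P z \<in> {z. Some z \<in> V}}"
      by (auto simp: image_iff polymap_def split: option.splits) (metis option.exhaust map_option_is_None option.sel option.simps(9))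
    then show ?thesis using openin_sphere_Some[OF o[OF open_sphere_Some[OF V]]] by simp
  next
    case True
    then obtain C where C: "compact C" "V = insert None (Some ` (- C))" using V unfolding openin_sphere by blast
    let ?K = "{z. poly P z \<in> C}"
    obtain B where B: "B > 0" "\<And>z. z \<in> C \<Longrightarrow> norm z \<le> B" using compact_imp_bounded[OF C(1), unfolded bounded_pos] by blast
    obtain a q where P: "P = pCons a q" by (cases P)
    have "q \<noteq> 0" using assms P by auto
    then obtain s where s: "\<And>z. s \<le> norm z \<Longrightarrow> B + 1 \<le> norm (poly P z)" using poly_infinity[of q "B + 1" a] P by blast
    have "bounded ?K"
    proof (rule boundedI[of _ s])
      fix z assume "z \<in> ?K"
      then have "norm (poly P z) \<le> B" using B(2) by simp
      then show "norm z \<le> s" using s[of z] by linarith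
    qed
    moreover have "?K = - {z. poly P z \<in> - C}" by auto
    then have "closed ?K" using o[of "- C"] compact_imp_closed[OF C(1)] by (metis closed_Compl open_Compl)
    ultimately have "compact ?K" by (simp add: compact_eq_bounded_closed)
    moreover have "{x \<in> topspace riemann_sphere. polymap P x \<in> V} = insert None (Some ` (- ?K))"
    proof (intro set_eqI)
      fix x show "x \<in> {x \<in> topspace riemann_sphere. polymap P x \<in> V} \<longleftrightarrow> x \<in> insert None (Some ` (- ?K))"
        by (cases x) (auto simp: C(2))
    qed
    ultimately show ?thesis unfolding openin_sphere by blast
  qed
qed auto

lemma polymap_branched: "degree P \<ge> 1 \<Longrightarrow> branched_cover riemann_sphere (polymap P)"
  unfolding branched_cover_def
proof (intro conjI ballI)
  assume d: "degree P \<ge> 1"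
  show "compact_space riemann_sphere" by (simp add: riemann_sphere_def)
  show "Hausdorff_space riemann_sphere"
    unfolding riemann_sphere_def by (simp add: Hausdorff_space_Alexandroff_compactification locally_compact_space_euclidean)
  show "continuous_map riemann_sphere riemann_sphere (polymap P)" by (rule polymap_continuous[OF d])
  show "\<exists>k. has_ram_order riemann_sphere (polymap P) x k" for x using polymap_ram[OF d] by (cases x) auto
qed

text \<open>The polynomial with zeros of order \<open>a\<close> at \<open>0\<close> and \<open>b\<close> at \<open>1\<close>. Its only other critical point is \<open>a / (a + b)\<close>, and it is normalised to have the value \<open>1\<close> there.\<close>

definition model0 :: "nat \<Rightarrow> nat \<Rightarrow> complex poly" where "model0 a b = [:0, 1:] ^ a * [:1, - 1:] ^ b"
definition crit :: "nat \<Rightarrow> nat \<Rightarrow> complex" where "crit a b = of_nat a / of_nat (a + b)"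
definition model :: "nat \<Rightarrow> nat \<Rightarrow> complex poly" where
  "model a b = smult (1 / poly (model0 a b) (crit a b)) (model0 a b)"

context
  fixes a b :: nat assumes ab: "a \<ge> 1" "b \<ge> 1"
begin

lemma poly_model0: "poly (model0 a b) z = z ^ a * (1 - z) ^ b"
  by (simp add: model0_def poly_power)

lemma crit_ne: "crit a b \<noteq> 0" "crit a b \<noteq> 1" "1 - crit a b = of_nat b / of_nat (a + b)"
proof -
  have n: "of_nat a \<noteq> (0::complex)" "of_nat b \<noteq> (0::complex)" "of_nat a + of_nat b \<noteq> (0::complex)" using ab by (auto simp flip: of_nat_add)
  then show "crit a b \<noteq> 0" "1 - crit a b = of_nat b / of_nat (a + b)" by (auto simp: crit_def field_simps)
  then show "crit a b \<noteq> 1" using n by auto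
qed

lemma model0_crit: "poly (model0 a b) (crit a b) \<noteq> 0"
  using crit_ne(1,2) by (simp add: poly_model0)

lemma poly_model: "poly (model a b) z = z ^ a * (1 - z) ^ b / poly (model0 a b) (crit a b)"
  by (simp add: model_def poly_model0)

lemma model_crit: "poly (model a b) (crit a b) = 1"
  using model0_crit by (simp add: model_def)

lemma model_zero: "poly (model a b) z = 0 \<longleftrightarrow> z = 0 \<or> z = 1"
  using ab model0_crit by (auto simp: poly_model)

lemma model_ne: "model a b \<noteq> 0"
  using model_crit by auto

lemma degree_model: "degree (model a b) = a + b"
proof -
  have "degree (model0 a b) = a + b"
    unfolding model0_def by (subst degree_mult_eq) (auto simp: degree_power_eq)
  then show ?thesis using model0_crit by (simp add: model_def)
qed

text \<open>The logarithmic derivative is \<open>a / z - b / (1 - z)\<close>; this form avoids division.\<close>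

lemma pderiv_model: "[:0, 1:] * [:1, - 1:] * pderiv (model a b) = [:of_nat a, - of_nat (a + b):] * model a b"
proof -
  obtain a' b' where s: "a = Suc a'" "b = Suc b'" using ab by (metis not0_implies_Suc not_one_le_zero)
  define A B where "A = [:0, 1 :: complex:]" and "B = [:1, - 1 :: complex:]"
  have AB: "pderiv A = 1" "pderiv B = - 1" "\<And>z. poly A z = z" "\<And>z. poly B z = 1 - z"
    by (simp_all add: A_def B_def pderiv_pCons one_pCons)
  have m: "model0 a b = A ^ Suc a' * B ^ Suc b'" by (simp only: model0_def A_def B_def s)
  have "A * B * pderiv (model0 a b) = [:of_nat a, - of_nat (a + b):] * model0 a b"
  proof (rule poly_eq_poly_eq_iff[THEN iffD1], rule ext)
    fix z :: complex
    show "poly (A * B * pderiv (model0 a b)) z = poly ([:of_nat a, - of_nat (a + b):] * model0 a b) z"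
      unfolding m pderiv_mult pderiv_power_Suc AB by (simp add: AB s poly_power algebra_simps)
  qed
  then have "[:0, 1:] * [:1, - 1:] * pderiv (model0 a b) = [:of_nat a, - of_nat (a + b):] * model0 a b" by (simp only: A_def B_def)
  then show ?thesis by (simp only: model_def pderiv_smult mult_smult_right)
qed

lemma pderiv_model_zero:
  assumes "poly (pderiv (model a b)) z = 0" "z \<noteq> 0" "z \<noteq> 1"
  shows "z = crit a b"
proof -
  have "poly ([:0, 1:] * [:1, - 1:] * pderiv (model a b)) z = poly ([:of_nat a, - of_nat (a + b):] * model a b) z"
    by (simp only: pderiv_model)
  then have "poly ([:of_nat a, - of_nat (a + b):] * model a b) z = 0" using assms(1) by simp
  then have "poly [:of_nat a, - of_nat (a + b):] z = 0 \<or> poly (model a b) z = 0" by (simp only: poly_mult mult_eq_0_iff)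
  then have "of_nat a = z * of_nat (a + b)" using assms(2,3) model_zero[of z] by (simp add: algebra_simps)
  moreover have "of_nat (a + b) \<noteq> (0::complex)" using ab by (metis add_is_0 not_one_le_zero of_nat_eq_0_iff)
  ultimately show ?thesis by (simp add: crit_def del: of_nat_add)
qed

lemma order_model:
  "order 0 (model a b) = a" "order 1 (model a b) = b"
  "order (crit a b) (model a b - 1) = 2"
  "poly (model a b) z = y \<Longrightarrow> z \<noteq> 0 \<Longrightarrow> z \<noteq> 1 \<Longrightarrow> z \<noteq> crit a b \<Longrightarrow> order z (model a b - [:y:]) = 1"
proof -
  have c: "1 / poly (model0 a b) (crit a b) \<noteq> 0" using model0_crit by simp
  have nz: "model0 a b \<noteq> 0" using model0_crit by auto
  have p1: "[:1, - 1:] = smult (- 1) [:- 1, 1 :: complex:]" by simp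
  have o0: "order 0 ([:0, 1 :: complex:] ^ a) = a" using order_power_n_n[of "0::complex" a] by simp
  have o0': "order 1 ([:0, 1 :: complex:] ^ a) = 0" by (rule order_0I) (simp add: poly_power)
  have o1: "order 0 ([:1, - 1 :: complex:] ^ b) = 0" by (rule order_0I) (simp add: poly_power)
  have p1b: "[:1, - 1 :: complex:] ^ b = smult ((- 1) ^ b) ([:- 1, 1:] ^ b)" by (simp only: p1 smult_power)
  have m1: "((- 1) ^ b :: complex) \<noteq> 0" by simp
  have o1': "order 1 ([:1, - 1 :: complex:] ^ b) = b"
    unfolding p1b order_smult[OF m1] by (rule order_power_n_n)
  show "order 0 (model a b) = a" "order 1 (model a b) = b"
    unfolding model_def order_smult[OF c] using nz o0 o0' o1 o1' by (simp_all add: model0_def order_mult)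
  have P1: "model a b - [:y:] \<noteq> 0" for y using degree_model ab by (metis add_is_0 degree_pCons_0 not_one_le_zero right_minus_eq)
  have pd: "pderiv (model a b - [:y:]) = pderiv (model a b)" for y by (simp add: pderiv_diff pderiv_pCons)
  show "order z (model a b - [:y:]) = 1" if z: "poly (model a b) z = y" "z \<noteq> 0" "z \<noteq> 1" "z \<noteq> crit a b"
  proof -
    have "poly (pderiv (model a b)) z \<noteq> 0" using pderiv_model_zero z by blast
    then have "order z (pderiv (model a b - [:y:])) = 0" unfolding pd by (rule order_0I)
    moreover have "poly (model a b - [:y:]) z = 0" using z by simp
    ultimately show ?thesis using order_pderiv[OF P1] by simp
  qed
  let ?c = "crit a b"
  have "pderiv (model a b) \<noteq> 0" using degree_model ab by (metis add_is_0 not_one_le_zero pderiv_eq_0_iff)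
  then have pn: "[:0, 1:] * [:1, - 1:] * pderiv (model a b) \<noteq> 0" by (simp only: mult_eq_0_iff) simp
  have "order ?c ([:0, 1:] * [:1, - 1:] * pderiv (model a b)) = order ?c ([:0, 1:] * [:1, - 1:]) + order ?c (pderiv (model a b))"
    by (rule order_mult[OF pn])
  also have "order ?c ([:0, 1:] * [:1, - 1:]) = 0" by (rule order_0I) (use crit_ne(1,2) in \<open>simp only: poly_mult mult_eq_0_iff, simp\<close>)
  finally have 1: "order ?c ([:of_nat a, - of_nat (a + b):] * model a b) = order ?c (pderiv (model a b))" by (simp only: pderiv_model)
  have nab: "of_nat (a + b) \<noteq> (0::complex)" using ab by (metis add_is_0 not_one_le_zero of_nat_eq_0_iff)
  have nab': "- of_nat (a + b) \<noteq> (0::complex)" using nab by (simp only: neg_equal_0_iff_equal not_False_eq_True)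
  have nab0: "of_nat (a + b) * crit a b = of_nat a" using ab by (simp add: crit_def del: of_nat_add)
  have lin: "[:of_nat a, - of_nat (a + b):] = smult (- of_nat (a + b)) ([:- ?c, 1:] ^ 1)"
    using nab0 by (simp del: of_nat_add)
  have "order ?c ([:of_nat a, - of_nat (a + b):] * model a b) = order ?c [:of_nat a, - of_nat (a + b):] + order ?c (model a b)"
    by (rule order_mult) (use pn pderiv_model in metis)
  also have "order ?c [:of_nat a, - of_nat (a + b):] = 1"
    unfolding lin order_smult[OF nab'] by (rule order_power_n_n)
  also have "order ?c (model a b) = 0" by (rule order_0I) (simp add: model_crit)
  finally have "order ?c (pderiv (model a b)) = 1" using 1 by simp
  moreover have "poly (model a b - [:1:]) ?c = 0" using model_crit by simp
  ultimately have "order ?c (model a b - [:1:]) = 2" using order_pderiv[OF P1[of 1]] pd[of 1] by simp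
  then show "order ?c (model a b - 1) = 2" by (simp add: one_pCons)
qed

abbreviation "P \<equiv> polymap (model a b)"

lemma model_cover: "three_point_cover riemann_sphere P (a + b)"
  unfolding three_point_cover_def
proof (intro conjI allI impI)
  have d: "degree (model a b) \<ge> 1" using degree_model ab by simp
  show "branched_cover riemann_sphere P" by (rule polymap_branched[OF d])
  fix y :: "complex option" assume y: "y \<notin> {Some 0, Some 1, None}"
  then obtain w where w: "y = Some w" "w \<noteq> 0" "w \<noteq> 1" by (cases y) auto
  let ?Z = "{z. poly (model a b - [:w:]) z = 0}"
  have fib: "fibre riemann_sphere P y = Some ` ?Z"
  proof (intro set_eqI)
    fix x show "x \<in> fibre riemann_sphere P y \<longleftrightarrow> x \<in> Some ` ?Z"
      by (cases x) (auto simp: fibre_def w(1))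
  qed
  have root: "poly (model a b) z = w" "z \<noteq> 0" "z \<noteq> 1" "z \<noteq> crit a b" if "z \<in> ?Z" for z
    using that w model_zero[of z] model_crit by auto
  have ord1: "order z (model a b - [:w:]) = 1" if "z \<in> ?Z" for z using order_model(4)[OF root[OF that]] .
  show "\<forall>x\<in>fibre riemann_sphere P y. ram_order riemann_sphere P x = 1"
    unfolding fib
  proof (clarify, rule ram_order_eq)
    fix z assume "poly (model a b - [:w:]) z = 0"
    then have z: "z \<in> ?Z" by simp
    show "has_ram_order riemann_sphere P (Some z) 1"
      using polymap_ram(1)[OF d, of z] ord1[OF z] root(1)[OF z] by simp
  qed
  have P0: "model a b - [:w:] \<noteq> 0" using d by (metis degree_pCons_0 not_one_le_zero right_minus_eq)
  show "finite (fibre riemann_sphere P y)" unfolding fib using poly_roots_finite[OF P0] by simp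
  have "(\<Prod>z\<in>?Z. [:- z, 1:] ^ order z (model a b - [:w:])) = (\<Prod>z\<in>?Z. [:- z, 1:])"
    by (rule prod.cong) (use ord1 in simp_all)
  then have dec: "smult (lead_coeff (model a b - [:w:])) (\<Prod>z\<in>?Z. [:- z, 1:]) = model a b - [:w:]"
    using complex_poly_decompose[of "model a b - [:w:]"] by simp
  have "degree (model a b - [:w:]) = degree (\<Prod>z\<in>?Z. [:- z, 1:])"
    using degree_smult_eq[of "lead_coeff (model a b - [:w:])" "\<Prod>z\<in>?Z. [:- z, 1:]"] P0 unfolding dec leading_coeff_0_iff by (simp only: if_False)
  also have "\<dots> = (\<Sum>z\<in>?Z. degree [:- z, 1:])" by (rule degree_prod_eq_sum_degree) simp
  finally have "card ?Z = degree (model a b - [:w:])" by simp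
  also have "\<dots> = degree (model a b + - [:w:])" by (simp only: diff_conv_add_uminus)
  also have "\<dots> = a + b" using degree_add_eq_left[of "- [:w:]" "model a b"] degree_model ab by simp
  finally show "card (fibre riemann_sphere P y) = a + b" unfolding fib by (simp add: card_image)
qed

lemma model_fibres:
  "fibre riemann_sphere P (Some 0) = {Some 0, Some 1}"
  "fibre riemann_sphere P None = {None}"
  "Some (crit a b) \<in> fibre riemann_sphere P (Some 1)"
  "finite (fibre riemann_sphere P (Some 1))"
  "has_ram_order riemann_sphere P (Some 0) a"
  "has_ram_order riemann_sphere P (Some 1) b"
  "has_ram_order riemann_sphere P None (a + b)"
  "has_ram_order riemann_sphere P (Some (crit a b)) 2"
  "x \<in> fibre riemann_sphere P (Some 1) \<Longrightarrow> x \<noteq> Some (crit a b) \<Longrightarrow>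
     has_ram_order riemann_sphere P x 1"
proof -
  have d: "degree (model a b) \<ge> 1" using degree_model ab by simp
  note ram = polymap_ram(1)[OF d]
  show "fibre riemann_sphere P (Some 0) = {Some 0, Some 1}"
  proof (intro set_eqI)
    fix x show "x \<in> fibre riemann_sphere P (Some 0) \<longleftrightarrow> x \<in> {Some 0, Some 1}"
      by (cases x) (simp_all add: fibre_def model_zero)
  qed
  show "fibre riemann_sphere P None = {None}"
  proof (intro set_eqI)
    fix x show "x \<in> fibre riemann_sphere P None \<longleftrightarrow> x \<in> {None}"
      by (cases x) (simp_all add: fibre_def)
  qed
  show "Some (crit a b) \<in> fibre riemann_sphere P (Some 1)" by (simp add: fibre_def model_crit)
  have P0: "model a b - [:1:] \<noteq> 0" using d by (metis degree_pCons_0 not_one_le_zero right_minus_eq)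
  have "fibre riemann_sphere P (Some 1) \<subseteq> Some ` {z. poly (model a b - [:1:]) z = 0}"
  proof
    fix x assume "x \<in> fibre riemann_sphere P (Some 1)"
    then show "x \<in> Some ` {z. poly (model a b - [:1:]) z = 0}" by (cases x) (auto simp: fibre_def)
  qed
  then show "finite (fibre riemann_sphere P (Some 1))"
    using poly_roots_finite[OF P0] finite_surj by blast
  have z: "poly (model a b) 0 = 0" "poly (model a b) 1 = 0" by (simp_all add: model_zero)
  show "has_ram_order riemann_sphere P (Some 0) a" using ram[of 0] z order_model(1) by simp
  show "has_ram_order riemann_sphere P (Some 1) b" using ram[of 1] z order_model(2) by simp
  show "has_ram_order riemann_sphere P None (a + b)" using polymap_ram(2)[OF d] degree_model by simp
  show "has_ram_order riemann_sphere P (Some (crit a b)) 2"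
    using ram[of "crit a b"] model_crit order_model(3) by (simp flip: one_pCons)
  assume x: "x \<in> fibre riemann_sphere P (Some 1)" "x \<noteq> Some (crit a b)"
  then obtain w where w: "x = Some w" "poly (model a b) w = 1" "w \<noteq> crit a b" by (cases x) (auto simp: fibre_def)
  moreover have "w \<noteq> 0" "w \<noteq> 1" using w(2) z by auto
  ultimately show "has_ram_order riemann_sphere P x 1" using ram[of w] order_model(4)[of w 1] by simp
qed

end

section \<open>The Hurwitz number of a trivalent vertex\<close>

lemma over_compose: "over S p S' p' h \<Longrightarrow> over S' p' S'' p'' h' \<Longrightarrow> over S p S'' p'' (h' \<circ> h)"
  unfolding over_def
  by (metis comp_apply homeomorphic_imp_surjective_map homeomorphic_map_compose imageI)

lemma over_inverse:
  assumes "over S p S' p' h"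
  obtains g where "over S' p' S p g" "\<And>x. x \<in> topspace S \<Longrightarrow> g (h x) = x" "\<And>y. y \<in> topspace S' \<Longrightarrow> h (g y) = y"
proof -
  obtain g where g: "homeomorphic_maps S S' h g" using assms by (auto simp: over_def homeomorphic_map_maps)
  then have gh: "\<And>x. x \<in> topspace S \<Longrightarrow> g (h x) = x" "\<And>y. y \<in> topspace S' \<Longrightarrow> h (g y) = y"
    by (auto simp: homeomorphic_maps_def)
  have "homeomorphic_map S' S g" using g homeomorphic_maps_map by blast
  moreover have "g y \<in> topspace S" if "y \<in> topspace S'" for y
    using g that by (auto simp: homeomorphic_maps_def continuous_map_def)
  then have "p (g y) = p' y" if "y \<in> topspace S'" for y using assms gh(2)[OF that] that unfolding over_def by metis
  ultimately show thesis using that[of g] gh by (simp add: over_def)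
qed

lemma over_topspace: "over S p S' p' h \<Longrightarrow> x \<in> topspace S \<Longrightarrow> h x \<in> topspace S'"
  unfolding over_def by (metis homeomorphic_imp_surjective_map imageI)

lemma over_fibre: "over S p S' p' h \<Longrightarrow> x \<in> fibre S p y \<Longrightarrow> h x \<in> fibre S' p' y"
  using over_topspace by (fastforce simp: fibre_def over_def)

lemma over_inj: "over S p S' p' h \<Longrightarrow> inj_on h (topspace S)"
  using over_inverse by (metis inj_on_inverseI)

lemma over_ram_order:
  assumes h: "over S p S' p' h" and x: "x \<in> topspace S" and k: "has_ram_order S p x k"
  shows "has_ram_order S' p' (h x) k"
proof -
  obtain r \<psi> where \<psi>: "r > 0" "continuous_map (top_of_set (ball (0::complex) r)) S \<psi>" "\<psi> 0 = x" "inj_on \<psi> (ball 0 r)"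
    "\<And>W. open W \<Longrightarrow> W \<subseteq> ball (0::complex) r \<Longrightarrow> openin S (\<psi> ` W)"
    "\<And>v. v \<in> ball 0 r \<Longrightarrow> p (\<psi> v) = sphere_param (p x) (v ^ k)"
    by (rule ram_chart[OF k]) blast
  have hom: "homeomorphic_map S S' h" and hp: "\<And>x. x \<in> topspace S \<Longrightarrow> p' (h x) = p x" using h by (auto simp: over_def)
  have t: "\<psi> v \<in> topspace S" if "v \<in> ball 0 r" for v using \<psi>(2) that by (auto simp: continuous_map_def)
  show ?thesis
  proof (rule ram_chart_imp[where \<psi> = "\<lambda>v. h (\<psi> v)" and r = r])
    show "k \<ge> 1" using k by (simp add: has_ram_order_def)
    show "continuous_map (top_of_set (ball 0 r)) S' (\<lambda>v. h (\<psi> v))"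
      using continuous_map_compose[OF \<psi>(2) homeomorphic_imp_continuous_map[OF hom]] by (simp add: o_def)
    show "inj_on (\<lambda>v. h (\<psi> v)) (ball 0 r)"
    proof (rule inj_onI)
      fix v w assume v: "v \<in> ball 0 r" "w \<in> ball 0 r" "h (\<psi> v) = h (\<psi> w)"
      have "\<psi> v = \<psi> w" by (rule inj_onD[OF over_inj[OF h] v(3) t[OF v(1)] t[OF v(2)]])
      then show "v = w" by (rule inj_onD[OF \<psi>(4) _ v(1,2)])
    qed
    show "openin S' ((\<lambda>v. h (\<psi> v)) ` W)" if "open W" "W \<subseteq> ball 0 r" for W
    proof -
      have "openin S' (h ` \<psi> ` W)"
        using homeomorphic_imp_open_map[OF hom] \<psi>(5)[OF that] unfolding open_map_def by blast
      then show ?thesis by (simp add: image_image)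
    qed
    show "p' (h (\<psi> v)) = sphere_param (p' (h x)) (v ^ k)" if "v \<in> ball 0 r" for v
      using \<psi>(6)[OF that] hp[OF t[OF that]] hp[OF x] by simp
  qed (use \<psi> in auto)
qed

text \<open>The inversion \<open>y \<mapsto> 1 / y\<close> exchanges zeros and poles. It turns the polynomial models into covers with one zero, to which the normal form applies, and later reduces the case of two zeros to that of two poles.\<close>

definition flip :: "complex option \<Rightarrow> complex option" where
  "flip y = (case y of None \<Rightarrow> Some 0 | Some a \<Rightarrow> sphere_param None a)"

lemma flip_simps [simp]: "flip None = Some 0" "flip (Some 0) = None" "flip (Some 1) = Some 1"
    "a \<noteq> 0 \<Longrightarrow> flip (Some a) = Some (1 / a)"
  by (simp_all add: flip_def)

lemma flip_flip [simp]: "flip (flip y) = y"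
  by (cases y; cases "y = Some 0") auto

lemma flip_eq_iff: "flip x = y \<longleftrightarrow> x = flip y"
  by (metis flip_flip)

lemma flip_inj [simp]: "flip x = flip y \<longleftrightarrow> x = y"
  by (metis flip_flip)

text \<open>At a finite nonzero value, \<open>1 / (a + w) = 1 / a - w / (a (a + w))\<close> has a nonvanishing factor in front of \<open>w\<close>, which the coordinate absorbs.\<close>

lemma flip_ram_imp:
  assumes k: "has_ram_order S p x k"
  shows "has_ram_order S (\<lambda>x. flip (p x)) x k"
proof -
  have k1: "k \<ge> 1" using k by (simp add: has_ram_order_def)
  obtain r \<psi> where \<psi>: "r > 0" "continuous_map (top_of_set (ball (0::complex) r)) S \<psi>" "\<psi> 0 = x" "inj_on \<psi> (ball 0 r)"
    "\<And>W. open W \<Longrightarrow> W \<subseteq> ball (0::complex) r \<Longrightarrow> openin S (\<psi> ` W)"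
    "\<And>v. v \<in> ball 0 r \<Longrightarrow> p (\<psi> v) = sphere_param (p x) (v ^ k)"
    by (rule ram_chart[OF k]) blast
  show ?thesis
  proof (cases "p x = None \<or> p x = Some 0")
    case True
    have "flip (sphere_param (p x) t) = sphere_param (flip (p x)) t" for t using True by (cases "t = 0") auto
    then show ?thesis
      by (intro ram_chart_imp[OF k1 \<psi>(1-5)]) (simp_all add: \<psi>(6))
  next
    case False
    then obtain a where a: "p x = Some a" "a \<noteq> 0" by (cases "p x") auto
    have "open ((\<lambda>v::complex. a + v ^ k) -` (- {0}))" by (intro open_vimage continuous_intros)
    then have "open (ball 0 r \<inter> (\<lambda>v. a + v ^ k) -` (- {0}))" by (intro open_Int open_ball)
    moreover have "0 \<in> ball 0 r \<inter> (\<lambda>v. a + v ^ k) -` (- {0})" using \<psi>(1) a(2) k1 by (simp add: power_0_left)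
    ultimately obtain s where s: "s > 0" "ball (0::complex) s \<subseteq> ball 0 r \<inter> (\<lambda>v. a + v ^ k) -` (- {0})" using openE by blast
    have sr: "ball (0::complex) s \<subseteq> ball 0 r" using s(2) by blast
    have ne: "a + v ^ k \<noteq> 0" if "v \<in> ball 0 s" for v using subsetD[OF s(2) that] by simp
    show ?thesis
    proof (rule has_ram_order_holomorphic[OF k1 s(1) continuous_map_on_subset[OF \<psi>(2) sr] \<psi>(3) inj_on_subset[OF \<psi>(4) sr]])
      show "openin S (\<psi> ` W)" if "open W" "W \<subseteq> ball 0 s" for W using \<psi>(5) that sr by blast
      show "(\<lambda>v. - 1 / (a * (a + v ^ k))) holomorphic_on ball 0 s" using ne a(2) by (intro holomorphic_intros) auto
      show "- 1 / (a * (a + 0 ^ k)) \<noteq> 0" using a(2) k1 by (simp add: power_0_left)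
      fix v assume v: "v \<in> ball (0::complex) s"
      have "p (\<psi> v) = Some (a + v ^ k)" using \<psi>(6)[OF subsetD[OF sr v]] a(1) by simp
      moreover have "1 / (a + w) = 1 / a + w * (- 1 / (a * (a + w)))" if "a + w \<noteq> 0" for w
      proof -
        have "1 / a = (a + w) / (a * (a + w))" using that a(2) by simp
        then have "1 / a + w * (- 1 / (a * (a + w))) = (a + w) / (a * (a + w)) - w / (a * (a + w))" by simp
        also have "\<dots> = ((a + w) - w) / (a * (a + w))" by (simp only: diff_divide_distrib)
        finally show ?thesis using a(2) by simp
      qed
      from this[OF ne[OF v]] have "1 / (a + v ^ k) = 1 / a + v ^ k * (- 1 / (a * (a + v ^ k)))" .
      ultimately show "flip (p (\<psi> v)) = sphere_param (flip (p x)) (v ^ k * (- 1 / (a * (a + v ^ k))))"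
        using a ne[OF v] by simp
    qed
  qed
qed

lemma flip_ram [simp]: "has_ram_order S (\<lambda>x. flip (p x)) x k \<longleftrightarrow> has_ram_order S p x k"
  using flip_ram_imp[of S "\<lambda>x. flip (p x)" x k] flip_ram_imp[of S p x k] by auto

lemma flip_ram_order [simp]: "ram_order S (\<lambda>x. flip (p x)) x = ram_order S p x"
proof -
  have "has_ram_order S (\<lambda>x. flip (p x)) x = has_ram_order S p x" by (rule ext) (rule flip_ram)
  then show ?thesis by (simp only: ram_order_def)
qed

lemma flip_fibre [simp]: "fibre S (\<lambda>x. flip (p x)) y = fibre S p (flip y)"
  by (simp add: fibre_def flip_eq_iff)

lemma flip_continuous: "continuous_map riemann_sphere riemann_sphere flip"
  unfolding continuous_map_def
proof (intro conjI allI impI)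
  fix V assume V: "openin riemann_sphere V"
  have eq: "{x \<in> topspace riemann_sphere. flip x \<in> V} = sphere_param None ` {z. Some z \<in> V} \<union> Some ` {t. sphere_param None t \<in> V}"
    (is "?L = ?A \<union> ?B")
  proof (intro equalityI subsetI)
    fix x assume x: "x \<in> ?L"
    show "x \<in> ?A \<union> ?B"
    proof (cases x)
      case None
      then show ?thesis using x by (intro UnI1 image_eqI[of _ _ 0]) auto
    next
      case (Some t)
      then show ?thesis using x by (intro UnI2 image_eqI[of _ _ t]) (auto simp: flip_def)
    qed
  next
    fix x assume "x \<in> ?A \<union> ?B"
    then consider z where "x = sphere_param None z" "Some z \<in> V" | t where "x = Some t" "sphere_param None t \<in> V" by blast
    then show "x \<in> ?L"
    proof cases
      case 1
      then have "flip x = Some z" by (cases "z = 0") auto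
      then show ?thesis using 1 by simp
    qed (auto simp: flip_def)
  qed
  show "openin riemann_sphere ?L" unfolding eq
    by (rule openin_Un[OF open_sphere_param_image[OF open_sphere_Some[OF V]] openin_sphere_Some[OF open_sphere_param_vimage[OF V]]])
qed auto

lemma flip_cover:
  assumes "three_point_cover S p d" shows "three_point_cover S (\<lambda>x. flip (p x)) d"
proof -
  have b: "branched_cover S p" and g: "\<And>y. y \<notin> {Some 0, Some 1, None} \<Longrightarrow>
      (\<forall>x\<in>fibre S p y. ram_order S p x = 1) \<and> finite (fibre S p y) \<and> card (fibre S p y) = d"
    using assms by (auto simp: three_point_cover_def)
  have "continuous_map S riemann_sphere (flip \<circ> p)"
    using b by (intro continuous_map_compose[OF _ flip_continuous]) (simp add: branched_cover_def)
  then have "branched_cover S (\<lambda>x. flip (p x))" using b by (simp add: branched_cover_def o_def)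
  moreover have "flip y \<notin> {Some 0, Some 1, None}" if "y \<notin> {Some 0, Some 1, None}" for y
    using that flip_eq_iff[of y] by auto
  ultimately show ?thesis using g unfolding three_point_cover_def by (simp only: flip_ram_order flip_fibre) blast
qed

definition two_poles where
  "two_poles S p a b u v \<longleftrightarrow> three_point_cover S p (a + b) \<and> fibre S p None = {u, v} \<and> u \<noteq> v \<and>
     has_ram_order S p u a \<and> has_ram_order S p v b \<and>
     (\<exists>x0. fibre S p (Some 0) = {x0} \<and> has_ram_order S p x0 (a + b)) \<and> finite (fibre S p (Some 1)) \<and>
     (\<exists>x1\<in>fibre S p (Some 1). has_ram_order S p x1 2 \<and> (\<forall>x\<in>fibre S p (Some 1). x \<noteq> x1 \<longrightarrow> has_ram_order S p x 1))"

lemma two_poles_normal_form: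
  assumes "two_poles S p a b u v" "a \<ge> 1" "b \<ge> 1"
  shows "\<exists>k\<in>{1..(a + b) div 2}. \<exists>g G. NF S p (a + b) k g G"
proof -
  obtain x0 x1 where x: "fibre S p (Some 0) = {x0}" "has_ram_order S p x0 (a + b)" "x1 \<in> fibre S p (Some 1)" "has_ram_order S p x1 2"
    "\<And>x. x \<in> fibre S p (Some 1) \<Longrightarrow> x \<noteq> x1 \<Longrightarrow> has_ram_order S p x 1"
    and f: "three_point_cover S p (a + b)" "finite (fibre S p (Some 1))"
    using assms(1) unfolding two_poles_def by blast
  interpret cov12 S p "a + b" x0 x1 by unfold_locales (use assms(2,3) x f in auto)
  show ?thesis using normal_form by (metis atLeastAtMost_iff)
qed

definition rat :: "nat \<Rightarrow> nat \<Rightarrow> complex option \<Rightarrow> complex option" where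
  "rat a b = (\<lambda>x. flip (polymap (model a b) x))"

lemma rat_two_poles:
  assumes "a \<ge> 1" "b \<ge> 1" shows "two_poles riemann_sphere (rat a b) a b (Some 0) (Some 1)"
  unfolding two_poles_def rat_def flip_ram flip_fibre flip_simps
  using model_fibres[OF assms] flip_cover[OF model_cover[OF assms]] by auto

lemma rat_swap:
  assumes "a \<ge> 1" "b \<ge> 1"
  obtains \<sigma> where "over riemann_sphere (rat a b) riemann_sphere (rat b a) \<sigma>" "\<sigma> (Some 0) = Some 1" "\<sigma> (Some 1) = Some 0"
proof -
  let ?\<sigma> = "polymap [:1, - 1:]"
  have c: "continuous_map riemann_sphere riemann_sphere ?\<sigma>" by (rule polymap_continuous) simp
  have inv: "?\<sigma> (?\<sigma> x) = x" for x by (cases x) auto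
  have "homeomorphic_maps riemann_sphere riemann_sphere ?\<sigma> ?\<sigma>" unfolding homeomorphic_maps_def using c inv by blast
  then have h: "homeomorphic_map riemann_sphere riemann_sphere ?\<sigma>" using homeomorphic_map_maps by blast
  have m0: "poly (model0 b a) (1 - z) = poly (model0 a b) z" for z
    using poly_model0[OF assms] poly_model0[OF assms(2,1)] by (simp add: mult.commute)
  have "crit b a = 1 - crit a b" using crit_ne(3)[OF assms] by (simp add: crit_def add.commute)
  then have "poly (model b a) (1 - z) = poly (model a b) z" for z using m0 by (simp add: model_def)
  then have "rat b a (?\<sigma> x) = rat a b x" for x by (cases x) (auto simp: rat_def)
  then show thesis using h by (intro that[of ?\<sigma>]) (auto simp: over_def)
qed

lemma two_poles_tpc: "two_poles S p a b u v \<Longrightarrow> tpc S p (a + b) \<and> finite (fibre S p None)"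
  unfolding two_poles_def tpc_def by auto

lemma two_poles_over_orders:
  assumes "two_poles S p a b u v" "two_poles S' p' a' b' u' v'" "over S p S' p' h"
  shows "(h u = u' \<and> h v = v' \<and> a = a' \<and> b = b') \<or> (h u = v' \<and> h v = u' \<and> a = b' \<and> b = a')"
proof -
  have f: "fibre S p None = {u, v}" "u \<noteq> v" "has_ram_order S p u a" "has_ram_order S p v b"
    "fibre S' p' None = {u', v'}" "has_ram_order S' p' u' a'" "has_ram_order S' p' v' b'"
    using assms(1,2) unfolding two_poles_def by blast+
  have t: "u \<in> topspace S" "v \<in> topspace S" using f(1) by (auto simp: fibre_def)
  have im: "h u \<in> {u', v'}" "h v \<in> {u', v'}" using over_fibre[OF assms(3)] f(1,5) by blast+
  have ne: "h u \<noteq> h v" using over_inj[OF assms(3)] t f(2) by (auto dest: inj_onD)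
  have r: "has_ram_order S' p' (h u) a" "has_ram_order S' p' (h v) b"
    using over_ram_order[OF assms(3)] t f(3,4) by auto
  have uq: "has_ram_order S' p' x k \<Longrightarrow> has_ram_order S' p' x l \<Longrightarrow> k = l" for x k l
    using ram_order_eq by metis
  show ?thesis
  proof (cases "h u = u'")
    case True
    then have "h v = v'" using im ne by auto
    then show ?thesis using True r f(6,7) uq by metis
  next
    case False
    then have "h u = v'" "h v = u'" using im ne by auto
    then show ?thesis using r f(6,7) uq by metis
  qed
qed

text \<open>The models with pole orders \<open>t\<close> and \<open>d - t\<close> for \<open>1 \<le> t \<le> d / 2\<close> have different normal forms, since equal ones would give equal pole orders. So every possible normal form is that of a model, and the given cover is isomorphic to one of them; its pole orders tell which. The reflection \<open>z \<mapsto> 1 - z\<close> puts the labels in order.\<close>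

lemma two_poles_classification:
  assumes S: "two_poles S p a b u v" and ab: "a \<ge> 1" "b \<ge> 1"
  obtains h where "over S p riemann_sphere (rat a b) h" "h u = Some 0" "h v = Some 1"
proof -
  let ?d = "a + b" let ?K = "{1..?d div 2}"
  have td: "1 \<le> t" "1 \<le> ?d - t" "t + (?d - t) = ?d" if "t \<in> ?K" for t using that by auto
  have M: "two_poles riemann_sphere (rat t (?d - t)) t (?d - t) (Some 0) (Some 1)" if "t \<in> ?K" for t
    by (rule rat_two_poles[OF td(1,2)[OF that]])
  have "\<exists>k\<in>?K. \<exists>g G. NF riemann_sphere (rat t (?d - t)) ?d k g G" if t: "t \<in> ?K" for t
    using two_poles_normal_form[OF M[OF t] td(1,2)[OF t]] unfolding td(3)[OF t] .
  then obtain \<kappa> where \<kappa>: "\<And>t. t \<in> ?K \<Longrightarrow> \<kappa> t \<in> ?K" "\<And>t. t \<in> ?K \<Longrightarrow> \<exists>g G. NF riemann_sphere (rat t (?d - t)) ?d (\<kappa> t) g G"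
    by metis
  have Mt: "tpc riemann_sphere (rat t (?d - t)) ?d" "finite (fibre riemann_sphere (rat t (?d - t)) None)" if "t \<in> ?K" for t
    using two_poles_tpc[OF M[OF that]] unfolding td(3)[OF that] by blast+
  have d1: "?d \<ge> 1" using ab by simp
  \<comment> \<open>Equal normal forms would make two models isomorphic, against their pole orders.\<close>
  have "inj_on \<kappa> ?K"
  proof (rule inj_onI)
    fix t t' assume t: "t \<in> ?K" "t' \<in> ?K" "\<kappa> t = \<kappa> t'"
    obtain g G where N: "NF riemann_sphere (rat t (?d - t)) ?d (\<kappa> t) g G" using \<kappa>(2)[OF t(1)] by blast
    obtain g' G' where N': "NF riemann_sphere (rat t' (?d - t')) ?d (\<kappa> t) g' G'" using \<kappa>(2)[OF t(2)] t(3) by metis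
    obtain h where "over riemann_sphere (rat t (?d - t)) riemann_sphere (rat t' (?d - t')) h"
      using NF_homeomorphic[OF Mt(1)[OF t(1)] Mt(1)[OF t(2)] N N' d1 Mt(2)[OF t(1)] Mt(2)[OF t(2)]] by blast
    from two_poles_over_orders[OF M[OF t(1)] M[OF t(2)] this] show "t = t'" using t(1,2) by auto
  qed
  then have sur: "\<kappa> ` ?K = ?K" using \<kappa>(1) by (intro endo_inj_surj) auto
  obtain k g G where k: "k \<in> ?K" and N: "NF S p ?d k g G" using two_poles_normal_form[OF S ab] by blast
  obtain t where t: "t \<in> ?K" "k = \<kappa> t" using k sur by blast
  obtain g' G' where N': "NF riemann_sphere (rat t (?d - t)) ?d k g' G'" using \<kappa>(2)[OF t(1)] t(2) by blast
  obtain h where h: "over S p riemann_sphere (rat t (?d - t)) h"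
    using NF_homeomorphic[OF _ Mt(1)[OF t(1)] N N' d1 _ Mt(2)[OF t(1)]] two_poles_tpc[OF S] by blast
  show thesis
  proof (cases "h u = Some 0")
    case True
    then have e: "h v = Some 1" "a = t" "b = ?d - t" using two_poles_over_orders[OF S M[OF t(1)] h] by auto
    have "rat t (?d - t) = rat a b" unfolding e(2)[symmetric] by simp
    then show ?thesis using that[of h] h True e(1) by simp
  next
    case False
    then have e: "h u = Some 1" "h v = Some 0" "a = ?d - t" "b = t" using two_poles_over_orders[OF S M[OF t(1)] h] by blast+
    have "rat t (?d - t) = rat b a" unfolding e(4)[symmetric] by simp
    then have h': "over S p riemann_sphere (rat b a) h" using h by simp
    obtain \<sigma> where \<sigma>: "over riemann_sphere (rat b a) riemann_sphere (rat a b) \<sigma>" "\<sigma> (Some 0) = Some 1" "\<sigma> (Some 1) = Some 0"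
      by (rule rat_swap[OF ab(2,1)]) blast
    show ?thesis by (rule that[OF over_compose[OF h' \<sigma>(1)]]) (use e \<sigma> in auto)
  qed
qed

text \<open>Away from finitely many points the map is locally composed of the polynomial and a branch of its inverse, hence entire; comparing absolute values of the polynomial bounds it by \<open>2 |z|\<close>. So it is linear, and it fixes \<open>0\<close> and \<open>1\<close>.\<close>

lemma rat_automorphism:
  assumes ab: "a \<ge> 1" "b \<ge> 1" and f: "over riemann_sphere (rat a b) riemann_sphere (rat a b) f"
    and f01: "f (Some 0) = Some 0" "f (Some 1) = Some 1"
  shows "f x = x"
proof -
  let ?P = "model a b"
  have pf: "polymap ?P (f x) = polymap ?P x" for x using f by (simp add: over_def rat_def)
  have fN: "f x = None \<longleftrightarrow> x = None" for x using pf[of x] by (cases x; cases "f x") auto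
  define F where "F z = the (f (Some z))" for z
  have fF: "f (Some z) = Some (F z)" for z using fN[of "Some z"] by (auto simp: F_def)
  have PF: "poly ?P (F z) = poly ?P z" for z using pf[of "Some z"] by (simp add: fF)
  have cf: "continuous_map riemann_sphere riemann_sphere f" using f by (simp add: over_def homeomorphic_imp_continuous_map)
  have oF: "open (F -` U)" if "open U" for U
  proof -
    have "openin riemann_sphere {x \<in> topspace riemann_sphere. f x \<in> Some ` U}"
      by (rule openin_continuous_map_preimage[OF cf openin_sphere_Some[OF that]])
    from open_sphere_Some[OF this] show ?thesis by (simp add: fF image_iff vimage_def)
  qed
  have cF: "continuous_on UNIV F" using oF by (subst continuous_on_open_vimage) auto
  let ?K = "{z. poly ?P z = 0} \<union> {z. poly (?P - [:1:]) z = 0}"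
  have "?P - [:1:] \<noteq> 0" using degree_model[OF ab] ab by (metis add_is_0 degree_pCons_0 not_one_le_zero right_minus_eq)
  then have K: "finite ?K" using poly_roots_finite model_ne[OF ab] by blast
  have "F field_differentiable at z" if z: "z \<notin> ?K" for z
  proof -
    let ?w = "F z"
    have "poly (pderiv ?P) ?w \<noteq> 0"
      using pderiv_model_zero[OF ab, of ?w] model_zero[OF ab, of ?w] model_crit[OF ab] PF[of z] z by auto
    then have "deriv (poly ?P) ?w \<noteq> 0" using poly_DERIV[of ?P ?w] DERIV_imp_deriv by metis
    moreover have hol: "poly ?P holomorphic_on T" for T by (intro holomorphic_intros)
    ultimately obtain r where r: "r > 0" "inj_on (poly ?P) (ball ?w r)" "open (poly ?P ` ball ?w r)"
      using has_complex_derivative_locally_invertible[OF hol UNIV_I open_UNIV] by metis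
    obtain g where g: "g holomorphic_on (poly ?P ` ball ?w r)" "\<And>y. y \<in> ball ?w r \<Longrightarrow> g (poly ?P y) = y"
      by (rule holomorphic_has_inverse[OF hol open_ball r(2)]) blast
    let ?V = "F -` ball ?w r"
    have V: "open ?V" "z \<in> ?V" using oF r(1) by auto
    have im: "poly ?P ` ?V \<subseteq> poly ?P ` ball ?w r" using PF by (metis (no_types, lifting) image_subsetI imageI vimageD)
    have "(g \<circ> poly ?P) holomorphic_on ?V" by (rule holomorphic_on_compose_gen[OF hol g(1) im])
    then have "F holomorphic_on ?V"
      by (rule holomorphic_transform) (use g(2) PF in \<open>metis comp_apply vimageD\<close>)
    then show ?thesis using V holomorphic_on_imp_differentiable_at by blast
  qed
  then have "F holomorphic_on (UNIV - ?K)" by (simp add: holomorphic_on_def field_differentiable_at_within)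
  then have hF: "F holomorphic_on UNIV" using no_isolated_singularity[OF cF _ open_UNIV K] by blast
  have c0: "poly (model0 a b) (crit a b) \<noteq> 0" by (rule model0_crit[OF ab])
  have growth: "norm (F z) \<le> 2 * norm z ^ 1" if z: "2 \<le> norm z" for z
  proof (rule ccontr)
    assume "\<not> norm (F z) \<le> 2 * norm z ^ 1"
    then have big: "norm (F z) > 2 * norm z" by simp
    have "norm (F z) \<le> norm (1 - F z) + 1" using norm_triangle_sub[of "F z" 1] by (simp add: norm_minus_commute)
    moreover have "norm (1 - z) \<le> 1 + norm z" using norm_triangle_ineq4[of 1 z] by simp
    ultimately have 1: "norm (1 - z) < norm (1 - F z)" using big z by linarith
    have 2: "norm z < norm (F z)" using big z by linarith
    have "norm z ^ a * norm (1 - z) ^ b < norm (F z) ^ a * norm (1 - F z) ^ b"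
      by (intro mult_strict_mono power_strict_mono)
         (use 1 2 ab z zero_less_power[OF le_less_trans[OF norm_ge_zero 2], of a] in auto)
    moreover have "F z ^ a * (1 - F z) ^ b = z ^ a * (1 - z) ^ b"
      using PF[of z] c0 by (simp add: poly_model[OF ab])
    then have "norm (F z ^ a * (1 - F z) ^ b) = norm (z ^ a * (1 - z) ^ b)" by (rule arg_cong)
    ultimately show False by (simp add: norm_mult norm_power)
  qed
  have lin: "F z = F 0 + deriv F 0 * z" for z
    using Liouville_polynomial[where \<xi> = z, OF hF growth] by simp
  have "F 0 = 0" "F 1 = 1" using f01 by (simp_all add: F_def)
  then have "F z = z" for z using lin[of z] lin[of 1] by simp
  then show ?thesis using fF fN by (cases x) auto
qed

text \<open>Exactly one isomorphism class, with trivial automorphism group.\<close>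

definition unique_cover :: "'i set \<Rightarrow> ('i \<Rightarrow> nat) \<Rightarrow> 'j set \<Rightarrow> ('j \<Rightarrow> nat) \<Rightarrow> nat multiset \<Rightarrow> bool" where
  "unique_cover I wm J wp \<mu> \<longleftrightarrow> hurwitz_covers I wm J wp \<mu> \<noteq> {} \<and>
    (\<forall>c\<in>hurwitz_covers I wm J wp \<mu>. \<forall>c'\<in>hurwitz_covers I wm J wp \<mu>. \<exists>f. cover_iso I J c c' f) \<and>
    (\<forall>c\<in>hurwitz_covers I wm J wp \<mu>. cover_aut I J c = {restrict id (topspace (surface c))})"

lemma hurwitz_number_unique:
  assumes "unique_cover I wm J wp \<mu>" "sum wm I = sum wp J"
  shows "hurwitz_number I wm J wp \<mu> = 1"
proof -
  let ?H = "hurwitz_covers I wm J wp \<mu>"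
  have u: "?H \<noteq> {}" "\<And>c c'. c \<in> ?H \<Longrightarrow> c' \<in> ?H \<Longrightarrow> \<exists>f. cover_iso I J c c' f"
    "\<And>c. c \<in> ?H \<Longrightarrow> cover_aut I J c = {restrict id (topspace (surface c))}"
    using assms(1) by (auto simp: unique_cover_def)
  have "iso_classes I wm J wp \<mu> = {?H}"
    unfolding iso_classes_def quotient_def using u(1,2) by fastforce
  moreover have "(SOME c. c \<in> ?H) \<in> ?H" using u(1) by (simp add: some_in_eq)
  ultimately show ?thesis using assms(2) u(3) by (simp add: hurwitz_number_def)
qed

definition flipc :: "('i, 'j) labelled_cover \<Rightarrow> ('j, 'i) labelled_cover" where
  "flipc c = \<lparr>surface = surface c, proj = (\<lambda>x. flip (proj c x)), label_zero = label_inf c, label_inf = label_zero c\<rparr>"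

lemma flipc_covers:
  assumes "c \<in> hurwitz_covers I wm J wp \<mu>" "sum wm I = sum wp J"
  shows "flipc c \<in> hurwitz_covers J wp I wm \<mu>"
proof -
  have tc: "three_point_cover (surface c) (\<lambda>x. flip (proj c x)) (sum wp J)"
    using assms flip_cover by (auto simp: hurwitz_covers_def Let_def)
  have one: "(flip y = Some 1) = (y = Some 1)" for y by (simp add: flip_eq_iff)
  show ?thesis using assms tc unfolding hurwitz_covers_def Let_def mem_Collect_eq
    by (simp only: flipc_def labelled_cover.simps flip_ram_order[abs_def] flip_fibre flip_simps one) (elim conjE, intro conjI TrueI; assumption)
qed

lemma flipc_iso: "cover_iso J I (flipc c) (flipc c') f \<longleftrightarrow> cover_iso I J c c' f"
  by (auto simp: cover_iso_def flipc_def)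

lemma flipc_unique:
  assumes "unique_cover I wm J wp \<mu>" "sum wm I = sum wp J"
  shows "unique_cover J wp I wm \<mu>"
proof -
  let ?H = "hurwitz_covers I wm J wp \<mu>" and ?H' = "hurwitz_covers J wp I wm \<mu>"
  have u: "?H \<noteq> {}" "\<And>c c'. c \<in> ?H \<Longrightarrow> c' \<in> ?H \<Longrightarrow> \<exists>f. cover_iso I J c c' f"
    "\<And>c. c \<in> ?H \<Longrightarrow> cover_aut I J c = {restrict id (topspace (surface c))}"
    using assms(1) by (auto simp: unique_cover_def)
  have fl: "flipc c \<in> ?H" if "c \<in> ?H'" for c using flipc_covers[OF that] assms(2) by simp
  have aut: "cover_aut J I c = cover_aut I J (flipc c)" for c
    using flipc_iso[of I J "c" "c"] by (simp add: cover_aut_def flipc_def cover_iso_def conj_ac)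
  have srf: "surface (flipc c) = surface c" for c :: "('x, 'y) labelled_cover" by (simp add: flipc_def)
  show ?thesis unfolding unique_cover_def
  proof (intro conjI ballI)
    show "?H' \<noteq> {}" using u(1) flipc_covers[OF _ assms(2)] by blast
    show "\<exists>f. cover_iso J I c c' f" if "c \<in> ?H'" "c' \<in> ?H'" for c c'
      using u(2)[OF fl[OF that(1)] fl[OF that(2)]] flipc_iso by blast
    show "cover_aut J I c = {restrict id (topspace (surface c))}" if "c \<in> ?H'" for c
      using u(3)[OF fl[OF that]] unfolding aut srf .
  qed
qed

text \<open>Every labelled cover is identified with the model, whose fibres and labels are known; automorphisms are conjugated to automorphisms of the model.\<close>

lemma unique_cover_two_poles:
  assumes j: "j1 \<noteq> j2" and w: "wp j1 \<ge> 1" "wp j2 \<ge> 1" "wm i = wp j1 + wp j2"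
  shows "unique_cover {i} wm {j1, j2} wp {#2#}"
proof -
  let ?H = "hurwitz_covers {i} wm {j1, j2} wp {#2#}" and ?a = "wp j1" and ?b = "wp j2"
  let ?M = "\<lparr>surface = riemann_sphere, proj = rat ?a ?b, label_zero = (\<lambda>_. None),
     label_inf = (\<lambda>j. if j = j1 then Some 0 else Some 1)\<rparr>"
  note mf = model_fibres[OF w(1,2)]
  have ro: "ram_order riemann_sphere (rat ?a ?b) x = k" if "has_ram_order riemann_sphere (polymap (model ?a ?b)) x k" for x k
    unfolding rat_def flip_ram_order using that by (rule ram_order_eq)
  have M: "?M \<in> ?H"
    unfolding hurwitz_covers_def Let_def mem_Collect_eq labelled_cover.simps
  proof (intro conjI)
    show "three_point_cover riemann_sphere (rat ?a ?b) (sum wm {i})"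
      unfolding rat_def using flip_cover[OF model_cover[OF w(1,2)]] w(3) by simp
    show "bij_betw (\<lambda>_. None) {i} (fibre riemann_sphere (rat ?a ?b) (Some 0))"
      unfolding rat_def flip_fibre flip_simps mf(2) by (simp add: bij_betw_def)
    show "\<forall>i\<in>{i}. ram_order riemann_sphere (rat ?a ?b) None = wm i" using ro[OF mf(7)] w(3) by simp
    show "bij_betw (\<lambda>j. if j = j1 then Some 0 else Some 1) {j1, j2} (fibre riemann_sphere (rat ?a ?b) None)"
      unfolding rat_def flip_fibre flip_simps mf(1) using j by (auto simp: bij_betw_def)
    show "\<forall>j\<in>{j1, j2}. ram_order riemann_sphere (rat ?a ?b) (if j = j1 then Some 0 else Some 1) = wp j"
      using ro[OF mf(5)] ro[OF mf(6)] j by auto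
    let ?F = "fibre riemann_sphere (polymap (model ?a ?b)) (Some 1)" and ?c = "Some (crit ?a ?b)"
    have F: "fibre riemann_sphere (rat ?a ?b) (Some 1) = ?F" unfolding rat_def by simp
    show fin: "finite (fibre riemann_sphere (rat ?a ?b) (Some 1))" unfolding F by (rule mf(4))
    have "image_mset (ram_order riemann_sphere (rat ?a ?b)) (mset_set ?F) =
        add_mset 2 (image_mset (ram_order riemann_sphere (rat ?a ?b)) (mset_set (?F - {?c})))"
      using mset_set.remove[OF mf(4,3)] ro[OF mf(8)] by simp
    also have "image_mset (ram_order riemann_sphere (rat ?a ?b)) (mset_set (?F - {?c})) = image_mset (\<lambda>_. 1) (mset_set (?F - {?c}))"
      by (rule image_mset_cong) (use ro[OF mf(9)] mf(4) in auto)
    finally show "\<exists>m. image_mset (ram_order riemann_sphere (rat ?a ?b)) (mset_set (fibre riemann_sphere (rat ?a ?b) (Some 1))) =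
        {#2#} + replicate_mset m 1" unfolding F by (auto simp: image_mset_const_eq)
    have "rat ?a ?b ?c = Some 1" using mf(3) by (simp add: fibre_def rat_def)
    then show "\<forall>C\<in>connected_components_of riemann_sphere. \<exists>x\<in>C. rat ?a ?b x = Some 1 \<and> 1 < ram_order riemann_sphere (rat ?a ?b) x"
      unfolding connected_sphere using ro[OF mf(8)] by auto
  qed
  have to_model: "\<exists>h. over (surface c) (proj c) riemann_sphere (rat ?a ?b) h \<and> h (label_inf c j1) = Some 0 \<and>
      h (label_inf c j2) = Some 1 \<and> h (label_zero c i) = None \<and>
      label_inf c j1 \<in> topspace (surface c) \<and> label_inf c j2 \<in> topspace (surface c) \<and> label_zero c i \<in> topspace (surface c)"
    if c: "c \<in> ?H" for c
  proof -
    let ?S = "surface c" and ?p = "proj c"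
    from c have c': "three_point_cover ?S ?p (sum wm {i})" "bij_betw (label_zero c) {i} (fibre ?S ?p (Some 0))"
      "ram_order ?S ?p (label_zero c i) = wm i" "bij_betw (label_inf c) {j1, j2} (fibre ?S ?p None)"
      "ram_order ?S ?p (label_inf c j1) = wp j1" "ram_order ?S ?p (label_inf c j2) = wp j2"
      "finite (fibre ?S ?p (Some 1))"
      "\<exists>m. image_mset (ram_order ?S ?p) (mset_set (fibre ?S ?p (Some 1))) = {#2#} + replicate_mset m 1"
      unfolding hurwitz_covers_def Let_def mem_Collect_eq by auto
    have t: "three_point_cover ?S ?p (?a + ?b)" using c'(1) w(3) by simp
    interpret tpc ?S ?p "?a + ?b" by unfold_locales (rule t)
    let ?F = "fibre ?S ?p (Some 1)"
    have Ft: "?F \<subseteq> topspace ?S" by (auto simp: fibre_def)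
    have z: "fibre ?S ?p (Some 0) = {label_zero c i}" using c'(2) by (auto simp: bij_betw_def)
    have n: "fibre ?S ?p None = {label_inf c j1, label_inf c j2}" "label_inf c j1 \<noteq> label_inf c j2"
      using c'(4) j by (auto simp: bij_betw_def)
    have tops: "label_zero c i \<in> topspace ?S" "label_inf c j1 \<in> topspace ?S" "label_inf c j2 \<in> topspace ?S"
      using z n(1) by (auto simp: fibre_def)
    obtain m where m: "image_mset (ram_order ?S ?p) (mset_set ?F) = {#2#} + replicate_mset m 1" using c'(8) by blast
    then have "2 \<in># image_mset (ram_order ?S ?p) (mset_set ?F)" by simp
    then obtain x1 where x1: "x1 \<in> ?F" "ram_order ?S ?p x1 = 2" using c'(7) by auto
    have "image_mset (ram_order ?S ?p) (mset_set (?F - {x1})) = replicate_mset m 1"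
      using m mset_set.remove[OF c'(7) x1(1)] x1(2) by simp
    moreover have "finite (?F - {x1})" using c'(7) by simp
    ultimately have "ram_order ?S ?p x = 1" if "x \<in> ?F" "x \<noteq> x1" for x
      using that by (metis (no_types, lifting) Diff_iff empty_iff finite_set_mset_mset_set image_eqI in_replicate_mset insert_iff set_image_mset)
    then have oth: "has_ram_order ?S ?p x 1" if "x \<in> ?F" "x \<noteq> x1" for x using ramified[of x] that Ft by (metis subsetD)
    have "two_poles ?S ?p ?a ?b (label_inf c j1) (label_inf c j2)"
      unfolding two_poles_def
    proof (intro conjI exI[of _ "label_zero c i"] bexI[of _ x1] ballI impI)
      show "has_ram_order ?S ?p (label_inf c j1) ?a" "has_ram_order ?S ?p (label_inf c j2) ?b" "has_ram_order ?S ?p (label_zero c i) (?a + ?b)"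
        using ramified tops c'(3,5,6) w(3) by metis+
      show "has_ram_order ?S ?p x1 2" using ramified[of x1] x1 Ft by auto
    qed (use t n z c'(7) oth x1 in auto)
    then obtain h where h: "over ?S ?p riemann_sphere (rat ?a ?b) h" "h (label_inf c j1) = Some 0" "h (label_inf c j2) = Some 1"
      by (rule two_poles_classification[OF _ w(1,2)]) blast
    have "h (label_zero c i) \<in> fibre riemann_sphere (rat ?a ?b) (Some 0)" by (rule over_fibre[OF h(1)]) (simp add: z)
    then have "h (label_zero c i) = None" unfolding rat_def flip_fibre flip_simps mf(2) by simp
    then show ?thesis using h tops by blast
  qed
  show ?thesis unfolding unique_cover_def
  proof (intro conjI ballI)
    show "?H \<noteq> {}" using M by blast
    show "\<exists>f. cover_iso {i} {j1, j2} c c' f" if c: "c \<in> ?H" "c' \<in> ?H" for c c'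
    proof -
      obtain h where h: "over (surface c) (proj c) riemann_sphere (rat ?a ?b) h" "h (label_inf c j1) = Some 0"
        "h (label_inf c j2) = Some 1" "h (label_zero c i) = None" using to_model[OF c(1)] by blast
      obtain h' where h': "over (surface c') (proj c') riemann_sphere (rat ?a ?b) h'" "h' (label_inf c' j1) = Some 0"
        "h' (label_inf c' j2) = Some 1" "h' (label_zero c' i) = None" "label_inf c' j1 \<in> topspace (surface c')"
        "label_inf c' j2 \<in> topspace (surface c')" "label_zero c' i \<in> topspace (surface c')" using to_model[OF c(2)] by blast
      obtain g where g: "over riemann_sphere (rat ?a ?b) (surface c') (proj c') g" "\<And>x. x \<in> topspace (surface c') \<Longrightarrow> g (h' x) = x"
        by (rule over_inverse[OF h'(1)]) blast
      have o: "over (surface c) (proj c) (surface c') (proj c') (g \<circ> h)" by (rule over_compose[OF h(1) g(1)])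
      have "(g \<circ> h) (label_inf c j1) = label_inf c' j1" "(g \<circ> h) (label_inf c j2) = label_inf c' j2" "(g \<circ> h) (label_zero c i) = label_zero c' i"
        using g(2)[OF h'(5)] g(2)[OF h'(6)] g(2)[OF h'(7)] h h' by simp_all
      then show ?thesis using o unfolding cover_iso_def over_def by blast
    qed
    show "cover_aut {i} {j1, j2} c = {restrict id (topspace (surface c))}" if c: "c \<in> ?H" for c
    proof (intro equalityI subsetI)
      let ?S = "surface c" and ?p = "proj c"
      obtain h where h: "over ?S ?p riemann_sphere (rat ?a ?b) h" "h (label_inf c j1) = Some 0"
        "h (label_inf c j2) = Some 1" and t: "label_inf c j1 \<in> topspace ?S" "label_inf c j2 \<in> topspace ?S" "label_zero c i \<in> topspace ?S"
        using to_model[OF c] by blast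
      obtain g where g: "over riemann_sphere (rat ?a ?b) ?S ?p g" "\<And>x. x \<in> topspace ?S \<Longrightarrow> g (h x) = x"
        by (rule over_inverse[OF h(1)]) blast
      {
        fix f assume "f \<in> cover_aut {i} {j1, j2} c"
        then have f: "f \<in> extensional (topspace ?S)" "over ?S ?p ?S ?p f" "f (label_inf c j1) = label_inf c j1" "f (label_inf c j2) = label_inf c j2"
          by (auto simp: cover_aut_def cover_iso_def over_def)
        have g01: "g (Some 0) = label_inf c j1" "g (Some 1) = label_inf c j2" using g(2)[OF t(1)] g(2)[OF t(2)] h by simp_all
        have "over riemann_sphere (rat ?a ?b) riemann_sphere (rat ?a ?b) (h \<circ> (f \<circ> g))"
          by (rule over_compose[OF over_compose[OF g(1) f(2)] h(1)])
        then have id: "(h \<circ> (f \<circ> g)) x = x" for x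
          by (rule rat_automorphism[OF w(1,2)]) (use g01 f h in auto)
        have "f x = x" if x: "x \<in> topspace ?S" for x
        proof -
          have "h (f x) = h x" using id[of "h x"] g(2)[OF x] by simp
          then have "g (h (f x)) = g (h x)" by simp
          then show ?thesis using g(2)[OF x] g(2)[OF over_topspace[OF f(2) x]] by simp
        qed
        then have "f = restrict id (topspace ?S)" using f(1) by (auto simp: fun_eq_iff extensional_def)
        then show "f \<in> {restrict id (topspace ?S)}" by simp
      }
      fix f assume "f \<in> {restrict id (topspace ?S)}"
      then have f: "f = restrict id (topspace ?S)" by simp
      have "homeomorphic_map ?S ?S f" by (rule homeomorphic_map_eq[OF homeomorphic_map_id[THEN iffD2, OF refl]]) (simp add: f)
      then show "f \<in> cover_aut {i} {j1, j2} c" using t by (simp add: cover_aut_def cover_iso_def f)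
    qed
  qed
qed

text \<open>One side has one point and the other two; inversion makes the two points poles.\<close>

theorem hurwitz_number_trivalent:
  assumes "finite I" "finite J" "card I + card J = 3" "I \<noteq> {}" "J \<noteq> {}"
    and w: "\<And>e. e \<in> I \<Longrightarrow> wm e \<ge> 1" "\<And>e. e \<in> J \<Longrightarrow> wp e \<ge> 1" and bal: "sum wm I = sum wp J"
  shows "hurwitz_number I wm J wp {#2#} = 1"
proof -
  have pos: "card I \<ge> 1" "card J \<ge> 1" using assms by (simp_all add: Suc_le_eq card_gt_0_iff)
  then consider "card I = 1" "card J = 2" | "card J = 1" "card I = 2" using assms(3) by linarith
  then have "unique_cover I wm J wp {#2#}"
  proof cases
    case 1
    obtain i where i: "I = {i}" using 1(1) card_1_singletonE by blast
    obtain j1 j2 where jj: "J = {j1, j2}" "j1 \<noteq> j2" using 1(2) by (auto simp: card_2_iff)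
    show ?thesis unfolding i jj(1) by (rule unique_cover_two_poles[OF jj(2)]) (use i jj w bal in auto)
  next
    case 2
    obtain i where i: "J = {i}" using 2(1) card_1_singletonE by blast
    obtain j1 j2 where jj: "I = {j1, j2}" "j1 \<noteq> j2" using 2(2) by (auto simp: card_2_iff)
    have "unique_cover J wp I wm {#2#}" unfolding i jj(1) by (rule unique_cover_two_poles[OF jj(2)]) (use i jj w bal in auto)
    then show ?thesis by (rule flipc_unique) (simp add: bal)
  qed
  then show ?thesis using bal by (rule hurwitz_number_unique)
qed

section \<open>The contribution of a trivalent graph\<close>

text \<open>The choices of exponents for the factors of a product of power series in the coefficient of \<open>q^N\<close>.\<close>

definition splittings :: "'e set \<Rightarrow> nat \<Rightarrow> ('e \<Rightarrow> nat) set" where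
  "splittings E N = {j \<in> extensional E. sum j E = N}"

lemma finite_splittings: "finite E \<Longrightarrow> finite (splittings E N)"
proof -
  assume E: "finite E"
  have "splittings E N \<subseteq> (\<Pi>\<^sub>E e\<in>E. {..N})"
  proof
    fix j assume j: "j \<in> splittings E N"
    have "j e \<le> N" if e: "e \<in> E" for e
    proof -
      have "j e \<le> sum j E" by (rule member_le_sum[OF e _ E]) simp
      then show ?thesis using j by (simp add: splittings_def)
    qed
    moreover have "j \<in> extensional E" using j by (simp add: splittings_def)
    ultimately show "j \<in> (\<Pi>\<^sub>E e\<in>E. {..N})" by (simp add: PiE_iff)
  qed
  then show ?thesis by (rule finite_subset) (rule finite_PiE[OF E], simp)
qed

lemma fps_nth_prod_splittings:
  fixes a :: "'e \<Rightarrow> complex fps"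
  assumes "finite E"
  shows "fps_nth (\<Prod>e\<in>E. a e) N = (\<Sum>j\<in>splittings E N. \<Prod>e\<in>E. fps_nth (a e) (j e))"
  using assms
proof (induction E arbitrary: N)
  case empty
  have "splittings {} N = (if N = 0 then {\<lambda>_::'e. undefined} else {})" by (auto simp: splittings_def)
  then show ?case by simp
next
  case (insert x E)
  have "(\<Sum>j\<in>splittings (insert x E) N. \<Prod>e\<in>insert x E. fps_nth (a e) (j e)) =
      (\<Sum>(i, j)\<in>(SIGMA i:{0..N}. splittings E (N - i)). fps_nth (a x) i * (\<Prod>e\<in>E. fps_nth (a e) (j e)))"
  proof (rule sum.reindex_bij_witness[of _ "\<lambda>(i, j). j(x := i)" "\<lambda>j. (j x, j(x := undefined))"])
    fix j assume j: "j \<in> splittings (insert x E) N"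
    have s: "sum (j(x := undefined)) E = sum j E" by (rule sum.cong) (use insert.hyps in auto)
    then show "(j x, j(x := undefined)) \<in> (SIGMA i:{0..N}. splittings E (N - i))"
      using j insert.hyps by (auto simp: splittings_def extensional_def)
    have "(\<Prod>e\<in>E. fps_nth (a e) ((j(x := undefined)) e)) = (\<Prod>e\<in>E. fps_nth (a e) (j e))"
      by (rule prod.cong) (use insert.hyps in auto)
    then show "(case (j x, j(x := undefined)) of (i, j) \<Rightarrow> fps_nth (a x) i * (\<Prod>e\<in>E. fps_nth (a e) (j e))) =
        (\<Prod>e\<in>insert x E. fps_nth (a e) (j e))" using insert.hyps by simp
  next
    fix y assume "y \<in> (SIGMA i:{0..N}. splittings E (N - i))"
    then obtain i j where y: "y = (i, j)" "i \<le> N" "j \<in> extensional E" "sum j E = N - i" by (auto simp: splittings_def)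
    have s: "sum (j(x := i)) E = sum j E" by (rule sum.cong) (use insert.hyps in auto)
    then show "(case y of (i, j) \<Rightarrow> j(x := i)) \<in> splittings (insert x E) N"
      using y insert.hyps by (auto simp: splittings_def extensional_def)
    have "j x = undefined" using y(3) insert.hyps by (auto simp: extensional_def)
    then have "j(x := undefined) = j" by auto
    then show "((case y of (i, j) \<Rightarrow> j(x := i)) x, (case y of (i, j) \<Rightarrow> j(x := i))(x := undefined)) = y"
      by (simp add: y)
  qed auto
  also have "\<dots> = (\<Sum>i=0..N. \<Sum>j\<in>splittings E (N - i). fps_nth (a x) i * (\<Prod>e\<in>E. fps_nth (a e) (j e)))"
    using finite_splittings[OF insert.hyps(1)] by (subst sum.Sigma) auto
  also have "\<dots> = fps_nth (\<Prod>e\<in>insert x E. a e) N"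
    using insert by (simp add: fps_mult_nth sum_distrib_left)
  finally show ?case by simp
qed

definition balanced :: "'e multigraph \<Rightarrow> ('e \<Rightarrow> nat \<times> nat) \<Rightarrow> ('e \<Rightarrow> nat) \<Rightarrow> bool" where
  "balanced \<Gamma> G w \<longleftrightarrow> (\<forall>v\<in>{1..nverts \<Gamma>}. sum w (incoming \<Gamma> G v) = sum w (outgoing \<Gamma> G v))"

lemma incident_edges:
  assumes "G \<in> orientations \<Gamma>"
  shows "incoming \<Gamma> G v \<union> outgoing \<Gamma> G v = {e \<in> edges \<Gamma>. v \<in> set_uprod (ends \<Gamma> e)}"
    "incoming \<Gamma> G v \<inter> outgoing \<Gamma> G v = {e \<in> edges \<Gamma>. ends \<Gamma> e = Upair v v}"
proof -
  have *: "ends \<Gamma> e = Upair (fst (G e)) (snd (G e))" if "e \<in> edges \<Gamma>" for e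
    using assms that by (auto simp: orientations_def PiE_iff split: prod.splits dest!: bspec)
  show "incoming \<Gamma> G v \<union> outgoing \<Gamma> G v = {e \<in> edges \<Gamma>. v \<in> set_uprod (ends \<Gamma> e)}"
    by (auto simp: incoming_def outgoing_def *)
  show "incoming \<Gamma> G v \<inter> outgoing \<Gamma> G v = {e \<in> edges \<Gamma>. ends \<Gamma> e = Upair v v}"
    by (auto simp: incoming_def outgoing_def *)
qed

lemma two_sets_cases:
  assumes u: "I \<union> J = insert e L" and i: "I \<inter> J = L" and e: "e \<notin> L"
  shows "(I = L \<and> J = insert e L) \<or> (J = L \<and> I = insert e L)"
proof -
  have m: "x \<in> I \<or> x \<in> J \<longleftrightarrow> x = e \<or> x \<in> L" for x using u by (simp only: Un_iff[symmetric] insert_iff[symmetric])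
  have n: "x \<in> I \<and> x \<in> J \<longleftrightarrow> x \<in> L" for x by (simp only: i[symmetric] Int_iff)
  show ?thesis
  proof (cases "e \<in> I")
    case True
    have "J = L" "I = insert e L" by (rule set_eqI, use m n e True in metis, rule set_eqI, unfold insert_iff, use m n e True in metis)
    then show ?thesis by (intro disjI2 conjI)
  next
    case False
    have "I = L" "J = insert e L" by (rule set_eqI, use m n e False in metis, rule set_eqI, unfold insert_iff, use m n e False in metis)
    then show ?thesis by (intro disjI1 conjI)
  qed
qed

text \<open>Besides the loop, which counts on both sides, exactly one edge ends at the vertex; its positive width appears on one side only.\<close>

lemma loop_unbalanced:
  assumes \<Gamma>: "is_multigraph \<Gamma>" "trivalent \<Gamma>" and G: "G \<in> orientations \<Gamma>" and w: "w \<in> width_space \<Gamma>"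
    and e0: "e0 \<in> edges \<Gamma>" "ends \<Gamma> e0 = Upair v v"
  shows "\<not> balanced \<Gamma> G w"
proof
  assume bal: "balanced \<Gamma> G w"
  let ?A = "{e \<in> edges \<Gamma>. v \<in> set_uprod (ends \<Gamma> e)}" and ?L = "{e \<in> edges \<Gamma>. ends \<Gamma> e = Upair v v}"
  let ?I = "incoming \<Gamma> G v" and ?O = "outgoing \<Gamma> G v"
  have fin: "finite (edges \<Gamma>)" using \<Gamma>(1) by (simp add: is_multigraph_def)
  have "set_uprod (ends \<Gamma> e0) \<subseteq> {1..nverts \<Gamma>}" using \<Gamma>(1) e0(1) unfolding is_multigraph_def by blast
  then have v: "v \<in> {1..nverts \<Gamma>}" unfolding e0(2) by simp
  have val: "card ?A + card ?L = 3" using \<Gamma>(2) v unfolding trivalent_def valency_def by blast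
  have LA: "?L \<subseteq> ?A"
  proof
    fix e assume e: "e \<in> ?L"
    then have "ends \<Gamma> e = Upair v v" by blast
    then have "v \<in> set_uprod (ends \<Gamma> e)" by (simp only: set_uprod_simps insertI1)
    then show "e \<in> ?A" using e by blast
  qed
  have fL: "finite ?L" "finite ?A" using fin by simp_all
  have "?L \<noteq> {}" using e0 by blast
  then have cL: "card ?L \<ge> 1" using fL(1) by (simp only: One_nat_def Suc_le_eq card_gt_0_iff not_False_eq_True simp_thms)
  have "card ?L \<le> card ?A" by (rule card_mono[OF fL(2) LA])
  then have c1: "card ?L = 1" "card ?A = 2" using val cL by linarith+
  then have "card (?A - ?L) = 1" using card_Diff_subset[OF fL(1) LA] by linarith
  then obtain e1 where e1: "?A - ?L = {e1}" by (rule card_1_singletonE)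
  have A: "?A = insert e1 ?L" "e1 \<notin> ?L" using e1 LA by blast+
  have "e1 \<in> edges \<Gamma>" using e1 by blast
  then have w1: "w e1 \<ge> 1" using w by (simp add: width_space_def PiE_iff)
  note inc = incident_edges[OF G, of v]
  have S: "sum w ?I = sum w ?O" by (rule bal[unfolded balanced_def, rule_format, OF v])
  have D: "(?I = ?L \<and> ?O = insert e1 ?L) \<or> (?O = ?L \<and> ?I = insert e1 ?L)"
    by (rule two_sets_cases) (simp_all only: inc A not_False_eq_True)
  have ins: "sum w (insert e1 ?L) = w e1 + sum w ?L" by (rule sum.insert[OF fL(1) A(2)])
  from D show False
  proof (elim disjE conjE)
    assume a: "?I = ?L" "?O = insert e1 ?L"
    have "sum w ?L = w e1 + sum w ?L" using S unfolding a ins .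
    then show False using w1 by linarith
  next
    assume a: "?O = ?L" "?I = insert e1 ?L"
    have "w e1 + sum w ?L = sum w ?L" using S unfolding a ins .
    then show False using w1 by linarith
  qed
qed

text \<open>If all three edges were incoming or all outgoing, positive widths could not balance; so both sides are inhabited and the Hurwitz number is \<open>1\<close>.\<close>

lemma vertex_factor:
  assumes \<Gamma>: "is_multigraph \<Gamma>" "trivalent \<Gamma>" and G: "G \<in> orientations \<Gamma>" and w: "w \<in> width_space \<Gamma>"
    and v: "v \<in> {1..nverts \<Gamma>}" and loopless: "\<And>e. e \<in> edges \<Gamma> \<Longrightarrow> ends \<Gamma> e \<noteq> Upair v v"
  shows "hurwitz_number (incoming \<Gamma> G v) w (outgoing \<Gamma> G v) w {#2#} * balance \<Gamma> G w v =
    (if sum w (incoming \<Gamma> G v) = sum w (outgoing \<Gamma> G v) then 1 else 0)"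
proof -
  let ?I = "incoming \<Gamma> G v" and ?O = "outgoing \<Gamma> G v"
  have fin: "finite (edges \<Gamma>)" using \<Gamma>(1) by (simp add: is_multigraph_def)
  have sub: "?I \<subseteq> edges \<Gamma>" "?O \<subseteq> edges \<Gamma>" by (auto simp: incoming_def outgoing_def)
  have f: "finite ?I" "finite ?O" using sub fin finite_subset by blast+
  have L: "{e \<in> edges \<Gamma>. ends \<Gamma> e = Upair v v} = {}" using loopless by blast
  have "card {e \<in> edges \<Gamma>. v \<in> set_uprod (ends \<Gamma> e)} + card {e \<in> edges \<Gamma>. ends \<Gamma> e = Upair v v} = 3"
    using \<Gamma>(2) v unfolding trivalent_def valency_def by blast
  then have "card (?I \<union> ?O) = 3" unfolding incident_edges(1)[OF G] L by simp
  moreover have "?I \<inter> ?O = {}" using incident_edges(2)[OF G, of v] L by simp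
  ultimately have c: "card ?I + card ?O = 3" using card_Un_disjoint[OF f] by simp
  have w1: "w e \<ge> 1" if "e \<in> edges \<Gamma>" for e using w that by (auto simp: width_space_def PiE_iff)
  have "hurwitz_number ?I w ?O w {#2#} = 1" if bal: "sum w ?I = sum w ?O"
  proof (rule hurwitz_number_trivalent[OF f c _ _ _ _ bal])
    have pos: "sum w X > 0" if "X \<subseteq> edges \<Gamma>" "X \<noteq> {}" for X
    proof (rule sum_pos)
      show "finite X" "X \<noteq> {}" using that fin finite_subset by blast+
      show "0 < w e" if "e \<in> X" for e using w1[of e] \<open>X \<subseteq> edges \<Gamma>\<close> that by auto
    qed
    show "?I \<noteq> {}"
    proof
      assume "?I = {}"
      then have "?O \<noteq> {}" "sum w ?O = 0" using c bal by auto
      then show False using pos[OF sub(2)] by simp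
    qed
    show "?O \<noteq> {}"
    proof
      assume "?O = {}"
      then have "?I \<noteq> {}" "sum w ?I = 0" using c bal by auto
      then show False using pos[OF sub(1)] by simp
    qed
  qed (use w1 sub in auto)
  then show ?thesis by (simp add: balance_def)
qed

abbreviation vertex_weight where
  "vertex_weight prof \<Gamma> G w v \<equiv> hurwitz_number (incoming \<Gamma> G v) w (outgoing \<Gamma> G v) w (prof ! (v - 1)) * balance \<Gamma> G w v"

lemma contribution_balanced:
  assumes \<Gamma>: "is_multigraph \<Gamma>" "trivalent \<Gamma>" and prof: "prof = replicate (nverts \<Gamma>) {#2#}"
    and loopless: "\<And>e v. e \<in> edges \<Gamma> \<Longrightarrow> ends \<Gamma> e \<noteq> Upair v v"
  shows "contribution \<epsilon> prof \<Gamma> s = (\<Sum>G\<in>orientations \<Gamma>. \<Sum>(h, w)\<in>terms_of_exponent \<epsilon> \<Gamma> G s.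
    if balanced \<Gamma> G w then of_nat (\<Prod>e\<in>edges \<Gamma>. w e) else 0)"
  unfolding contribution_def
proof (intro sum.cong refl)
  fix G x assume G: "G \<in> orientations \<Gamma>" and x: "x \<in> terms_of_exponent \<epsilon> \<Gamma> G s"
  obtain h w where hw: "x = (h, w)" by (cases x)
  then have w: "w \<in> width_space \<Gamma>" using x by (simp add: terms_of_exponent_def)
  let ?b = "\<lambda>v. sum w (incoming \<Gamma> G v) = sum w (outgoing \<Gamma> G v)"
  have "(\<Prod>v\<in>{1..nverts \<Gamma>}. vertex_weight prof \<Gamma> G w v) =
      (\<Prod>v\<in>{1..nverts \<Gamma>}. if ?b v then 1 else 0)"
  proof (rule prod.cong[OF refl])
    fix v assume v: "v \<in> {1..nverts \<Gamma>}"
    then have "v - 1 < nverts \<Gamma>" by auto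
    then have "prof ! (v - 1) = {#2#}" unfolding prof by (rule nth_replicate)
    then show "vertex_weight prof \<Gamma> G w v = (if ?b v then 1 else 0)"
      using vertex_factor[OF \<Gamma> G w v loopless] by simp
  qed
  also have "\<dots> = (if balanced \<Gamma> G w then 1 else 0)" by (auto simp: balanced_def)
  finally have eq: "(\<Prod>v\<in>{1..nverts \<Gamma>}. vertex_weight prof \<Gamma> G w v) =
    (if balanced \<Gamma> G w then 1 else 0)" .
  show "(case x of (h, w) \<Rightarrow> complex_of_real ((\<Prod>e\<in>edges \<Gamma>. real (w e)) * (\<Prod>v\<in>{1..nverts \<Gamma>}.
      vertex_weight prof \<Gamma> G w v))) =
    (case x of (h, w) \<Rightarrow> if balanced \<Gamma> G w then of_nat (\<Prod>e\<in>edges \<Gamma>. w e) else 0)"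
    unfolding hw prod.case eq by simp
qed

lemma contribution_loop:
  assumes \<Gamma>: "is_multigraph \<Gamma>" "trivalent \<Gamma>" and e0: "e0 \<in> edges \<Gamma>" "ends \<Gamma> e0 = Upair v v"
  shows "contribution \<epsilon> prof \<Gamma> s = 0"
  unfolding contribution_def
proof (intro sum.neutral ballI)
  fix G x assume G: "G \<in> orientations \<Gamma>" and x: "x \<in> terms_of_exponent \<epsilon> \<Gamma> G s"
  obtain h w where hw: "x = (h, w)" by (cases x)
  then have w: "w \<in> width_space \<Gamma>" using x by (simp add: terms_of_exponent_def)
  obtain v where v: "v \<in> {1..nverts \<Gamma>}" "sum w (incoming \<Gamma> G v) \<noteq> sum w (outgoing \<Gamma> G v)"
    using loop_unbalanced[OF \<Gamma> G w e0] by (auto simp: balanced_def)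
  then have "balance \<Gamma> G w v = 0" by (simp add: balance_def)
  then have "(\<Prod>v\<in>{1..nverts \<Gamma>}. vertex_weight prof \<Gamma> G w v) = 0"
    using v(1) by (intro prod_zero) auto
  then show "(case x of (h, w) \<Rightarrow> complex_of_real ((\<Prod>e\<in>edges \<Gamma>. real (w e)) * (\<Prod>v\<in>{1..nverts \<Gamma>}.
      vertex_weight prof \<Gamma> G w v))) = 0"
    unfolding hw by simp
qed

text \<open>The series \<open>n / (1 - q^n)\<close>, which collects the width and all heights of one edge.\<close>

definition edge_series :: "int \<Rightarrow> complex fps" where "edge_series = EE 1 1"

lemma edge_series_nth:
  "fps_nth (edge_series m) k = (if m \<noteq> 0 \<and> nat \<bar>m\<bar> dvd k \<and> (m < 0 \<longrightarrow> k > 0) then of_nat (nat \<bar>m\<bar>) else 0)"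
proof (cases "m > 0")
  case True
  then show ?thesis by (simp add: edge_series_def EE_def gf_def fps_of_int fps_mult_left_const_nth flip: fps_of_int)
next
  case False
  then show ?thesis by (cases "m = 0") (auto simp: edge_series_def EE_def gf_def simp flip: fps_of_int)
qed

lemma edge_series_nz:
  "fps_nth (edge_series m) k \<noteq> 0 \<longleftrightarrow> m \<noteq> 0 \<and> (\<exists>i. k = nat \<bar>m\<bar> * i \<and> (m < 0 \<longrightarrow> i > 0))"
proof (cases "m = 0")
  case False
  then have n: "nat \<bar>m\<bar> > 0" by simp
  then have "k > 0 \<longleftrightarrow> i > 0" if "k = nat \<bar>m\<bar> * i" for i using that by simp
  then show ?thesis unfolding edge_series_nth using False n by (auto simp only: dvd_def split: if_splits) auto
qed (simp add: edge_series_nth)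

lemma edge_series_value: "fps_nth (edge_series m) k \<noteq> 0 \<Longrightarrow> fps_nth (edge_series m) k = of_nat (nat \<bar>m\<bar>)"
  unfolding edge_series_nth by (simp split: if_splits)

text \<open>Loopless graphs, with every edge given by its smaller and its larger end.\<close>

locale ordered_graph =
  fixes \<Gamma> :: "'e multigraph" and lo hi :: "'e \<Rightarrow> nat" and \<epsilon> :: "nat \<Rightarrow> real"
  assumes mg: "is_multigraph \<Gamma>" and ends: "\<And>e. e \<in> edges \<Gamma> \<Longrightarrow> ends \<Gamma> e = Upair (lo e) (hi e) \<and> lo e < hi e"
begin

abbreviation "E \<equiv> edges \<Gamma>"

lemma finE: "finite E" using mg by (simp add: is_multigraph_def)

lemma orientation_iff: "G \<in> orientations \<Gamma> \<longleftrightarrow> G \<in> extensional E \<and> (\<forall>e\<in>E. G e = (lo e, hi e) \<or> G e = (hi e, lo e))"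
proof -
  have "{(a, b). Upair a b = ends \<Gamma> e} = {(lo e, hi e), (hi e, lo e)}" if "e \<in> E" for e
    using ends[OF that] by auto
  then show ?thesis by (auto simp: orientations_def PiE_iff)
qed

definition configurations :: "real \<Rightarrow> (('e \<Rightarrow> nat \<times> nat) \<times> ('e \<Rightarrow> real) \<times> ('e \<Rightarrow> nat)) set" where
  "configurations s = {(G, h, w). G \<in> orientations \<Gamma> \<and> (h, w) \<in> terms_of_exponent \<epsilon> \<Gamma> G s \<and> balanced \<Gamma> G w}"

text \<open>Pairs of a flow and a way to distribute the exponent over the edges that occur in the flow sum.\<close>

definition split_flows :: "nat \<Rightarrow> (('e \<Rightarrow> int) \<times> ('e \<Rightarrow> nat)) set" where
  "split_flows N = {(f, j). f \<in> flows E lo hi \<and> j \<in> splittings E N \<and>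
     (\<forall>e\<in>E. fps_nth (edge_series (f e)) (j e) \<noteq> 0)}"

text \<open>The signed flow of an orientation with widths: positive if the edge points to its larger end.\<close>

definition flow_of :: "('e \<Rightarrow> nat \<times> nat) \<Rightarrow> ('e \<Rightarrow> nat) \<Rightarrow> 'e \<Rightarrow> int" where
  "flow_of G w e = (if e \<in> E then if G e = (lo e, hi e) then int (w e) else - int (w e) else 0)"

definition gap :: "'e \<Rightarrow> real" where "gap e = \<epsilon> (hi e) - \<epsilon> (lo e)"

lemma flow_of_flows:
  assumes G: "G \<in> orientations \<Gamma>" shows "flow_of G w \<in> flows E lo hi \<longleftrightarrow> balanced \<Gamma> G w"
proof -
  have eq: "(\<Sum>e\<in>E. flow_of G w e * (of_bool (lo e = v) - of_bool (hi e = v))) =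
      int (sum w (outgoing \<Gamma> G v)) - int (sum w (incoming \<Gamma> G v))" for v
  proof -
    have "(\<Sum>e\<in>E. flow_of G w e * (of_bool (lo e = v) - of_bool (hi e = v))) =
        (\<Sum>e\<in>E. (if fst (G e) = v then int (w e) else 0) - (if snd (G e) = v then int (w e) else 0))"
    proof (rule sum.cong[OF refl])
      fix e assume e: "e \<in> E"
      then consider "G e = (lo e, hi e)" | "G e = (hi e, lo e)" using G by (auto simp: orientation_iff)
      then show "flow_of G w e * (of_bool (lo e = v) - of_bool (hi e = v)) =
          (if fst (G e) = v then int (w e) else 0) - (if snd (G e) = v then int (w e) else 0)"
        by cases (use e ends[OF e] in \<open>auto simp: flow_of_def\<close>)
    qed
    then show ?thesis using finE by (simp add: sum_subtractf outgoing_def incoming_def sum.inter_filter if_distrib[of int] cong: if_cong)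
  qed
  have out: "outgoing \<Gamma> G v = {}" "incoming \<Gamma> G v = {}" if "v \<notin> {1..nverts \<Gamma>}" for v
  proof -
    have "{e \<in> E. v \<in> set_uprod (ends \<Gamma> e)} = {}" using mg that unfolding is_multigraph_def by blast
    then show "outgoing \<Gamma> G v = {}" "incoming \<Gamma> G v = {}" using incident_edges(1)[OF G, of v] by blast+
  qed
  have "flow_of G w \<in> flows E lo hi \<longleftrightarrow> (\<forall>v. sum w (outgoing \<Gamma> G v) = sum w (incoming \<Gamma> G v))"
  proof -
    have "\<forall>e. e \<notin> E \<longrightarrow> flow_of G w e = 0" by (simp add: flow_of_def)
    then show ?thesis unfolding flows_def mem_Collect_eq eq right_minus_eq of_nat_eq_iff by blast
  qed
  also have "\<dots> \<longleftrightarrow> balanced \<Gamma> G w"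
  proof
    assume bal: "balanced \<Gamma> G w"
    show "\<forall>v. sum w (outgoing \<Gamma> G v) = sum w (incoming \<Gamma> G v)"
    proof
      fix v show "sum w (outgoing \<Gamma> G v) = sum w (incoming \<Gamma> G v)"
        using bal out[of v] by (cases "v \<in> {1..nverts \<Gamma>}") (auto simp: balanced_def)
    qed
  qed (simp add: balanced_def)
  finally show ?thesis .
qed

lemma sum_gap: "f \<in> flows E lo hi \<Longrightarrow> (\<Sum>e\<in>E. of_int (f e) * gap e) = 0"
  using flows_potential[OF finE, of f lo hi \<epsilon>] by (simp add: gap_def algebra_simps sum_subtractf)

text \<open>The correspondence between configurations and split flows. The exponent \<open>h w\<close> of an edge with signed flow \<open>f\<close> differs by \<open>f (\<epsilon>_hi - \<epsilon>_lo)\<close> from a multiple of the width, and these corrections add up to \<open>0\<close>.\<close>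

definition unconf :: "('e \<Rightarrow> int) \<times> ('e \<Rightarrow> nat) \<Rightarrow> ('e \<Rightarrow> nat \<times> nat) \<times> ('e \<Rightarrow> real) \<times> ('e \<Rightarrow> nat)" where
  "unconf = (\<lambda>(f, j). (\<lambda>e\<in>E. if f e > 0 then (lo e, hi e) else (hi e, lo e),
     \<lambda>e\<in>E. real (j e) / real (nat \<bar>f e\<bar>) + of_int (sgn (f e)) * gap e, \<lambda>e\<in>E. nat \<bar>f e\<bar>))"

definition conf :: "('e \<Rightarrow> nat \<times> nat) \<times> ('e \<Rightarrow> real) \<times> ('e \<Rightarrow> nat) \<Rightarrow> ('e \<Rightarrow> int) \<times> ('e \<Rightarrow> nat)" where
  "conf = (\<lambda>(G, h, w). (flow_of G w, \<lambda>e\<in>E. nat \<lfloor>h e * real (w e) - of_int (flow_of G w e) * gap e\<rfloor>))"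

text \<open>The additional \<open>1\<close> in the height of a descending edge matches the expansion of \<open>n / (1 - q^n)\<close> for negative \<open>n\<close>, which starts with \<open>q^|n|\<close>.\<close>

lemma edge_height:
  assumes G: "G \<in> orientations \<Gamma>" and h: "h \<in> height_space \<epsilon> \<Gamma> G" and w: "w \<in> width_space \<Gamma>" and e: "e \<in> E"
  obtains k where "h e = real k + (if G e = (lo e, hi e) then gap e else - gap e)" "G e \<noteq> (lo e, hi e) \<Longrightarrow> k \<ge> 1" "w e \<ge> 1"
    "h e * real (w e) - of_int (flow_of G w e) * gap e = real (w e * k)"
proof -
  have "h e - height_shift \<epsilon> G e \<in> \<nat>" using h e by (auto simp: height_space_def PiE_iff)
  then obtain k where k: "h e = height_shift \<epsilon> G e + real k" by (auto elim!: Nats_cases simp: algebra_simps)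
  have w1: "w e \<ge> 1" using w e by (auto simp: width_space_def PiE_iff)
  show thesis
  proof (cases "G e = (lo e, hi e)")
    case True
    then have "h e = real k + gap e" using k ends[OF e] by (simp add: height_shift_def gap_def)
    then show ?thesis using that[of k] True w1 e by (simp add: flow_of_def algebra_simps)
  next
    case False
    then have "G e = (hi e, lo e)" using G e by (auto simp: orientation_iff)
    then have "h e = real (k + 1) + - gap e" using k ends[OF e] by (simp add: height_shift_def gap_def)
    moreover from this have "h e * real (w e) - of_int (flow_of G w e) * gap e = real (w e * (k + 1))"
      using False e by (simp only: flow_of_def if_True if_False) (simp add: algebra_simps)
    ultimately show ?thesis using that[of "k + 1"] False w1 by simp
  qed
qed

lemma conf_props:
  assumes x: "(G, h, w) \<in> configurations s"
  shows "\<exists>N. s = real N \<and> conf (G, h, w) \<in> split_flows N" "unconf (conf (G, h, w)) = (G, h, w)"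
proof -
  have G: "G \<in> orientations \<Gamma>" and h: "h \<in> height_space \<epsilon> \<Gamma> G" and w: "w \<in> width_space \<Gamma>" and bal: "balanced \<Gamma> G w"
    and s: "(\<Sum>e\<in>E. h e * real (w e)) = s" using x by (auto simp: configurations_def terms_of_exponent_def)
  let ?f = "flow_of G w"
  define jj where "jj = snd (conf (G, h, w))"
  have f: "?f \<in> flows E lo hi" using flow_of_flows[OF G] bal by simp
  have j: "real (jj e) = h e * real (w e) - of_int (?f e) * gap e \<and> nat \<bar>?f e\<bar> = w e \<and> fps_nth (edge_series (?f e)) (jj e) \<noteq> 0 \<and>
      (?f e > 0 \<longleftrightarrow> G e = (lo e, hi e)) \<and> real (jj e) / real (w e) + of_int (sgn (?f e)) * gap e = h e"
    if e: "e \<in> E" for e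
  proof -
    obtain k where k: "h e = real k + (if G e = (lo e, hi e) then gap e else - gap e)" "G e \<noteq> (lo e, hi e) \<Longrightarrow> k \<ge> 1" "w e \<ge> 1"
      "h e * real (w e) - of_int (?f e) * gap e = real (w e * k)" by (rule edge_height[OF G h w e]) blast
    have je: "jj e = w e * k" using e k(4) by (simp add: jj_def conf_def del: of_nat_mult)
    have fw: "nat \<bar>?f e\<bar> = w e" "?f e \<noteq> 0" "?f e < 0 \<longrightarrow> k > 0" using e k(2,3) by (auto simp: flow_of_def)
    then have nz: "fps_nth (edge_series (?f e)) (jj e) \<noteq> 0" unfolding edge_series_nz je fw(1) by blast
    have "real (jj e) / real (w e) + of_int (sgn (?f e)) * gap e = h e" "?f e > 0 \<longleftrightarrow> G e = (lo e, hi e)"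
      using k(1,3) e unfolding je by (auto simp: flow_of_def)
    then show ?thesis using k(4) fw(1) nz unfolding je by (intro conjI) (simp_all only: not_False_eq_True)
  qed
  have "(\<Sum>e\<in>E. real (jj e)) = (\<Sum>e\<in>E. h e * real (w e)) - (\<Sum>e\<in>E. of_int (?f e) * gap e)"
    unfolding sum_subtractf[symmetric] by (rule sum.cong) (use j in auto)
  then have sj: "real (sum jj E) = s" using sum_gap[OF f] s by simp
  have jE: "jj \<in> extensional E" by (simp add: jj_def conf_def)
  have c: "conf (G, h, w) = (?f, jj)" by (simp add: jj_def conf_def)
  have nz: "\<forall>e\<in>E. fps_nth (edge_series (?f e)) (jj e) \<noteq> 0" using j by blast
  have ext: "G \<in> extensional E" "h \<in> extensional E" "w \<in> extensional E"
    by (rule G[unfolded orientation_iff, THEN conjunct1] h[unfolded height_space_def PiE_iff, THEN conjunct2]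
        w[unfolded width_space_def PiE_iff, THEN conjunct2])+
  have "(?f, jj) \<in> split_flows (sum jj E)"
    unfolding split_flows_def splittings_def mem_Collect_eq prod.case by (intro conjI f jE nz refl)
  then show "\<exists>N. s = real N \<and> conf (G, h, w) \<in> split_flows N"
    unfolding c by (intro exI[of _ "sum jj E"] conjI sj[symmetric])
  have "(\<lambda>e\<in>E. if ?f e > 0 then (lo e, hi e) else (hi e, lo e)) = G"
  proof (rule extensionalityI[of _ E])
    fix e assume e: "e \<in> E"
    have o: "G e = (lo e, hi e) \<or> G e = (hi e, lo e)" using G e unfolding orientation_iff by blast
    have "?f e > 0 \<longleftrightarrow> G e = (lo e, hi e)" using j[OF e] by blast
    then show "(\<lambda>e\<in>E. if ?f e > 0 then (lo e, hi e) else (hi e, lo e)) e = G e"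
      using o by (cases "G e = (lo e, hi e)") (simp_all add: e)
  qed (simp_all add: ext)
  moreover have "(\<lambda>e\<in>E. real (jj e) / real (nat \<bar>?f e\<bar>) + of_int (sgn (?f e)) * gap e) = h"
  proof (rule extensionalityI[of _ E])
    fix e assume e: "e \<in> E"
    have "nat \<bar>?f e\<bar> = w e" "real (jj e) / real (w e) + of_int (sgn (?f e)) * gap e = h e" using j[OF e] by blast+
    then show "(\<lambda>e\<in>E. real (jj e) / real (nat \<bar>?f e\<bar>) + of_int (sgn (?f e)) * gap e) e = h e"
      using e by (simp only: restrict_apply if_True)
  qed (simp_all add: ext)
  moreover have "(\<lambda>e\<in>E. nat \<bar>?f e\<bar>) = w"
  proof (rule extensionalityI[of _ E])
    fix e assume e: "e \<in> E"
    have "nat \<bar>?f e\<bar> = w e" using j[OF e] by blast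
    then show "(\<lambda>e\<in>E. nat \<bar>?f e\<bar>) e = w e" using e by (simp only: restrict_apply if_True)
  qed (simp_all add: ext)
  ultimately show "unconf (conf (G, h, w)) = (G, h, w)" unfolding c unconf_def by (simp only: prod.case)
qed

lemma unconf_props:
  assumes x: "(f, j) \<in> split_flows N"
  shows "unconf (f, j) \<in> configurations (real N)" "conf (unconf (f, j)) = (f, j)"
proof -
  have f: "f \<in> flows E lo hi" and j: "j \<in> extensional E" "sum j E = N"
    and d: "\<And>e. e \<in> E \<Longrightarrow> f e \<noteq> 0 \<and> (\<exists>i. j e = nat \<bar>f e\<bar> * i \<and> (f e < 0 \<longrightarrow> i > 0))"
    using x by (auto simp: split_flows_def splittings_def edge_series_nz)
  obtain G h w where u: "unconf (f, j) = (G, h, w)" by (metis prod_cases3)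
  then have GE: "G = (\<lambda>e\<in>E. if f e > 0 then (lo e, hi e) else (hi e, lo e))"
    and hE: "h = (\<lambda>e\<in>E. real (j e) / real (nat \<bar>f e\<bar>) + of_int (sgn (f e)) * gap e)" and wE: "w = (\<lambda>e\<in>E. nat \<bar>f e\<bar>)"
    by (simp_all add: unconf_def)
  have G: "G \<in> orientations \<Gamma>" unfolding orientation_iff GE by simp
  have "nat \<bar>f e\<bar> \<ge> 1" if "e \<in> E" for e using d[OF that] by linarith
  then have w: "w \<in> width_space \<Gamma>" unfolding width_space_def wE by (simp add: PiE_iff)
  have ff: "flow_of G w = f"
  proof
    fix e show "flow_of G w e = f e"
    proof (cases "e \<in> E")
      case True
      then have "lo e \<noteq> hi e" using ends by (metis less_irrefl)
      then show ?thesis using True by (cases "f e > 0") (simp_all add: flow_of_def GE wE)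
    next
      case False
      then show ?thesis using f by (simp add: flow_of_def flows_def)
    qed
  qed
  have bal: "balanced \<Gamma> G w" using flow_of_flows[OF G, of w] f by (simp add: ff)
  have h: "h \<in> height_space \<epsilon> \<Gamma> G"
    unfolding height_space_def
  proof (rule PiE_I)
    fix e assume e: "e \<in> E"
    obtain k where k: "j e = nat \<bar>f e\<bar> * k" "f e < 0 \<longrightarrow> k > 0" and f0: "f e \<noteq> 0" using d[OF e] by blast
    have jk: "real (j e) / real (nat \<bar>f e\<bar>) = real k" unfolding k(1) using f0 by simp
    have he: "h e = real k + of_int (sgn (f e)) * gap e" unfolding hE jk[symmetric] using e by (simp only: restrict_apply if_True)
    have "h e - height_shift \<epsilon> G e = real (if f e > 0 then k else k - 1)"
      unfolding he using e ends[OF e] f0 k(2) by (auto simp: GE height_shift_def gap_def sgn_if of_nat_diff)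
    then show "h e \<in> {x. x - height_shift \<epsilon> G e \<in> \<nat>}" by (metis mem_Collect_eq of_nat_in_Nats)
  qed (simp add: hE)
  have hw: "h e * real (w e) - of_int (f e) * gap e = real (j e)" if e: "e \<in> E" for e
  proof -
    have "real (nat \<bar>f e\<bar>) \<noteq> 0" using d[OF e] by simp
    moreover have "of_int (sgn (f e)) * real (nat \<bar>f e\<bar>) = of_int (f e)" by (simp add: sgn_if)
    ultimately show ?thesis using e by (simp add: hE wE distrib_right mult.assoc mult.left_commute)

  qed
  have "(\<Sum>e\<in>E. h e * real (w e)) - (\<Sum>e\<in>E. of_int (f e) * gap e) = (\<Sum>e\<in>E. real (j e))"
    unfolding sum_subtractf[symmetric] by (rule sum.cong) (use hw in auto)
  then have s: "(\<Sum>e\<in>E. h e * real (w e)) = real N" using sum_gap[OF f] j(2) by (simp flip: of_nat_sum)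
  show "unconf (f, j) \<in> configurations (real N)" unfolding u using G h w s bal by (simp add: configurations_def terms_of_exponent_def)
  have "(\<lambda>e\<in>E. nat \<lfloor>h e * real (w e) - of_int (f e) * gap e\<rfloor>) = j"
    by (rule extensionalityI[of _ E]) (use hw j(1) in auto)
  then show "conf (unconf (f, j)) = (f, j)" unfolding u conf_def by (simp add: ff)
qed

text \<open>Both sides enumerate the same set with the same weights; finiteness is known for configurations and is transported to split flows.\<close>

lemma configurations_sum:
  assumes fin: "finite (configurations (real N))"
  shows "(\<Sum>(G, h, w)\<in>configurations (real N). of_nat (\<Prod>e\<in>E. w e)) = fps_nth (flow_sum E lo hi (\<lambda>_. edge_series)) N"
proof -
  let ?T = "split_flows N" and ?a = "\<lambda>f j. \<Prod>e\<in>E. fps_nth (edge_series (f e)) (j e)"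
  have cT: "conf x \<in> ?T" "unconf (conf x) = x" if "x \<in> configurations (real N)" for x
    using conf_props[of "fst x" "fst (snd x)" "snd (snd x)" "real N"] that by auto
  have uT: "unconf y \<in> configurations (real N)" "conf (unconf y) = y" if "y \<in> ?T" for y
    using unconf_props[of "fst y" "snd y" N] that by auto
  have "unconf ` ?T \<subseteq> configurations (real N)" using uT by blast
  moreover have "inj_on unconf ?T" using uT(2) by (metis inj_on_inverseI)
  ultimately have finT: "finite ?T" using fin by (metis finite_imageD finite_subset)
  have nz: "?a f j = (if (f, j) \<in> ?T then of_nat (\<Prod>e\<in>E. nat \<bar>f e\<bar>) else 0)" if "f \<in> flows E lo hi" "j \<in> splittings E N" for f j
  proof (cases "(f, j) \<in> ?T")
    case True
    then have "?a f j = (\<Prod>e\<in>E. of_nat (nat \<bar>f e\<bar>))" by (intro prod.cong[OF refl] edge_series_value) (auto simp: split_flows_def)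
    then show ?thesis using True by simp
  next
    case False
    then have "\<not> (\<forall>e\<in>E. fps_nth (edge_series (f e)) (j e) \<noteq> 0)" using that by (simp add: split_flows_def)
    then obtain e where "e \<in> E" "fps_nth (edge_series (f e)) (j e) = 0" by blast
    then have "?a f j = 0" using finE by (intro prod_zero) auto
    then show ?thesis using False by simp
  qed
  have finJ: "finite (splittings E N)" by (rule finite_splittings[OF finE])
  have "fps_nth (flow_sum E lo hi (\<lambda>_. edge_series)) N = (\<Sum>f\<in>fst ` ?T. fps_nth (\<Prod>e\<in>E. edge_series (f e)) N)"
    unfolding flow_sum_def
  proof (rule fsum_nth)
    show "finite (fst ` ?T)" using finT by simp
    show "fst ` ?T \<subseteq> flows E lo hi" by (auto simp: split_flows_def)
    fix f assume f: "f \<in> flows E lo hi - fst ` ?T"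
    then have "?a f j = 0" if "j \<in> splittings E N" for j using nz[of f j] that by force
    then show "fps_nth (\<Prod>e\<in>E. edge_series (f e)) N = 0" by (simp add: fps_nth_prod_splittings[OF finE])
  qed
  also have "\<dots> = (\<Sum>f\<in>fst ` ?T. \<Sum>j\<in>splittings E N. ?a f j)" by (simp add: fps_nth_prod_splittings[OF finE])
  also have "\<dots> = (\<Sum>(f, j)\<in>fst ` ?T \<times> splittings E N. ?a f j)" by (rule sum.cartesian_product)
  also have "\<dots> = (\<Sum>(f, j)\<in>?T. of_nat (\<Prod>e\<in>E. nat \<bar>f e\<bar>))"
  proof (rule sum.mono_neutral_cong_right)
    show "?T \<subseteq> fst ` ?T \<times> splittings E N" by (force simp: split_flows_def)
    show "\<forall>i\<in>fst ` ?T \<times> splittings E N - ?T. (case i of (f, j) \<Rightarrow> ?a f j) = 0"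
    proof
      fix i assume i: "i \<in> fst ` ?T \<times> splittings E N - ?T"
      obtain f j where ij: "i = (f, j)" by (cases i)
      have "f \<in> flows E lo hi" "j \<in> splittings E N" "(f, j) \<notin> ?T" using i by (auto simp: ij split_flows_def)
      then show "(case i of (f, j) \<Rightarrow> ?a f j) = 0" using nz[of f j] by (simp add: ij)
    qed
    show "(case x of (f, j) \<Rightarrow> ?a f j) = (case x of (f, j) \<Rightarrow> of_nat (\<Prod>e\<in>E. nat \<bar>f e\<bar>))" if x: "x \<in> ?T" for x
    proof -
      obtain f j where ij: "x = (f, j)" by (cases x)
      have "f \<in> flows E lo hi" "j \<in> splittings E N" using x by (auto simp: ij split_flows_def)
      then show ?thesis using nz[of f j] x by (simp add: ij)
    qed
  qed (use finT finJ in auto)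
  also have "\<dots> = (\<Sum>(G, h, w)\<in>configurations (real N). of_nat (\<Prod>e\<in>E. w e))"
  proof (rule sum.reindex_bij_witness[of _ conf unconf])
    show "(case unconf y of (G, h, w) \<Rightarrow> of_nat (\<Prod>e\<in>E. w e)) = (case y of (f, j) \<Rightarrow> (of_nat (\<Prod>e\<in>E. nat \<bar>f e\<bar>) :: complex))" if "y \<in> ?T" for y
      by (cases y) (simp add: unconf_def cong: prod.cong)
  qed (use cT uT in auto)
  finally show ?thesis by simp
qed

end

lemma contribution_flow_sum:
  assumes \<Gamma>: "is_multigraph \<Gamma>" "trivalent \<Gamma>" and prof: "prof = replicate (nverts \<Gamma>) {#2#}"
    and eps: "\<And>i. i \<in> {1..nverts \<Gamma>} \<Longrightarrow> 0 \<le> \<epsilon> i \<and> \<epsilon> i < 1" "strict_mono_on {1..nverts \<Gamma>} \<epsilon>"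
    and ends: "\<And>e. e \<in> edges \<Gamma> \<Longrightarrow> ends \<Gamma> e = Upair (lo e) (hi e) \<and> lo e < hi e"
  shows "contribution \<epsilon> prof \<Gamma> = real_exponent_series (flow_sum (edges \<Gamma>) lo hi (\<lambda>_. edge_series))"
proof
  fix s
  interpret ordered_graph \<Gamma> lo hi \<epsilon> by unfold_locales (use \<Gamma> ends in auto)
  have loopless: "ends \<Gamma> e \<noteq> Upair v v" if "e \<in> edges \<Gamma>" for e v using ends[OF that] by auto
  have fo: "finite (orientations \<Gamma>)" by (rule finite_orientations[OF \<Gamma>(1)])
  have ft: "\<forall>G\<in>orientations \<Gamma>. finite (terms_of_exponent \<epsilon> \<Gamma> G s)" for s
    using finite_terms_of_exponent[OF \<Gamma>(1) _ eps] by blast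
  let ?S = "\<lambda>s. SIGMA G:orientations \<Gamma>. terms_of_exponent \<epsilon> \<Gamma> G s"
  have finS: "finite (?S s)" for s using fo ft by (intro finite_SigmaI) auto
  have cf: "configurations s = {x \<in> ?S s. case x of (G, h, w) \<Rightarrow> balanced \<Gamma> G w}" for s by (auto simp: configurations_def)
  have fin: "finite (configurations s)" for s unfolding cf using finS by simp
  have "contribution \<epsilon> prof \<Gamma> s = (\<Sum>G\<in>orientations \<Gamma>. \<Sum>x\<in>terms_of_exponent \<epsilon> \<Gamma> G s.
      if balanced \<Gamma> G (snd x) then of_nat (\<Prod>e\<in>edges \<Gamma>. snd x e) else 0)"
    using contribution_balanced[OF \<Gamma> prof loopless, of \<epsilon> s] by (simp add: case_prod_unfold)
  also have "\<dots> = (\<Sum>(G, x)\<in>?S s. if balanced \<Gamma> G (snd x) then of_nat (\<Prod>e\<in>edges \<Gamma>. snd x e) else 0)"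
    by (rule sum.Sigma[OF fo ft])
  also have "\<dots> = (\<Sum>y\<in>?S s. if (case y of (G, h, w) \<Rightarrow> balanced \<Gamma> G w) then (case y of (G, h, w) \<Rightarrow> of_nat (\<Prod>e\<in>edges \<Gamma>. w e)) else 0)"
    by (rule sum.cong) auto
  also have "\<dots> = (\<Sum>(G, h, w)\<in>configurations s. of_nat (\<Prod>e\<in>edges \<Gamma>. w e))"
    unfolding cf by (rule sum.inter_filter[symmetric, OF finS])
  finally have c: "contribution \<epsilon> prof \<Gamma> s = (\<Sum>(G, h, w)\<in>configurations s. of_nat (\<Prod>e\<in>edges \<Gamma>. w e))" .
  show "contribution \<epsilon> prof \<Gamma> s = real_exponent_series (flow_sum (edges \<Gamma>) lo hi (\<lambda>_. edge_series)) s"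
  proof (cases "s \<in> \<nat>")
    case True
    then obtain N where s: "s = real N" by (auto elim: Nats_cases)
    then have "contribution \<epsilon> prof \<Gamma> s = fps_nth (flow_sum (edges \<Gamma>) lo hi (\<lambda>_. edge_series)) N"
      using c configurations_sum[of N] fin by simp
    then show ?thesis using s by (simp add: real_exponent_series_def)
  next
    case False
    have "configurations s = {}"
    proof (rule ccontr)
      assume "configurations s \<noteq> {}"
      then obtain G h w where "(G, h, w) \<in> configurations s" by (metis all_not_in_conv prod_cases3)
      from conf_props(1)[OF this] show False using False by auto
    qed
    then show ?thesis using c False by (simp add: real_exponent_series_def)
  qed
qed

text \<open>Count incident pairs of a vertex and an edge in two ways.\<close>

lemma trivalent_edge_count:
  assumes \<Gamma>: "is_multigraph \<Gamma>" "trivalent \<Gamma>" and ends: "\<And>e. e \<in> edges \<Gamma> \<Longrightarrow> ends \<Gamma> e = Upair (lo e) (hi e) \<and> lo e < hi e"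
  shows "2 * card (edges \<Gamma>) = 3 * nverts \<Gamma>"
proof -
  let ?V = "{1..nverts \<Gamma>}"
  have fin: "finite (edges \<Gamma>)" using \<Gamma>(1) by (simp add: is_multigraph_def)
  have "(\<Sum>v\<in>?V. card {e \<in> edges \<Gamma>. v \<in> set_uprod (ends \<Gamma> e)}) = (\<Sum>e\<in>edges \<Gamma>. 2)"
  proof (rule sum_multicount_gen)
    show "\<forall>e\<in>edges \<Gamma>. card {v \<in> ?V. v \<in> set_uprod (ends \<Gamma> e)} = 2"
    proof
      fix e assume e: "e \<in> edges \<Gamma>"
      have "set_uprod (ends \<Gamma> e) \<subseteq> ?V" using \<Gamma>(1) e by (simp add: is_multigraph_def)
      then have "{v \<in> ?V. v \<in> set_uprod (ends \<Gamma> e)} = {lo e, hi e}" using ends[OF e] by auto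
      then show "card {v \<in> ?V. v \<in> set_uprod (ends \<Gamma> e)} = 2" using ends[OF e] by simp
    qed
  qed (use fin in auto)
  moreover have "(\<Sum>v\<in>?V. card {e \<in> edges \<Gamma>. v \<in> set_uprod (ends \<Gamma> e)}) = (\<Sum>v\<in>?V. 3)"
  proof (rule sum.cong[OF refl])
    fix v assume v: "v \<in> ?V"
    have "ends \<Gamma> e \<noteq> Upair v v" if "e \<in> edges \<Gamma>" for e using ends[OF that] by auto
    then have "{e \<in> edges \<Gamma>. ends \<Gamma> e = Upair v v} = {}" by blast
    then have "valency \<Gamma> v = card {e \<in> edges \<Gamma>. v \<in> set_uprod (ends \<Gamma> e)}" unfolding valency_def by (simp only: card.empty add_0_right)
    then show "card {e \<in> edges \<Gamma>. v \<in> set_uprod (ends \<Gamma> e)} = 3" using \<Gamma>(2) v by (simp add: trivalent_def)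
  qed
  ultimately show ?thesis by simp
qed

theorem theorem1p3:
  fixes n :: nat and \<epsilon> :: "nat \<Rightarrow> real" and \<Gamma> :: "'e multigraph" and prof :: "nat multiset list"
  assumes "\<And>i. i \<in> {1..n} \<Longrightarrow> 0 \<le> \<epsilon> i \<and> \<epsilon> i < 1"
    and "strict_mono_on {1..n} \<epsilon>"
    and "prof = replicate n {#2#}"
    and "is_multigraph \<Gamma>" and "nverts \<Gamma> = n" and "trivalent \<Gamma>"
  shows "(\<Sum>\<mu>\<leftarrow>prof. \<Sum>\<^sub># \<mu>) + (\<Sum>\<mu>\<leftarrow>prof. size \<mu>) = 3 * n \<and>
    (\<exists>F \<in> quasimodular_of_mixed_weight_le ((\<Sum>\<mu>\<leftarrow>prof. \<Sum>\<^sub># \<mu>) + (\<Sum>\<mu>\<leftarrow>prof. size \<mu>)).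
       contribution \<epsilon> prof \<Gamma> = real_exponent_series F)"
proof -
  have K: "(\<Sum>\<mu>\<leftarrow>prof. \<Sum>\<^sub># \<mu>) + (\<Sum>\<mu>\<leftarrow>prof. size \<mu>) = 3 * n" using assms(3) by (simp add: sum_list_replicate)
  have "\<exists>F \<in> espan (3 * n). contribution \<epsilon> prof \<Gamma> = real_exponent_series F"
  proof (cases "\<exists>e\<in>edges \<Gamma>. \<exists>v. ends \<Gamma> e = Upair v v")
    case True
    then have "contribution \<epsilon> prof \<Gamma> = real_exponent_series 0"
      using contribution_loop[OF assms(4,6)] by (fastforce simp: real_exponent_series_def fun_eq_iff)
    then show ?thesis using espan.zero by blast
  next
    case False
    have "\<exists>a b. ends \<Gamma> e = Upair a b \<and> a < b" if e: "e \<in> edges \<Gamma>" for e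
    proof -
      obtain a b where ab: "ends \<Gamma> e = Upair a b" by (metis uprod_exhaust)
      then have "a \<noteq> b" using False e by auto
      then show ?thesis using ab by (metis Upair_inject linorder_neqE_nat)
    qed
    then obtain lo hi where ends: "\<And>e. e \<in> edges \<Gamma> \<Longrightarrow> ends \<Gamma> e = Upair (lo e) (hi e) \<and> lo e < hi e" by metis
    have hi: "lo e < hi e \<and> hi e \<le> n" if "e \<in> edges \<Gamma>" for e
      using ends[OF that] assms(4,5) that by (auto simp: is_multigraph_def dest!: bspec)
    have "finite (edges \<Gamma>)" using assms(4) by (simp add: is_multigraph_def)
    from flow_sum_quasimodular[OF this hi, where \<phi> = "\<lambda>_. edge_series" and K = "\<lambda>_. 2"]
    have "flow_sum (edges \<Gamma>) lo hi (\<lambda>_. edge_series) \<in> espan (2 * card (edges \<Gamma>))" using RR_EE1[of 1 1 2] by (simp add: edge_series_def mult.commute)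
    then have "flow_sum (edges \<Gamma>) lo hi (\<lambda>_. edge_series) \<in> espan (3 * n)"
      using trivalent_edge_count[OF assms(4,6) ends] assms(5) by simp
    moreover have "contribution \<epsilon> prof \<Gamma> = real_exponent_series (flow_sum (edges \<Gamma>) lo hi (\<lambda>_. edge_series))"
      by (rule contribution_flow_sum[OF assms(4,6) _ _ _ ends]) (use assms in auto)
    ultimately show ?thesis by blast
  qed
  then show ?thesis using K espan_subset by auto
qed

end
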